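(* Let $G$ be a finite group, $\mathbb{k}$ an algebraically closed field of characteristic $p>0$, and let $\alpha$ be the Brauer character of a faithful finite-dimensional $\mathbb{k}G$-module. Let $K$ be the Markov chain on the set $\mathrm{IBr}(G)$ of irreducible Brauer characters of $G$ with transition matrix $$K(\chi,\chi')=\frac{\langle \chi',\chi\otimes\alpha\rangle\,\chi'(1)}{\alpha(1)\chi(1)}\qquad(\chi,\chi'\in \mathrm{IBr}(G)).$$ Let $\mathcal C$ be a set of representatives of the $p$-regular conjugacy classes of $G$. Then: (i) The stationary distribution of $K$ is $\pi(\chi)=\dfrac{\mathsf p_\chi(1)\,\chi(1)}{|G|}$ $(\chi\in\mathrm{IBr}(G))$. (ii) The eigenvalues of $K$ are $\alpha(c)/\alpha(1)$, where $c$ ranges over $\mathcal C$. (iii) The right eigenfunctions are $\mathsf r_c$ $(c\in\mathcal C)$, where for $\chi\in\mathrm{IBr}(G)$, $\mathsf r_c(\chi)=\dfrac{\chi(c)}{\chi(1)}$. (iv) The left eigenfunctions are $\ell_c$ $(c\in\mathcal C)$, where for $\chi\in\mathrm{IBr}(G)$, $\ell_c(\chi)=\dfrac{\overline{\mathsf p_\chi(c)}\,\chi(1)}{|C_G(c)|}$. Moreover, $\ell_1(\chi)=\pi(\chi)$, $\mathsf r_1(\chi)=1$, and for $c,c'\in\mathcal C$, $$\sum_{\chi\in\mathrm{IBr}(G)}\ell_c(\chi)\,\overline{\mathsf r_{c'}(\chi)}=\delta_{c,c'}.$$ (v) For $\ell\ge 1$ and $\chi,\chi'\in\mathrm{IBr}(G)$,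 $$K^\ell(\chi,\chi')=\sum_{c\in\mathcal C}\left(\frac{\overline{\alpha(c)}}{\alpha(1)}\right)^{\ell}\overline{\mathsf r_c(\chi)}\,\ell_c(\chi').$$ In particular, for the trivial character $\mathbb 1$ of $G$, $$\frac{K^\ell(\mathbb 1,\chi')}{\pi(\chi')}-1=\sum_{c\in\mathcal C,\ c\neq 1}\left(\frac{\overline{\alpha(c)}}{\alpha(1)}\right)^{\ell}\frac{\overline{\mathsf p_{\chi'}(c)}}{\mathsf p_{\chi'}(1)}\,|c^G|.$$
   Context: A $p$-regular element is one of order prime to $p$; Brauer characters are complex-valued functions on $p$-regular elements. An irreducible $\mathbb{k}G$-module is identified with its Brauer character. For $\chi\in\mathrm{IBr}(G)$ and a finite-dimensional $\mathbb{k}G$-module with Brauer character $\varrho$, $\langle\chi,\varrho\rangle$ denotes the multiplicity of $\chi$ as a composition factor of that module. $\mathsf p_\chi$ is the Brauer character of the projective indecomposable cover of the irreducible module $\chi$. $c^G$ is the conjugacy class of $c$, and $C_G(c)$ is its centralizer; the identity class is represented in $\mathcal C$ by $1$. $K^\ell$ is the transition matrix after $\ell$ steps. A right eigenfunction $f$ with eigenvalue $\beta$ satisfies $\sum_{\chi'}K(\chi,\chi')f(\chi')=\beta f(\chi)$; a left eigenfunction satisfies $\sum_\chi f(\chi)K(\chi,\chi')=\beta f(\chi')$. In (iii) and (iv), $\mathsf r_c$ and $\ell_c$ are eigenfunctions for the eigenvalue $\alpha(c)/\alpha(1)$. A bar denotes complex conjugation.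
   Formalization: As printed, the last identity of (iv) and both formulas of (v) fail (e.g. G=Z/3, p=2). They are proved without the bars on r_{c'}, α(c) and r_c; the printed forms are proved when every c in C is conjugate to its inverse. The module is assumed nonzero. *)

theory Defs
  imports
    Complex_Main
    "HOL-Library.FuncSet"
    "HOL-Library.Nonpos_Ints"
    "HOL-Computational_Algebra.Polynomial"
    "HOL-Algebra.Multiplicative_Group"
    "Jordan_Normal_Form.Char_Poly"
    "Jordan_Normal_Form.VS_Connect"
begin

section \<open>Conjugacy and p-regular elements\<close>

definition conj_class :: "('g, 'b) monoid_scheme \<Rightarrow> 'g \<Rightarrow> 'g set" where
  "conj_class G c = (\<lambda>x. x \<otimes>\<^bsub>G\<^esub> c \<otimes>\<^bsub>G\<^esub> inv\<^bsub>G\<^esub> x) ` carrier G"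

definition centralizer :: "('g, 'b) monoid_scheme \<Rightarrow> 'g \<Rightarrow> 'g set" where
  "centralizer G c = {x \<in> carrier G. x \<otimes>\<^bsub>G\<^esub> c = c \<otimes>\<^bsub>G\<^esub> x}"

definition p_regular :: "('g, 'b) monoid_scheme \<Rightarrow> nat \<Rightarrow> 'g set" where
  "p_regular G p = {g \<in> carrier G. coprime (group.ord G g) p}"

definition p_regular_reps :: "('g, 'b) monoid_scheme \<Rightarrow> nat \<Rightarrow> 'g set \<Rightarrow> bool" where
  "p_regular_reps G p C \<longleftrightarrow>
     C \<subseteq> p_regular G p \<and> (\<forall>g \<in> p_regular G p. \<exists>!c. c \<in> C \<and> c \<in> conj_class G g)"

section \<open>Finite-dimensional modules\<close>

text \<open>
  A finite-dimensional module over the group algebra of G over the field 'k is given, in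
  coordinates, by a pair (n, A): the underlying space consists of the column vectors of
  dimension n, on which g in G acts by the n by n matrix A g.  The dimension is part of the
  data, and 0 is allowed.
\<close>

type_synonym ('g, 'k) gmod = "nat \<times> ('g \<Rightarrow> 'k mat)"

definition is_gmod :: "('g, 'b) monoid_scheme \<Rightarrow> ('g, 'k :: field) gmod \<Rightarrow> bool" where
  "is_gmod G M \<longleftrightarrow>
     (\<forall>g \<in> carrier G. snd M g \<in> carrier_mat (fst M) (fst M)) \<and>
     snd M \<one>\<^bsub>G\<^esub> = 1\<^sub>m (fst M) \<and>
     (\<forall>g \<in> carrier G. \<forall>h \<in> carrier G. snd M (g \<otimes>\<^bsub>G\<^esub> h) = snd M g * snd M h)"

definition faithful_gmod :: "('g, 'b) monoid_scheme \<Rightarrow> ('g, 'k :: field) gmod \<Rightarrow> bool" where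
  "faithful_gmod G M \<longleftrightarrow> is_gmod G M \<and> inj_on (snd M) (carrier G)"

definition triv_gmod :: "('g, 'k :: field) gmod" where
  "triv_gmod = (1, \<lambda>_. 1\<^sub>m 1)"

text \<open>The tensor product, acting by Kronecker products of matrices.\<close>

definition tensor_gmod :: "('g, 'k :: field) gmod \<Rightarrow> ('g, 'k) gmod \<Rightarrow> ('g, 'k) gmod"
    (infixl "\<otimes>\<^sub>M" 70) where
  "M \<otimes>\<^sub>M N = (fst M * fst N, \<lambda>g. mat (fst M * fst N) (fst M * fst N)
     (\<lambda>(i, j). snd M g $$ (i div fst N, j div fst N) * snd N g $$ (i mod fst N, j mod fst N)))"

definition gsubmod ::
    "('g, 'b) monoid_scheme \<Rightarrow> ('g, 'k :: field) gmod \<Rightarrow> 'k vec set \<Rightarrow> bool" where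
  "gsubmod G M W \<longleftrightarrow>
     VectorSpace.subspace class_ring W (module_vec TYPE('k) (fst M)) \<and>
     (\<forall>g \<in> carrier G. \<forall>w \<in> W. snd M g *\<^sub>v w \<in> W)"

definition irreducible_gmod :: "('g, 'b) monoid_scheme \<Rightarrow> ('g, 'k :: field) gmod \<Rightarrow> bool" where
  "irreducible_gmod G M \<longleftrightarrow> is_gmod G M \<and> fst M > 0 \<and>
     (\<forall>W. gsubmod G M W \<longrightarrow> W = {0\<^sub>v (fst M)} \<or> W = carrier_vec (fst M))"

definition indecomposable_gmod ::
    "('g, 'b) monoid_scheme \<Rightarrow> ('g, 'k :: field) gmod \<Rightarrow> bool" where
  "indecomposable_gmod G M \<longleftrightarrow> is_gmod G M \<and> fst M > 0 \<and>
     (\<forall>U V. gsubmod G M U \<and> gsubmod G M V \<and> U \<inter> V = {0\<^sub>v (fst M)} \<and>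
        (\<forall>w \<in> carrier_vec (fst M). \<exists>u \<in> U. \<exists>v \<in> V. w = u + v) \<longrightarrow>
        U = {0\<^sub>v (fst M)} \<or> V = {0\<^sub>v (fst M)})"

definition gmod_hom ::
    "('g, 'b) monoid_scheme \<Rightarrow> ('g, 'k :: field) gmod \<Rightarrow> ('g, 'k) gmod \<Rightarrow> 'k mat set" where
  "gmod_hom G M N = {T \<in> carrier_mat (fst N) (fst M).
     \<forall>g \<in> carrier G. T * snd M g = snd N g * T}"

definition gmod_epi ::
    "('g, 'b) monoid_scheme \<Rightarrow> ('g, 'k :: field) gmod \<Rightarrow> ('g, 'k) gmod \<Rightarrow> 'k mat set" where
  "gmod_epi G M N = {T \<in> gmod_hom G M N.
     (\<lambda>v. T *\<^sub>v v) ` carrier_vec (fst M) = carrier_vec (fst N)}"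

text \<open>Projectivity in the category of finite-dimensional modules.\<close>

definition projective_gmod :: "('g, 'b) monoid_scheme \<Rightarrow> ('g, 'k :: field) gmod \<Rightarrow> bool" where
  "projective_gmod G P \<longleftrightarrow> is_gmod G P \<and>
     (\<forall>M N. is_gmod G M \<longrightarrow> is_gmod G N \<longrightarrow>
        (\<forall>T \<in> gmod_epi G M N. \<forall>F \<in> gmod_hom G P N. \<exists>F' \<in> gmod_hom G P M. T * F' = F))"

definition proj_indec_cover ::
    "('g, 'b) monoid_scheme \<Rightarrow> ('g, 'k :: field) gmod \<Rightarrow> ('g, 'k) gmod \<Rightarrow> bool" where
  "proj_indec_cover G S P \<longleftrightarrow>
     projective_gmod G P \<and> indecomposable_gmod G P \<and> gmod_epi G P S \<noteq> {}"

section \<open>Composition multiplicities\<close>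

text \<open>
  The quotient of V by W (submodules of M with W contained in V) is isomorphic to S.  An
  isomorphism of the quotient with S is the same as an equivariant linear surjection of V onto
  S with kernel W, and every linear map on V is the restriction of a matrix.
\<close>

definition factor_iso ::
    "('g, 'b) monoid_scheme \<Rightarrow> ('g, 'k :: field) gmod \<Rightarrow> 'k vec set \<Rightarrow> 'k vec set \<Rightarrow>
     ('g, 'k) gmod \<Rightarrow> bool" where
  "factor_iso G M W V S \<longleftrightarrow> (\<exists>T \<in> carrier_mat (fst S) (fst M).
     (\<forall>g \<in> carrier G. \<forall>v \<in> V. T *\<^sub>v (snd M g *\<^sub>v v) = snd S g *\<^sub>v (T *\<^sub>v v)) \<and>
     (\<lambda>v. T *\<^sub>v v) ` V = carrier_vec (fst S) \<and>
     {v \<in> V. T *\<^sub>v v = 0\<^sub>v (fst S)} = W)"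

definition composition_series ::
    "('g, 'b) monoid_scheme \<Rightarrow> ('g, 'k :: field) gmod \<Rightarrow> nat \<Rightarrow> (nat \<Rightarrow> 'k vec set) \<Rightarrow> bool" where
  "composition_series G M m W \<longleftrightarrow>
     W 0 = {0\<^sub>v (fst M)} \<and> W m = carrier_vec (fst M) \<and>
     (\<forall>i \<le> m. gsubmod G M (W i)) \<and>
     (\<forall>i < m. W i \<subset> W (Suc i) \<and> \<not> (\<exists>U. gsubmod G M U \<and> W i \<subset> U \<and> U \<subset> W (Suc i)))"

text \<open>The description is meaningful by the Jordan--Hoelder theorem.\<close>

definition comp_mult ::
    "('g, 'b) monoid_scheme \<Rightarrow> ('g, 'k :: field) gmod \<Rightarrow> ('g, 'k) gmod \<Rightarrow> nat" where
  "comp_mult G S M = (THE r. \<exists>m W. composition_series G M m W \<and>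
     r = card {i. i < m \<and> factor_iso G M (W i) (W (Suc i)) S})"

section \<open>Brauer characters\<close>

text \<open>
  Brauer characters depend on the choice of an isomorphism from the roots of unity of the field
  onto the complex roots of unity of order prime to its characteristic.  (All roots of unity of
  a field of characteristic p have order prime to p.)
\<close>

definition brauer_lift :: "('k :: field \<Rightarrow> complex) \<Rightarrow> bool" where
  "brauer_lift \<theta> \<longleftrightarrow>
     bij_betw \<theta> {x. \<exists>n > 0. x ^ n = 1} {z. \<exists>n > 0. coprime n CHAR('k) \<and> z ^ n = 1} \<and>
     (\<forall>x y. (\<exists>n > 0. x ^ n = 1) \<longrightarrow> (\<exists>n > 0. y ^ n = 1) \<longrightarrow> \<theta> (x * y) = \<theta> x * \<theta> y)"

text \<open>
  The sum of the lifts of the eigenvalues, with multiplicity.  As Brauer characters live on the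
  p-regular elements only, they are extended by 0, so that two of them are equal as functions
  on the type if and only if they agree on the p-regular elements.
\<close>

definition brauer_char ::
    "('k :: field \<Rightarrow> complex) \<Rightarrow> ('g, 'b) monoid_scheme \<Rightarrow> ('g, 'k) gmod \<Rightarrow> 'g \<Rightarrow> complex" where
  "brauer_char \<theta> G M = (\<lambda>g. if g \<in> p_regular G CHAR('k)
     then (\<Sum>x \<in># proots (char_poly (snd M g)). \<theta> x) else 0)"

definition IBr ::
    "('k :: field \<Rightarrow> complex) \<Rightarrow> ('g, 'b) monoid_scheme \<Rightarrow> ('g \<Rightarrow> complex) set" where
  "IBr \<theta> G = brauer_char \<theta> G ` {S. irreducible_gmod G S}"

text \<open>
  The identification of an irreducible Brauer character with a module affording it; the module
  is determined up to isomorphism.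
\<close>

definition irr_mod ::
    "('k :: field \<Rightarrow> complex) \<Rightarrow> ('g, 'b) monoid_scheme \<Rightarrow> ('g \<Rightarrow> complex) \<Rightarrow> ('g, 'k) gmod" where
  "irr_mod \<theta> G \<chi> = (SOME S. irreducible_gmod G S \<and> brauer_char \<theta> G S = \<chi>)"

definition proj_char ::
    "('k :: field \<Rightarrow> complex) \<Rightarrow> ('g, 'b) monoid_scheme \<Rightarrow> ('g \<Rightarrow> complex) \<Rightarrow> 'g \<Rightarrow> complex" where
  "proj_char \<theta> G \<chi> = brauer_char \<theta> G (SOME P. proj_indec_cover G (irr_mod \<theta> G \<chi>) P)"

section \<open>Finite Markov chains with complex-valued matrices\<close>

definition stationary_dist ::
    "'s set \<Rightarrow> ('s \<Rightarrow> 's \<Rightarrow> complex) \<Rightarrow> ('s \<Rightarrow> complex) \<Rightarrow> bool" where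
  "stationary_dist I K \<mu> \<longleftrightarrow>
     (\<forall>x \<in> I. \<mu> x \<in> \<real>\<^sub>\<ge>\<^sub>0) \<and> (\<Sum>x \<in> I. \<mu> x) = 1 \<and>
     (\<forall>y \<in> I. (\<Sum>x \<in> I. \<mu> x * K x y) = \<mu> y)"

definition right_eigenfunction ::
    "'s set \<Rightarrow> ('s \<Rightarrow> 's \<Rightarrow> complex) \<Rightarrow> complex \<Rightarrow> ('s \<Rightarrow> complex) \<Rightarrow> bool" where
  "right_eigenfunction I K \<beta> f \<longleftrightarrow>
     (\<exists>x \<in> I. f x \<noteq> 0) \<and> (\<forall>x \<in> I. (\<Sum>y \<in> I. K x y * f y) = \<beta> * f x)"

definition left_eigenfunction ::
    "'s set \<Rightarrow> ('s \<Rightarrow> 's \<Rightarrow> complex) \<Rightarrow> complex \<Rightarrow> ('s \<Rightarrow> complex) \<Rightarrow> bool" where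
  "left_eigenfunction I K \<beta> f \<longleftrightarrow>
     (\<exists>x \<in> I. f x \<noteq> 0) \<and> (\<forall>y \<in> I. (\<Sum>x \<in> I. f x * K x y) = \<beta> * f y)"

text \<open>The functions b c, for c in C, form a basis of the space of functions on I.\<close>

definition function_basis :: "'s set \<Rightarrow> 'c set \<Rightarrow> ('c \<Rightarrow> 's \<Rightarrow> complex) \<Rightarrow> bool" where
  "function_basis I C b \<longleftrightarrow>
     (\<forall>f. \<exists>!a. a \<in> extensional C \<and> (\<forall>x \<in> I. f x = (\<Sum>c \<in> C. a c * b c x)))"

fun mc_power :: "'s set \<Rightarrow> ('s \<Rightarrow> 's \<Rightarrow> complex) \<Rightarrow> nat \<Rightarrow> 's \<Rightarrow> 's \<Rightarrow> complex" where
  "mc_power I K 0 x y = (if x = y then 1 else 0)"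
| "mc_power I K (Suc l) x y = (\<Sum>z \<in> I. mc_power I K l x z * K z y)"

section \<open>The tensor product chain\<close>

definition K_chain ::
    "('k :: field \<Rightarrow> complex) \<Rightarrow> ('g, 'b) monoid_scheme \<Rightarrow> ('g, 'k) gmod \<Rightarrow>
     ('g \<Rightarrow> complex) \<Rightarrow> ('g \<Rightarrow> complex) \<Rightarrow> complex" where
  "K_chain \<theta> G A \<chi> \<chi>' =
     of_nat (comp_mult G (irr_mod \<theta> G \<chi>') (irr_mod \<theta> G \<chi> \<otimes>\<^sub>M A)) * \<chi>' \<one>\<^bsub>G\<^esub> /
     (brauer_char \<theta> G A \<one>\<^bsub>G\<^esub> * \<chi> \<one>\<^bsub>G\<^esub>)"

definition pi_stat ::
    "('k :: field \<Rightarrow> complex) \<Rightarrow> ('g, 'b) monoid_scheme \<Rightarrow> ('g \<Rightarrow> complex) \<Rightarrow> complex" where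
  "pi_stat \<theta> G \<chi> = proj_char \<theta> G \<chi> \<one>\<^bsub>G\<^esub> * \<chi> \<one>\<^bsub>G\<^esub> / of_nat (card (carrier G))"

definition r_fun :: "('g, 'b) monoid_scheme \<Rightarrow> 'g \<Rightarrow> ('g \<Rightarrow> complex) \<Rightarrow> complex" where
  "r_fun G c \<chi> = \<chi> c / \<chi> \<one>\<^bsub>G\<^esub>"

text \<open>
  With this left eigenfunction (eigenvalue alpha(c)/alpha(1)), the dual right eigenfunction is
  r_c and not its complex conjugate.  For G cyclic of order 3 with generator c, in
  characteristic 2, the sum of l_c times the conjugate of r_c is 0; and if alpha is a nontrivial
  linear character, then the expansion of K with alpha(c) and r_c conjugated puts K(1, _) at the
  conjugate of alpha instead of at alpha.  Hence pairing and expansion are to be stated without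
  these conjugations; the versions with conjugations agree with them when every p-regular
  element is conjugate to its inverse, that is, when all Brauer characters are real.
\<close>

definition l_fun ::
    "('k :: field \<Rightarrow> complex) \<Rightarrow> ('g, 'b) monoid_scheme \<Rightarrow> 'g \<Rightarrow> ('g \<Rightarrow> complex) \<Rightarrow> complex" where
  "l_fun \<theta> G c \<chi> = cnj (proj_char \<theta> G \<chi> c) * \<chi> \<one>\<^bsub>G\<^esub> / of_nat (card (centralizer G c))"

end

theory Submission
  imports Defs
begin

text \<open>
  Let P run over the projective covers of the irreducible modules.  As a left module, the group algebra kG decomposes
  compatibly with right multiplication by a p-regular element c: its indecomposable summands can be chosen to be
  eigenspaces of c, and then the summands with top S contribute exactly the eigenvalues of c on S.  Computing the
  Brauer trace of x \<mapsto> g^{-1} x c on kG through this decomposition on the one hand, and as that of a permutation of G on the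
  other hand, gives the orthogonality relation
    \<Sum>_S cnj (P_S(g)) S(c) = #{x. x c = g x}
  without any lifting to characteristic 0.  Hence there are at least as many irreducible modules as p-regular classes.
  Conversely the ordinary traces of the irreducible modules are linearly independent over k (evaluate them on the idempotents of kG
  that generate the projective covers) and depend on the p-regular part only.  So the two families r_c, l_c are
  biorthogonal bases.  It follows that the irreducible Brauer characters are linearly independent, which
  yields the Jordan--Hoelder theorem, and the multiplicativity of Brauer characters on tensor products says that the r_c are
  eigenfunctions of K.  Everything else is linear algebra, except that the eigenvalue 1 is simple, which is faithfulness.
\<close>

section \<open>Matrices over a field\<close>

text \<open>The compatible decomposition exists because the order of a p-regular c is invertible in
  k: the eigenprojections of right multiplication by c are polynomials in it, hence commute with
  left multiplication and split every summand on which it is not yet a scalar. On a summand P with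
  scalar x the operator is x times the action of g^{-1}; the lift is multiplicative on roots of
  unity, so the Brauer trace is the lift of x times the conjugate of P(g). On the permutation side
  an orbit with l elements carries each l-th root of unity once, and only fixed points survive
  lifting.

  Both inequalities between the two numbers are needed: orthogonality makes one rectangular matrix a
  one-sided inverse of another, and only squareness makes the inverse two-sided, which gives the row
  relation behind every expansion.

  Multiplicities and projective covers enter through description operators, so their values are
  usable only after uniqueness has been proved. Modules are matrices on column vectors; a subspace
  is carried along as a pair X, Y with Y * X = 1, whose product X * Y projects onto it.\<close>

lemma mat_assoc:
  "dim_col A = dim_row B \<Longrightarrow> dim_col B = dim_row C \<Longrightarrow> A * B * C = A * (B * C :: 'a :: semiring_0 mat)"
  by (rule assoc_mult_mat[of _ "dim_row A" "dim_row B" _ "dim_row C" _ "dim_col C"]) auto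

lemma mat_vec_assoc:
  "dim_col A = dim_row B \<Longrightarrow> dim_col B = dim_vec v \<Longrightarrow> A * B *\<^sub>v v = A *\<^sub>v (B *\<^sub>v v :: 'a :: semiring_0 vec)"
  by (rule assoc_mult_mat_vec[of _ "dim_row A" "dim_row B" _ "dim_vec v"]) auto

lemma mat_cancel_left:
  assumes "B * A = 1\<^sub>m m" "dim_col B = dim_row A" "dim_row C = m" "dim_col A = m"
  shows "B * (A * C) = (C :: 'a :: semiring_1 mat)"
  using mat_assoc[of B A C] assms by (metis left_mult_one_mat carrier_matI)

lemma mat_vec_cancel_left:
  assumes "B * A = 1\<^sub>m m" "dim_col B = dim_row A" "dim_vec v = m" "dim_col A = m"
  shows "B *\<^sub>v (A *\<^sub>v v) = (v :: 'a :: semiring_1 vec)"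
  using mat_vec_assoc[of B A v] assms by (metis one_mult_mat_vec carrier_vecI)

lemma mult_mat_unit_vec:
  fixes A :: "'a :: semiring_1 mat"
  assumes "A \<in> carrier_mat n m" "j < m"
  shows "A *\<^sub>v unit_vec m j = col A j"
  using assms by (intro eq_vecI) auto

lemma eq_mat_by_vec:
  fixes A B :: "'a :: semiring_1 mat"
  assumes "A \<in> carrier_mat n m" "B \<in> carrier_mat n m"
    and "\<And>v. v \<in> carrier_vec m \<Longrightarrow> A *\<^sub>v v = B *\<^sub>v v"
  shows "A = B"
  using assms mult_mat_unit_vec[OF assms(1)] mult_mat_unit_vec[OF assms(2)]
  by (intro mat_col_eqI) (metis carrier_matD(2) unit_vec_carrier, auto)

lemma mult_mat_vec_zero [simp]: "A *\<^sub>v 0\<^sub>v (dim_col A) = 0\<^sub>v (dim_row A)" for A :: "'a :: semiring_1 mat"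
  by (intro eq_vecI) auto

lemma mult_mat_vec_zero': "A \<in> carrier_mat n m \<Longrightarrow> A *\<^sub>v 0\<^sub>v m = 0\<^sub>v n" for A :: "'a :: semiring_1 mat"
  using mult_mat_vec_zero[of A] by auto

lemma zero_mat_mult_vec [simp]: "v \<in> carrier_vec m \<Longrightarrow> 0\<^sub>m n m *\<^sub>v v = 0\<^sub>v n" for v :: "'a :: semiring_1 vec"
  by (intro eq_vecI) auto

text \<open>Padding with zero rows makes the matrix square and keeps its kernel; row n of the padded
  matrix is zero, so its determinant vanishes.\<close>

lemma wide_matrix_kernel:
  fixes A :: "'a :: field mat"
  assumes A: "A \<in> carrier_mat n m" and nm: "n < m"
  shows "\<exists>v \<in> carrier_vec m. v \<noteq> 0\<^sub>v m \<and> A *\<^sub>v v = 0\<^sub>v n"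
proof -
  define B where "B = mat m m (\<lambda>(i, j). if i < n then A $$ (i, j) else 0)"
  have B: "B \<in> carrier_mat m m" by (simp add: B_def)
  have "B\<^sup>T *\<^sub>v unit_vec m n = 0\<^sub>v m"
    using mult_mat_unit_vec[of "B\<^sup>T" m m n] B nm by (intro eq_vecI) (auto simp: B_def)
  hence "det (B\<^sup>T) = 0"
    using det_0_iff_vec_prod_zero_field[of "B\<^sup>T" m] B nm by (metis transpose_carrier_mat unit_vec_carrier unit_vec_nonzero)
  hence "det B = 0" using det_transpose[OF B] by simp
  then obtain v where v: "v \<in> carrier_vec m" "v \<noteq> 0\<^sub>v m" "B *\<^sub>v v = 0\<^sub>v m"
    using det_0_iff_vec_prod_zero_field[OF B] by auto
  have "A *\<^sub>v v = 0\<^sub>v n"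
  proof (rule eq_vecI)
    fix i assume i: "i < dim_vec (0\<^sub>v n :: 'a vec)"
    have "row A i = row B i" using A i nm by (intro eq_vecI) (auto simp: B_def)
    hence "(A *\<^sub>v v) $ i = (B *\<^sub>v v) $ i" using A B i nm by auto
    thus "(A *\<^sub>v v) $ i = 0\<^sub>v n $ i" using v(3) i nm by auto
  qed (use A in auto)
  thus ?thesis using v by auto
qed

text \<open>A kernel vector of \<open>Y\<close> would also be killed by \<open>X * Y = 1\<close>.
  Applied in both directions this replaces the invariance of dimension.\<close>

lemma right_inverse_dim_le:
  fixes X :: "'a :: field mat"
  assumes X: "X \<in> carrier_mat n r" and Y: "Y \<in> carrier_mat r n" and XY: "X * Y = 1\<^sub>m n"
  shows "n \<le> r"
proof (rule ccontr)
  assume "\<not> n \<le> r"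
  then obtain v where v: "v \<in> carrier_vec n" "v \<noteq> 0\<^sub>v n" "Y *\<^sub>v v = 0\<^sub>v r"
    using wide_matrix_kernel[OF Y] by auto
  have "v = X *\<^sub>v (Y *\<^sub>v v)" by (rule mat_vec_cancel_left[OF XY, symmetric]) (use X Y v(1) in auto)
  also have "\<dots> = 0\<^sub>v n" using v mult_mat_vec_zero'[OF X] by simp
  finally show False using v by simp
qed

lemma injective_square_inverse:
  fixes A :: "'a :: field mat"
  assumes A: "A \<in> carrier_mat n n"
    and inj: "\<And>v. v \<in> carrier_vec n \<Longrightarrow> A *\<^sub>v v = 0\<^sub>v n \<Longrightarrow> v = 0\<^sub>v n"
  obtains B where "B \<in> carrier_mat n n" "A * B = 1\<^sub>m n" "B * A = 1\<^sub>m n"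
proof -
  have "det A \<noteq> 0" using det_0_iff_vec_prod_zero_field[OF A] inj by auto
  from det_non_zero_imp_unit[OF A this, of undefined] obtain B where
    "B \<in> carrier_mat n n" "B * A = 1\<^sub>m n" "A * B = 1\<^sub>m n"
    unfolding Units_def ring_mat_def by auto
  thus ?thesis using that by blast
qed

lemma minus_mat_zero: "A \<in> carrier_mat n m \<Longrightarrow> A - 0\<^sub>m n m = (A :: 'a :: group_add mat)"
  by (intro eq_matI) auto

subsection \<open>Subspaces of column vectors\<close>

lemma subspace_vec_iff:
  "VectorSpace.subspace class_ring W (module_vec TYPE('a :: field) n) \<longleftrightarrow>
     W \<subseteq> carrier_vec n \<and> 0\<^sub>v n \<in> W \<and> (\<forall>u\<in>W. \<forall>v\<in>W. u + v \<in> W) \<and> (\<forall>c. \<forall>v\<in>W. c \<cdot>\<^sub>v v \<in> W)"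
  unfolding VectorSpace.subspace_def LinearCombinations.submodule_def
  using vec_vs[of n, where ?'a = 'a] vec_module[of n, where ?'a = 'a]
  by (auto simp: module_vec_simps)

abbreviation vsub :: "nat \<Rightarrow> 'a :: field vec set \<Rightarrow> bool" where
  "vsub n W \<equiv> VectorSpace.subspace class_ring W (module_vec TYPE('a) n)"

text \<open>Encoded as a four-block matrix with a second block row of height 0 (in
  \<open>vcat\<close>: a second block column of width 0), so that the product formula for four-block
  matrices applies.\<close>

definition hcat :: "'a :: zero mat \<Rightarrow> 'a mat \<Rightarrow> 'a mat" where
  "hcat A B = four_block_mat A B (0\<^sub>m 0 (dim_col A)) (0\<^sub>m 0 (dim_col B))"

definition vcat :: "'a :: zero mat \<Rightarrow> 'a mat \<Rightarrow> 'a mat" where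
  "vcat A B = four_block_mat A (0\<^sub>m (dim_row A) 0) B (0\<^sub>m (dim_row B) 0)"

lemma hcat_carrier [simp]: "A \<in> carrier_mat n r \<Longrightarrow> B \<in> carrier_mat n s \<Longrightarrow> hcat A B \<in> carrier_mat n (r + s)"
  by (auto simp: hcat_def)

lemma vcat_carrier [simp]: "A \<in> carrier_mat r n \<Longrightarrow> B \<in> carrier_mat s n \<Longrightarrow> vcat A B \<in> carrier_mat (r + s) n"
  by (auto simp: vcat_def)

lemma vcat_mult_hcat:
  fixes X Y :: "'a :: semiring_0 mat"
  assumes "Y \<in> carrier_mat r n" "Y' \<in> carrier_mat s n" "X \<in> carrier_mat n r'" "X' \<in> carrier_mat n s'"
  shows "vcat Y Y' * hcat X X' = four_block_mat (Y * X) (Y * X') (Y' * X) (Y' * X')"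
  unfolding vcat_def hcat_def
  by (subst mult_four_block_mat[where ?nr1.0 = r and ?n1.0 = n and ?n2.0 = 0 and ?nr2.0 = s
        and ?nc1.0 = r' and ?nc2.0 = s'])
     (use assms in \<open>auto intro!: cong_four_block_mat eq_matI\<close>)

lemma hcat_mult_vcat:
  fixes X Y :: "'a :: semiring_0 mat"
  assumes "Y \<in> carrier_mat r n'" "Y' \<in> carrier_mat s n'" "X \<in> carrier_mat n r" "X' \<in> carrier_mat n s"
  shows "hcat X X' * vcat Y Y' = X * Y + X' * Y'"
  unfolding vcat_def hcat_def
  by (subst mult_four_block_mat[where ?nr1.0 = n and ?n1.0 = r and ?n2.0 = s and ?nr2.0 = 0
        and ?nc1.0 = n' and ?nc2.0 = 0])
     (use assms in \<open>auto intro!: eq_matI\<close>)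

lemma mult_hcat:
  fixes X M :: "'a :: semiring_0 mat"
  assumes "M \<in> carrier_mat n' n" "X \<in> carrier_mat n r" "X' \<in> carrier_mat n s"
  shows "M * hcat X X' = hcat (M * X) (M * X')"
proof -
  have "row (four_block_mat X X' (0\<^sub>m 0 r) (0\<^sub>m 0 s)) i = row X i @\<^sub>v row X' i" if "i < n" for i
    using that assms by (intro eq_vecI) auto
  show ?thesis using assms unfolding hcat_def
    by (intro eq_matI) (auto simp: scalar_prod_def)
qed

text \<open>A coordinate form of choosing a basis: the columns of \<open>X\<close> are a basis of
  \<open>W\<close>, and \<open>X * Y\<close> is a projection onto \<open>W\<close>. The induction is
  on the number of coordinates that do not vanish identically on \<open>W\<close>; a vector w of
  \<open>W\<close> with coordinate i equal to 1 is split off, and what remains are the vectors of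
  \<open>W\<close> with coordinate i equal to 0.\<close>

lemma subspace_projection:
  fixes W :: "'a :: field vec set"
  assumes "vsub n W"
  shows "\<exists>r X Y. X \<in> carrier_mat n r \<and> Y \<in> carrier_mat r n \<and> Y * X = 1\<^sub>m r \<and>
    (\<forall>u\<in>W. X *\<^sub>v (Y *\<^sub>v u) = u) \<and> (\<forall>v\<in>carrier_vec n. X *\<^sub>v (Y *\<^sub>v v) \<in> W)"
  using assms
proof (induction "card {i. i < n \<and> (\<exists>w\<in>W. w $ i \<noteq> 0)}" arbitrary: W rule: less_induct)
  case less
  note W = less.prems[unfolded subspace_vec_iff]
  show ?case
  proof (cases "W = {0\<^sub>v n}")
    case True
    show ?thesis using True
      by (intro exI[of _ 0] exI[of _ "0\<^sub>m n 0"] exI[of _ "0\<^sub>m 0 n"]) (auto intro!: eq_matI)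
  next
    case False
    then obtain w0 where w0: "w0 \<in> W" "w0 \<noteq> 0\<^sub>v n" using W by auto
    then obtain i where i: "i < n" "w0 $ i \<noteq> 0" using W by (metis carrier_vecD eq_vecI index_zero_vec subsetD)
    define w where "w = inverse (w0 $ i) \<cdot>\<^sub>v w0"
    have w: "w \<in> W" "w \<in> carrier_vec n" "w $ i = 1" using W w0 i by (auto simp: w_def)
    define W' where "W' = {u \<in> W. u $ i = 0}"
    have cW: "W \<subseteq> carrier_vec n" using W by auto
    have dW: "dim_vec u = n" if "u \<in> W" for u using cW that by auto
    have W': "vsub n W'"
      unfolding subspace_vec_iff using W i dW by (auto simp: W'_def)
    have "card {j. j < n \<and> (\<exists>u\<in>W'. u $ j \<noteq> 0)} < card {j. j < n \<and> (\<exists>u\<in>W. u $ j \<noteq> 0)}"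
      proof (rule psubset_card_mono)
      have "i \<in> {j. j < n \<and> (\<exists>u\<in>W. u $ j \<noteq> 0)}" proof -
        have "w $ i \<noteq> 0" using w(3) by simp
        thus ?thesis using w(1) i(1) by blast
      qed
      moreover have "i \<notin> {j. j < n \<and> (\<exists>u\<in>W'. u $ j \<noteq> 0)}" by (auto simp: W'_def)
      moreover have "{j. j < n \<and> (\<exists>u\<in>W'. u $ j \<noteq> 0)} \<subseteq> {j. j < n \<and> (\<exists>u\<in>W. u $ j \<noteq> 0)}" by (auto simp: W'_def)
      ultimately show "{j. j < n \<and> (\<exists>u\<in>W'. u $ j \<noteq> 0)} \<subset> {j. j < n \<and> (\<exists>u\<in>W. u $ j \<noteq> 0)}" by blast
    qed simp
    from less.hyps[OF this W'] obtain r X1 Y1 where X1: "X1 \<in> carrier_mat n r"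
      and Y1: "Y1 \<in> carrier_mat r n" and YX1: "Y1 * X1 = 1\<^sub>m r"
      and fix1: "\<And>u. u \<in> W' \<Longrightarrow> X1 *\<^sub>v (Y1 *\<^sub>v u) = u"
      and im1: "\<And>v. v \<in> carrier_vec n \<Longrightarrow> X1 *\<^sub>v (Y1 *\<^sub>v v) \<in> W'" by blast
    \<comment> \<open>\<open>wm\<close> is the vector w as a column and \<open>em\<close> the i-th
      coordinate functional, so \<open>wm * em\<close> maps v to v_i w.\<close>
    define wm where "wm = mat n 1 (\<lambda>(j, _). w $ j)"
    define em where "em = mat 1 n (\<lambda>(_, j). if j = i then 1 else 0 :: 'a)"
    have wm: "wm \<in> carrier_mat n 1" and em: "em \<in> carrier_mat 1 n" by (auto simp: wm_def em_def)
    have E: "wm * em \<in> carrier_mat n n" using wm em by auto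
    have em_vec: "em *\<^sub>v v = vec 1 (\<lambda>_. v $ i)" if "v \<in> carrier_vec n" for v
      using that i by (intro eq_vecI) (auto simp: em_def scalar_prod_def if_distrib[of "\<lambda>x. x * _"] cong: if_cong)
    have wm_vec: "wm *\<^sub>v vec 1 (\<lambda>_. a) = a \<cdot>\<^sub>v w" for a
      using w by (intro eq_vecI) (auto simp: wm_def scalar_prod_def)
    have em_w: "em * wm = 1\<^sub>m 1"
      using w i by (intro eq_matI) (auto simp: em_def wm_def scalar_prod_def if_distrib[of "\<lambda>x. x * _"] cong: if_cong)
    have imX1: "X1 *\<^sub>v v \<in> W'" if v: "v \<in> carrier_vec r" for v
    proof -
      have "X1 *\<^sub>v (Y1 *\<^sub>v (X1 *\<^sub>v v)) = X1 *\<^sub>v v"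
        using mat_vec_cancel_left[OF YX1] X1 Y1 v by auto
      thus ?thesis using im1[of "X1 *\<^sub>v v"] X1 v by auto
    qed
    have em_X1: "em * X1 = 0\<^sub>m 1 r"
    proof (rule eq_mat_by_vec[of _ 1 r])
      fix v :: "'a vec" assume v: "v \<in> carrier_vec r"
      have "em * X1 *\<^sub>v v = vec 1 (\<lambda>_. (X1 *\<^sub>v v) $ i)" 
        using em_vec[OF mult_mat_vec_carrier[OF X1 v]] assoc_mult_mat_vec[OF em X1 v] by (simp only:)
      also have "(X1 *\<^sub>v v) $ i = 0" using imX1[OF v] by (simp add: W'_def)
      finally show "em * X1 *\<^sub>v v = 0\<^sub>m 1 r *\<^sub>v v" using v by (auto simp: zero_vec_def)
    qed (use em X1 in auto)
    \<comment> \<open>\<open>Y1\<close> applied to v - v_i w: this kills w and is still a left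
      inverse of \<open>X1\<close>, whose image has zero i-th coordinate.\<close>
    define Z where "Z = Y1 * (1\<^sub>m n - wm * em)"
    have Z: "Z \<in> carrier_mat r n" unfolding Z_def by (rule mult_carrier_mat[OF Y1 minus_carrier_mat[OF E]])
    have Zw: "Z * wm = 0\<^sub>m r 1"
    proof -
      have "(1\<^sub>m n - wm * em) * wm = wm - wm * (em * wm)"
        using minus_mult_distrib_mat[OF one_carrier_mat E wm] wm em by (simp add: mat_assoc)
      also have "\<dots> = 0\<^sub>m n 1" using em_w wm by auto
      finally show ?thesis unfolding Z_def using Y1 E wm em by (subst mat_assoc) auto
    qed
    have ZX: "Z * X1 = 1\<^sub>m r"
    proof -
      have "(1\<^sub>m n - wm * em) * X1 = X1 - wm * (em * X1)"
        using minus_mult_distrib_mat[OF one_carrier_mat E X1] wm em X1 by (simp add: mat_assoc)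
      also have "\<dots> = X1" using em_X1 wm X1 by auto
      finally show ?thesis unfolding Z_def using Y1 E X1 YX1 by (subst mat_assoc) auto
    qed
    define X where "X = hcat wm X1"
    define Y where "Y = vcat em Z"
    have X: "X \<in> carrier_mat n (1 + r)" and Y: "Y \<in> carrier_mat (1 + r) n"
      using wm X1 em Z by (auto simp: X_def Y_def simp del: plus_1_eq_Suc One_nat_def)
    have YX: "Y * X = 1\<^sub>m (1 + r)"
      unfolding X_def Y_def
      by (subst vcat_mult_hcat[OF em Z wm X1], unfold em_w em_X1 Zw ZX) simp
    have XY: "X * Y = wm * em + X1 * Z"
      unfolding X_def Y_def by (rule hcat_mult_vcat[OF em Z wm X1])
    have XYv: "X *\<^sub>v (Y *\<^sub>v v) = v $ i \<cdot>\<^sub>v w + X1 *\<^sub>v (Y1 *\<^sub>v (v - v $ i \<cdot>\<^sub>v w))" if v: "v \<in> carrier_vec n" for v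
    proof -
      have e: "wm * em *\<^sub>v v = v $ i \<cdot>\<^sub>v w"
        unfolding assoc_mult_mat_vec[OF wm em v] em_vec[OF v] wm_vec ..
      have "X *\<^sub>v (Y *\<^sub>v v) = (wm * em + X1 * Z) *\<^sub>v v" using X Y v by (simp flip: XY add: mat_vec_assoc)
      also have "\<dots> = wm * em *\<^sub>v v + X1 * Z *\<^sub>v v"
        using E X1 Z v by (intro add_mult_distrib_mat_vec[of _ n n]) auto
      also have "X1 * Z *\<^sub>v v = X1 *\<^sub>v (Y1 *\<^sub>v ((1\<^sub>m n - wm * em) *\<^sub>v v))"
        unfolding Z_def using X1 Y1 wm em v by (simp add: mat_vec_assoc)
      also have "(1\<^sub>m n - wm * em) *\<^sub>v v = v - v $ i \<cdot>\<^sub>v w"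
        using minus_mult_distrib_mat_vec[OF one_carrier_mat E v] v e by auto
      finally show ?thesis using e by simp
    qed
    show ?thesis
    proof (intro exI conjI ballI)
      fix u assume u: "u \<in> W"
      have uc: "u \<in> carrier_vec n" using u cW by auto
      have "u - u $ i \<cdot>\<^sub>v w = u + (- u $ i) \<cdot>\<^sub>v w" using uc w by (intro eq_vecI) auto
      hence "u - u $ i \<cdot>\<^sub>v w \<in> W'" using u w uc i W by (auto simp: W'_def)
      from fix1[OF this] XYv[OF uc] show "X *\<^sub>v (Y *\<^sub>v u) = u" using uc w by auto
    next
      fix v :: "'a vec" assume v: "v \<in> carrier_vec n"
      have "X1 *\<^sub>v (Y1 *\<^sub>v (v - v $ i \<cdot>\<^sub>v w)) \<in> W" using im1[of "v - v $ i \<cdot>\<^sub>v w"] v w by (auto simp: W'_def)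
      thus "X *\<^sub>v (Y *\<^sub>v v) \<in> W" unfolding XYv[OF v] using W w by auto
    qed (fact X Y YX)+
  qed
qed

lemma subspace_im:
  fixes A :: "'a :: field mat"
  assumes A: "A \<in> carrier_mat n m" and W: "vsub m W"
  shows "vsub n ((\<lambda>v. A *\<^sub>v v) ` W)"
proof -
  have "\<exists>w\<in>W. A *\<^sub>v u + A *\<^sub>v v = A *\<^sub>v w" if "u \<in> W" "v \<in> W" for u v
    using W that A
    by (intro bexI[of _ "u + v"] mult_add_distrib_mat_vec[of A n m, symmetric]) (auto simp: subspace_vec_iff)
  moreover have "\<exists>w\<in>W. c \<cdot>\<^sub>v (A *\<^sub>v u) = A *\<^sub>v w" if "u \<in> W" for u c
    using W that A by (intro bexI[of _ "c \<cdot>\<^sub>v u"] mult_mat_vec[of A n m, symmetric]) (auto simp: subspace_vec_iff)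
  moreover have "0\<^sub>v n \<in> (\<lambda>v. A *\<^sub>v v) ` W"
    using W A mult_mat_vec_zero'[OF A] by (metis imageI subspace_vec_iff)
  ultimately show ?thesis using W A by (auto simp: subspace_vec_iff image_iff)
qed

lemma subspace_preimage:
  fixes A :: "'a :: field mat"
  assumes A: "A \<in> carrier_mat n m" and W: "vsub n W" and U: "vsub m U"
  shows "vsub m {v \<in> U. A *\<^sub>v v \<in> W}"
proof -
  note U = U[unfolded subspace_vec_iff] and W = W[unfolded subspace_vec_iff]
  have "A *\<^sub>v (u + v) \<in> W" if "u \<in> U" "v \<in> U" "A *\<^sub>v u \<in> W" "A *\<^sub>v v \<in> W" for u v
    using that U W mult_add_distrib_mat_vec[OF A, of u v] by (simp add: subset_iff)
  moreover have "A *\<^sub>v (c \<cdot>\<^sub>v u) \<in> W" if "u \<in> U" "A *\<^sub>v u \<in> W" for u c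
    using that U W mult_mat_vec[OF A, of u c] by (simp add: subset_iff)
  moreover have "A *\<^sub>v 0\<^sub>v m \<in> W" using mult_mat_vec_zero'[OF A] W by simp
  ultimately show ?thesis using U W unfolding subspace_vec_iff by simp blast
qed

lemma subspace_full: "vsub n (carrier_vec n :: 'a :: field vec set)"
  and subspace_zero: "vsub n {0\<^sub>v n :: 'a :: field vec}"
  by (auto simp: subspace_vec_iff)

text \<open>A projection onto the image of \<open>E\<close> need not have the same kernel as
  \<open>E\<close>. Composing the retraction with \<open>E\<close> repairs this:
  \<open>X * (Y * E) = E\<close>, and \<open>Y * E\<close> is still a left inverse of
  \<open>X\<close> because \<open>E\<close> fixes the columns of \<open>X\<close>.\<close>

lemma idempotent_split:
  fixes E :: "'a :: field mat"
  assumes E: "E \<in> carrier_mat n n" and EE: "E * E = E"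
  obtains r X Y where "X \<in> carrier_mat n r" "Y \<in> carrier_mat r n" "Y * X = 1\<^sub>m r" "E = X * Y"
proof -
  have "vsub n ((\<lambda>v. E *\<^sub>v v) ` carrier_vec n)" by (rule subspace_im[OF E subspace_full])
  from subspace_projection[OF this] obtain r X Y where X: "X \<in> carrier_mat n r" and Y: "Y \<in> carrier_mat r n"
    and YX: "Y * X = 1\<^sub>m r" and f: "\<And>v. v \<in> carrier_vec n \<Longrightarrow> X *\<^sub>v (Y *\<^sub>v (E *\<^sub>v v)) = E *\<^sub>v v"
    and im: "\<And>v. v \<in> carrier_vec n \<Longrightarrow> X *\<^sub>v (Y *\<^sub>v v) \<in> (\<lambda>v. E *\<^sub>v v) ` carrier_vec n" by blast
  have 1: "X * (Y * E) = E"
    by (rule eq_mat_by_vec[of _ n n]) (use X Y E f in \<open>auto simp: mat_vec_assoc\<close>)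
  have EEv: "E *\<^sub>v (E *\<^sub>v v) = E *\<^sub>v v" if "v \<in> carrier_vec n" for v
    unfolding assoc_mult_mat_vec[OF E E that, symmetric] EE ..
  have 2: "E * X = X"
  proof (rule eq_mat_by_vec[of _ n r])
    fix v :: "'a vec" assume v: "v \<in> carrier_vec r"
    have "X *\<^sub>v (Y *\<^sub>v (X *\<^sub>v v)) = X *\<^sub>v v" using mat_vec_cancel_left[OF YX] X Y v by auto
    then obtain u where "u \<in> carrier_vec n" "X *\<^sub>v v = E *\<^sub>v u" using im[of "X *\<^sub>v v"] X v by auto
    thus "E * X *\<^sub>v v = X *\<^sub>v v" using E X v EEv by (auto simp: mat_vec_assoc)
  qed (use E X in auto)
  have "Y * E * X = 1\<^sub>m r" using 2 X Y E YX by (auto simp: mat_assoc)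
  thus ?thesis using that[of X r "Y * E"] 1 X Y E by auto
qed

text \<open>The images of X and X' are complementary subspaces.\<close>

definition splitting :: "nat \<Rightarrow> nat \<Rightarrow> nat \<Rightarrow> 'a :: field mat \<Rightarrow> 'a mat \<Rightarrow> 'a mat \<Rightarrow> 'a mat \<Rightarrow> bool" where
  "splitting n r s X Y X' Y' \<longleftrightarrow> n = r + s \<and>
     X \<in> carrier_mat n r \<and> Y \<in> carrier_mat r n \<and> X' \<in> carrier_mat n s \<and> Y' \<in> carrier_mat s n \<and>
     Y * X = 1\<^sub>m r \<and> Y' * X' = 1\<^sub>m s \<and> Y * X' = 0\<^sub>m r s \<and> Y' * X = 0\<^sub>m s r \<and> X * Y + X' * Y' = 1\<^sub>m n"

lemma splitting_inverse:
  assumes "splitting n r s X Y X' Y'"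
  shows "vcat Y Y' * hcat X X' = 1\<^sub>m n" "hcat X X' * vcat Y Y' = 1\<^sub>m n"
proof -
  note a = assms[unfolded splitting_def]
  have c: "Y \<in> carrier_mat r n" "Y' \<in> carrier_mat s n" "X \<in> carrier_mat n r" "X' \<in> carrier_mat n s" using a by auto
  show "vcat Y Y' * hcat X X' = 1\<^sub>m n" using vcat_mult_hcat[OF c] a by simp
  show "hcat X X' * vcat Y Y' = 1\<^sub>m n" using hcat_mult_vcat[OF c] a by simp
qed

text \<open>The complementary projection \<open>1 - X * Y\<close> is idempotent, and splitting it
  supplies the second pair. That r and s add up to n follows from the two concatenated matrices
  being inverse to each other.\<close>

lemma complement_exists:
  fixes X Y :: "'a :: field mat"
  assumes X: "X \<in> carrier_mat n r" and Y: "Y \<in> carrier_mat r n" and YX: "Y * X = 1\<^sub>m r"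
  obtains s X' Y' where "splitting n r s X Y X' Y'"
proof -
  have XY: "X * Y \<in> carrier_mat n n" using X Y by auto
  let ?E = "1\<^sub>m n - X * Y"
  have E: "?E \<in> carrier_mat n n" using XY by (auto intro!: minus_carrier_mat)
  have XYX: "X * Y * X = X" using X Y YX by (simp add: mat_assoc)
  have YXY: "Y * (X * Y) = Y" by (rule mat_cancel_left[OF YX]) (use X Y in auto)
  have EX: "?E * X = 0\<^sub>m n r"
    unfolding minus_mult_distrib_mat[OF one_carrier_mat XY X] XYX left_mult_one_mat[OF X]
    using X by (intro eq_matI) auto
  have YE: "Y * ?E = 0\<^sub>m r n"
    unfolding mult_minus_distrib_mat[OF Y one_carrier_mat XY] YXY right_mult_one_mat[OF Y]
    using Y by (intro eq_matI) auto
  have EXY: "?E * (X * Y) = 0\<^sub>m n n"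
    unfolding assoc_mult_mat[OF E X Y, symmetric] EX using Y by simp
  have "?E * ?E = ?E - 0\<^sub>m n n" 
    unfolding mult_minus_distrib_mat[OF E one_carrier_mat XY] EXY right_mult_one_mat[OF E] ..
  also have "\<dots> = ?E" using minus_mat_zero[OF E] .
  finally have EE: "?E * ?E = ?E" .
  obtain s X' Y' where X': "X' \<in> carrier_mat n s" and Y': "Y' \<in> carrier_mat s n"
    and YX': "Y' * X' = 1\<^sub>m s" and EXY': "?E = X' * Y'" by (rule idempotent_split[OF E EE])
  have EX': "?E * X' = X'" unfolding EXY' using X' Y' YX' by (simp add: mat_assoc)
  have "Y * X' = Y * ?E * X'" by (rule assoc_mult_mat[OF Y E X', unfolded EX', symmetric])
  hence 1: "Y * X' = 0\<^sub>m r s" unfolding YE using X' by simp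
  have YE': "Y' * ?E = Y'" unfolding EXY' by (rule mat_cancel_left[OF YX']) (use X' Y' in auto)
  have "Y' * X = Y' * (?E * X)" by (rule assoc_mult_mat[OF Y' E X, unfolded YE'])
  hence 2: "Y' * X = 0\<^sub>m s r" unfolding EX using Y' by simp
  have 3: "X * Y + X' * Y' = 1\<^sub>m n"
    unfolding EXY'[symmetric] using X Y by (intro eq_matI) (simp_all del: index_mult_mat(1))
  have "vcat Y Y' * hcat X X' = 1\<^sub>m (r + s)" using vcat_mult_hcat[OF Y Y' X X'] YX YX' 1 2 by simp
  moreover have "hcat X X' * vcat Y Y' = 1\<^sub>m n" using hcat_mult_vcat[OF Y Y' X X'] 3 by simp
  ultimately have "n = r + s"
    using right_inverse_dim_le[OF hcat_carrier[OF X X'] vcat_carrier[OF Y Y']]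
      right_inverse_dim_le[OF vcat_carrier[OF Y Y'] hcat_carrier[OF X X']] by simp
  hence "splitting n r s X Y X' Y'" unfolding splitting_def using X Y X' Y' YX YX' 1 2 3 by simp
  thus ?thesis by (rule that)
qed

subsection \<open>Eigenvalues with multiplicity\<close>

text \<open>Eigenvalues with algebraic multiplicity. Keeping the multiset instead of a sum lets the
  same lemmas serve both the lifted trace and the ordinary trace.\<close>

definition evs :: "'a :: field mat \<Rightarrow> 'a multiset" where
  "evs A = proots (char_poly A)"

lemma char_poly_nonzero: "A \<in> carrier_mat n n \<Longrightarrow> char_poly A \<noteq> (0 :: 'a :: field poly)"
  using degree_monic_char_poly[of A n] by auto

lemma evs_similar: "similar_mat A B \<Longrightarrow> evs A = evs B"
  by (simp add: evs_def char_poly_similar)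

lemma evs_conjugate:
  assumes "P \<in> carrier_mat n n" "Q \<in> carrier_mat n n" "P * Q = 1\<^sub>m n" "Q * P = 1\<^sub>m n" "B \<in> carrier_mat n n"
    and "A = P * B * Q"
  shows "evs A = evs B"
  by (rule evs_similar, rule similar_matI[of _ _ P Q n]) (use assms in auto)

lemma evs_intertwined:
  fixes A B :: "'a :: field mat"
  assumes "A \<in> carrier_mat n n" "B \<in> carrier_mat m m" "P \<in> carrier_mat n m" "Q \<in> carrier_mat m n"
    and PQ: "P * Q = 1\<^sub>m n" and QP: "Q * P = 1\<^sub>m m" and AP: "A * P = P * B"
  shows "evs A = evs B"
proof -
  have nm: "n = m" using right_inverse_dim_le[OF assms(3,4) PQ] right_inverse_dim_le[OF assms(4,3) QP] by simp
  have "A = P * B * Q"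
    unfolding AP[symmetric] using assoc_mult_mat[OF assms(1,3,4)] PQ assms(1) by simp
  thus ?thesis using evs_conjugate[of P n Q B A] assms nm by simp
qed

lemma evs_four_block:
  fixes A :: "'a :: field mat"
  assumes A: "A \<in> carrier_mat r r" and B: "B \<in> carrier_mat r s" and D: "D \<in> carrier_mat s s"
  shows "evs (four_block_mat A B (0\<^sub>m s r) D) = evs A + evs D"
proof -
  let ?F = "four_block_mat A B (0\<^sub>m s r) D"
  have "char_poly_matrix ?F = four_block_mat (char_poly_matrix A) (map_mat (\<lambda>a. [:- a:]) B) (0\<^sub>m s r) (char_poly_matrix D)"
    unfolding char_poly_matrix_def using assms by (intro eq_matI) auto
  hence "char_poly ?F = char_poly A * char_poly D"
    unfolding char_poly_def using assms
    by (simp add: det_four_block_mat_lower_left_zero[of _ r _ s])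
  thus ?thesis unfolding evs_def using char_poly_nonzero[OF A] char_poly_nonzero[OF D]
    by (simp add: proots_mult)
qed

lemma splitting_similar:
  fixes A :: "'a :: field mat"
  assumes S: "splitting n r s X Y X' Y'" and A: "A \<in> carrier_mat n n"
  shows "A = hcat X X' * four_block_mat (Y * (A * X)) (Y * (A * X')) (Y' * (A * X)) (Y' * (A * X')) * vcat Y Y'"
proof -
  note a = S[unfolded splitting_def]
  have c: "Y \<in> carrier_mat r n" "Y' \<in> carrier_mat s n" "X \<in> carrier_mat n r" "X' \<in> carrier_mat n s" and n: "n = r + s"
    using a by auto
  have H: "hcat X X' \<in> carrier_mat n n" and V: "vcat Y Y' \<in> carrier_mat n n" using c n by auto
  have AH: "A * hcat X X' = hcat (A * X) (A * X')" by (rule mult_hcat[OF A c(3,4)])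
  have "four_block_mat (Y * (A * X)) (Y * (A * X')) (Y' * (A * X)) (Y' * (A * X')) = vcat Y Y' * (A * hcat X X')"
    unfolding AH by (rule vcat_mult_hcat[symmetric, where r = r and s = s and n = n]) (use c A in auto)
  moreover have "hcat X X' * (vcat Y Y' * (A * hcat X X')) * vcat Y Y' = A"
  proof -
    have "hcat X X' * (vcat Y Y' * (A * hcat X X')) = A * hcat X X'"
      by (rule mat_cancel_left[OF splitting_inverse(2)[OF S]]) (use H V A in auto)
    moreover have "A * hcat X X' * vcat Y Y' = A * (hcat X X' * vcat Y Y')"
      by (rule assoc_mult_mat[OF A H V])
    ultimately show ?thesis using splitting_inverse(2)[OF S] A by simp
  qed
  ultimately show ?thesis by simp
qed

text \<open>The last hypothesis says that the image of \<open>X\<close> is invariant under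
  \<open>A\<close>; in the basis adapted to the splitting \<open>A\<close> is then block upper
  triangular.\<close>

lemma evs_splitting:
  fixes A :: "'a :: field mat"
  assumes S: "splitting n r s X Y X' Y'" and A: "A \<in> carrier_mat n n" and 0: "Y' * (A * X) = 0\<^sub>m s r"
  shows "evs A = evs (Y * (A * X)) + evs (Y' * (A * X'))"
proof -
  note a = S[unfolded splitting_def]
  have c: "Y \<in> carrier_mat r n" "Y' \<in> carrier_mat s n" "X \<in> carrier_mat n r" "X' \<in> carrier_mat n s" and n: "n = r + s"
    using a by auto
  have "evs A = evs (four_block_mat (Y * (A * X)) (Y * (A * X')) (0\<^sub>m s r) (Y' * (A * X')))"
    by (rule evs_conjugate[of "hcat X X'" n "vcat Y Y'", OF _ _ splitting_inverse(2,1)[OF S] _ splitting_similar[OF S A, unfolded 0]])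
       (use c A n in auto)
  also have "\<dots> = evs (Y * (A * X)) + evs (Y' * (A * X'))"
    by (rule evs_four_block) (use c A in auto)
  finally show ?thesis .
qed

lemma evs_upper_triangular:
  fixes U :: "'a :: field mat"
  assumes "U \<in> carrier_mat n n" "upper_triangular U"
  shows "evs U = mset (diag_mat U)"
proof -
  have "proots (\<Prod>a\<leftarrow>as. [:- a, 1:]) = mset as" for as :: "'a list"
  proof (induction as)
    case (Cons a as)
    have "(\<Prod>a\<leftarrow>as. [:- a, 1:]) \<noteq> (0 :: 'a poly)" by (auto simp: prod_list_zero_iff)
    thus ?case using Cons by (simp add: proots_mult del: mult_pCons_left)
  qed simp
  thus ?thesis unfolding evs_def char_poly_upper_triangular[OF assms] .
qed

lemma evs_eigenvector:
  fixes A :: "'a :: field mat"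
  assumes A: "A \<in> carrier_mat n n" and x: "x \<in># evs A"
  obtains v where "v \<in> carrier_vec n" "v \<noteq> 0\<^sub>v n" "A *\<^sub>v v = x \<cdot>\<^sub>v v"
proof -
  have "poly (char_poly A) x = 0" using x char_poly_nonzero[OF A] by (simp add: evs_def)
  thus ?thesis using that A unfolding eigenvalue_root_char_poly[OF A, symmetric] eigenvalue_def eigenvector_def by auto
qed

section \<open>Triangularization over an algebraically closed field\<close>

lemma eigenvalue_exists:
  fixes A :: "'a :: alg_closed_field mat"
  assumes A: "A \<in> carrier_mat n n" and n: "n > 0"
  obtains x v where "v \<in> carrier_vec n" "v \<noteq> 0\<^sub>v n" "A *\<^sub>v v = x \<cdot>\<^sub>v v"
proof -
  have "degree (char_poly A) > 0" using degree_monic_char_poly[OF A] n by simp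
  then obtain x where "poly (char_poly A) x = 0" using alg_closed_imp_poly_has_root by blast
  hence "x \<in># evs A" using char_poly_nonzero[OF A] by (simp add: evs_def)
  from evs_eigenvector[OF A this] that show ?thesis by metis
qed

text \<open>The triangular form is kept together with its base change, since the same
  \<open>P\<close> and \<open>Q\<close> also triangularize powers and scalar multiples, and
  Kronecker products of base changes triangularize Kronecker products.\<close>

definition triangularizes :: "nat \<Rightarrow> 'a :: field mat \<Rightarrow> 'a mat \<Rightarrow> 'a mat \<Rightarrow> 'a mat \<Rightarrow> bool" where
  "triangularizes n P Q U A \<longleftrightarrow> P \<in> carrier_mat n n \<and> Q \<in> carrier_mat n n \<and> U \<in> carrier_mat n n \<and>
     P * Q = 1\<^sub>m n \<and> Q * P = 1\<^sub>m n \<and> A = P * U * Q \<and> upper_triangular U"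

lemma four_block_conjugate:
  fixes a b P Q U :: "'a :: field mat"
  assumes a: "a \<in> carrier_mat r r" and b: "b \<in> carrier_mat r n"
    and P: "P \<in> carrier_mat n n" and Q: "Q \<in> carrier_mat n n" and U: "U \<in> carrier_mat n n"
    and PQ: "P * Q = 1\<^sub>m n"
  shows "four_block_mat a b (0\<^sub>m n r) (P * U * Q) =
    four_block_mat (1\<^sub>m r) (0\<^sub>m r n) (0\<^sub>m n r) P * four_block_mat a (b * P) (0\<^sub>m n r) U *
    four_block_mat (1\<^sub>m r) (0\<^sub>m r n) (0\<^sub>m n r) Q"
    and "four_block_mat (1\<^sub>m r) (0\<^sub>m r n) (0\<^sub>m n r) P * four_block_mat (1\<^sub>m r) (0\<^sub>m r n) (0\<^sub>m n r) Q = 1\<^sub>m (r + n)"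
proof -
  note c = one_carrier_mat[of r] zero_carrier_mat[of r n] zero_carrier_mat[of n r]
  have bP: "b * P \<in> carrier_mat r n" and PU: "P * U \<in> carrier_mat n n" using b P U by auto
  have "b * P * Q = b" using assoc_mult_mat[OF b P Q] PQ right_mult_one_mat[OF b] by simp
  thus "four_block_mat a b (0\<^sub>m n r) (P * U * Q) =
    four_block_mat (1\<^sub>m r) (0\<^sub>m r n) (0\<^sub>m n r) P * four_block_mat a (b * P) (0\<^sub>m n r) U *
    four_block_mat (1\<^sub>m r) (0\<^sub>m r n) (0\<^sub>m n r) Q"
    unfolding mult_four_block_mat[OF c P a bP c(3) U]
    using a b P Q U bP PU mult_four_block_mat[of a r r "b * P" n "0\<^sub>m n r" n "P * U" "1\<^sub>m r" r "0\<^sub>m r n" n "0\<^sub>m n r" Q]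
    by auto
  show "four_block_mat (1\<^sub>m r) (0\<^sub>m r n) (0\<^sub>m n r) P * four_block_mat (1\<^sub>m r) (0\<^sub>m r n) (0\<^sub>m n r) Q = 1\<^sub>m (r + n)"
    unfolding mult_four_block_mat[OF c P c Q] using P Q PQ by auto
qed

text \<open>Induction on the size: an eigenvector spans an invariant line, and the induction
  hypothesis applies to the matrix induced on a complement.\<close>

lemma triangularize:
  fixes A :: "'a :: alg_closed_field mat"
  assumes "A \<in> carrier_mat n n"
  shows "\<exists>P Q U. triangularizes n P Q U A"
  using assms
proof (induction n arbitrary: A)
  case 0
  thus ?case
    by (intro exI[of _ "1\<^sub>m 0"] exI[of _ A]) (auto simp: triangularizes_def intro!: eq_matI)
next
  case (Suc n)
  note A = Suc.prems
  obtain x v where v: "v \<in> carrier_vec (Suc n)" "v \<noteq> 0\<^sub>v (Suc n)" "A *\<^sub>v v = x \<cdot>\<^sub>v v"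
    by (rule eigenvalue_exists[OF A]) auto
  define X where "X = mat (Suc n) 1 (\<lambda>(i, _). v $ i)"
  have X: "X \<in> carrier_mat (Suc n) 1" by (simp add: X_def)
  obtain i where i: "i < Suc n" "v $ i \<noteq> 0" using v by (metis carrier_vecD eq_vecI index_zero_vec)
  \<comment> \<open>The coordinate functional at a nonzero coordinate of v, scaled to be a left
    inverse of the column \<open>X\<close>.\<close>
  define Y where "Y = mat 1 (Suc n) (\<lambda>(_, j). if j = i then inverse (v $ i) else 0)"
  have Y: "Y \<in> carrier_mat 1 (Suc n)" by (simp add: Y_def)
  have YX: "Y * X = 1\<^sub>m 1"
    using i by (intro eq_matI) (auto simp: X_def Y_def scalar_prod_def if_distrib[of "\<lambda>x. x * _"] cong: if_cong)
  obtain s X' Y' where S: "splitting (Suc n) 1 s X Y X' Y'" by (rule complement_exists[OF X Y YX])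
  have s: "s = n" and X': "X' \<in> carrier_mat (Suc n) n" and Y': "Y' \<in> carrier_mat n (Suc n)"
    and Y'X: "Y' * X = 0\<^sub>m n 1"
    using S by (auto simp: splitting_def)
  have AX: "A * X = x \<cdot>\<^sub>m X"
  proof (rule eq_matI)
    fix a b assume ab: "a < dim_row (x \<cdot>\<^sub>m X)" "b < dim_col (x \<cdot>\<^sub>m X)"
    have "col X 0 = v" using v by (intro eq_vecI) (auto simp: X_def)
    hence "(A * X) $$ (a, b) = (A *\<^sub>v v) $ a" using ab A X by auto
    thus "(A * X) $$ (a, b) = (x \<cdot>\<^sub>m X) $$ (a, b)" using v ab by (auto simp: X_def)
  qed (use A X in auto)
  have 0: "Y' * (A * X) = 0\<^sub>m n 1"
    unfolding AX mult_smult_distrib[OF Y' X] Y'X by (intro eq_matI) auto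
  let ?A' = "Y' * (A * X')"
  have A': "?A' \<in> carrier_mat n n" using A Y' X' by auto
  obtain P Q U where T: "triangularizes n P Q U ?A'" using Suc.IH[OF A'] by auto
  note T = T[unfolded triangularizes_def]
  let ?a = "Y * (A * X)" and ?b = "Y * (A * X')"
  have ca: "?a \<in> carrier_mat 1 1" and cb: "?b \<in> carrier_mat 1 n" using A X Y X' by auto
  let ?F = "four_block_mat ?a ?b (0\<^sub>m n 1) ?A'"
  let ?P = "four_block_mat (1\<^sub>m 1) (0\<^sub>m 1 n) (0\<^sub>m n 1) P"
  let ?Q = "four_block_mat (1\<^sub>m 1) (0\<^sub>m 1 n) (0\<^sub>m n 1) Q"
  let ?U = "four_block_mat ?a (?b * P) (0\<^sub>m n 1) U"
  have F: "?F = ?P * ?U * ?Q" and PQ: "?P * ?Q = 1\<^sub>m (Suc n)" and QP: "?Q * ?P = 1\<^sub>m (Suc n)"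
    using four_block_conjugate[OF ca cb, of P Q U] four_block_conjugate(2)[OF ca cb, of Q P U] T by auto
  have U: "upper_triangular ?U"
    by (rule upper_triangular_four_block[of _ 1 _ n]) (use T ca in \<open>auto simp: upper_triangular_def\<close>)
  have cPQU: "?P \<in> carrier_mat (Suc n) (Suc n)" "?Q \<in> carrier_mat (Suc n) (Suc n)" "?U \<in> carrier_mat (Suc n) (Suc n)"
    using four_block_carrier_mat[of "1\<^sub>m 1" 1 1 P n n] four_block_carrier_mat[of "1\<^sub>m 1" 1 1 Q n n] four_block_carrier_mat[OF ca, of U n n] T
    by auto
  let ?H = "hcat X X'" and ?V = "vcat Y Y'"
  have cH: "?H \<in> carrier_mat (Suc n) (Suc n)" and cV: "?V \<in> carrier_mat (Suc n) (Suc n)"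
    using hcat_carrier[OF X X'] vcat_carrier[OF Y Y'] by auto
  note HV = splitting_inverse[OF S]
  have "A = ?H * ?F * ?V" using splitting_similar[OF S A] unfolding 0 .
  also have "\<dots> = (?H * ?P) * ?U * (?Q * ?V)" unfolding F
    using cPQU cH cV by (simp add: mat_assoc del: index_mat_four_block)
  finally have 1: "A = (?H * ?P) * ?U * (?Q * ?V)" .
  have 2: "(?H * ?P) * (?Q * ?V) = 1\<^sub>m (Suc n)"
  proof -
    have "?P * (?Q * ?V) = ?V" by (rule mat_cancel_left[OF PQ]) (use cPQU cV in \<open>auto simp del: index_mat_four_block\<close>)
    thus ?thesis using assoc_mult_mat[OF cH cPQU(1) mult_carrier_mat[OF cPQU(2) cV]] HV by simp
  qed
  have 3: "(?Q * ?V) * (?H * ?P) = 1\<^sub>m (Suc n)"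
  proof -
    have "?V * (?H * ?P) = ?P" by (rule mat_cancel_left[OF HV(1)]) (use cPQU cV cH in \<open>auto simp del: index_mat_four_block\<close>)
    thus ?thesis using assoc_mult_mat[OF cPQU(2) cV mult_carrier_mat[OF cH cPQU(1)]] QP by simp
  qed
  show ?case unfolding triangularizes_def
    using 1 2 3 U cPQU(3) mult_carrier_mat[OF cH cPQU(1)] mult_carrier_mat[OF cPQU(2) cV] by blast
qed

lemma evs_triangularizes:
  assumes "triangularizes n P Q U A"
  shows "evs A = mset (diag_mat U)"
  using assms evs_conjugate[of P n Q U A] evs_upper_triangular[of U n] unfolding triangularizes_def by auto

lemma size_evs:
  fixes A :: "'a :: alg_closed_field mat"
  assumes A: "A \<in> carrier_mat n n"
  shows "size (evs A) = n"
proof -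
  obtain P Q U where T: "triangularizes n P Q U A" using triangularize[OF A] by blast
  hence "U \<in> carrier_mat n n" by (auto simp: triangularizes_def)
  thus ?thesis unfolding evs_triangularizes[OF T] by (auto simp: diag_mat_def)
qed

lemma upper_triangular_mult:
  fixes U V :: "'a :: field mat"
  assumes U: "U \<in> carrier_mat n n" "upper_triangular U" and V: "V \<in> carrier_mat n n" "upper_triangular V"
  shows "upper_triangular (U * V)" and "i < n \<Longrightarrow> (U * V) $$ (i, i) = U $$ (i, i) * V $$ (i, i)"
proof -
  have 0: "U $$ (i, k) * V $$ (k, j) = 0" if "i < n" "j < n" "k < n" "k < i \<or> j < k" for i j k
    using that assms by (auto simp: upper_triangular_def)
  show "upper_triangular (U * V)"
  proof
    fix i j assume ij: "j < i" "i < dim_row (U * V)"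
    have "U $$ (i, k) * V $$ (k, j) = 0" if "k < n" for k
      by (rule 0) (use ij that U in auto)
    thus "(U * V) $$ (i, j) = 0" using ij U V by (auto simp: scalar_prod_def intro!: sum.neutral)
  qed
  assume i: "i < n"
  have "(U * V) $$ (i, i) = (\<Sum>k = 0..<n. U $$ (i, k) * V $$ (k, i))" using U V i by (auto simp: scalar_prod_def)
  also have "\<dots> = (\<Sum>k = 0..<n. if k = i then U $$ (i, i) * V $$ (i, i) else 0)"
    by (intro sum.cong) (use 0[of i i] i in \<open>auto simp: nat_neq_iff\<close>)
  also have "\<dots> = U $$ (i, i) * V $$ (i, i)" using i by simp
  finally show "(U * V) $$ (i, i) = U $$ (i, i) * V $$ (i, i)" .
qed

lemma upper_triangular_pow:
  fixes U :: "'a :: field mat"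
  assumes U: "U \<in> carrier_mat n n" "upper_triangular U"
  shows "upper_triangular (U ^\<^sub>m k) \<and> (\<forall>i<n. (U ^\<^sub>m k) $$ (i, i) = U $$ (i, i) ^ k)"
proof (induction k)
  case 0
  thus ?case using U by auto
next
  case (Suc k)
  have "U ^\<^sub>m k \<in> carrier_mat n n" using U by simp
  with Suc upper_triangular_mult[OF this _ U] show ?case by (auto simp: mult.commute)
qed

lemma mset_diag_mat: "A \<in> carrier_mat n n \<Longrightarrow> mset (diag_mat A) = image_mset (\<lambda>i. A $$ (i, i)) (mset_set {..<n})"
  by (simp add: diag_mat_def atLeast0LessThan flip: mset_set_upto_eq_mset_upto)

lemma sum_evs_triangularizes:
  assumes "triangularizes n P Q U A"
  shows "(\<Sum>x\<in>#evs A. f x) = (\<Sum>i<n. f (U $$ (i, i)))"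
  using assms mset_diag_mat[of U n] unfolding evs_triangularizes[OF assms]
  by (simp add: triangularizes_def sum_unfold_sum_mset multiset.map_comp comp_def)

lemma triangularizes_pow:
  assumes T: "triangularizes n P Q U A"
  shows "triangularizes n P Q (U ^\<^sub>m k) (A ^\<^sub>m k)"
proof -
  note t = T[unfolded triangularizes_def]
  have "similar_mat_wit A U P Q" by (rule similar_mat_witI[of _ _ n]) (use t in auto)
  thus ?thesis using t upper_triangular_pow[of U n k] similar_mat_wit_pow_id[of A U P Q k]
    unfolding triangularizes_def by auto
qed

lemma triangularizes_smult:
  fixes A :: "'a :: field mat"
  assumes T: "triangularizes n P Q U A"
  shows "triangularizes n P Q (c \<cdot>\<^sub>m U) (c \<cdot>\<^sub>m A)"
proof -
  note t = T[unfolded triangularizes_def]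
  have "c \<cdot>\<^sub>m A = P * (c \<cdot>\<^sub>m U) * Q"
    using t mult_smult_distrib[of P n n U n c] mult_smult_assoc_mat[of "P * U" n n Q n c] mult_carrier_mat[of P n n U n]
    by simp
  thus ?thesis using t unfolding triangularizes_def by (auto simp: upper_triangular_def)
qed

lemma evs_pow:
  fixes A :: "'a :: alg_closed_field mat"
  assumes "A \<in> carrier_mat n n"
  shows "evs (A ^\<^sub>m k) = image_mset (\<lambda>x. x ^ k) (evs A)"
proof -
  obtain P Q U where T: "triangularizes n P Q U A" using triangularize[OF assms] by blast
  hence U: "U \<in> carrier_mat n n" "upper_triangular U" by (auto simp: triangularizes_def)
  show ?thesis unfolding evs_triangularizes[OF T] evs_triangularizes[OF triangularizes_pow[OF T]]
      mset_diag_mat[OF U(1)] mset_diag_mat[OF pow_carrier_mat[OF U(1)]] multiset.map_comp comp_def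
    by (rule image_mset_cong) (use upper_triangular_pow[OF U, of k] in auto)
qed

lemma evs_smult:
  fixes A :: "'a :: alg_closed_field mat"
  assumes "A \<in> carrier_mat n n"
  shows "evs (c \<cdot>\<^sub>m A) = image_mset ((*) c) (evs A)"
proof -
  obtain P Q U where T: "triangularizes n P Q U A" using triangularize[OF assms] by blast
  hence U: "U \<in> carrier_mat n n" by (auto simp: triangularizes_def)
  show ?thesis unfolding evs_triangularizes[OF T] evs_triangularizes[OF triangularizes_smult[OF T]]
      mset_diag_mat[OF U] mset_diag_mat[OF smult_carrier_mat[OF U]] multiset.map_comp comp_def
    by (rule image_mset_cong) (use U in auto)
qed

lemma evs_one: "evs (1\<^sub>m n :: 'a :: field mat) = replicate_mset n 1"
proof -
  have "evs (1\<^sub>m n :: 'a mat) = image_mset (\<lambda>i. (1\<^sub>m n :: 'a mat) $$ (i, i)) (mset_set {..<n})"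
    using evs_upper_triangular[of "1\<^sub>m n :: 'a mat" n] mset_diag_mat[of "1\<^sub>m n :: 'a mat" n] by simp
  also have "\<dots> = image_mset (\<lambda>_. 1) (mset_set {..<n})" by (rule image_mset_cong) auto
  finally show ?thesis by (simp add: image_mset_const_eq)
qed

definition tr :: "'a :: comm_ring_1 mat \<Rightarrow> 'a" where
  "tr A = (\<Sum>i<dim_row A. A $$ (i, i))"

lemma tr_commute:
  assumes A: "A \<in> carrier_mat n m" and B: "B \<in> carrier_mat m n"
  shows "tr (A * B) = tr (B * A)"
proof -
  have "tr (A * B) = (\<Sum>i<n. \<Sum>j<m. A $$ (i, j) * B $$ (j, i))"
    using A B by (auto simp: tr_def scalar_prod_def atLeast0LessThan intro!: sum.cong)
  also have "\<dots> = (\<Sum>j<m. \<Sum>i<n. B $$ (j, i) * A $$ (i, j))"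
    by (subst sum.swap) (simp add: mult.commute)
  also have "\<dots> = tr (B * A)"
    using A B by (auto simp: tr_def scalar_prod_def atLeast0LessThan intro!: sum.cong)
  finally show ?thesis .
qed

lemma tr_triangularizes:
  assumes T: "triangularizes n P Q U A"
  shows "tr A = (\<Sum>i<n. U $$ (i, i))"
proof -
  note t = T[unfolded triangularizes_def]
  have "tr A = tr (P * (U * Q))" using t assoc_mult_mat[of P n n U n Q n] by simp
  also have "\<dots> = tr (U * Q * P)" by (rule tr_commute[of _ n n]) (use t in auto)
  also have "U * Q * P = U" using t assoc_mult_mat[of U n n Q n P n] right_mult_one_mat[of U n n] by simp
  finally show ?thesis using t by (auto simp: tr_def)
qed

subsection \<open>Kronecker products\<close>

definition kron :: "'a :: semiring_1 mat \<Rightarrow> 'a mat \<Rightarrow> 'a mat" where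
  "kron A B = mat (dim_row A * dim_row B) (dim_col A * dim_col B)
     (\<lambda>(i, j). A $$ (i div dim_row B, j div dim_col B) * B $$ (i mod dim_row B, j mod dim_col B))"

lemma kron_carrier [simp]:
  "A \<in> carrier_mat n m \<Longrightarrow> B \<in> carrier_mat n' m' \<Longrightarrow> kron A B \<in> carrier_mat (n * n') (m * m')"
  by (auto simp: kron_def)

lemma sum_div_mod:
  fixes f :: "nat \<Rightarrow> nat \<Rightarrow> 'a :: comm_monoid_add"
  shows "(\<Sum>k<n * m. f (k div m) (k mod m)) = (\<Sum>i<n. \<Sum>j<m. f i j)"
proof -
  have "(\<Sum>(i, j)\<in>{..<n} \<times> {..<m}. f i j) = (\<Sum>k<n * m. f (k div m) (k mod m))"
  proof (rule sum.reindex_bij_witness[where i = "\<lambda>k. (k div m, k mod m)" and j = "\<lambda>(i, j). i * m + j"])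
    fix a assume "a \<in> {..<n} \<times> {..<m}"
    then obtain i j where a: "a = (i, j)" "i < n" "j < m" by auto
    have "i * m + j < n * m" using a by (metis mult_Suc add.commute Suc_leI mult_le_mono1 order_less_le_trans nat_add_left_cancel_less)
    thus "(case a of (i, j) \<Rightarrow> i * m + j) \<in> {..<n * m}" using a by simp
  qed (auto simp: less_mult_imp_div_less intro!: mod_less_divisor gr0I)
  thus ?thesis by (simp add: sum.cartesian_product)
qed

lemma div_mod_less: "i < n * m \<Longrightarrow> i div m < n \<and> i mod m < (m :: nat)"
  by (cases m) (auto simp: less_mult_imp_div_less)

lemma kron_mult:
  fixes A :: "'a :: field mat"
  assumes A: "A \<in> carrier_mat n m" and B: "B \<in> carrier_mat n' m'"
    and C: "C \<in> carrier_mat m l" and D: "D \<in> carrier_mat m' l'"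
  shows "kron A B * kron C D = kron (A * C) (B * D)"
proof (rule eq_matI)
  fix i j assume "i < dim_row (kron (A * C) (B * D))" "j < dim_col (kron (A * C) (B * D))"
  hence i: "i < n * n'" and j: "j < l * l'" using assms by (auto simp: kron_def)
  note ij = div_mod_less[OF i] div_mod_less[OF j]
  let ?f = "\<lambda>a b. A $$ (i div n', a) * B $$ (i mod n', b) * (C $$ (a, j div l') * D $$ (b, j mod l'))"
  have "(kron A B * kron C D) $$ (i, j) = (\<Sum>k<m * m'. ?f (k div m') (k mod m'))"
    using assms i j by (auto simp: kron_def scalar_prod_def atLeast0LessThan intro!: sum.cong)
  also have "\<dots> = (\<Sum>a<m. \<Sum>b<m'. ?f a b)" by (rule sum_div_mod)
  also have "\<dots> = (\<Sum>a<m. A $$ (i div n', a) * C $$ (a, j div l')) * (\<Sum>b<m'. B $$ (i mod n', b) * D $$ (b, j mod l'))"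
    by (simp add: sum_product mult_ac)
  also have "\<dots> = kron (A * C) (B * D) $$ (i, j)"
    using assms i j ij by (auto simp: kron_def scalar_prod_def atLeast0LessThan)
  finally show "(kron A B * kron C D) $$ (i, j) = kron (A * C) (B * D) $$ (i, j)" .
qed (use assms in \<open>auto simp: kron_def\<close>)

lemma kron_one: "kron (1\<^sub>m n) (1\<^sub>m m) = (1\<^sub>m (n * m) :: 'a :: field mat)"
proof (rule eq_matI)
  fix i j assume "i < dim_row (1\<^sub>m (n * m) :: 'a mat)" "j < dim_col (1\<^sub>m (n * m) :: 'a mat)"
  hence i: "i < n * m" and j: "j < n * m" by auto
  have "i = j \<longleftrightarrow> i div m = j div m \<and> i mod m = j mod m" by (metis div_mult_mod_eq)
  thus "kron (1\<^sub>m n) (1\<^sub>m m) $$ (i, j) = (1\<^sub>m (n * m) :: 'a mat) $$ (i, j)"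
    using div_mod_less[OF i] div_mod_less[OF j] i j by (auto simp: kron_def)
qed (auto simp: kron_def)

text \<open>The index order is lexicographic in quotient and remainder: below the diagonal either
  the quotients lie below the diagonal of \<open>U\<close>, or they agree and the remainders lie
  below the diagonal of \<open>U'\<close>.\<close>

lemma triangularizes_kron:
  assumes "triangularizes n P Q U A" "triangularizes m P' Q' U' B"
  shows "triangularizes (n * m) (kron P P') (kron Q Q') (kron U U') (kron A B)"
proof -
  note t = assms[unfolded triangularizes_def]
  have "kron (P * U * Q) (P' * U' * Q') = kron P P' * kron U U' * kron Q Q'"
    using t kron_mult[of P n n P' m m U n U' m] kron_mult[of "P * U" n n "P' * U'" m m Q n Q' m]
      mult_carrier_mat[of P n n U n] mult_carrier_mat[of P' m m U' m] by simp
  moreover have "kron P P' * kron Q Q' = 1\<^sub>m (n * m)" "kron Q Q' * kron P P' = 1\<^sub>m (n * m)"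
    using t by (simp_all add: kron_mult[of _ n n _ m m _ n _ m] kron_one)
  moreover have "upper_triangular (kron U U')"
  proof
    fix i j assume ij: "j < i" "i < dim_row (kron U U')"
    hence i: "i < n * m" using t by (auto simp: kron_def)
    hence j: "j < n * m" using ij by simp
    have "j div m < i div m \<or> (j div m = i div m \<and> j mod m < i mod m)"
      using ij(1) div_le_mono[of j i m] by (metis div_mult_mod_eq le_neq_implies_less less_imp_le_nat nat_add_left_cancel_less)
    thus "kron U U' $$ (i, j) = 0"
      using t i j div_mod_less[OF i] by (auto simp: kron_def upper_triangular_def)
  qed
  ultimately show ?thesis using t unfolding triangularizes_def by auto
qed

text \<open>The eigenvalues of a Kronecker product are the products of pairs of eigenvalues.
  Multiplicativity of \<open>f\<close> is required on eigenvalues only, since a Brauer lift is known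
  to be multiplicative only on roots of unity.\<close>

lemma sum_evs_kron:
  fixes A B :: "'a :: alg_closed_field mat" and f :: "'a \<Rightarrow> 'b :: comm_semiring_1"
  assumes A: "A \<in> carrier_mat n n" and B: "B \<in> carrier_mat m m"
    and f: "\<And>x y. x \<in># evs A \<Longrightarrow> y \<in># evs B \<Longrightarrow> f (x * y) = f x * f y"
  shows "(\<Sum>x\<in>#evs (kron A B). f x) = (\<Sum>x\<in>#evs A. f x) * (\<Sum>y\<in>#evs B. f y)"
proof -
  obtain P Q U where T: "triangularizes n P Q U A" using triangularize[OF A] by blast
  obtain P' Q' U' where T': "triangularizes m P' Q' U' B" using triangularize[OF B] by blast
  note t = T[unfolded triangularizes_def] T'[unfolded triangularizes_def]
  have e: "U $$ (i, i) \<in># evs A" if "i < n" for i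
    using that t mset_diag_mat[of U n] unfolding evs_triangularizes[OF T] by auto
  have e': "U' $$ (i, i) \<in># evs B" if "i < m" for i
    using that t mset_diag_mat[of U' m] unfolding evs_triangularizes[OF T'] by auto
  have "(\<Sum>x\<in>#evs (kron A B). f x) = (\<Sum>i<n * m. f (U $$ (i div m, i div m) * U' $$ (i mod m, i mod m)))"
    unfolding sum_evs_triangularizes[OF triangularizes_kron[OF T T']]
    using t by (intro sum.cong) (auto simp: kron_def)
  also have "\<dots> = (\<Sum>i<n. \<Sum>j<m. f (U $$ (i, i) * U' $$ (j, j)))" by (rule sum_div_mod)
  also have "\<dots> = (\<Sum>i<n. \<Sum>j<m. f (U $$ (i, i)) * f (U' $$ (j, j)))"
    using f e e' by simp
  also have "\<dots> = (\<Sum>i<n. f (U $$ (i, i))) * (\<Sum>j<m. f (U' $$ (j, j)))" by (simp add: sum_product)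
  finally show ?thesis unfolding sum_evs_triangularizes[OF T] sum_evs_triangularizes[OF T'] .
qed

section \<open>Modules and homomorphisms\<close>

lemma gmod_carrier: "is_gmod G M \<Longrightarrow> g \<in> carrier G \<Longrightarrow> snd M g \<in> carrier_mat (fst M) (fst M)"
  and gmod_one: "is_gmod G M \<Longrightarrow> snd M \<one>\<^bsub>G\<^esub> = 1\<^sub>m (fst M)"
  and gmod_mult: "is_gmod G M \<Longrightarrow> g \<in> carrier G \<Longrightarrow> h \<in> carrier G \<Longrightarrow>
    snd M (g \<otimes>\<^bsub>G\<^esub> h) = snd M g * snd M h"
  by (auto simp: is_gmod_def)

lemma hom_carrier: "T \<in> gmod_hom G M N \<Longrightarrow> T \<in> carrier_mat (fst N) (fst M)"
  and hom_commute: "T \<in> gmod_hom G M N \<Longrightarrow> g \<in> carrier G \<Longrightarrow> T * snd M g = snd N g * T"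
  by (auto simp: gmod_hom_def)

lemma homI:
  "T \<in> carrier_mat (fst N) (fst M) \<Longrightarrow> (\<And>g. g \<in> carrier G \<Longrightarrow> T * snd M g = snd N g * T) \<Longrightarrow> T \<in> gmod_hom G M N"
  by (auto simp: gmod_hom_def)

lemma hom_vec:
  assumes "is_gmod G M" "is_gmod G N" "T \<in> gmod_hom G M N" "g \<in> carrier G" "v \<in> carrier_vec (fst M)"
  shows "T *\<^sub>v (snd M g *\<^sub>v v) = snd N g *\<^sub>v (T *\<^sub>v v)"
  using assoc_mult_mat_vec[OF hom_carrier gmod_carrier, OF assms(3,1,4,5)]
    assoc_mult_mat_vec[OF gmod_carrier hom_carrier, OF assms(2,4,3,5)] hom_commute[OF assms(3,4)] by simp

lemma hom_id: "is_gmod G M \<Longrightarrow> 1\<^sub>m (fst M) \<in> gmod_hom G M M"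
  by (rule homI) (auto dest: gmod_carrier)

lemma hom_comp:
  assumes M: "is_gmod G M" and N: "is_gmod G N" and L: "is_gmod G L"
    and T: "T \<in> gmod_hom G M N" and T': "T' \<in> gmod_hom G N L"
  shows "T' * T \<in> gmod_hom G M L"
proof (rule homI)
  note c = hom_carrier[OF T] hom_carrier[OF T']
  show "T' * T \<in> carrier_mat (fst L) (fst M)" using c by auto
  fix g assume g: "g \<in> carrier G"
  note cg = gmod_carrier[OF M g] gmod_carrier[OF N g] gmod_carrier[OF L g]
  have "T' * T * snd M g = T' * (snd N g * T)"
    using assoc_mult_mat[OF c(2,1) cg(1)] hom_commute[OF T g] by simp
  also have "\<dots> = snd L g * T' * T"
    using assoc_mult_mat[OF c(2) cg(2) c(1)] hom_commute[OF T' g] by simp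
  also have "\<dots> = snd L g * (T' * T)" by (rule assoc_mult_mat[OF cg(3) c(2,1)])
  finally show "T' * T * snd M g = snd L g * (T' * T)" .
qed

lemma hom_minus_smult:
  fixes T :: "'k :: field mat"
  assumes M: "is_gmod G M" and N: "is_gmod G N" and T: "T \<in> gmod_hom G M N" and T': "T' \<in> gmod_hom G M N"
  shows "T - c \<cdot>\<^sub>m T' \<in> gmod_hom G M N"
proof (rule homI)
  note cT = hom_carrier[OF T] hom_carrier[OF T']
  have cc: "c \<cdot>\<^sub>m T' \<in> carrier_mat (fst N) (fst M)" using cT by auto
  show "T - c \<cdot>\<^sub>m T' \<in> carrier_mat (fst N) (fst M)" using cT by (auto intro: minus_carrier_mat)
  fix g assume g: "g \<in> carrier G"
  note cg = gmod_carrier[OF M g] gmod_carrier[OF N g]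
  show "(T - c \<cdot>\<^sub>m T') * snd M g = snd N g * (T - c \<cdot>\<^sub>m T')"
    unfolding minus_mult_distrib_mat[OF cT(1) cc cg(1)] mult_minus_distrib_mat[OF cg(2) cT(1) cc]
      mult_smult_assoc_mat[OF cT(2) cg(1)] mult_smult_distrib[OF cg(2) cT(2)]
    using hom_commute[OF T g] hom_commute[OF T' g] by simp
qed

section \<open>Submodules, quotients and isomorphisms\<close>

lemma gsubmodD:
  assumes "gsubmod G M W"
  shows "W \<subseteq> carrier_vec (fst M)" "0\<^sub>v (fst M) \<in> W"
    and "\<And>g w. g \<in> carrier G \<Longrightarrow> w \<in> W \<Longrightarrow> snd M g *\<^sub>v w \<in> W"
    and "vsub (fst M) W"
  using assms by (auto simp: gsubmod_def subspace_vec_iff)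

lemma gsubmod_full: "is_gmod G M \<Longrightarrow> gsubmod G M (carrier_vec (fst M))"
  using subspace_full by (auto simp: gsubmod_def intro!: mult_mat_vec_carrier dest: gmod_carrier)

lemma gsubmod_zero: "is_gmod G M \<Longrightarrow> gsubmod G M {0\<^sub>v (fst M)}"
  using mult_mat_vec_zero'[OF gmod_carrier[of G M]] by (auto simp: gsubmod_def subspace_zero)

lemma gsubmod_preimage:
  assumes M: "is_gmod G M" and N: "is_gmod G N" and T: "T \<in> gmod_hom G M N"
    and W: "gsubmod G N W" and U: "gsubmod G M U"
  shows "gsubmod G M {v \<in> U. T *\<^sub>v v \<in> W}"
  unfolding gsubmod_def
proof (intro conjI ballI)
  show "vsub (fst M) {v \<in> U. T *\<^sub>v v \<in> W}"
    by (rule subspace_preimage[OF hom_carrier[OF T] gsubmodD(4)[OF W] gsubmodD(4)[OF U]])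
  fix g w assume g: "g \<in> carrier G" and w: "w \<in> {v \<in> U. T *\<^sub>v v \<in> W}"
  thus "snd M g *\<^sub>v w \<in> {v \<in> U. T *\<^sub>v v \<in> W}"
    using hom_vec[OF M N T g, of w] gsubmodD[OF W] gsubmodD[OF U] by auto
qed

lemma gsubmod_kernel:
  assumes "is_gmod G M" "is_gmod G N" "T \<in> gmod_hom G M N"
  shows "gsubmod G M {v \<in> carrier_vec (fst M). T *\<^sub>v v = 0\<^sub>v (fst N)}"
  using gsubmod_preimage[OF assms gsubmod_zero gsubmod_full] assms by simp

lemma gsubmod_image:
  assumes M: "is_gmod G M" and N: "is_gmod G N" and T: "T \<in> gmod_hom G M N" and W: "gsubmod G M W"
  shows "gsubmod G N ((\<lambda>v. T *\<^sub>v v) ` W)"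
  unfolding gsubmod_def
proof (intro conjI ballI)
  show "vsub (fst N) ((\<lambda>v. T *\<^sub>v v) ` W)" by (rule subspace_im[OF hom_carrier[OF T] gsubmodD(4)[OF W]])
  fix g w assume g: "g \<in> carrier G" and "w \<in> (\<lambda>v. T *\<^sub>v v) ` W"
  then obtain u where u: "u \<in> W" "w = T *\<^sub>v u" by auto
  have "snd N g *\<^sub>v w = T *\<^sub>v (snd M g *\<^sub>v u)"
    unfolding u(2) by (rule hom_vec[OF M N T g, symmetric]) (use u gsubmodD[OF W] in auto)
  thus "snd N g *\<^sub>v w \<in> (\<lambda>v. T *\<^sub>v v) ` W" using gsubmodD(3)[OF W g u(1)] by auto
qed

text \<open>A submodule, realised as X : N \<rightarrow> M, and its quotient, realised as Y' : M \<rightarrow> N'.\<close>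

definition sub_quot ::
  "('g, 'b) monoid_scheme \<Rightarrow> ('g, 'k :: field) gmod \<Rightarrow> 'k vec set \<Rightarrow> ('g, 'k) gmod \<Rightarrow> ('g, 'k) gmod \<Rightarrow>
    'k mat \<Rightarrow> 'k mat \<Rightarrow> 'k mat \<Rightarrow> 'k mat \<Rightarrow> bool" where
  "sub_quot G M W N N' X Y X' Y' \<longleftrightarrow>
     splitting (fst M) (fst N) (fst N') X Y X' Y' \<and> is_gmod G N \<and> is_gmod G N' \<and>
     X \<in> gmod_hom G N M \<and> Y' \<in> gmod_hom G M N' \<and>
     (\<lambda>v. X *\<^sub>v v) ` carrier_vec (fst N) = W \<and>
     {v \<in> carrier_vec (fst M). Y' *\<^sub>v v = 0\<^sub>v (fst N')} = W \<and>
     (\<forall>g\<in>carrier G. evs (snd M g) = evs (snd N g) + evs (snd N' g))"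

text \<open>In coordinates adapted to \<open>W\<close> every group element is block upper
  triangular; its diagonal blocks are the actions on \<open>W\<close> and on the quotient.
  \<open>X\<close> and \<open>Y'\<close> are equivariant, \<open>Y\<close> and \<open>X'\<close> in
  general only linear.\<close>

lemma sub_quot_exists:
  fixes M :: "('g, 'k :: field) gmod"
  assumes M: "is_gmod G M" and W: "gsubmod G M W"
  obtains N N' X Y X' Y' where "sub_quot G M W N N' X Y X' Y'"
proof -
  let ?n = "fst M" and ?A = "snd M"
  obtain r X Y where X: "X \<in> carrier_mat ?n r" and Y: "Y \<in> carrier_mat r ?n" and YX: "Y * X = 1\<^sub>m r"
    and fix_W: "\<And>u. u \<in> W \<Longrightarrow> X *\<^sub>v (Y *\<^sub>v u) = u"
    and im_W: "\<And>v. v \<in> carrier_vec ?n \<Longrightarrow> X *\<^sub>v (Y *\<^sub>v v) \<in> W"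
    using subspace_projection[OF gsubmodD(4)[OF W]] by blast
  obtain s X' Y' where S: "splitting ?n r s X Y X' Y'" by (rule complement_exists[OF X Y YX])
  note s = S[unfolded splitting_def]
  have X': "X' \<in> carrier_mat ?n s" and Y': "Y' \<in> carrier_mat s ?n" and YX': "Y' * X' = 1\<^sub>m s"
    and Y'X: "Y' * X = 0\<^sub>m s r" and sum: "X * Y + X' * Y' = 1\<^sub>m ?n" using s by auto
  have XW: "X *\<^sub>v v \<in> W" if v: "v \<in> carrier_vec r" for v
  proof -
    have "Y *\<^sub>v (X *\<^sub>v v) = v" by (rule mat_vec_cancel_left[OF YX]) (use X Y v in auto)
    thus ?thesis using im_W[of "X *\<^sub>v v"] X v by auto
  qed
  define N where "N = (r, \<lambda>g. Y * (?A g * X))"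
  define N' where "N' = (s, \<lambda>g. Y' * (?A g * X'))"
  have imX: "(\<lambda>v. X *\<^sub>v v) ` carrier_vec (fst N) = W"
  proof
    show "W \<subseteq> (\<lambda>v. X *\<^sub>v v) ` carrier_vec (fst N)"
    proof
      fix w assume w: "w \<in> W"
      have "Y *\<^sub>v w \<in> carrier_vec r" by (rule mult_mat_vec_carrier[OF Y]) (use w gsubmodD(1)[OF W] in auto)
      thus "w \<in> (\<lambda>v. X *\<^sub>v v) ` carrier_vec (fst N)" using fix_W[OF w] unfolding N_def by (auto simp: image_iff intro!: bexI[of _ "Y *\<^sub>v w"])
    qed
  qed (use XW in \<open>auto simp: N_def\<close>)
  have AX: "X * snd N g = ?A g * X" if g: "g \<in> carrier G" for g
  proof (rule eq_mat_by_vec[of _ ?n r])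
    note A = gmod_carrier[OF M g]
    show "X * snd N g \<in> carrier_mat ?n r" "?A g * X \<in> carrier_mat ?n r" using X Y A by (auto simp: N_def)
    fix v :: "'k vec" assume v: "v \<in> carrier_vec r"
    have AXv: "?A g * X *\<^sub>v v = ?A g *\<^sub>v (X *\<^sub>v v)" by (rule assoc_mult_mat_vec[OF A X v])
    have "X * snd N g *\<^sub>v v = X *\<^sub>v (Y *\<^sub>v (?A g * X *\<^sub>v v))"
      using X Y A v by (simp add: N_def mat_vec_assoc)
    also have "\<dots> = ?A g * X *\<^sub>v v" unfolding AXv by (rule fix_W[OF gsubmodD(3)[OF W g XW[OF v]]])
    finally show "X * snd N g *\<^sub>v v = ?A g * X *\<^sub>v v" .
  qed
  have 0: "Y' * (?A g * X) = 0\<^sub>m s r" if g: "g \<in> carrier G" for g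
  proof -
    have "Y' * (X * snd N g) = Y' * X * snd N g"
      by (rule assoc_mult_mat[OF Y' X, symmetric]) (use X Y gmod_carrier[OF M g] in \<open>auto simp: N_def\<close>)
    also have "\<dots> = 0\<^sub>m s r" unfolding Y'X using X Y gmod_carrier[OF M g] by (auto simp: N_def)
    finally show ?thesis unfolding AX[OF g] .
  qed
  have YA: "Y' * ?A g = snd N' g * Y'" if g: "g \<in> carrier G" for g
  proof -
    note A = gmod_carrier[OF M g]
    have YA: "Y' * ?A g \<in> carrier_mat s ?n" using Y' A by auto
    \<comment> \<open>Inserting the identity separates the component in \<open>W\<close>, which
      \<open>?A g\<close> keeps in \<open>W\<close> and \<open>Y'\<close> then kills.\<close>
    have "Y' * ?A g = Y' * ?A g * (X * Y + X' * Y')" unfolding sum using right_mult_one_mat[OF YA] by simp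
    also have "\<dots> = Y' * ?A g * (X * Y) + Y' * ?A g * (X' * Y')"
      by (rule mult_add_distrib_mat[OF YA]) (use X Y X' Y' in auto)
    also have "Y' * ?A g * (X * Y) = Y' * (?A g * X) * Y"
      using X Y Y' A by (simp add: mat_assoc)
    also have "\<dots> = 0\<^sub>m s ?n" unfolding 0[OF g] using Y by auto
    also have "Y' * ?A g * (X' * Y') = snd N' g * Y'"
      using X' Y' A by (simp add: mat_assoc N'_def)
    also have "0\<^sub>m s ?n + snd N' g * Y' = snd N' g * Y'"
      by (rule left_add_zero_mat) (use X' Y' A in \<open>auto simp: N'_def\<close>)
    finally show ?thesis .
  qed
  have N: "is_gmod G N"
    unfolding is_gmod_def
  proof (intro conjI ballI)
    fix g h assume g: "g \<in> carrier G" and h: "h \<in> carrier G"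
    note A = gmod_carrier[OF M g] gmod_carrier[OF M h]
    have "snd N (g \<otimes>\<^bsub>G\<^esub> h) = Y * (?A g * (?A h * X))"
      using A X Y by (simp add: N_def gmod_mult[OF M g h] mat_assoc)
    also have "\<dots> = Y * (?A g * (X * snd N h))" unfolding AX[OF h] ..
    also have "\<dots> = snd N g * snd N h" using A X Y by (simp add: N_def mat_assoc)
    finally show "snd N (g \<otimes>\<^bsub>G\<^esub> h) = snd N g * snd N h" .
  qed (use X Y YX gmod_carrier[OF M] in \<open>auto simp: N_def gmod_one[OF M]\<close>)
  have N': "is_gmod G N'"
    unfolding is_gmod_def
  proof (intro conjI ballI)
    fix g h assume g: "g \<in> carrier G" and h: "h \<in> carrier G"
    note A = gmod_carrier[OF M g] gmod_carrier[OF M h]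
    have "snd N' (g \<otimes>\<^bsub>G\<^esub> h) = Y' * ?A g * (?A h * X')"
      using A X' Y' by (simp add: N'_def gmod_mult[OF M g h] mat_assoc)
    also have "\<dots> = snd N' g * Y' * (?A h * X')" unfolding YA[OF g] ..
    also have "\<dots> = snd N' g * snd N' h" using A X' Y' by (simp add: N'_def mat_assoc)
    finally show "snd N' (g \<otimes>\<^bsub>G\<^esub> h) = snd N' g * snd N' h" .
  qed (use X' Y' YX' gmod_carrier[OF M] in \<open>auto simp: N'_def gmod_one[OF M]\<close>)
  have ker: "{v \<in> carrier_vec ?n. Y' *\<^sub>v v = 0\<^sub>v (fst N')} = W"
  proof (intro equalityI subsetI)
    fix v assume v: "v \<in> W"
    hence vc: "v \<in> carrier_vec ?n" using gsubmodD(1)[OF W] by auto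
    obtain u where u: "u \<in> carrier_vec r" "v = X *\<^sub>v u" using imX v by (auto simp: N_def)
    have "Y' *\<^sub>v v = Y' * X *\<^sub>v u" unfolding u(2) by (rule assoc_mult_mat_vec[OF Y' X u(1), symmetric])
    thus "v \<in> {v \<in> carrier_vec ?n. Y' *\<^sub>v v = 0\<^sub>v (fst N')}" using vc u(1) by (simp add: Y'X N'_def)
  next
    fix v assume v: "v \<in> {v \<in> carrier_vec ?n. Y' *\<^sub>v v = 0\<^sub>v (fst N')}"
    have "v = (X * Y + X' * Y') *\<^sub>v v" using sum v by simp
    also have "\<dots> = X * Y *\<^sub>v v + X' * Y' *\<^sub>v v"
      by (rule add_mult_distrib_mat_vec[of _ ?n ?n]) (use X Y X' Y' v in auto)
    also have "X * Y *\<^sub>v v = X *\<^sub>v (Y *\<^sub>v v)" by (rule assoc_mult_mat_vec[OF X Y]) (use v in auto)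
    also have "X' * Y' *\<^sub>v v = X' *\<^sub>v (Y' *\<^sub>v v)" by (rule assoc_mult_mat_vec[OF X' Y']) (use v in auto)
    also have "Y' *\<^sub>v v = 0\<^sub>v s" using v by (simp add: N'_def)
    also have "X' *\<^sub>v 0\<^sub>v s = 0\<^sub>v ?n" by (rule mult_mat_vec_zero'[OF X'])
    also have "X *\<^sub>v (Y *\<^sub>v v) + 0\<^sub>v ?n = X *\<^sub>v (Y *\<^sub>v v)"
      by (rule right_zero_vec) (use X Y v in auto)
    finally show "v \<in> W" using im_W[of v] v by simp
  qed
  have "evs (?A g) = evs (snd N g) + evs (snd N' g)" if g: "g \<in> carrier G" for g
    using evs_splitting[OF S gmod_carrier[OF M g] 0[OF g]] by (simp add: N_def N'_def)
  hence "sub_quot G M W N N' X Y X' Y'"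
    unfolding sub_quot_def using S N N' imX ker AX YA X Y'
    by (auto simp: gmod_hom_def N_def N'_def)
  thus ?thesis by (rule that)
qed

lemma surjective_right_inverse:
  fixes F :: "'k :: field mat"
  assumes F: "F \<in> carrier_mat n m" and surj: "(\<lambda>v. F *\<^sub>v v) ` carrier_vec m = carrier_vec n"
  obtains R where "R \<in> carrier_mat m n" "F * R = 1\<^sub>m n"
proof -
  have "\<exists>u\<in>carrier_vec m. F *\<^sub>v u = v" if "v \<in> carrier_vec n" for v using surj that by (metis imageE)
  then obtain p where p: "\<And>v. v \<in> carrier_vec n \<Longrightarrow> p v \<in> carrier_vec m \<and> F *\<^sub>v p v = v" by metis
  define R where "R = mat m n (\<lambda>(i, j). p (unit_vec n j) $ i)"
  have R: "R \<in> carrier_mat m n" by (simp add: R_def)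
  have "F * R = 1\<^sub>m n"
  proof (rule mat_col_eqI)
    fix j assume "j < dim_col (1\<^sub>m n :: 'k mat)"
    hence j: "j < n" by simp
    have cR: "col R j = p (unit_vec n j)" using p[of "unit_vec n j"] j by (intro eq_vecI) (auto simp: R_def)
    have "col (F * R) j = F *\<^sub>v col R j" using F R j by (intro eq_vecI) auto
    thus "col (F * R) j = col (1\<^sub>m n) j" unfolding cR using p[of "unit_vec n j"] j by simp
  qed (use F R in auto)
  thus ?thesis using that R by blast
qed

lemma epi_right_inverse:
  assumes "F \<in> gmod_epi G M N"
  obtains R where "R \<in> carrier_mat (fst M) (fst N)" "F * R = 1\<^sub>m (fst N)"
  using assms by (auto simp: gmod_epi_def intro: surjective_right_inverse[OF hom_carrier])

lemma inverse_hom: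
  assumes M: "is_gmod G M" and N: "is_gmod G N" and F: "F \<in> gmod_hom G M N"
    and R: "R \<in> carrier_mat (fst M) (fst N)" and FR: "F * R = 1\<^sub>m (fst N)" and RF: "R * F = 1\<^sub>m (fst M)"
  shows "R \<in> gmod_hom G N M"
proof (rule homI[OF R])
  fix g assume g: "g \<in> carrier G"
  note c = gmod_carrier[OF M g] gmod_carrier[OF N g] hom_carrier[OF F] R
  have "R * snd N g = R * (snd N g * (F * R))" using FR right_mult_one_mat[OF c(2)] by simp
  also have "\<dots> = R * (snd N g * F * R)" using assoc_mult_mat[OF c(2,3,4)] by simp
  also have "\<dots> = R * (F * (snd M g * R))"
    unfolding hom_commute[OF F g, symmetric] using assoc_mult_mat[OF c(3,1,4)] by simp
  also have "\<dots> = snd M g * R" by (rule mat_cancel_left[OF RF]) (use c in auto)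
  finally show "R * snd N g = snd M g * R" .
qed

definition gmod_iso :: "('g, 'b) monoid_scheme \<Rightarrow> ('g, 'k :: field) gmod \<Rightarrow> ('g, 'k) gmod \<Rightarrow> bool" where
  "gmod_iso G M N \<longleftrightarrow> (\<exists>F \<in> gmod_hom G M N. \<exists>R \<in> gmod_hom G N M. F * R = 1\<^sub>m (fst N) \<and> R * F = 1\<^sub>m (fst M))"

lemma gmod_iso_sym: "gmod_iso G M N \<Longrightarrow> gmod_iso G N M"
  unfolding gmod_iso_def by blast

lemma gmod_iso_refl: "is_gmod G M \<Longrightarrow> gmod_iso G M M"
  unfolding gmod_iso_def using hom_id by (metis left_mult_one_mat one_carrier_mat)

lemma gmod_iso_trans:
  assumes M: "is_gmod G M" and N: "is_gmod G N" and L: "is_gmod G L" and "gmod_iso G M N" "gmod_iso G N L"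
  shows "gmod_iso G M L"
proof -
  obtain F R where F: "F \<in> gmod_hom G M N" and R: "R \<in> gmod_hom G N M" "F * R = 1\<^sub>m (fst N)" "R * F = 1\<^sub>m (fst M)"
    using assms by (auto simp: gmod_iso_def)
  obtain F' R' where F': "F' \<in> gmod_hom G N L" and R': "R' \<in> gmod_hom G L N" "F' * R' = 1\<^sub>m (fst L)" "R' * F' = 1\<^sub>m (fst N)"
    using assms by (auto simp: gmod_iso_def)
  note c = hom_carrier[OF F] hom_carrier[OF R(1)] hom_carrier[OF F'] hom_carrier[OF R'(1)]
  have "F' * F * (R * R') = 1\<^sub>m (fst L)"
    using c R R' by (simp add: mat_assoc mat_cancel_left[OF R(2)])
  moreover have "R * R' * (F' * F) = 1\<^sub>m (fst M)"
    using c R R' by (simp add: mat_assoc mat_cancel_left[OF R'(3)])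
  ultimately show ?thesis
    unfolding gmod_iso_def using hom_comp[OF M N L F F'] hom_comp[OF L N M R'(1) R(1)] by blast
qed

lemma gmod_iso_evs:
  assumes "is_gmod G M" "is_gmod G N" "gmod_iso G M N" "g \<in> carrier G"
  shows "evs (snd M g) = evs (snd N g)"
proof -
  obtain F R where F: "F \<in> gmod_hom G M N" and R: "R \<in> gmod_hom G N M" "F * R = 1\<^sub>m (fst N)" "R * F = 1\<^sub>m (fst M)"
    using assms by (auto simp: gmod_iso_def)
  show ?thesis
    by (rule evs_intertwined[OF gmod_carrier[OF assms(2,4)] gmod_carrier[OF assms(1,4)] hom_carrier[OF F]
          hom_carrier[OF R(1)] R(2,3) hom_commute[OF F assms(4), symmetric], symmetric])
qed

lemma minus_vec_zero_imp_eq: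
  fixes u v :: "'a :: group_add vec"
  assumes "u \<in> carrier_vec n" "v \<in> carrier_vec n" "u - v = 0\<^sub>v n"
  shows "u = v"
proof (rule eq_vecI)
  fix i assume "i < dim_vec v"
  hence "u $ i - v $ i = (u - v) $ i" by simp
  also have "\<dots> = 0" unfolding assms(3) using assms(2) \<open>i < dim_vec v\<close> by simp
  finally show "u $ i = v $ i" by simp
qed (use assms in auto)

lemma bijective_matrix_inverse:
  fixes F :: "'k :: field mat"
  assumes cF: "F \<in> carrier_mat n m"
    and inj: "\<And>v. v \<in> carrier_vec m \<Longrightarrow> F *\<^sub>v v = 0\<^sub>v n \<Longrightarrow> v = 0\<^sub>v m"
    and surj: "(\<lambda>v. F *\<^sub>v v) ` carrier_vec m = carrier_vec n"
  obtains R where "R \<in> carrier_mat m n" "F * R = 1\<^sub>m n" "R * F = 1\<^sub>m m"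
proof -
  obtain R where R: "R \<in> carrier_mat m n" "F * R = 1\<^sub>m n"
    by (rule surjective_right_inverse[OF cF surj])
  have "R * F = 1\<^sub>m m"
  proof (rule eq_mat_by_vec[of _ m m])
    fix v :: "'k vec" assume v: "v \<in> carrier_vec m"
    let ?u = "R *\<^sub>v (F *\<^sub>v v)"
    have u: "?u \<in> carrier_vec m" using R cF v by auto
    have "F *\<^sub>v ?u = F *\<^sub>v v" by (rule mat_vec_cancel_left[OF R(2)]) (use cF R v in auto)
    hence "F *\<^sub>v (?u - v) = 0\<^sub>v n"
      unfolding mult_minus_distrib_mat_vec[OF cF u v] using cF v by simp
    hence "?u - v = 0\<^sub>v m" by (intro inj) (use u v in auto)
    hence "?u = v" by (rule minus_vec_zero_imp_eq[OF u v])
    thus "R * F *\<^sub>v v = 1\<^sub>m m *\<^sub>v v" using v assoc_mult_mat_vec[OF R(1) cF v] by simp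
  qed (use R cF in auto)
  thus ?thesis using that R by blast
qed

lemma bijective_hom_inverse:
  fixes M :: "('g, 'k :: field) gmod"
  assumes M: "is_gmod G M" and N: "is_gmod G N" and F: "F \<in> gmod_hom G M N"
    and inj: "\<And>v. v \<in> carrier_vec (fst M) \<Longrightarrow> F *\<^sub>v v = 0\<^sub>v (fst N) \<Longrightarrow> v = 0\<^sub>v (fst M)"
    and surj: "(\<lambda>v. F *\<^sub>v v) ` carrier_vec (fst M) = carrier_vec (fst N)"
  obtains R where "R \<in> gmod_hom G N M" "F * R = 1\<^sub>m (fst N)" "R * F = 1\<^sub>m (fst M)"
proof -
  obtain R where R: "R \<in> carrier_mat (fst M) (fst N)" "F * R = 1\<^sub>m (fst N)" "R * F = 1\<^sub>m (fst M)"
    by (rule bijective_matrix_inverse[OF hom_carrier[OF F] inj surj])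
  show ?thesis by (rule that[OF inverse_hom[OF M N F R] R(2,3)])
qed

lemma bijective_hom_iso:
  fixes M :: "('g, 'k :: field) gmod"
  assumes "is_gmod G M" "is_gmod G N" and F: "F \<in> gmod_hom G M N"
    and "\<And>v. v \<in> carrier_vec (fst M) \<Longrightarrow> F *\<^sub>v v = 0\<^sub>v (fst N) \<Longrightarrow> v = 0\<^sub>v (fst M)"
    and "(\<lambda>v. F *\<^sub>v v) ` carrier_vec (fst M) = carrier_vec (fst N)"
  shows "gmod_iso G M N"
  by (rule bijective_hom_inverse[OF assms]) (use F in \<open>auto simp: gmod_iso_def\<close>)

section \<open>Schur's and Fitting's lemma\<close>

lemma irreducibleD: "irreducible_gmod G S \<Longrightarrow> is_gmod G S" "irreducible_gmod G S \<Longrightarrow> fst S > 0"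
  and irreducible_submodule: "irreducible_gmod G S \<Longrightarrow> gsubmod G S W \<Longrightarrow> W = {0\<^sub>v (fst S)} \<or> W = carrier_vec (fst S)"
  by (auto simp: irreducible_gmod_def)

lemma hom_zero_iff:
  "F \<in> gmod_hom G M N \<Longrightarrow> F = 0\<^sub>m (fst N) (fst M) \<longleftrightarrow> (\<forall>v\<in>carrier_vec (fst M). F *\<^sub>v v = 0\<^sub>v (fst N))"
  using eq_mat_by_vec[OF hom_carrier zero_carrier_mat, of F G M N] by auto

lemma irreducible_hom_injective:
  assumes S: "irreducible_gmod G S" and N: "is_gmod G N" and F: "F \<in> gmod_hom G S N"
    and nz: "F \<noteq> 0\<^sub>m (fst N) (fst S)" and v: "v \<in> carrier_vec (fst S)" "F *\<^sub>v v = 0\<^sub>v (fst N)"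
  shows "v = 0\<^sub>v (fst S)"
  using irreducible_submodule[OF S gsubmod_kernel[OF irreducibleD(1)[OF S] N F]] nz v hom_zero_iff[OF F] by blast

lemma irreducible_hom_surjective:
  assumes S: "irreducible_gmod G S" and M: "is_gmod G M" and F: "F \<in> gmod_hom G M S"
    and nz: "F \<noteq> 0\<^sub>m (fst S) (fst M)"
  shows "F \<in> gmod_epi G M S"
  using irreducible_submodule[OF S gsubmod_image[OF M irreducibleD(1)[OF S] F gsubmod_full[OF M]]] nz hom_zero_iff[OF F] F
  unfolding gmod_epi_def by blast

lemma schur_iso:
  assumes S: "irreducible_gmod G S" and T: "irreducible_gmod G T" and F: "F \<in> gmod_hom G S T"
    and nz: "F \<noteq> 0\<^sub>m (fst T) (fst S)"
  shows "gmod_iso G S T"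
  using bijective_hom_iso[OF irreducibleD(1)[OF S] irreducibleD(1)[OF T] F]
    irreducible_hom_injective[OF S irreducibleD(1)[OF T] F nz]
    irreducible_hom_surjective[OF T irreducibleD(1)[OF S] F nz] by (auto simp: gmod_epi_def)

text \<open>\<open>F\<close> minus an eigenvalue has a nonzero kernel vector; a nonzero endomorphism
  of \<open>S\<close> would be injective, so the difference is 0.\<close>

lemma schur_scalar:
  fixes S :: "('g, 'k :: alg_closed_field) gmod"
  assumes S: "irreducible_gmod G S" and F: "F \<in> gmod_hom G S S"
  shows "\<exists>c. F = c \<cdot>\<^sub>m 1\<^sub>m (fst S)"
proof -
  let ?n = "fst S"
  note M = irreducibleD(1)[OF S] and cF = hom_carrier[OF F]
  obtain c v where v: "v \<in> carrier_vec ?n" "v \<noteq> 0\<^sub>v ?n" "F *\<^sub>v v = c \<cdot>\<^sub>v v"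
    by (rule eigenvalue_exists[OF cF irreducibleD(2)[OF S]])
  have h: "F - c \<cdot>\<^sub>m 1\<^sub>m ?n \<in> gmod_hom G S S" by (rule hom_minus_smult[OF M M F hom_id[OF M]])
  have "(F - c \<cdot>\<^sub>m 1\<^sub>m ?n) *\<^sub>v v = F *\<^sub>v v - (c \<cdot>\<^sub>m 1\<^sub>m ?n) *\<^sub>v v"
    by (rule minus_mult_distrib_mat_vec[OF cF _ v(1)]) auto
  also have "(c \<cdot>\<^sub>m 1\<^sub>m ?n) *\<^sub>v v = c \<cdot>\<^sub>v v" using v(1) by (intro eq_vecI) auto
  finally have "(F - c \<cdot>\<^sub>m 1\<^sub>m ?n) *\<^sub>v v = 0\<^sub>v ?n" using v by simp
  hence "F - c \<cdot>\<^sub>m 1\<^sub>m ?n = 0\<^sub>m ?n ?n" using irreducible_hom_injective[OF S M h _ v(1)] v(2) by blast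
  hence "F = c \<cdot>\<^sub>m 1\<^sub>m ?n"
    using cF by (intro eq_matI) (auto simp: mat_eq_iff)
  thus ?thesis ..
qed

section \<open>Powers of an endomorphism and the Fitting decomposition\<close>

lemma pow_mat_add:
  fixes A :: "'a :: semiring_1 mat"
  assumes A: "A \<in> carrier_mat n n"
  shows "A ^\<^sub>m (a + b) = A ^\<^sub>m a * A ^\<^sub>m b"
proof (induction b)
  case 0
  thus ?case using right_mult_one_mat[OF pow_carrier_mat[OF A]] A by simp
next
  case (Suc b)
  thus ?case using assoc_mult_mat[OF pow_carrier_mat[OF A] pow_carrier_mat[OF A] A] by simp
qed

lemma hom_pow:
  assumes M: "is_gmod G M" and F: "F \<in> gmod_hom G M M"
  shows "F ^\<^sub>m k \<in> gmod_hom G M M"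
proof (induction k)
  case 0
  thus ?case using hom_carrier[OF F] hom_id[OF M] by simp
next
  case (Suc k)
  thus ?case using hom_comp[OF M M M F] by simp
qed

text \<open>Otherwise there are vectors v_i killed by F^(i+1) and not by F^i for every i, and v_0,
  ..., v_n would be n + 1 linearly independent vectors in dimension n.\<close>

lemma kernel_stabilizes:
  fixes F :: "'a :: field mat"
  assumes F: "F \<in> carrier_mat n n"
  shows "\<exists>N. \<forall>v\<in>carrier_vec n. F ^\<^sub>m Suc N *\<^sub>v v = 0\<^sub>v n \<longrightarrow> F ^\<^sub>m N *\<^sub>v v = 0\<^sub>v n"
proof (rule ccontr)
  assume "\<not> ?thesis"
  then obtain v where v: "\<And>i. v i \<in> carrier_vec n" "\<And>i. F ^\<^sub>m Suc i *\<^sub>v v i = 0\<^sub>v n" "\<And>i. F ^\<^sub>m i *\<^sub>v v i \<noteq> 0\<^sub>v n"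
    by metis
  note Fk = pow_carrier_mat[OF F]
  define V where "V = mat n (Suc n) (\<lambda>(a, i). v i $ a)"
  have V: "V \<in> carrier_mat n (Suc n)" by (simp add: V_def)
  have colV: "col V i = v i" if "i < Suc n" for i using that v(1)[of i] by (intro eq_vecI) (auto simp: V_def)
  obtain c where c: "c \<in> carrier_vec (Suc n)" "c \<noteq> 0\<^sub>v (Suc n)" "V *\<^sub>v c = 0\<^sub>v n"
    using wide_matrix_kernel[OF V] by auto
  define J where "J = {i. i < Suc n \<and> c $ i \<noteq> 0}"
  have "J \<noteq> {}" using c(1,2) by (auto simp: J_def)
  \<comment> \<open>The largest index in a linear relation between the v_i: F^j kills all terms
    below j, so the relation forces F^j v_j = 0.\<close>
  define j where "j = Max J"
  have "finite J" by (simp add: J_def)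
  hence j: "j \<in> J" and top: "\<And>i. i \<in> J \<Longrightarrow> i \<le> j" using \<open>J \<noteq> {}\<close> by (auto simp: j_def)
  have low: "F ^\<^sub>m j *\<^sub>v v i = 0\<^sub>v n" if "i < j" for i
  proof -
    have "j = (j - Suc i) + Suc i" using that by simp
    hence "F ^\<^sub>m j = F ^\<^sub>m (j - Suc i) * F ^\<^sub>m Suc i" using pow_mat_add[OF F] by metis
    hence "F ^\<^sub>m j *\<^sub>v v i = F ^\<^sub>m (j - Suc i) *\<^sub>v (F ^\<^sub>m Suc i *\<^sub>v v i)"
      using assoc_mult_mat_vec[OF Fk Fk v(1)] by metis
    thus ?thesis unfolding v(2) using mult_mat_vec_zero'[OF Fk] by simp
  qed
  have "F ^\<^sub>m j *\<^sub>v v j = 0\<^sub>v n"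
  proof (rule eq_vecI)
    fix a assume "a < dim_vec (0\<^sub>v n :: 'a vec)"
    hence a: "a < n" by simp
    have "0 = ((F ^\<^sub>m j * V) *\<^sub>v c) $ a"
      using assoc_mult_mat_vec[OF Fk V c(1)] c(3) mult_mat_vec_zero'[OF Fk] a by simp
    also have "\<dots> = (\<Sum>i<Suc n. (F ^\<^sub>m j * V) $$ (a, i) * c $ i)"
    proof -
      have "(W *\<^sub>v c) $ a = (\<Sum>i<Suc n. W $$ (a, i) * c $ i)" if "W \<in> carrier_mat n (Suc n)" for W
        using that c(1) a by (simp add: scalar_prod_def atLeast0LessThan del: sum.lessThan_Suc)
      thus ?thesis using mult_carrier_mat[OF Fk V] by blast
    qed
    also have "\<dots> = (\<Sum>i<Suc n. if i = j then (F ^\<^sub>m j *\<^sub>v v j) $ a * c $ j else 0)"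
    proof (rule sum.cong)
      fix i assume "i \<in> {..<Suc n}"
      hence i: "i < Suc n" by simp
      have e: "(F ^\<^sub>m j * V) $$ (a, i) = (F ^\<^sub>m j *\<^sub>v v i) $ a"
        using Fk[of j] V i a colV[OF i] F by simp
      consider "i < j" | "i = j" | "i > j" by linarith
      thus "(F ^\<^sub>m j * V) $$ (a, i) * c $ i = (if i = j then (F ^\<^sub>m j *\<^sub>v v j) $ a * c $ j else 0)"
      proof cases
        case 1
        thus ?thesis unfolding e low[OF 1] using a by simp
      next
        case 3
        hence "c $ i = 0" using top[of i] i by (auto simp: J_def)
        thus ?thesis using 3 by simp
      next
        case 2
        thus ?thesis using e by (simp del: index_mult_mat(1) index_mult_mat_vec)
      qed
    qed simp
    also have "\<dots> = (F ^\<^sub>m j *\<^sub>v v j) $ a * c $ j" using j by (simp add: J_def del: sum.lessThan_Suc)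
    finally show "(F ^\<^sub>m j *\<^sub>v v j) $ a = 0\<^sub>v n $ a" using j a by (simp add: J_def)
  qed (use F in simp)
  thus False using v(3) by simp
qed

lemma indecomposableD:
  assumes "indecomposable_gmod G M"
  shows "is_gmod G M" "fst M > 0"
    and "\<And>U V. gsubmod G M U \<Longrightarrow> gsubmod G M V \<Longrightarrow> U \<inter> V = {0\<^sub>v (fst M)} \<Longrightarrow>
      (\<And>w. w \<in> carrier_vec (fst M) \<Longrightarrow> \<exists>u\<in>U. \<exists>v\<in>V. w = u + v) \<Longrightarrow> U = {0\<^sub>v (fst M)} \<or> V = {0\<^sub>v (fst M)}"
  using assms unfolding indecomposable_gmod_def by blast+

text \<open>Let \<open>P\<close> be a power of \<open>F\<close> at which the kernels have
  stabilized. Then the module is the direct sum of the image and the kernel of \<open>P\<close>.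
  Indecomposability leaves two cases: the image is zero and \<open>F\<close> is nilpotent, or the
  kernel is zero and \<open>F\<close> is injective.\<close>

lemma fitting:
  fixes M :: "('g, 'k :: field) gmod"
  assumes I: "indecomposable_gmod G M" and F: "F \<in> gmod_hom G M M"
    and nil: "\<And>k. F ^\<^sub>m k \<noteq> 0\<^sub>m (fst M) (fst M)"
  obtains R where "R \<in> gmod_hom G M M" "F * R = 1\<^sub>m (fst M)" "R * F = 1\<^sub>m (fst M)"
proof -
  let ?n = "fst M"
  note M = indecomposableD(1)[OF I] and cF = hom_carrier[OF F]
  obtain N where N: "\<And>v. v \<in> carrier_vec ?n \<Longrightarrow> F ^\<^sub>m Suc N *\<^sub>v v = 0\<^sub>v ?n \<Longrightarrow> F ^\<^sub>m N *\<^sub>v v = 0\<^sub>v ?n"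
    using kernel_stabilizes[OF cF] by blast
  define P where "P = F ^\<^sub>m N"
  have P: "P \<in> gmod_hom G M M" unfolding P_def by (rule hom_pow[OF M F])
  note cP = hom_carrier[OF P]
  have stable: "F ^\<^sub>m (k + N) *\<^sub>v v = 0\<^sub>v ?n \<Longrightarrow> P *\<^sub>v v = 0\<^sub>v ?n" if v: "v \<in> carrier_vec ?n" for k v
  proof (induction k)
    case (Suc k)
    have e: "F ^\<^sub>m (a + k) *\<^sub>v v = F ^\<^sub>m a *\<^sub>v (F ^\<^sub>m k *\<^sub>v v)" for a
      unfolding pow_mat_add[OF cF] by (rule assoc_mult_mat_vec) (use cF v in auto)
    have "F ^\<^sub>m (Suc N + k) *\<^sub>v v = 0\<^sub>v ?n" using Suc.prems by (metis add_Suc add.commute)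
    hence "F ^\<^sub>m (N + k) *\<^sub>v v = 0\<^sub>v ?n" unfolding e by (intro N mult_mat_vec_carrier[OF pow_carrier_mat[OF cF] v]) simp
    thus ?case using Suc.IH by (simp add: add.commute)
  qed (simp add: P_def)
  have PP: "P *\<^sub>v v = 0\<^sub>v ?n" if v: "v \<in> carrier_vec ?n" and "P *\<^sub>v (P *\<^sub>v v) = 0\<^sub>v ?n" for v
  proof -
    have "F ^\<^sub>m (N + N) *\<^sub>v v = P *\<^sub>v (P *\<^sub>v v)"
      unfolding P_def pow_mat_add[OF cF] by (rule assoc_mult_mat_vec) (use cF v in auto)
    thus ?thesis using stable[OF v, of N] that by simp
  qed
  let ?U = "(\<lambda>v. P *\<^sub>v v) ` carrier_vec ?n" and ?V = "{v \<in> carrier_vec ?n. P *\<^sub>v v = 0\<^sub>v ?n}"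
  have U: "gsubmod G M ?U" by (rule gsubmod_image[OF M M P gsubmod_full[OF M]])
  have V: "gsubmod G M ?V" by (rule gsubmod_kernel[OF M M P])
  have UV: "?U \<inter> ?V = {0\<^sub>v ?n}" 
  proof
    show "?U \<inter> ?V \<subseteq> {0\<^sub>v ?n}" using PP by blast
    show "{0\<^sub>v ?n} \<subseteq> ?U \<inter> ?V" using gsubmodD(2)[OF U] gsubmodD(2)[OF V] by blast
  qed
  have sum: "\<exists>u\<in>?U. \<exists>v\<in>?V. w = u + v" if w: "w \<in> carrier_vec ?n" for w
  proof -
    obtain r X Y where X: "X \<in> carrier_mat ?n r" and Y: "Y \<in> carrier_mat r ?n" and YX: "Y * X = 1\<^sub>m r"
      and fix_U: "\<And>u. u \<in> ?U \<Longrightarrow> X *\<^sub>v (Y *\<^sub>v u) = u"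
      and im_U: "\<And>v. v \<in> carrier_vec ?n \<Longrightarrow> X *\<^sub>v (Y *\<^sub>v v) \<in> ?U"
      using subspace_projection[OF gsubmodD(4)[OF U]] by blast
    \<comment> \<open>The restriction of \<open>P\<close> to its own image, in the coordinates given
      by \<open>X\<close>; it is injective and therefore invertible.\<close>
    define D where "D = Y * (P * X)"
    have D: "D \<in> carrier_mat r r" using X Y cP by (auto simp: D_def)
    have YXv: "Y *\<^sub>v (X *\<^sub>v v) = v" if "v \<in> carrier_vec r" for v
      by (rule mat_vec_cancel_left[OF YX]) (use X Y that in auto)
    have XU: "X *\<^sub>v v \<in> ?U" if "v \<in> carrier_vec r" for v
      using im_U[of "X *\<^sub>v v"] YXv[OF that] X that by auto
    have Dv: "X *\<^sub>v (D *\<^sub>v v) = P *\<^sub>v (X *\<^sub>v v)" if v: "v \<in> carrier_vec r" for v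
    proof -
      have Xv: "X *\<^sub>v v \<in> carrier_vec ?n" using X v by auto
      have "D *\<^sub>v v = Y *\<^sub>v (P *\<^sub>v (X *\<^sub>v v))" using X Y cP v by (simp add: D_def mat_vec_assoc)
      thus ?thesis using fix_U[of "P *\<^sub>v (X *\<^sub>v v)"] Xv by auto
    qed
    have "v = 0\<^sub>v r" if v: "v \<in> carrier_vec r" and 0: "D *\<^sub>v v = 0\<^sub>v r" for v
    proof -
      have Xv: "X *\<^sub>v v \<in> carrier_vec ?n" using X v by auto
      have "P *\<^sub>v (X *\<^sub>v v) = 0\<^sub>v ?n" using Dv[OF v] 0 mult_mat_vec_zero'[OF X] by simp
      hence "X *\<^sub>v v = 0\<^sub>v ?n" using UV XU[OF v] Xv by blast
      thus ?thesis using YXv[OF v] mult_mat_vec_zero'[OF Y] by simp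
    qed
    from injective_square_inverse[OF D this] obtain B where B: "B \<in> carrier_mat r r" "D * B = 1\<^sub>m r" by metis
    \<comment> \<open>Chosen so that \<open>P\<close> takes X z and w to the same vector; then w - X
      z lies in the kernel.\<close>
    define z where "z = B *\<^sub>v (Y *\<^sub>v (P *\<^sub>v w))"
    have Pw: "P *\<^sub>v w \<in> carrier_vec ?n" and YPw: "Y *\<^sub>v (P *\<^sub>v w) \<in> carrier_vec r" and z: "z \<in> carrier_vec r"
      using cP Y B w by (auto simp: z_def)
    have "P *\<^sub>v (X *\<^sub>v z) = X *\<^sub>v (D *\<^sub>v z)" by (rule Dv[OF z, symmetric])
    also have "D *\<^sub>v z = Y *\<^sub>v (P *\<^sub>v w)"
      unfolding z_def by (rule mat_vec_cancel_left[OF B(2)]) (use D B Y in auto)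
    also have "X *\<^sub>v \<dots> = P *\<^sub>v w" by (rule fix_U) (use w in auto)
    finally have Pz: "P *\<^sub>v (X *\<^sub>v z) = P *\<^sub>v w" .
    have Xz: "X *\<^sub>v z \<in> carrier_vec ?n" using X z by auto
    have "P *\<^sub>v (w - X *\<^sub>v z) = 0\<^sub>v ?n" unfolding mult_minus_distrib_mat_vec[OF cP w Xz] Pz using Pw by simp
    hence "w - X *\<^sub>v z \<in> ?V" using w Xz by auto
    moreover have "w = X *\<^sub>v z + (w - X *\<^sub>v z)" using w X by (intro eq_vecI) auto
    ultimately show ?thesis using XU[OF z] by blast
  qed
  from indecomposableD(3)[OF I U V UV sum] show ?thesis
  proof
    assume U0: "?U = {0\<^sub>v ?n}"
    have "P = 0\<^sub>m ?n ?n" unfolding hom_zero_iff[OF P] using U0 by blast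
    thus ?thesis using nil by (simp add: P_def)
  next
    assume V0: "?V = {0\<^sub>v ?n}"
    have "v = 0\<^sub>v ?n" if v: "v \<in> carrier_vec ?n" "F *\<^sub>v v = 0\<^sub>v ?n" for v
    proof -
      have "F ^\<^sub>m Suc N *\<^sub>v v = P *\<^sub>v (F *\<^sub>v v)"
        using assoc_mult_mat_vec[OF cP cF v(1)] by (simp add: P_def)
      hence "F ^\<^sub>m Suc N *\<^sub>v v = 0\<^sub>v ?n" unfolding v(2) using mult_mat_vec_zero'[OF cP] by simp
      hence "v \<in> ?V" using stable[OF v(1), of 1] v(1) by simp
      thus ?thesis using V0 by blast
    qed
    from injective_square_inverse[OF cF this] obtain R where
      R: "R \<in> carrier_mat ?n ?n" "F * R = 1\<^sub>m ?n" "R * F = 1\<^sub>m ?n" by metis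
    show ?thesis by (rule that[OF inverse_hom[OF M M F R] R(2,3)])
  qed
qed

text \<open>Since b F^k = b is nonzero for every k, \<open>F\<close> is not nilpotent. This is how
  the locality of the endomorphism ring is used: an endomorphism compatible with a nonzero linear
  map out of the module is invertible.\<close>

lemma fixing_endomorphism_invertible:
  fixes M :: "('g, 'k :: field) gmod"
  assumes I: "indecomposable_gmod G M" and F: "F \<in> gmod_hom G M M"
    and b: "b \<in> carrier_mat m (fst M)" "b \<noteq> 0\<^sub>m m (fst M)" and bF: "b * F = b"
  obtains R where "R \<in> gmod_hom G M M" "F * R = 1\<^sub>m (fst M)" "R * F = 1\<^sub>m (fst M)"
proof (rule fitting[OF I F])
  fix k
  note cF = hom_carrier[OF F]
  have "b * F ^\<^sub>m k = b"
  proof (induction k)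
    case (Suc k)
    thus ?case using assoc_mult_mat[OF b(1) pow_carrier_mat[OF cF] cF, of k] bF by simp
  qed (use right_mult_one_mat[OF b(1)] cF in simp)
  thus "F ^\<^sub>m k \<noteq> 0\<^sub>m (fst M) (fst M)" using b right_mult_zero_mat[OF b(1)] by metis
qed (rule that)

section \<open>Direct sums\<close>

text \<open>In contrast to \<open>sub_quot\<close> all four maps are equivariant.\<close>

definition direct_sum ::
  "('g, 'b) monoid_scheme \<Rightarrow> ('g, 'k :: field) gmod \<Rightarrow> ('g, 'k) gmod \<Rightarrow> ('g, 'k) gmod \<Rightarrow>
    'k mat \<Rightarrow> 'k mat \<Rightarrow> 'k mat \<Rightarrow> 'k mat \<Rightarrow> bool" where
  "direct_sum G M N N' X Y X' Y' \<longleftrightarrow> splitting (fst M) (fst N) (fst N') X Y X' Y' \<and> is_gmod G N \<and> is_gmod G N' \<and>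
     X \<in> gmod_hom G N M \<and> Y \<in> gmod_hom G M N \<and> X' \<in> gmod_hom G N' M \<and> Y' \<in> gmod_hom G M N'"

lemma retract_module:
  fixes M :: "('g, 'k :: field) gmod"
  assumes M: "is_gmod G M" and X: "X \<in> carrier_mat (fst M) r" and Y: "Y \<in> carrier_mat r (fst M)"
    and YX: "Y * X = 1\<^sub>m r" and E: "X * Y \<in> gmod_hom G M M"
  defines "N \<equiv> (r, \<lambda>g. Y * (snd M g * X))"
  shows "is_gmod G N" "X \<in> gmod_hom G N M" "Y \<in> gmod_hom G M N"
proof -
  let ?n = "fst M"
  have fN: "fst N = r" by (simp add: N_def)
  have AX: "X * snd N g = snd M g * X" if g: "g \<in> carrier G" for g
  proof -
    note A = gmod_carrier[OF M g]
    have "X * snd N g = X * Y * snd M g * X" using X Y A by (simp add: N_def mat_assoc)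
    also have "\<dots> = snd M g * (X * (Y * X))"
      unfolding hom_commute[OF E g] using X Y A by (simp add: mat_assoc)
    finally show ?thesis unfolding YX right_mult_one_mat[OF X] .
  qed
  have YA: "Y * snd M g = snd N g * Y" if g: "g \<in> carrier G" for g
  proof -
    note A = gmod_carrier[OF M g]
    have "snd N g * Y = Y * (snd M g * (X * Y))" using X Y A by (simp add: N_def mat_assoc)
    also have "\<dots> = Y * X * (Y * snd M g)"
      unfolding hom_commute[OF E g, symmetric] using X Y A by (simp add: mat_assoc)
    also have "\<dots> = Y * snd M g" unfolding YX by (rule left_mult_one_mat) (use Y A in auto)
    finally show ?thesis ..
  qed
  show "is_gmod G N"
    unfolding is_gmod_def
  proof (intro conjI ballI)
    fix g h assume g: "g \<in> carrier G" and h: "h \<in> carrier G"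
    note A = gmod_carrier[OF M g] gmod_carrier[OF M h]
    have "snd N (g \<otimes>\<^bsub>G\<^esub> h) = Y * (snd M g * (snd M h * X))"
      using A X Y by (simp add: N_def gmod_mult[OF M g h] mat_assoc)
    also have "\<dots> = Y * (snd M g * (X * snd N h))" unfolding AX[OF h] ..
    also have "\<dots> = snd N g * snd N h" using A X Y by (simp add: N_def mat_assoc)
    finally show "snd N (g \<otimes>\<^bsub>G\<^esub> h) = snd N g * snd N h" .
  qed (use X Y YX gmod_carrier[OF M] in \<open>auto simp: N_def gmod_one[OF M]\<close>)
  show "X \<in> gmod_hom G N M" by (rule homI) (use X AX fN in auto)
  show "Y \<in> gmod_hom G M N" by (rule homI) (use Y YA fN in auto)
qed

lemma idempotent_direct_sum:
  fixes M :: "('g, 'k :: field) gmod"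
  assumes M: "is_gmod G M" and E: "E \<in> gmod_hom G M M" and EE: "E * E = E"
  obtains N N' X Y X' Y' where "direct_sum G M N N' X Y X' Y'" "E = X * Y"
proof -
  let ?n = "fst M"
  obtain r X Y where X: "X \<in> carrier_mat ?n r" and Y: "Y \<in> carrier_mat r ?n" and YX: "Y * X = 1\<^sub>m r" and XY: "E = X * Y"
    by (rule idempotent_split[OF hom_carrier[OF E] EE])
  obtain s X' Y' where S: "splitting ?n r s X Y X' Y'" by (rule complement_exists[OF X Y YX])
  note s = S[unfolded splitting_def]
  have X': "X' \<in> carrier_mat ?n s" and Y': "Y' \<in> carrier_mat s ?n" and YX': "Y' * X' = 1\<^sub>m s"
    and sum: "X * Y + X' * Y' = 1\<^sub>m ?n" using s by auto
  have "X' * Y' = 1\<^sub>m ?n - 1 \<cdot>\<^sub>m E"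
    unfolding sum[symmetric] XY using X Y X' Y' by (intro eq_matI) auto
  hence E': "X' * Y' \<in> gmod_hom G M M" using hom_minus_smult[OF M M hom_id[OF M] E] by simp
  have E: "X * Y \<in> gmod_hom G M M" using E XY by simp
  have "direct_sum G M (r, \<lambda>g. Y * (snd M g * X)) (s, \<lambda>g. Y' * (snd M g * X')) X Y X' Y'"
    using S retract_module[OF M X Y YX E] retract_module[OF M X' Y' YX' E'] by (auto simp: direct_sum_def)
  thus ?thesis by (rule that[OF _ XY])
qed

lemma nontrivial_direct_sum:
  fixes M :: "('g, 'k :: field) gmod"
  assumes D: "direct_sum G M N N' X Y X' Y'" and E: "X * Y \<noteq> 0\<^sub>m (fst M) (fst M)" "X * Y \<noteq> 1\<^sub>m (fst M)"
  shows "fst N < fst M" "fst N' < fst M"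
proof -
  note s = D[unfolded direct_sum_def splitting_def]
  have X: "X \<in> carrier_mat (fst M) (fst N)" and Y: "Y \<in> carrier_mat (fst N) (fst M)"
    and X': "X' \<in> carrier_mat (fst M) (fst N')" and Y': "Y' \<in> carrier_mat (fst N') (fst M)" 
    and sum: "X * Y + X' * Y' = 1\<^sub>m (fst M)" using s by auto
  have "fst N \<noteq> 0"
  proof
    assume "fst N = 0"
    hence "X * Y = 0\<^sub>m (fst M) (fst M)" using X Y by (intro eq_matI) (auto simp: scalar_prod_def)
    thus False using E by simp
  qed
  moreover have "fst N' \<noteq> 0"
  proof
    assume "fst N' = 0"
    hence "X' * Y' = 0\<^sub>m (fst M) (fst M)" using X' Y' by (intro eq_matI) (auto simp: scalar_prod_def)
    hence "X * Y = 1\<^sub>m (fst M)" using sum right_add_zero_mat[of "X * Y" "fst M" "fst M"] X Y by simp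
    thus False using E by simp
  qed
  ultimately show "fst N < fst M" "fst N' < fst M" using s by auto
qed

text \<open>Turns a decomposition into two submodules into an idempotent endomorphism. The map from
  \<open>U\<close> to the quotient by \<open>V\<close> is bijective; following the quotient map by
  its inverse and the inclusion of \<open>U\<close> gives the projection onto \<open>U\<close> along
  \<open>V\<close>.\<close>

lemma not_indecomposable_idempotent:
  fixes M :: "('g, 'k :: field) gmod"
  assumes M: "is_gmod G M" and n: "fst M > 0" and NI: "\<not> indecomposable_gmod G M"
  obtains E where "E \<in> gmod_hom G M M" "E * E = E" "E \<noteq> 0\<^sub>m (fst M) (fst M)" "E \<noteq> 1\<^sub>m (fst M)"
proof -
  let ?n = "fst M"
  obtain U V where U: "gsubmod G M U" and V: "gsubmod G M V" and UV: "U \<inter> V = {0\<^sub>v ?n}"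
    and sum: "\<And>w. w \<in> carrier_vec ?n \<Longrightarrow> \<exists>u\<in>U. \<exists>v\<in>V. w = u + v" and U0: "U \<noteq> {0\<^sub>v ?n}" and V0: "V \<noteq> {0\<^sub>v ?n}"
    using NI M n unfolding indecomposable_gmod_def by blast
  obtain N N' X Y X' Y' where S: "sub_quot G M U N N' X Y X' Y'" by (rule sub_quot_exists[OF M U])
  obtain L L' P Q P' Q' where T: "sub_quot G M V L L' P Q P' Q'" by (rule sub_quot_exists[OF M V])
  note s = S[unfolded sub_quot_def] and t = T[unfolded sub_quot_def]
  have N: "is_gmod G N" and L': "is_gmod G L'" and X: "X \<in> gmod_hom G N M" and Q': "Q' \<in> gmod_hom G M L'"
    and imX: "(\<lambda>v. X *\<^sub>v v) ` carrier_vec (fst N) = U" and YX: "Y * X = 1\<^sub>m (fst N)" and cY: "Y \<in> carrier_mat (fst N) ?n"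
    and kerQ: "{v \<in> carrier_vec ?n. Q' *\<^sub>v v = 0\<^sub>v (fst L')} = V"
    and QP': "Q' * P' = 1\<^sub>m (fst L')" and cP': "P' \<in> carrier_mat ?n (fst L')"
    using s t by (auto simp: splitting_def)
  note cX = hom_carrier[OF X] and cQ' = hom_carrier[OF Q']
  have QX: "Q' * X \<in> gmod_hom G N L'" by (rule hom_comp[OF N M L' X Q'])
  obtain B where B: "B \<in> gmod_hom G L' N" "Q' * X * B = 1\<^sub>m (fst L')" "B * (Q' * X) = 1\<^sub>m (fst N)"
  proof (rule bijective_hom_inverse[OF N L' QX])
    fix v :: "'k vec" assume v: "v \<in> carrier_vec (fst N)" and 0: "Q' * X *\<^sub>v v = 0\<^sub>v (fst L')"
    have Xv: "X *\<^sub>v v \<in> carrier_vec ?n" using cX v by auto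
    have "X *\<^sub>v v \<in> V" using 0 assoc_mult_mat_vec[OF cQ' cX v] Xv kerQ by auto
    hence "X *\<^sub>v v = 0\<^sub>v ?n" using imX v UV by blast
    moreover have "Y *\<^sub>v (X *\<^sub>v v) = v" by (rule mat_vec_cancel_left[OF YX]) (use cX cY v in auto)
    ultimately show "v = 0\<^sub>v (fst N)" using mult_mat_vec_zero'[OF cY] by simp
  next
    show "(\<lambda>v. Q' * X *\<^sub>v v) ` carrier_vec (fst N) = carrier_vec (fst L')"
    proof (intro equalityI subsetI)
      fix z :: "'k vec" assume z: "z \<in> carrier_vec (fst L')"
      have Pz: "P' *\<^sub>v z \<in> carrier_vec ?n" using cP' z by auto
      obtain u v where uv: "u \<in> U" "v \<in> V" "P' *\<^sub>v z = u + v" using sum[OF Pz] by blast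
      obtain w where w: "w \<in> carrier_vec (fst N)" "u = X *\<^sub>v w" using uv(1) imX by auto
      have uc: "u \<in> carrier_vec ?n" and vc: "v \<in> carrier_vec ?n" and Qv: "Q' *\<^sub>v v = 0\<^sub>v (fst L')"
        using uv(1,2) gsubmodD(1)[OF U] kerQ by auto
      have "z = Q' *\<^sub>v (P' *\<^sub>v z)" by (rule mat_vec_cancel_left[OF QP', symmetric]) (use cP' cQ' z in auto)
      also have "\<dots> = Q' *\<^sub>v u + Q' *\<^sub>v v" unfolding uv(3) by (rule mult_add_distrib_mat_vec[OF cQ' uc vc])
      also have "\<dots> = Q' *\<^sub>v u" unfolding Qv by (rule right_zero_vec) (use cQ' uc in auto)
      also have "\<dots> = Q' * X *\<^sub>v w" unfolding w(2) by (rule assoc_mult_mat_vec[OF cQ' cX w(1), symmetric])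
      finally show "z \<in> (\<lambda>v. Q' * X *\<^sub>v v) ` carrier_vec (fst N)" using w(1) by blast
    qed (use cQ' cX in auto)
  qed
  note cB = hom_carrier[OF B(1)]
  define E where "E = X * (B * Q')"
  have E: "E \<in> gmod_hom G M M"
    unfolding E_def by (rule hom_comp[OF M N M hom_comp[OF M L' N Q' B(1)] X])
  note cE = hom_carrier[OF E]
  have BQX: "B * Q' * X = 1\<^sub>m (fst N)" using B(3) assoc_mult_mat[OF cB cQ' cX] by simp
  have "E * E = X * (B * Q' * X * (B * Q'))" unfolding E_def using cX cB cQ' by (simp add: mat_assoc)
  also have "\<dots> = E" unfolding BQX E_def using left_mult_one_mat[of "B * Q'" "fst N" ?n] cB cQ' by simp
  finally have EE: "E * E = E" .
  have EX: "E * X = X"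
    unfolding E_def using assoc_mult_mat[OF cX mult_carrier_mat[OF cB cQ'] cX] BQX right_mult_one_mat[OF cX] by simp
  have "E \<noteq> 0\<^sub>m ?n ?n"
  proof
    assume "E = 0\<^sub>m ?n ?n"
    hence "X = 0\<^sub>m ?n (fst N)" using EX cX by simp
    hence "U \<subseteq> {0\<^sub>v ?n}" unfolding imX[symmetric] by auto
    thus False using U0 gsubmodD(2)[OF U] by blast
  qed
  moreover have "E \<noteq> 1\<^sub>m ?n"
  proof
    assume E1: "E = 1\<^sub>m ?n"
    have "v = 0\<^sub>v ?n" if v: "v \<in> V" for v
    proof -
      have vc: "v \<in> carrier_vec ?n" and Qv: "Q' *\<^sub>v v = 0\<^sub>v (fst L')" using v kerQ by auto
      have "v = E *\<^sub>v v" using E1 vc by simp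
      also have "\<dots> = X *\<^sub>v (B *\<^sub>v (Q' *\<^sub>v v))" unfolding E_def using cX cB cQ' vc by (simp add: mat_vec_assoc)
      also have "\<dots> = 0\<^sub>v ?n" unfolding Qv mult_mat_vec_zero'[OF cB] mult_mat_vec_zero'[OF cX] ..
      finally show ?thesis .
    qed
    thus False using V0 gsubmodD(2)[OF V] by blast
  qed
  ultimately show ?thesis using that[OF E EE] by blast
qed

section \<open>Projective covers\<close>

lemma projective_gmodD:
  assumes "projective_gmod G P"
  shows "is_gmod G P"
    and "\<And>M N T F. is_gmod G M \<Longrightarrow> is_gmod G N \<Longrightarrow> T \<in> gmod_epi G M N \<Longrightarrow> F \<in> gmod_hom G P N \<Longrightarrow>
      \<exists>F' \<in> gmod_hom G P M. T * F' = F"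
  using assms unfolding projective_gmod_def by blast+

lemma epi_hom: "T \<in> gmod_epi G M N \<Longrightarrow> T \<in> gmod_hom G M N"
  by (simp add: gmod_epi_def)

lemma epi_nonzero:
  fixes M :: "('g, 'k :: field) gmod"
  assumes "T \<in> gmod_epi G M N" "fst N > 0"
  shows "T \<noteq> 0\<^sub>m (fst N) (fst M)"
proof
  assume T: "T = 0\<^sub>m (fst N) (fst M)"
  obtain R where R: "R \<in> carrier_mat (fst M) (fst N)" "T * R = 1\<^sub>m (fst N)" by (rule epi_right_inverse[OF assms(1)])
  have "T * R = 0\<^sub>m (fst N) (fst N)" unfolding T using R(1) by simp
  hence "(1\<^sub>m (fst N) :: 'k mat) $$ (0, 0) = 0\<^sub>m (fst N) (fst N) $$ (0, 0)" using R(2) by simp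
  thus False using assms(2) by simp
qed

lemma retract_projective:
  fixes P :: "('g, 'k :: field) gmod"
  assumes P: "projective_gmod G P" and Q: "is_gmod G Q"
    and X: "X \<in> gmod_hom G Q P" and Y: "Y \<in> gmod_hom G P Q" and YX: "Y * X = 1\<^sub>m (fst Q)"
  shows "projective_gmod G Q"
  unfolding projective_gmod_def
proof (intro conjI Q allI impI ballI)
  fix M N :: "('g, 'k) gmod" and T F
  assume M: "is_gmod G M" and N: "is_gmod G N" and T: "T \<in> gmod_epi G M N" and F: "F \<in> gmod_hom G Q N"
  note P' = projective_gmodD(1)[OF P]
  obtain F' where F': "F' \<in> gmod_hom G P M" "T * F' = F * Y"
    using projective_gmodD(2)[OF P M N T hom_comp[OF P' Q N Y F]] by blast
  note c = hom_carrier[OF X] hom_carrier[OF Y] hom_carrier[OF F] hom_carrier[OF F'(1)] hom_carrier[OF epi_hom[OF T]]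
  have "T * (F' * X) = F * Y * X" using assoc_mult_mat[OF c(5,4,1)] F'(2) by simp
  also have "\<dots> = F" using assoc_mult_mat[OF c(3,2,1)] YX right_mult_one_mat[OF c(3)] by simp
  finally show "\<exists>F'\<in>gmod_hom G Q M. T * F' = F" using hom_comp[OF Q P' M X F'(1)] by blast
qed

text \<open>If \<open>b\<close> did not vanish on the kernel of \<open>a\<close>, it would map that
  kernel onto \<open>T\<close>; lifting \<open>b\<close> through this surjection gives an
  endomorphism of \<open>P\<close> that fixes \<open>b\<close> and has its image in the kernel of
  \<open>a\<close>. Being invertible, it would force \<open>a = 0\<close>. By symmetry all nonzero
  maps to irreducible modules have the same kernel, the unique maximal submodule of
  \<open>P\<close>.\<close>

lemma projective_top_kernel:
  fixes P :: "('g, 'k :: field) gmod"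
  assumes P: "projective_gmod G P" and I: "indecomposable_gmod G P"
    and S: "irreducible_gmod G S" and T: "irreducible_gmod G T"
    and a: "a \<in> gmod_hom G P S" "a \<noteq> 0\<^sub>m (fst S) (fst P)"
    and b: "b \<in> gmod_hom G P T" "b \<noteq> 0\<^sub>m (fst T) (fst P)"
    and v: "v \<in> carrier_vec (fst P)" "a *\<^sub>v v = 0\<^sub>v (fst S)"
  shows "b *\<^sub>v v = 0\<^sub>v (fst T)"
proof (rule ccontr)
  assume bv: "b *\<^sub>v v \<noteq> 0\<^sub>v (fst T)"
  note P' = projective_gmodD(1)[OF P] and S' = irreducibleD(1)[OF S] and T' = irreducibleD(1)[OF T]
  let ?A = "{v \<in> carrier_vec (fst P). a *\<^sub>v v = 0\<^sub>v (fst S)}"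
  obtain N N' X Y X' Y' where "sub_quot G P ?A N N' X Y X' Y'"
    by (rule sub_quot_exists[OF P' gsubmod_kernel[OF P' S' a(1)]])
  hence N: "is_gmod G N" and X: "X \<in> gmod_hom G N P" and imX: "(\<lambda>v. X *\<^sub>v v) ` carrier_vec (fst N) = ?A"
    by (auto simp: sub_quot_def)
  note cX = hom_carrier[OF X] and ca = hom_carrier[OF a(1)] and cb = hom_carrier[OF b(1)]
  have bX: "b * X \<in> gmod_hom G N T" by (rule hom_comp[OF N P' T' X b(1)])
  obtain w where w: "w \<in> carrier_vec (fst N)" "v = X *\<^sub>v w" using imX v by (metis (mono_tags, lifting) imageE mem_Collect_eq)
  have "b * X *\<^sub>v w \<noteq> 0\<^sub>v (fst T)" using assoc_mult_mat_vec[OF cb cX w(1)] bv w(2) by simp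
  hence "b * X \<noteq> 0\<^sub>m (fst T) (fst N)" using hom_zero_iff[OF bX] w(1) by blast
  hence "b * X \<in> gmod_epi G N T" by (rule irreducible_hom_surjective[OF T N bX])
  then obtain F where F: "F \<in> gmod_hom G P N" "b * X * F = b"
    using projective_gmodD(2)[OF P N T' _ b(1)] by blast
  note cF = hom_carrier[OF F(1)]
  have XF: "X * F \<in> gmod_hom G P P" by (rule hom_comp[OF P' N P' F(1) X])
  have "b * (X * F) = b" using assoc_mult_mat[OF cb cX cF] F(2) by simp
  then obtain R where R: "R \<in> gmod_hom G P P" "X * F * R = 1\<^sub>m (fst P)"
    by (rule fixing_endomorphism_invertible[OF I XF cb b(2)])
  note cR = hom_carrier[OF R(1)]
  have "a *\<^sub>v u = 0\<^sub>v (fst S)" if u: "u \<in> carrier_vec (fst P)" for u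
  proof -
    have FRu: "F *\<^sub>v (R *\<^sub>v u) \<in> carrier_vec (fst N)" using cF cR u by auto
    have "u = X * F * R *\<^sub>v u" unfolding R(2) using u by simp
    also have "\<dots> = X * F *\<^sub>v (R *\<^sub>v u)" by (rule assoc_mult_mat_vec[OF mult_carrier_mat[OF cX cF] cR u])
    also have "\<dots> = X *\<^sub>v (F *\<^sub>v (R *\<^sub>v u))" by (rule assoc_mult_mat_vec[OF cX cF]) (use cR u in auto)
    finally have "u \<in> ?A" using imX FRu by blast
    thus ?thesis by simp
  qed
  thus False using hom_zero_iff[OF a(1)] a(2) by blast
qed

text \<open>\<open>b\<close> vanishes on the kernel of \<open>a\<close> and so factors through
  \<open>S\<close>, by \<open>b * R\<close> for any linear section \<open>R\<close> of
  \<open>a\<close>.\<close>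

lemma projective_top_factor:
  fixes P :: "('g, 'k :: field) gmod"
  assumes P: "projective_gmod G P" and I: "indecomposable_gmod G P"
    and S: "irreducible_gmod G S" and T: "irreducible_gmod G T"
    and a: "a \<in> gmod_hom G P S" "a \<noteq> 0\<^sub>m (fst S) (fst P)"
    and b: "b \<in> gmod_hom G P T" "b \<noteq> 0\<^sub>m (fst T) (fst P)"
  obtains c where "c \<in> gmod_hom G S T" "b = c * a"
proof -
  note P' = projective_gmodD(1)[OF P] and S' = irreducibleD(1)[OF S] and T' = irreducibleD(1)[OF T]
  note ca = hom_carrier[OF a(1)] and cb = hom_carrier[OF b(1)]
  obtain R where R: "R \<in> carrier_mat (fst P) (fst S)" "a * R = 1\<^sub>m (fst S)"
    by (rule epi_right_inverse[OF irreducible_hom_surjective[OF S P' a]])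
  have cbR: "b * R \<in> carrier_mat (fst T) (fst S)" using cb R by auto
  have bRa: "b * R * a = b"
  proof (rule eq_mat_by_vec[of _ "fst T" "fst P"])
    fix v :: "'k vec" assume v: "v \<in> carrier_vec (fst P)"
    have av: "a *\<^sub>v v \<in> carrier_vec (fst S)" and Rav: "R *\<^sub>v (a *\<^sub>v v) \<in> carrier_vec (fst P)" using ca R v by auto
    have "a *\<^sub>v (R *\<^sub>v (a *\<^sub>v v)) = a *\<^sub>v v" by (rule mat_vec_cancel_left[OF R(2)]) (use ca R v in auto)
    hence "a *\<^sub>v (R *\<^sub>v (a *\<^sub>v v) - v) = 0\<^sub>v (fst S)"
      unfolding mult_minus_distrib_mat_vec[OF ca Rav v] using av by simp
    hence "b *\<^sub>v (R *\<^sub>v (a *\<^sub>v v) - v) = 0\<^sub>v (fst T)"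
      by (intro projective_top_kernel[OF P I S T a b]) (use Rav v in auto)
    hence "b *\<^sub>v (R *\<^sub>v (a *\<^sub>v v)) - b *\<^sub>v v = 0\<^sub>v (fst T)"
      unfolding mult_minus_distrib_mat_vec[OF cb Rav v] .
    hence "b *\<^sub>v (R *\<^sub>v (a *\<^sub>v v)) = b *\<^sub>v v"
      by (rule minus_vec_zero_imp_eq[OF mult_mat_vec_carrier[OF cb Rav] mult_mat_vec_carrier[OF cb v]])
    moreover have "b * R * a *\<^sub>v v = b *\<^sub>v (R *\<^sub>v (a *\<^sub>v v))"
      using assoc_mult_mat_vec[OF cbR ca v] assoc_mult_mat_vec[OF cb R(1) av] by simp
    ultimately show "b * R * a *\<^sub>v v = b *\<^sub>v v" by simp
  qed (use cb ca R in auto)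
  \<comment> \<open>\<open>R\<close> itself need not be equivariant; inserting
    \<open>a * R = 1\<close> moves the group element past \<open>a\<close>, where
    \<open>b * R * a = b\<close> applies.\<close>
  have "b * R \<in> gmod_hom G S T"
  proof (rule homI[OF cbR])
    fix g assume g: "g \<in> carrier G"
    note cg = gmod_carrier[OF P' g] gmod_carrier[OF S' g] gmod_carrier[OF T' g]
    have "b * R * snd S g = b * R * (snd S g * (a * R))" unfolding R(2) right_mult_one_mat[OF cg(2)] ..
    also have "\<dots> = b * R * (snd S g * a) * R"
      using assoc_mult_mat[OF cg(2) ca R(1)] assoc_mult_mat[OF cbR mult_carrier_mat[OF cg(2) ca] R(1)] by simp
    also have "b * R * (snd S g * a) = b * R * a * snd P g"
      unfolding hom_commute[OF a(1) g, symmetric] by (rule assoc_mult_mat[OF cbR ca cg(1), symmetric])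
    also have "\<dots> = snd T g * b" unfolding bRa by (rule hom_commute[OF b(1) g])
    also have "snd T g * b * R = snd T g * (b * R)" by (rule assoc_mult_mat[OF cg(3) cb R(1)])
    finally show "b * R * snd S g = snd T g * (b * R)" .
  qed
  thus ?thesis by (rule that[OF _ bRa[symmetric]])
qed

lemma projective_top_unique:
  fixes P :: "('g, 'k :: field) gmod"
  assumes "projective_gmod G P" "indecomposable_gmod G P"
    and S: "irreducible_gmod G S" and T: "irreducible_gmod G T"
    and a: "a \<in> gmod_hom G P S" "a \<noteq> 0\<^sub>m (fst S) (fst P)"
    and b: "b \<in> gmod_hom G P T" "b \<noteq> 0\<^sub>m (fst T) (fst P)"
  shows "gmod_iso G S T"
proof -
  obtain c where c: "c \<in> gmod_hom G S T" "b = c * a" by (rule projective_top_factor[OF assms])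
  have "c \<noteq> 0\<^sub>m (fst T) (fst S)"
  proof
    assume "c = 0\<^sub>m (fst T) (fst S)"
    hence "b = 0\<^sub>m (fst T) (fst P)" using c(2) hom_carrier[OF a(1)] by simp
    thus False using b(2) by simp
  qed
  thus ?thesis by (rule schur_iso[OF S T c(1)])
qed

text \<open>By Schur's lemma the homomorphisms from \<open>P\<close> to \<open>S\<close> form a
  space of dimension one, so each summand of the regular module with top \<open>S\<close>
  contributes one line to \<open>S\<close>.\<close>

lemma projective_top_scalar:
  fixes P :: "('g, 'k :: alg_closed_field) gmod"
  assumes P: "projective_gmod G P" and I: "indecomposable_gmod G P" and S: "irreducible_gmod G S"
    and a: "a \<in> gmod_hom G P S" "a \<noteq> 0\<^sub>m (fst S) (fst P)" and b: "b \<in> gmod_hom G P S"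
  shows "\<exists>c. b = c \<cdot>\<^sub>m a"
proof (cases "b = 0\<^sub>m (fst S) (fst P)")
  case True
  thus ?thesis using hom_carrier[OF a(1)] by (intro exI[of _ 0]) auto
next
  case False
  obtain F where F: "F \<in> gmod_hom G S S" "b = F * a" by (rule projective_top_factor[OF P I S S a b False])
  obtain c where "F = c \<cdot>\<^sub>m 1\<^sub>m (fst S)" using schur_scalar[OF S F(1)] by blast
  hence "b = c \<cdot>\<^sub>m a"
    using F(2) mult_smult_assoc_mat[OF one_carrier_mat hom_carrier[OF a(1)], of c] left_mult_one_mat[OF hom_carrier[OF a(1)]] by simp
  thus ?thesis ..
qed

text \<open>Each cover map is lifted through the other; both composites are compatible with a
  nonzero map to \<open>S\<close> and hence invertible. This makes the Brauer character of a cover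
  independent of its choice.\<close>

lemma proj_indec_cover_unique:
  fixes P Q :: "('g, 'k :: field) gmod"
  assumes S: "irreducible_gmod G S" and P: "proj_indec_cover G S P" and Q: "proj_indec_cover G S Q"
  shows "gmod_iso G P Q"
proof -
  have pP: "projective_gmod G P" and iP: "indecomposable_gmod G P" and pQ: "projective_gmod G Q" and iQ: "indecomposable_gmod G Q"
    using P Q by (auto simp: proj_indec_cover_def)
  obtain a b where a: "a \<in> gmod_epi G P S" and b: "b \<in> gmod_epi G Q S" using P Q by (auto simp: proj_indec_cover_def)
  note P' = indecomposableD(1)[OF iP] and Q' = indecomposableD(1)[OF iQ] and S' = irreducibleD(1)[OF S]
  obtain F where F: "F \<in> gmod_hom G P Q" "b * F = a" using projective_gmodD(2)[OF pP Q' S' b epi_hom[OF a]] by blast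
  obtain H where H: "H \<in> gmod_hom G Q P" "a * H = b" using projective_gmodD(2)[OF pQ P' S' a epi_hom[OF b]] by blast
  note ca = hom_carrier[OF epi_hom[OF a]] and cb = hom_carrier[OF epi_hom[OF b]] and cF = hom_carrier[OF F(1)] and cH = hom_carrier[OF H(1)]
  have "a * (H * F) = a" using assoc_mult_mat[OF ca cH cF] F(2) H(2) by simp
  then obtain L where L: "L \<in> gmod_hom G P P" "L * (H * F) = 1\<^sub>m (fst P)"
    by (rule fixing_endomorphism_invertible[OF iP hom_comp[OF P' Q' P' F(1) H(1)] ca epi_nonzero[OF a irreducibleD(2)[OF S]]])
  have "b * (F * H) = b" using assoc_mult_mat[OF cb cF cH] F(2) H(2) by simp
  then obtain R where R: "R \<in> gmod_hom G Q Q" "F * H * R = 1\<^sub>m (fst Q)"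
    by (rule fixing_endomorphism_invertible[OF iQ hom_comp[OF Q' P' Q' H(1) F(1)] cb epi_nonzero[OF b irreducibleD(2)[OF S]]])
  note cL = hom_carrier[OF L(1)] and cR = hom_carrier[OF R(1)]
  have LH: "L * H * F = 1\<^sub>m (fst P)" using assoc_mult_mat[OF cL cH cF] L(2) by simp
  have HR: "F * (H * R) = 1\<^sub>m (fst Q)" using assoc_mult_mat[OF cF cH cR] R(2) by simp
  \<comment> \<open>A left and a right inverse of \<open>F\<close> coincide.\<close>
  have "L * H = L * H * (F * (H * R))" unfolding HR using right_mult_one_mat[OF mult_carrier_mat[OF cL cH]] by simp
  also have "\<dots> = H * R"
    by (rule mat_cancel_left[OF LH]) (use cL cH cF cR in auto)
  finally have "H * R * F = 1\<^sub>m (fst P)" using LH by simp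
  thus ?thesis unfolding gmod_iso_def using F(1) hom_comp[OF Q' Q' P' R(1) H(1)] HR by blast
qed

section \<open>Simple quotients and existence of covers\<close>

lemma simple_quotient_exists:
  fixes M :: "('g, 'k :: field) gmod"
  assumes "is_gmod G M" "fst M > 0"
  shows "\<exists>S T. irreducible_gmod G S \<and> T \<in> gmod_epi G M S"
  using assms
proof (induction "fst M" arbitrary: M rule: less_induct)
  case less
  note M = less.prems(1)
  show ?case
  proof (cases "irreducible_gmod G M")
    case True
    have "1\<^sub>m (fst M) \<in> gmod_epi G M M" using hom_id[OF M] by (auto simp: gmod_epi_def image_iff)
    thus ?thesis using True by blast
  next
    case False
    then obtain W where W: "gsubmod G M W" "W \<noteq> {0\<^sub>v (fst M)}" "W \<noteq> carrier_vec (fst M)"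
      using less.prems by (auto simp: irreducible_gmod_def)
    obtain N N' X Y X' Y' where SQ: "sub_quot G M W N N' X Y X' Y'" by (rule sub_quot_exists[OF M W(1)])
    note s = SQ[unfolded sub_quot_def]
    have N': "is_gmod G N'" and Y': "Y' \<in> gmod_hom G M N'" and dim: "fst M = fst N + fst N'"
      and imX: "(\<lambda>v. X *\<^sub>v v) ` carrier_vec (fst N) = W" and kerY: "{v \<in> carrier_vec (fst M). Y' *\<^sub>v v = 0\<^sub>v (fst N')} = W"
      and YX: "Y' * X' = 1\<^sub>m (fst N')" and X': "X' \<in> carrier_mat (fst M) (fst N')" and X: "X \<in> carrier_mat (fst M) (fst N)"
      using s by (auto simp: splitting_def)
    note cY = hom_carrier[OF Y']
    have "fst N \<noteq> 0"
    proof
      assume 0: "fst N = 0"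
      have "X *\<^sub>v v = 0\<^sub>v (fst M)" if "v \<in> carrier_vec 0" for v
        using X that 0 by (intro eq_vecI) (auto simp: scalar_prod_def)
      hence "W \<subseteq> {0\<^sub>v (fst M)}" using imX 0 by auto
      thus False using W(2) gsubmodD(2)[OF W(1)] by blast
    qed
    moreover have "fst N' \<noteq> 0"
    proof
      assume 0: "fst N' = 0"
      have "Y' *\<^sub>v v = 0\<^sub>v (fst N')" for v using cY 0 by (intro eq_vecI) auto
      thus False using kerY W(3) by simp
    qed
    ultimately obtain S T where S: "irreducible_gmod G S" and T: "T \<in> gmod_epi G N' S"
      using less.hyps[of N'] dim N' by auto
    note cT = hom_carrier[OF epi_hom[OF T]]
    have "(\<lambda>v. T * Y' *\<^sub>v v) ` carrier_vec (fst M) = carrier_vec (fst S)"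
    proof (intro equalityI subsetI)
      fix z :: "'k vec" assume "z \<in> carrier_vec (fst S)"
      then obtain w where w: "w \<in> carrier_vec (fst N')" "z = T *\<^sub>v w" using T by (force simp: gmod_epi_def)
      have "Y' *\<^sub>v (X' *\<^sub>v w) = w" by (rule mat_vec_cancel_left[OF YX]) (use cY X' w in auto)
      hence "T * Y' *\<^sub>v (X' *\<^sub>v w) = z" using assoc_mult_mat_vec[OF cT cY, of "X' *\<^sub>v w"] X' w by auto
      moreover have "X' *\<^sub>v w \<in> carrier_vec (fst M)" using X' w by auto
      ultimately show "z \<in> (\<lambda>v. T * Y' *\<^sub>v v) ` carrier_vec (fst M)" by blast
    qed (use cT cY in auto)
    hence "T * Y' \<in> gmod_epi G M S"
      using hom_comp[OF M N' irreducibleD(1)[OF S] Y' epi_hom[OF T]] by (simp add: gmod_epi_def)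
    thus ?thesis using S by blast
  qed
qed

text \<open>A proper decomposition of \<open>P\<close> leaves a summand on which \<open>T\<close> is
  nonzero, hence onto the irreducible \<open>S\<close>; this summand is again projective and of
  smaller dimension.\<close>

lemma proj_indec_cover_exists:
  fixes P S :: "('g, 'k :: field) gmod"
  assumes "projective_gmod G P" "T \<in> gmod_epi G P S" and S: "irreducible_gmod G S"
  shows "\<exists>Q. proj_indec_cover G S Q"
  using assms(1,2)
proof (induction "fst P" arbitrary: P T rule: less_induct)
  case less
  note P = less.prems(1) and T = less.prems(2)
  note P' = projective_gmodD(1)[OF P] and S' = irreducibleD(1)[OF S] and cT = hom_carrier[OF epi_hom[OF T]]
  note Tnz = epi_nonzero[OF T irreducibleD(2)[OF S]]
  show ?case
  proof (cases "indecomposable_gmod G P")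
    case True
    hence "proj_indec_cover G S P" using P T by (auto simp: proj_indec_cover_def)
    thus ?thesis ..
  next
    case False
    have n: "fst P > 0" using Tnz cT by (cases "fst P = 0") (auto simp: mat_eq_iff)
    obtain E where E: "E \<in> gmod_hom G P P" "E * E = E" "E \<noteq> 0\<^sub>m (fst P) (fst P)" "E \<noteq> 1\<^sub>m (fst P)"
      by (rule not_indecomposable_idempotent[OF P' n False])
    obtain N N' X Y X' Y' where D: "direct_sum G P N N' X Y X' Y'" "E = X * Y"
      by (rule idempotent_direct_sum[OF P' E(1,2)])
    note small = nontrivial_direct_sum[OF D(1), folded D(2), OF E(3,4)]
    note d = D(1)[unfolded direct_sum_def splitting_def]
    have N: "is_gmod G N" "is_gmod G N'" and X: "X \<in> gmod_hom G N P" and Y: "Y \<in> gmod_hom G P N"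
      and X': "X' \<in> gmod_hom G N' P" and Y': "Y' \<in> gmod_hom G P N'"
      and YX: "Y * X = 1\<^sub>m (fst N)" and YX': "Y' * X' = 1\<^sub>m (fst N')" and sum: "X * Y + X' * Y' = 1\<^sub>m (fst P)"
      using d by auto
    note c = hom_carrier[OF X] hom_carrier[OF Y] hom_carrier[OF X'] hom_carrier[OF Y']
    have "T = T * X * Y + T * X' * Y'"
    proof -
      have "T = T * (X * Y + X' * Y')" unfolding sum right_mult_one_mat[OF cT] ..
      also have "\<dots> = T * (X * Y) + T * (X' * Y')" by (rule mult_add_distrib_mat[OF cT]) (use c in auto)
      finally show ?thesis using assoc_mult_mat[OF cT c(1,2)] assoc_mult_mat[OF cT c(3,4)] by simp
    qed
    hence "T * X \<noteq> 0\<^sub>m (fst S) (fst N) \<or> T * X' \<noteq> 0\<^sub>m (fst S) (fst N')" using Tnz c by auto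
    thus ?thesis
    proof
      assume nz: "T * X \<noteq> 0\<^sub>m (fst S) (fst N)"
      have "T * X \<in> gmod_epi G N S"
        by (rule irreducible_hom_surjective[OF S N(1) hom_comp[OF N(1) P' S' X epi_hom[OF T]] nz])
      thus ?thesis using less.hyps[OF small(1) retract_projective[OF P N(1) X Y YX]] by blast
    next
      assume nz: "T * X' \<noteq> 0\<^sub>m (fst S) (fst N')"
      have "T * X' \<in> gmod_epi G N' S"
        by (rule irreducible_hom_surjective[OF S N(2) hom_comp[OF N(2) P' S' X' epi_hom[OF T]] nz])
      thus ?thesis using less.hyps[OF small(2) retract_projective[OF P N(2) X' Y' YX']] by blast
    qed
  qed
qed

section \<open>Decomposition into indecomposable modules\<close>

text \<open>Matrices of all sizes share one type, so the empty sum has no canonical value; the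
  dimensions are therefore arguments.\<close>

definition msum :: "nat \<Rightarrow> nat \<Rightarrow> nat \<Rightarrow> (nat \<Rightarrow> 'a :: comm_monoid_add mat) \<Rightarrow> 'a mat" where
  "msum nr nc d F = mat nr nc (\<lambda>(i, j). \<Sum>k<d. F k $$ (i, j))"

lemma msum_carrier [simp]: "msum nr nc d F \<in> carrier_mat nr nc"
  by (simp add: msum_def)

lemma msum_cong: "(\<And>k. k < d \<Longrightarrow> F k = F' k) \<Longrightarrow> msum nr nc d F = msum nr nc d F'"
  by (auto simp: msum_def intro!: eq_matI sum.cong)

lemma mult_msum:
  fixes T :: "'a :: semiring_0 mat"
  assumes T: "T \<in> carrier_mat a nr" and F: "\<And>k. k < d \<Longrightarrow> F k \<in> carrier_mat nr nc"
  shows "T * msum nr nc d F = msum a nc d (\<lambda>k. T * F k)"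
proof (rule eq_matI)
  fix i j assume "i < dim_row (msum a nc d (\<lambda>k. T * F k))" "j < dim_col (msum a nc d (\<lambda>k. T * F k))"
  hence ij: "i < a" "j < nc" by (auto simp: msum_def)
  have e: "(T * F k) $$ (i, j) = (\<Sum>l<nr. T $$ (i, l) * F k $$ (l, j))" if "k < d" for k
    using F[OF that] T ij by (simp add: scalar_prod_def atLeast0LessThan)
  have "(T * msum nr nc d F) $$ (i, j) = (\<Sum>l<nr. \<Sum>k<d. T $$ (i, l) * F k $$ (l, j))"
    using T ij by (simp add: msum_def scalar_prod_def atLeast0LessThan sum_distrib_left)
  also have "\<dots> = (\<Sum>k<d. (T * F k) $$ (i, j))" by (subst sum.swap) (simp add: e)
  finally show "(T * msum nr nc d F) $$ (i, j) = msum a nc d (\<lambda>k. T * F k) $$ (i, j)"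
    using ij by (simp add: msum_def)
qed (use T in \<open>auto simp: msum_def\<close>)

lemma msum_mult:
  fixes T :: "'a :: semiring_0 mat"
  assumes T: "T \<in> carrier_mat nc b" and F: "\<And>k. k < d \<Longrightarrow> F k \<in> carrier_mat nr nc"
  shows "msum nr nc d F * T = msum nr b d (\<lambda>k. F k * T)"
proof (rule eq_matI)
  fix i j assume "i < dim_row (msum nr b d (\<lambda>k. F k * T))" "j < dim_col (msum nr b d (\<lambda>k. F k * T))"
  hence ij: "i < nr" "j < b" by (auto simp: msum_def)
  have e: "(F k * T) $$ (i, j) = (\<Sum>l<nc. F k $$ (i, l) * T $$ (l, j))" if "k < d" for k
    using F[OF that] T ij by (simp add: scalar_prod_def atLeast0LessThan)
  have "(msum nr nc d F * T) $$ (i, j) = (\<Sum>l<nc. \<Sum>k<d. F k $$ (i, l) * T $$ (l, j))"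
    using T ij by (simp add: msum_def scalar_prod_def atLeast0LessThan sum_distrib_right)
  also have "\<dots> = (\<Sum>k<d. (F k * T) $$ (i, j))" by (subst sum.swap) (simp add: e)
  finally show "(msum nr nc d F * T) $$ (i, j) = msum nr b d (\<lambda>k. F k * T) $$ (i, j)"
    using ij by (simp add: msum_def)
qed (use T in \<open>auto simp: msum_def\<close>)

lemma mult_msum_mult:
  fixes X Y :: "'a :: semiring_0 mat"
  assumes X: "X \<in> carrier_mat a n" and Y: "Y \<in> carrier_mat m b" and F: "\<And>k. k < d \<Longrightarrow> F k \<in> carrier_mat n m"
  shows "X * (msum n m d F * Y) = msum a b d (\<lambda>k. X * (F k * Y))"
proof -
  have "msum n m d F * Y = msum n b d (\<lambda>k. F k * Y)" by (rule msum_mult[OF Y F])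
  moreover have "X * msum n b d (\<lambda>k. F k * Y) = msum a b d (\<lambda>k. X * (F k * Y))"
    by (rule mult_msum[OF X mult_carrier_mat[OF F Y]])
  ultimately show ?thesis by simp
qed

lemma sum_lessThan_add: "(\<Sum>k<d + e. f k) = (\<Sum>k<d. f k) + (\<Sum>k<e. f (k + d))"
  for f :: "nat \<Rightarrow> 'a :: comm_monoid_add"
  by (induction e) (auto simp: add_ac)

lemma msum_add: "msum nr nc (d + e) F = msum nr nc d F + msum nr nc e (\<lambda>k. F (k + d))"
  by (auto simp: msum_def sum_lessThan_add intro!: eq_matI)

section \<open>Eigenprojections of a matrix of finite order\<close>

lemma mult_mat_vec_index:
  "A \<in> carrier_mat n m \<Longrightarrow> v \<in> carrier_vec m \<Longrightarrow> i < n \<Longrightarrow> (A *\<^sub>v v) $ i = (\<Sum>j<m. A $$ (i, j) * v $ j)"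
  by (auto simp: scalar_prod_def atLeast0LessThan)

text \<open>A finite Fourier formula: for R^m = 1, x^m = 1 and m invertible it is the projection
  onto the eigenspace of x, and it commutes with everything that commutes with
  \<open>R\<close>.\<close>

definition eigenprojection :: "nat \<Rightarrow> nat \<Rightarrow> 'k :: field \<Rightarrow> 'k mat \<Rightarrow> 'k mat" where
  "eigenprojection n m x R = inverse (of_nat m) \<cdot>\<^sub>m msum n n m (\<lambda>k. inverse x ^ k \<cdot>\<^sub>m R ^\<^sub>m k)"

context
  fixes R :: "'k :: field mat" and n m :: nat and x :: 'k
  assumes R: "R \<in> carrier_mat n n" and Rm: "R ^\<^sub>m m = 1\<^sub>m n" and m: "(of_nat m :: 'k) \<noteq> 0"
    and xm: "x ^ m = 1"
begin

lemma eigenprojection_carrier: "eigenprojection n m x R \<in> carrier_mat n n"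
  by (simp add: eigenprojection_def)

lemma eigenprojection_commute:
  assumes T: "T \<in> carrier_mat n n" and TR: "T * R = R * T"
  shows "T * eigenprojection n m x R = eigenprojection n m x R * T"
proof -
  have Tk: "T * R ^\<^sub>m k = R ^\<^sub>m k * T" for k
  proof (induction k)
    case 0
    thus ?case using T R by simp
  next
    case (Suc k)
    have c: "R ^\<^sub>m k \<in> carrier_mat n n" using R by simp
    have "T * (R ^\<^sub>m k * R) = R ^\<^sub>m k * (T * R)"
      using assoc_mult_mat[OF T c R] assoc_mult_mat[OF c T R] Suc by simp
    thus ?case unfolding TR using assoc_mult_mat[OF c R T] by simp
  qed
  have c: "inverse x ^ k \<cdot>\<^sub>m R ^\<^sub>m k \<in> carrier_mat n n" for k using R by simp
  have "T * (inverse x ^ k \<cdot>\<^sub>m R ^\<^sub>m k) = (inverse x ^ k \<cdot>\<^sub>m R ^\<^sub>m k) * T" for k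
    using mult_smult_distrib[OF T pow_carrier_mat[OF R]] mult_smult_assoc_mat[OF pow_carrier_mat[OF R] T] Tk by simp
  thus ?thesis unfolding eigenprojection_def
    using mult_smult_distrib[OF T msum_carrier] mult_smult_assoc_mat[OF msum_carrier T] mult_msum[OF T c] msum_mult[OF T c]
    by simp
qed

lemma eigenprojection_eigenvector:
  assumes v: "v \<in> carrier_vec n" and Rv: "R *\<^sub>v v = x \<cdot>\<^sub>v v"
  shows "eigenprojection n m x R *\<^sub>v v = v"
proof (rule eq_vecI)
  have x0: "x \<noteq> 0" using xm m by (cases m) auto
  have Rk: "R ^\<^sub>m k *\<^sub>v v = x ^ k \<cdot>\<^sub>v v" for k
  proof (induction k)
    case 0
    thus ?case using R v by simp
  next
    case (Suc k)
    have "R ^\<^sub>m Suc k *\<^sub>v v = R ^\<^sub>m k *\<^sub>v (x \<cdot>\<^sub>v v)"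
      using assoc_mult_mat_vec[OF pow_carrier_mat[OF R] R v] Rv by simp
    also have "\<dots> = x \<cdot>\<^sub>v (R ^\<^sub>m k *\<^sub>v v)" by (rule mult_mat_vec[OF pow_carrier_mat[OF R] v])
    finally show ?case using Suc by (simp add: smult_smult_assoc)
  qed
  have inv: "inverse x ^ k * (x ^ k * a) = a" for k a
    using x0 by (simp flip: mult.assoc power_mult_distrib)
  fix i assume "i < dim_vec v"
  hence i: "i < n" using v by simp
  have "(eigenprojection n m x R *\<^sub>v v) $ i = (\<Sum>j<n. \<Sum>k<m. inverse (of_nat m) * (inverse x ^ k * ((R ^\<^sub>m k) $$ (i, j) * v $ j)))"
    unfolding mult_mat_vec_index[OF eigenprojection_carrier v i]
    using i R by (simp add: eigenprojection_def msum_def sum_distrib_left sum_distrib_right mult_ac)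
  also have "\<dots> = (\<Sum>k<m. inverse (of_nat m) * (inverse x ^ k * (R ^\<^sub>m k *\<^sub>v v) $ i))"
    by (subst sum.swap) (simp add: mult_mat_vec_index[OF pow_carrier_mat[OF R] v i] sum_distrib_left del: index_mult_mat_vec)
  also have "\<dots> = (\<Sum>k<m. inverse (of_nat m) * v $ i)"
    unfolding Rk using i v by (simp add: inv)
  also have "\<dots> = v $ i" using m by simp
  finally show "(eigenprojection n m x R *\<^sub>v v) $ i = v $ i" .
qed (simp add: eigenprojection_def msum_def v carrier_vecD[OF v])

lemma eigenprojection_image: "R * eigenprojection n m x R = x \<cdot>\<^sub>m eigenprojection n m x R"
proof (rule eq_matI)
  have x0: "x \<noteq> 0" using xm m by (cases m) auto
  let ?E = "eigenprojection n m x R"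
  fix i j assume "i < dim_row (x \<cdot>\<^sub>m ?E)" "j < dim_col (x \<cdot>\<^sub>m ?E)"
  hence ij: "i < n" "j < n" by (auto simp: eigenprojection_def msum_def)
  let ?f = "\<lambda>k. inverse x ^ k * (R ^\<^sub>m k) $$ (i, j)"
  have c: "inverse x ^ k \<cdot>\<^sub>m R ^\<^sub>m k \<in> carrier_mat n n" for k using R by simp
  have Rk: "R * (inverse x ^ k \<cdot>\<^sub>m R ^\<^sub>m k) = inverse x ^ k \<cdot>\<^sub>m R ^\<^sub>m Suc k" for k
    unfolding mult_smult_distrib[OF R pow_carrier_mat[OF R]] using pow_mat_add[OF R, of 1 k] R by simp
  have "R * ?E = inverse (of_nat m) \<cdot>\<^sub>m msum n n m (\<lambda>k. inverse x ^ k \<cdot>\<^sub>m R ^\<^sub>m Suc k)"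
    unfolding eigenprojection_def mult_smult_distrib[OF R msum_carrier] mult_msum[OF R c] Rk ..
  hence "(R * ?E) $$ (i, j) = inverse (of_nat m) * (\<Sum>k<m. inverse x ^ k * (R ^\<^sub>m Suc k) $$ (i, j))"
    using ij R by (simp add: msum_def)
  also have "(\<Sum>k<m. inverse x ^ k * (R ^\<^sub>m Suc k) $$ (i, j)) = x * (\<Sum>k<m. ?f (Suc k))"
    unfolding sum_distrib_left by (intro sum.cong) (use x0 in auto)
  \<comment> \<open>Multiplication by \<open>R\<close> has shifted the summation index; the boundary
    terms agree since R^m = 1 and x^m = 1.\<close>
  also have "(\<Sum>k<m. ?f (Suc k)) = (\<Sum>k<m. ?f k)"
  proof -
    have "?f 0 + (\<Sum>k<m. ?f (Suc k)) = (\<Sum>k<m. ?f k) + ?f m"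
      using sum.lessThan_Suc_shift[of ?f m] sum.lessThan_Suc[of ?f m] by simp
    moreover have "?f m = ?f 0" using Rm xm R by (simp add: power_inverse)
    ultimately show ?thesis by (simp only: add.commute[of _ "?f 0"] add_left_cancel)
  qed
  finally show "(R * ?E) $$ (i, j) = (x \<cdot>\<^sub>m ?E) $$ (i, j)"
    using ij R by (simp add: eigenprojection_def msum_def)
qed (use R in \<open>auto simp: eigenprojection_def msum_def\<close>)

lemma eigenprojection_idempotent:
  "eigenprojection n m x R * eigenprojection n m x R = eigenprojection n m x R"
proof (rule eq_mat_by_vec[of _ n n])
  let ?E = "eigenprojection n m x R"
  note E = eigenprojection_carrier
  show "?E * ?E \<in> carrier_mat n n" "?E \<in> carrier_mat n n" using E by auto
  fix v :: "'k vec" assume v: "v \<in> carrier_vec n"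
  have Ev: "?E *\<^sub>v v \<in> carrier_vec n" using E v by auto
  have "R *\<^sub>v (?E *\<^sub>v v) = (x \<cdot>\<^sub>m ?E) *\<^sub>v v"
    unfolding eigenprojection_image[symmetric] by (rule assoc_mult_mat_vec[OF R E v, symmetric])
  also have "\<dots> = x \<cdot>\<^sub>v (?E *\<^sub>v v)" using E v by (intro eq_vecI) auto
  finally have "?E *\<^sub>v (?E *\<^sub>v v) = ?E *\<^sub>v v" by (rule eigenprojection_eigenvector[OF Ev])
  thus "?E * ?E *\<^sub>v v = ?E *\<^sub>v v" using assoc_mult_mat_vec[OF E E v] by simp
qed

end

lemma eigenvalue_root_of_unity:
  fixes R :: "'k :: field mat"
  assumes R: "R \<in> carrier_mat n n" and Rm: "R ^\<^sub>m m = 1\<^sub>m n"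
    and v: "v \<in> carrier_vec n" "v \<noteq> 0\<^sub>v n" "R *\<^sub>v v = x \<cdot>\<^sub>v v"
  shows "x ^ m = 1"
proof -
  have Rk: "R ^\<^sub>m k *\<^sub>v v = x ^ k \<cdot>\<^sub>v v" for k
  proof (induction k)
    case 0
    thus ?case using R v by simp
  next
    case (Suc k)
    have "R ^\<^sub>m Suc k *\<^sub>v v = R ^\<^sub>m k *\<^sub>v (x \<cdot>\<^sub>v v)"
      using assoc_mult_mat_vec[OF pow_carrier_mat[OF R] R v(1)] v(3) by simp
    also have "\<dots> = x \<cdot>\<^sub>v (R ^\<^sub>m k *\<^sub>v v)" by (rule mult_mat_vec[OF pow_carrier_mat[OF R] v(1)])
    finally show ?case using Suc by (simp add: smult_smult_assoc)
  qed
  have "v = x ^ m \<cdot>\<^sub>v v" using Rk[of m] v(1) unfolding Rm by simp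
  moreover obtain i where "i < n" "v $ i \<noteq> 0" using v by (metis carrier_vecD eq_vecI index_zero_vec)
  ultimately show ?thesis using v(1) by (metis carrier_vecD index_smult_vec(1) mult_cancel_right1 mult.commute)
qed

text \<open>\<open>B i\<close> and \<open>C i\<close> are the inclusions and projections of a direct
  sum whose summands are indecomposable and eigenspaces of the endomorphism \<open>R\<close>. The
  last clause records the eigenvalues of the action followed by \<open>R\<close>, so that later
  arguments need not return to block matrices.\<close>

definition decomposition ::
  "('g, 'b) monoid_scheme \<Rightarrow> ('g, 'k :: field) gmod \<Rightarrow> 'k mat \<Rightarrow> nat \<Rightarrow> (nat \<Rightarrow> ('g, 'k) gmod) \<Rightarrow>
    (nat \<Rightarrow> 'k mat) \<Rightarrow> (nat \<Rightarrow> 'k mat) \<Rightarrow> (nat \<Rightarrow> 'k) \<Rightarrow> bool" where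
  "decomposition G M R d P B C x \<longleftrightarrow>
     (\<forall>i<d. indecomposable_gmod G (P i) \<and> B i \<in> gmod_hom G (P i) M \<and> C i \<in> gmod_hom G M (P i) \<and>
        R * B i = x i \<cdot>\<^sub>m B i \<and> C i * R = x i \<cdot>\<^sub>m C i) \<and>
     (\<forall>i<d. \<forall>j<d. C i * B j = (if i = j then 1\<^sub>m (fst (P i)) else 0\<^sub>m (fst (P i)) (fst (P j)))) \<and>
     msum (fst M) (fst M) d (\<lambda>i. B i * C i) = 1\<^sub>m (fst M) \<and>
     (\<forall>g\<in>carrier G. evs (snd M g * R) = (\<Sum>i<d. image_mset ((*) (x i)) (evs (snd (P i) g))))"

lemma evs_direct_sum:
  fixes M :: "('g, 'k :: field) gmod"
  assumes D: "direct_sum G M N N' X Y X' Y'" and A: "A \<in> carrier_mat (fst M) (fst M)"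
    and A1: "A1 \<in> carrier_mat (fst N) (fst N)" and A2: "A2 \<in> carrier_mat (fst N') (fst N')"
    and AX: "A * X = X * A1" and AX': "A * X' = X' * A2"
  shows "evs A = evs A1 + evs A2"
proof -
  note d = D[unfolded direct_sum_def] and s = D[unfolded direct_sum_def splitting_def]
  have X: "X \<in> carrier_mat (fst M) (fst N)" and Y: "Y \<in> carrier_mat (fst N) (fst M)"
    and X': "X' \<in> carrier_mat (fst M) (fst N')" and Y': "Y' \<in> carrier_mat (fst N') (fst M)"
    and YX: "Y * X = 1\<^sub>m (fst N)" and YX': "Y' * X' = 1\<^sub>m (fst N')" and Y'X: "Y' * X = 0\<^sub>m (fst N') (fst N)" using s by auto
  have 0: "Y' * (A * X) = 0\<^sub>m (fst N') (fst N)"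
    unfolding AX using assoc_mult_mat[OF Y' X A1] Y'X A1 by simp
  have 1: "Y * (A * X) = A1" unfolding AX by (rule mat_cancel_left[OF YX]) (use X Y A1 in auto)
  have 2: "Y' * (A * X') = A2" unfolding AX' by (rule mat_cancel_left[OF YX']) (use X' Y' A2 in auto)
  have "evs A = evs (Y * (A * X)) + evs (Y' * (A * X'))" by (rule evs_splitting[OF _ A 0]) (use d in blast)
  thus ?thesis unfolding 1 2 .
qed

text \<open>Two sources of an idempotent that commutes with \<open>R\<close> as well: if
  \<open>R\<close> is a scalar, any idempotent endomorphism will do; otherwise an eigenprojection of
  \<open>R\<close>, which is neither 0 nor 1 because it fixes an eigenvector and \<open>R\<close> is
  not a scalar.\<close>

lemma splitting_commuting_endomorphism:
  fixes M :: "('g, 'k :: alg_closed_field) gmod"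
  assumes M: "is_gmod G M" and n: "fst M > 0" and R: "R \<in> gmod_hom G M M"
    and Rm: "R ^\<^sub>m m = 1\<^sub>m (fst M)" and m: "(of_nat m :: 'k) \<noteq> 0"
    and N: "\<not> (indecomposable_gmod G M \<and> (\<exists>x. R = x \<cdot>\<^sub>m 1\<^sub>m (fst M)))"
  obtains E where "E \<in> gmod_hom G M M" "E * E = E" "E * R = R * E" "E \<noteq> 0\<^sub>m (fst M) (fst M)" "E \<noteq> 1\<^sub>m (fst M)"
proof (cases "\<exists>x. R = x \<cdot>\<^sub>m 1\<^sub>m (fst M)")
  case True
  then obtain x where x: "R = x \<cdot>\<^sub>m 1\<^sub>m (fst M)" ..
  obtain E where E: "E \<in> gmod_hom G M M" "E * E = E" "E \<noteq> 0\<^sub>m (fst M) (fst M)" "E \<noteq> 1\<^sub>m (fst M)"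
    using not_indecomposable_idempotent[OF M n] N True by blast
  note cE = hom_carrier[OF E(1)]
  have "E * R = R * E" unfolding x mult_smult_distrib[OF cE one_carrier_mat] mult_smult_assoc_mat[OF one_carrier_mat cE]
    using cE by simp
  thus ?thesis using that E by blast
next
  case False
  let ?n = "fst M"
  note cR = hom_carrier[OF R]
  obtain x v where v: "v \<in> carrier_vec ?n" "v \<noteq> 0\<^sub>v ?n" "R *\<^sub>v v = x \<cdot>\<^sub>v v" by (rule eigenvalue_exists[OF cR n])
  have xm: "x ^ m = 1" by (rule eigenvalue_root_of_unity[OF cR Rm v])
  note ep = cR Rm m xm
  let ?E = "eigenprojection ?n m x R"
  note cE = eigenprojection_carrier[OF ep]
  have E: "?E \<in> gmod_hom G M M"
    using eigenprojection_commute[OF ep gmod_carrier[OF M]] hom_commute[OF R] by (intro homI[OF cE]) auto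
  have ER: "?E * R = R * ?E" using eigenprojection_commute[OF ep cR] by simp
  have Ev: "?E *\<^sub>v v = v" by (rule eigenprojection_eigenvector[OF ep v(1,3)])
  have "?E \<noteq> 0\<^sub>m ?n ?n" using Ev v by auto
  moreover have "?E \<noteq> 1\<^sub>m ?n"
  proof
    assume "?E = 1\<^sub>m ?n"
    hence "R = x \<cdot>\<^sub>m 1\<^sub>m ?n" using eigenprojection_image[OF ep] right_mult_one_mat[OF cR] by simp
    thus False using False by blast
  qed
  ultimately show ?thesis using that[OF E eigenprojection_idempotent[OF ep] ER] by blast
qed

text \<open>The restriction of \<open>R\<close> to a summand cut out by a commuting idempotent. That
  its m-th power is again 1 keeps the induction going.\<close>

lemma retract_endomorphism:
  fixes M :: "('g, 'k :: field) gmod"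
  assumes M: "is_gmod G M" and N: "is_gmod G N" and X: "X \<in> gmod_hom G N M" and Y: "Y \<in> gmod_hom G M N"
    and YX: "Y * X = 1\<^sub>m (fst N)" and R: "R \<in> gmod_hom G M M" and ER: "X * Y * R = R * (X * Y)"
  defines "Q \<equiv> Y * (R * X)"
  shows "Q \<in> gmod_hom G N N" "R * X = X * Q" "Y * R = Q * Y" "R ^\<^sub>m m = 1\<^sub>m (fst M) \<Longrightarrow> Q ^\<^sub>m m = 1\<^sub>m (fst N)"
proof -
  note c = hom_carrier[OF X] hom_carrier[OF Y] hom_carrier[OF R]
  show Q: "Q \<in> gmod_hom G N N" unfolding Q_def by (intro hom_comp[OF N M N _ Y] hom_comp[OF N M M X R])
  note cQ = hom_carrier[OF Q]
  have "X * Q = X * Y * R * X" unfolding Q_def using c by (simp add: mat_assoc)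
  also have "\<dots> = R * (X * (Y * X))" unfolding ER using c by (simp add: mat_assoc)
  also have "\<dots> = R * X" unfolding YX right_mult_one_mat[OF c(1)] ..
  finally show RX: "R * X = X * Q" ..
  have "Q * Y = Y * (R * (X * Y))" unfolding Q_def using c by (simp add: mat_assoc)
  also have "\<dots> = Y * X * (Y * R)" unfolding ER[symmetric] using c by (simp add: mat_assoc)
  also have "\<dots> = Y * R" unfolding YX by (rule left_mult_one_mat) (use c in auto)
  finally show "Y * R = Q * Y" ..
  assume Rm: "R ^\<^sub>m m = 1\<^sub>m (fst M)"
  have "R ^\<^sub>m k * X = X * Q ^\<^sub>m k" for k
  proof (induction k)
    case 0
    thus ?case using c cQ by simp
  next
    case (Suc k)
    note p = pow_carrier_mat[OF c(3), of k] pow_carrier_mat[OF cQ, of k]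
    have "R ^\<^sub>m Suc k * X = R ^\<^sub>m k * (X * Q)" using assoc_mult_mat[OF p(1) c(3,1)] RX by simp
    also have "\<dots> = X * Q ^\<^sub>m k * Q" using assoc_mult_mat[OF p(1) c(1) cQ] Suc by simp
    finally show ?case using assoc_mult_mat[OF c(1) p(2) cQ] by simp
  qed
  from this[of m] have "X * Q ^\<^sub>m m = X" unfolding Rm using c by simp
  moreover have "Y * (X * Q ^\<^sub>m m) = Q ^\<^sub>m m" by (rule mat_cancel_left[OF YX]) (use c cQ in auto)
  ultimately show "Q ^\<^sub>m m = 1\<^sub>m (fst N)" using YX by simp
qed

text \<open>The summands of \<open>N'\<close> are appended after the d summands of \<open>N\<close>,
  hence the index shift by d; mixed products vanish because \<open>Y * X'\<close> and
  \<open>Y' * X\<close> do.\<close>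

lemma decomposition_direct_sum:
  fixes M :: "('g, 'k :: alg_closed_field) gmod"
  assumes M: "is_gmod G M" and D: "direct_sum G M N N' X Y X' Y'" and R: "R \<in> gmod_hom G M M"
    and Q: "Q \<in> gmod_hom G N N" "R * X = X * Q" "Y * R = Q * Y"
    and Q': "Q' \<in> gmod_hom G N' N'" "R * X' = X' * Q'" "Y' * R = Q' * Y'"
    and dec: "decomposition G N Q d P B C x" and dec': "decomposition G N' Q' d' P' B' C' x'"
  shows "decomposition G M R (d + d') (\<lambda>i. if i < d then P i else P' (i - d))
    (\<lambda>i. if i < d then X * B i else X' * B' (i - d)) (\<lambda>i. if i < d then C i * Y else C' (i - d) * Y')
    (\<lambda>i. if i < d then x i else x' (i - d))"
proof -
  note s = D[unfolded direct_sum_def splitting_def]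
  have N: "is_gmod G N" and N': "is_gmod G N'" and X: "X \<in> gmod_hom G N M" and Y: "Y \<in> gmod_hom G M N"
    and X': "X' \<in> gmod_hom G N' M" and Y': "Y' \<in> gmod_hom G M N'"
    and YX: "Y * X = 1\<^sub>m (fst N)" and YX': "Y' * X' = 1\<^sub>m (fst N')" and 0: "Y * X' = 0\<^sub>m (fst N) (fst N')" "Y' * X = 0\<^sub>m (fst N') (fst N)"
    and sum: "X * Y + X' * Y' = 1\<^sub>m (fst M)" using s by auto
  note cX = hom_carrier[OF X] and cY = hom_carrier[OF Y] and cX' = hom_carrier[OF X'] and cY' = hom_carrier[OF Y']
    and cR = hom_carrier[OF R] and cQ = hom_carrier[OF Q(1)] and cQ' = hom_carrier[OF Q'(1)]
  note e = dec[unfolded decomposition_def] and e' = dec'[unfolded decomposition_def]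
  have P: "indecomposable_gmod G (P i)" and B: "B i \<in> gmod_hom G (P i) N" and C: "C i \<in> gmod_hom G N (P i)"
    and QB: "Q * B i = x i \<cdot>\<^sub>m B i" and CQ: "C i * Q = x i \<cdot>\<^sub>m C i" if "i < d" for i using e that by auto
  have P': "indecomposable_gmod G (P' i)" and B': "B' i \<in> gmod_hom G (P' i) N'" and C': "C' i \<in> gmod_hom G N' (P' i)"
    and QB': "Q' * B' i = x' i \<cdot>\<^sub>m B' i" and CQ': "C' i * Q' = x' i \<cdot>\<^sub>m C' i" if "i < d'" for i using e' that by auto
  have 1: "X * B i \<in> gmod_hom G (P i) M \<and> C i * Y \<in> gmod_hom G M (P i) \<and>
      R * (X * B i) = x i \<cdot>\<^sub>m (X * B i) \<and> C i * Y * R = x i \<cdot>\<^sub>m (C i * Y)" if i: "i < d" for i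
  proof (intro conjI)
    note Pi = indecomposableD(1)[OF P[OF i]] and cB = hom_carrier[OF B[OF i]] and cC = hom_carrier[OF C[OF i]]
    show "X * B i \<in> gmod_hom G (P i) M" by (rule hom_comp[OF Pi N M B[OF i] X])
    show "C i * Y \<in> gmod_hom G M (P i)" by (rule hom_comp[OF M N Pi Y C[OF i]])
    show "R * (X * B i) = x i \<cdot>\<^sub>m (X * B i)"
      using assoc_mult_mat[OF cR cX cB] assoc_mult_mat[OF cX cQ cB] Q(2) QB[OF i] mult_smult_distrib[OF cX cB] by simp
    show "C i * Y * R = x i \<cdot>\<^sub>m (C i * Y)"
      using assoc_mult_mat[OF cC cY cR] assoc_mult_mat[OF cC cQ cY] Q(3) CQ[OF i] mult_smult_assoc_mat[OF cC cY] by simp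
  qed
  have 2: "X' * B' i \<in> gmod_hom G (P' i) M \<and> C' i * Y' \<in> gmod_hom G M (P' i) \<and>
      R * (X' * B' i) = x' i \<cdot>\<^sub>m (X' * B' i) \<and> C' i * Y' * R = x' i \<cdot>\<^sub>m (C' i * Y')" if i: "i < d'" for i
  proof (intro conjI)
    note Pi = indecomposableD(1)[OF P'[OF i]] and cB = hom_carrier[OF B'[OF i]] and cC = hom_carrier[OF C'[OF i]]
    show "X' * B' i \<in> gmod_hom G (P' i) M" by (rule hom_comp[OF Pi N' M B'[OF i] X'])
    show "C' i * Y' \<in> gmod_hom G M (P' i)" by (rule hom_comp[OF M N' Pi Y' C'[OF i]])
    show "R * (X' * B' i) = x' i \<cdot>\<^sub>m (X' * B' i)"
      using assoc_mult_mat[OF cR cX' cB] assoc_mult_mat[OF cX' cQ' cB] Q'(2) QB'[OF i] mult_smult_distrib[OF cX' cB] by simp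
    show "C' i * Y' * R = x' i \<cdot>\<^sub>m (C' i * Y')"
      using assoc_mult_mat[OF cC cY' cR] assoc_mult_mat[OF cC cQ' cY'] Q'(3) CQ'[OF i] mult_smult_assoc_mat[OF cC cY'] by simp
  qed
  have 3: "C i * Y * (X * B j) = (if i = j then 1\<^sub>m (fst (P i)) else 0\<^sub>m (fst (P i)) (fst (P j)))" if i: "i < d" "j < d" for i j
  proof -
    note cB = hom_carrier[OF B[OF i(2)]] and cC = hom_carrier[OF C[OF i(1)]]
    have "C i * Y * (X * B j) = C i * (Y * (X * B j))" by (rule assoc_mult_mat[OF cC cY mult_carrier_mat[OF cX cB]])
    also have "Y * (X * B j) = B j" by (rule mat_cancel_left[OF YX]) (use cX cY cB in auto)
    finally show ?thesis using e i by simp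
  qed
  have 4: "C' i * Y' * (X' * B' j) = (if i = j then 1\<^sub>m (fst (P' i)) else 0\<^sub>m (fst (P' i)) (fst (P' j)))" if i: "i < d'" "j < d'" for i j
  proof -
    note cB = hom_carrier[OF B'[OF i(2)]] and cC = hom_carrier[OF C'[OF i(1)]]
    have "C' i * Y' * (X' * B' j) = C' i * (Y' * (X' * B' j))" by (rule assoc_mult_mat[OF cC cY' mult_carrier_mat[OF cX' cB]])
    also have "Y' * (X' * B' j) = B' j" by (rule mat_cancel_left[OF YX']) (use cX' cY' cB in auto)
    finally show ?thesis using e' i by simp
  qed
  have 5: "C i * Y * (X' * B' j) = 0\<^sub>m (fst (P i)) (fst (P' j))" if i: "i < d" "j < d'" for i j
  proof -
    note cB = hom_carrier[OF B'[OF i(2)]] and cC = hom_carrier[OF C[OF i(1)]]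
    have "C i * Y * (X' * B' j) = C i * (Y * X' * B' j)"
      using assoc_mult_mat[OF cC cY mult_carrier_mat[OF cX' cB]] assoc_mult_mat[OF cY cX' cB] by simp
    thus ?thesis unfolding 0 using cB cC by simp
  qed
  have 6: "C' i * Y' * (X * B j) = 0\<^sub>m (fst (P' i)) (fst (P j))" if i: "i < d'" "j < d" for i j
  proof -
    note cB = hom_carrier[OF B[OF i(2)]] and cC = hom_carrier[OF C'[OF i(1)]]
    have "C' i * Y' * (X * B j) = C' i * (Y' * X * B j)"
      using assoc_mult_mat[OF cC cY' mult_carrier_mat[OF cX cB]] assoc_mult_mat[OF cY' cX cB] by simp
    thus ?thesis unfolding 0 using cB cC by simp
  qed
  have 7: "msum (fst M) (fst M) d (\<lambda>i. X * B i * (C i * Y)) = X * Y"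
  proof -
    have "msum (fst M) (fst M) d (\<lambda>i. X * B i * (C i * Y)) = msum (fst M) (fst M) d (\<lambda>i. X * (B i * C i * Y))"
    proof (rule msum_cong)
      fix i assume i: "i < d"
      note cB = hom_carrier[OF B[OF i]] and cC = hom_carrier[OF C[OF i]]
      show "X * B i * (C i * Y) = X * (B i * C i * Y)" using cX cB cC cY by (simp add: mat_assoc)
    qed
    also have "\<dots> = X * (msum (fst N) (fst N) d (\<lambda>i. B i * C i) * Y)"
      by (rule mult_msum_mult[OF cX cY, symmetric]) (rule mult_carrier_mat[OF hom_carrier[OF B] hom_carrier[OF C]])
    finally show ?thesis using e cY by simp
  qed
  have 8: "msum (fst M) (fst M) d' (\<lambda>i. X' * B' i * (C' i * Y')) = X' * Y'"
  proof -
    have "msum (fst M) (fst M) d' (\<lambda>i. X' * B' i * (C' i * Y')) = msum (fst M) (fst M) d' (\<lambda>i. X' * (B' i * C' i * Y'))"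
    proof (rule msum_cong)
      fix i assume i: "i < d'"
      note cB = hom_carrier[OF B'[OF i]] and cC = hom_carrier[OF C'[OF i]]
      show "X' * B' i * (C' i * Y') = X' * (B' i * C' i * Y')" using cX' cB cC cY' by (simp add: mat_assoc)
    qed
    also have "\<dots> = X' * (msum (fst N') (fst N') d' (\<lambda>i. B' i * C' i) * Y')"
      by (rule mult_msum_mult[OF cX' cY', symmetric]) (rule mult_carrier_mat[OF hom_carrier[OF B'] hom_carrier[OF C']])
    finally show ?thesis using e' cY' by simp
  qed
  have 9: "evs (snd M g * R) = (\<Sum>i<d. image_mset ((*) (x i)) (evs (snd (P i) g))) +
      (\<Sum>i<d'. image_mset ((*) (x' i)) (evs (snd (P' i) g)))" if g: "g \<in> carrier G" for g
  proof -
    note A = gmod_carrier[OF M g] and AN = gmod_carrier[OF N g] and AN' = gmod_carrier[OF N' g]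
    have "evs (snd M g * R) = evs (snd N g * Q) + evs (snd N' g * Q')"
    proof (rule evs_direct_sum[OF D])
      show "snd M g * R * X = X * (snd N g * Q)"
        using assoc_mult_mat[OF A cR cX] assoc_mult_mat[OF A cX cQ] assoc_mult_mat[OF cX AN cQ] Q(2) hom_commute[OF X g] by simp
      show "snd M g * R * X' = X' * (snd N' g * Q')"
        using assoc_mult_mat[OF A cR cX'] assoc_mult_mat[OF A cX' cQ'] assoc_mult_mat[OF cX' AN' cQ'] Q'(2) hom_commute[OF X' g] by simp
    qed (use A AN AN' cR cQ cQ' in auto)
    thus ?thesis using e e' g by simp
  qed
  show ?thesis
    unfolding decomposition_def
  proof (intro conjI allI impI ballI)
    fix i assume i: "i < d + d'"
    show "indecomposable_gmod G (if i < d then P i else P' (i - d))" using P P' i by auto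
  next
    fix i j assume "i < d + d'" "j < d + d'"
    thus "(if i < d then C i * Y else C' (i - d) * Y') * (if j < d then X * B j else X' * B' (j - d)) =
      (if i = j then 1\<^sub>m (fst (if i < d then P i else P' (i - d)))
        else 0\<^sub>m (fst (if i < d then P i else P' (i - d))) (fst (if j < d then P j else P' (j - d))))"
      using 3 4 5 6 by (cases "i < d"; cases "j < d") auto
  next
    show "msum (fst M) (fst M) (d + d') (\<lambda>i. (if i < d then X * B i else X' * B' (i - d)) * (if i < d then C i * Y else C' (i - d) * Y')) = 1\<^sub>m (fst M)"
      using 7 8 sum by (simp add: msum_add cong: msum_cong)
  next
    fix g assume "g \<in> carrier G"
    from 9[OF this] show "evs (snd M g * R) = (\<Sum>i<d + d'. image_mset ((*) (if i < d then x i else x' (i - d))) (evs (snd (if i < d then P i else P' (i - d)) g)))"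
      by (simp add: sum_lessThan_add)
  qed (use 1 2 in auto)
qed

text \<open>Induction on the dimension: as long as the module decomposes or \<open>R\<close> is not
  a scalar, an idempotent commuting with \<open>R\<close> cuts it into two proper summands stable
  under \<open>R\<close>. The invertibility of m in the field enters through the
  eigenprojections.\<close>

theorem decomposition_exists:
  fixes M :: "('g, 'k :: alg_closed_field) gmod"
  assumes "is_gmod G M" "R \<in> gmod_hom G M M" "R ^\<^sub>m m = 1\<^sub>m (fst M)" and m: "(of_nat m :: 'k) \<noteq> 0"
  shows "\<exists>d P B C x. decomposition G M R d P B C x"
  using assms(1-3)
proof (induction "fst M" arbitrary: M R rule: less_induct)
  case less
  note M = less.prems(1) and R = less.prems(2) and Rm = less.prems(3) and cR = hom_carrier[OF less.prems(2)]
  consider "fst M = 0" | "fst M > 0" "indecomposable_gmod G M \<and> (\<exists>x. R = x \<cdot>\<^sub>m 1\<^sub>m (fst M))"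
    | "fst M > 0" "\<not> (indecomposable_gmod G M \<and> (\<exists>x. R = x \<cdot>\<^sub>m 1\<^sub>m (fst M)))" by blast
  thus ?case
  proof cases
    case 1
    have "evs (snd M g * R) = {#}" if "g \<in> carrier G" for g
      using size_evs[OF mult_carrier_mat[OF gmod_carrier[OF M that] cR]] 1 by simp
    \<comment> \<open>The zero module has no summands at all, since indecomposable modules are
      nonzero.\<close>
    hence "decomposition G M R 0 (\<lambda>_. M) (\<lambda>_. R) (\<lambda>_. R) (\<lambda>_. 0)"
      using 1 by (auto simp: decomposition_def msum_def intro!: eq_matI)
    thus ?thesis by blast
  next
    case 2
    then obtain x where x: "R = x \<cdot>\<^sub>m 1\<^sub>m (fst M)" by blast
    have "evs (snd M g * R) = image_mset ((*) x) (evs (snd M g))" if "g \<in> carrier G" for g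
      unfolding x mult_smult_distrib[OF gmod_carrier[OF M that] one_carrier_mat] right_mult_one_mat[OF gmod_carrier[OF M that]]
      by (rule evs_smult[OF gmod_carrier[OF M that]])
    hence "decomposition G M R 1 (\<lambda>_. M) (\<lambda>_. 1\<^sub>m (fst M)) (\<lambda>_. 1\<^sub>m (fst M)) (\<lambda>_. x)"
      using 2 hom_id[OF M] x cR by (auto simp: decomposition_def msum_def intro!: eq_matI)
    thus ?thesis by blast
  next
    case 3
    obtain E where E: "E \<in> gmod_hom G M M" "E * E = E" "E * R = R * E" "E \<noteq> 0\<^sub>m (fst M) (fst M)" "E \<noteq> 1\<^sub>m (fst M)"
      by (rule splitting_commuting_endomorphism[OF M 3(1) R Rm m 3(2)])
    obtain N N' X Y X' Y' where D: "direct_sum G M N N' X Y X' Y'" "E = X * Y"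
      by (rule idempotent_direct_sum[OF M E(1,2)])
    note small = nontrivial_direct_sum[OF D(1), folded D(2), OF E(4,5)]
    note d = D(1)[unfolded direct_sum_def splitting_def]
    have N: "is_gmod G N" and N': "is_gmod G N'" and X: "X \<in> gmod_hom G N M" and Y: "Y \<in> gmod_hom G M N"
      and X': "X' \<in> gmod_hom G N' M" and Y': "Y' \<in> gmod_hom G M N'"
      and YX: "Y * X = 1\<^sub>m (fst N)" and YX': "Y' * X' = 1\<^sub>m (fst N')" and sum: "X * Y + X' * Y' = 1\<^sub>m (fst M)"
      using d by auto
    note c = hom_carrier[OF X] hom_carrier[OF Y] hom_carrier[OF X'] hom_carrier[OF Y']
    have cE: "X * Y \<in> carrier_mat (fst M) (fst M)" using c by auto
    have E': "X' * Y' = 1\<^sub>m (fst M) - X * Y"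
      unfolding sum[symmetric] using c by (intro eq_matI) auto
    have ER: "X * Y * R = R * (X * Y)" using E(3) D(2) by simp
    have ER': "X' * Y' * R = R * (X' * Y')"
      unfolding E' minus_mult_distrib_mat[OF one_carrier_mat cE cR] mult_minus_distrib_mat[OF cR one_carrier_mat cE] ER
      using cR by simp
    note q = retract_endomorphism[OF M N X Y YX R ER] and q' = retract_endomorphism[OF M N' X' Y' YX' R ER']
    obtain d P B C x where "decomposition G N (Y * (R * X)) d P B C x"
      using less.hyps[OF small(1) N q(1) q(4)[OF Rm]] by blast
    moreover obtain d' P' B' C' x' where "decomposition G N' (Y' * (R * X')) d' P' B' C' x'"
      using less.hyps[OF small(2) N' q'(1) q'(4)[OF Rm]] by blast
    ultimately show ?thesis using decomposition_direct_sum[OF M D(1) R q(1-3) q'(1-3)] by blast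
  qed
qed

section \<open>Brauer lifts and permutation matrices\<close>

lemma of_nat_eq_0_iff_coprime:
  assumes "CHAR('k :: field) > 0"
  shows "(of_nat n :: 'k) \<noteq> 0 \<longleftrightarrow> coprime n CHAR('k)"
proof -
  have "prime CHAR('k)" using assms prime_CHAR_semidom by blast
  thus ?thesis unfolding of_nat_eq_0_iff_char_dvd
    by (metis coprime_commute not_prime_unit prime_imp_coprime coprime_absorb_left)
qed

locale brauer =
  fixes \<theta> :: "'k :: alg_closed_field \<Rightarrow> complex"
  assumes lift: "brauer_lift \<theta>" and char_pos: "CHAR('k) > 0"
begin

lemma lift_bij: "bij_betw \<theta> {x. \<exists>n>0. x ^ n = 1} {z. \<exists>n>0. coprime n CHAR('k) \<and> z ^ n = 1}"
  using lift by (simp add: brauer_lift_def)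

lemma lift_mult:
  assumes "x ^ n = 1" "n > 0" "y ^ m = 1" "m > 0"
  shows "\<theta> (x * y) = \<theta> x * \<theta> y"
  using lift assms unfolding brauer_lift_def by blast

lemma lift_inj: "x ^ n = 1 \<Longrightarrow> n > 0 \<Longrightarrow> y ^ m = 1 \<Longrightarrow> m > 0 \<Longrightarrow> \<theta> x = \<theta> y \<Longrightarrow> x = y"
  using lift_bij unfolding bij_betw_def inj_on_def by blast

lemma lift_root: "x ^ n = 1 \<Longrightarrow> n > 0 \<Longrightarrow> \<exists>m>0. coprime m CHAR('k) \<and> \<theta> x ^ m = 1"
  using lift_bij unfolding bij_betw_def by blast

lemma lift_one [simp]: "\<theta> 1 = 1"
proof -
  have "\<theta> 1 = \<theta> 1 * \<theta> 1" using lift_mult[of 1 1 1 1] by simp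
  moreover have "\<theta> 1 \<noteq> 0" using lift_root[of 1 1] by (auto simp: zero_power)
  ultimately show ?thesis by simp
qed

lemma lift_power: "x ^ n = 1 \<Longrightarrow> n > 0 \<Longrightarrow> \<theta> (x ^ k) = \<theta> x ^ k"
proof (induction k)
  case (Suc k)
  have "(x ^ k) ^ n = 1" using Suc.prems by (metis power_commutes power_mult power_one mult.commute)
  thus ?case using lift_mult[of x n "x ^ k" n] Suc by simp
qed simp

lemma lift_power_eq_1: "x ^ n = 1 \<Longrightarrow> n > 0 \<Longrightarrow> \<theta> x ^ n = 1"
  using lift_power[of x n n] by simp

lemma norm_lift:
  assumes "x ^ n = 1" "n > 0"
  shows "norm (\<theta> x) = 1"
proof -
  have "norm (\<theta> x) ^ n = 1 ^ n" using lift_power_eq_1[OF assms] by (simp flip: norm_power)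
  thus ?thesis by (rule power_eq_imp_eq_base) (use assms in auto)
qed

lemma lift_inverse:
  assumes "x ^ n = 1" "n > 0"
  shows "\<theta> (inverse x) = cnj (\<theta> x)"
proof -
  have "x \<noteq> 0" using assms by (auto simp: zero_power)
  hence "\<theta> x * \<theta> (inverse x) = 1"
    using lift_mult[OF assms, of "inverse x" n] assms by (simp add: power_inverse)
  moreover have "\<theta> x * cnj (\<theta> x) = 1" using norm_lift[OF assms] by (simp add: complex_norm_square[symmetric])
  moreover have "\<theta> x \<noteq> 0" using norm_lift[OF assms] by auto
  ultimately show ?thesis by (metis mult_left_cancel)
qed

text \<open>A complex l-th root of unity is the lift of some x, and the lift of x^l equals that of
  1; injectivity gives x^l = 1.\<close>

lemma lift_bij_roots:
  assumes l: "coprime l CHAR('k)" "l > 0"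
  shows "bij_betw \<theta> {x. x ^ l = 1} {z. z ^ l = 1}"
  unfolding bij_betw_def
proof (intro conjI equalityI subsetI)
  show "inj_on \<theta> {x. x ^ l = 1}" using lift_inj l by (intro inj_onI) blast
  fix z :: complex assume z: "z \<in> {z. z ^ l = 1}"
  hence "z \<in> {z. \<exists>n>0. coprime n CHAR('k) \<and> z ^ n = 1}" using l by blast
  hence "z \<in> \<theta> ` {x. \<exists>n>0. x ^ n = 1}" using lift_bij unfolding bij_betw_def by blast
  then obtain x n where x: "x ^ n = 1" "n > 0" "\<theta> x = z" by blast
  have "(x ^ l) ^ n = 1" using x by (metis power_mult power_one mult.commute)
  moreover have "\<theta> (x ^ l) = \<theta> 1" using lift_power[OF x(1,2), of l] x(3) z by simp
  ultimately have "x ^ l = 1" using lift_inj[of "x ^ l" n 1 1] x(2) by simp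
  thus "z \<in> \<theta> ` {x. x ^ l = 1}" using x(3) by blast
qed (use l lift_power_eq_1 in auto)

lemma card_roots: "coprime l CHAR('k) \<Longrightarrow> l > 0 \<Longrightarrow> card {x :: 'k. x ^ l = 1} = l"
  using bij_betw_same_card[OF lift_bij_roots] card_roots_unity_eq by simp

text \<open>The reason why only orbits of length 1 contribute to the Brauer trace of a
  permutation.\<close>

lemma sum_lift_roots:
  assumes "coprime l CHAR('k)" "l > 0"
  shows "(\<Sum>x | x ^ l = 1. \<theta> x) = (if l = 1 then 1 else 0)"
proof -
  have "(\<Sum>x | x ^ l = 1. \<theta> x) = (\<Sum>z | z ^ l = 1. z)"
    by (rule sum.reindex_bij_betw[OF lift_bij_roots[OF assms]])
  thus ?thesis using sum_roots_unity[of l] assms by (cases "l = 1") auto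
qed

text \<open>The Brauer character as a function of a matrix. It is also applied to the maps that take
  x to g^{-1} x c on kG, which are not given by the action of a single group element.\<close>

definition bt :: "'k mat \<Rightarrow> complex" where
  "bt A = (\<Sum>x\<in>#evs A. \<theta> x)"

end

section \<open>Orbits of a permutation and its Brauer trace\<close>

definition perm_mat :: "nat \<Rightarrow> (nat \<Rightarrow> nat) \<Rightarrow> 'a :: {zero,one} mat" where
  "perm_mat n \<sigma> = mat n n (\<lambda>(i, j). if i = \<sigma> j then 1 else 0)"

lemma perm_mat_carrier [simp]: "perm_mat n \<sigma> \<in> carrier_mat n n"
  by (simp add: perm_mat_def)

lemma mult_perm_mat:
  fixes A :: "'a :: semiring_1 mat"
  assumes "A \<in> carrier_mat a n" "i < a" "j < n" "\<sigma> j < n"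
  shows "(A * perm_mat n \<sigma>) $$ (i, j) = A $$ (i, \<sigma> j)"
  using assms by (auto simp: perm_mat_def scalar_prod_def if_distrib[of "\<lambda>x. _ * x"] cong: if_cong)

text \<open>The orbits of a permutation of {..<n}: each orbit is represented by its least element, and an element is
  addressed by its distance from there.\<close>

locale finite_order_map =
  fixes n m :: nat and \<sigma> :: "nat \<Rightarrow> nat"
  assumes map: "\<And>i. i < n \<Longrightarrow> \<sigma> i < n" and order: "\<And>i. i < n \<Longrightarrow> (\<sigma> ^^ m) i = i" and m: "m > 0"
begin

definition rep :: "nat \<Rightarrow> nat" where "rep i = (LEAST r. \<exists>k. (\<sigma> ^^ k) i = r)"
definition len :: "nat \<Rightarrow> nat" where "len i = (LEAST l. l > 0 \<and> (\<sigma> ^^ l) i = i)"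
definition pos :: "nat \<Rightarrow> nat" where "pos i = (LEAST k. (\<sigma> ^^ k) (rep i) = i)"

lemma funpow_less: "i < n \<Longrightarrow> (\<sigma> ^^ k) i < n"
  by (induction k) (auto intro: map)

lemma len: assumes "i < n" shows "len i > 0" "(\<sigma> ^^ len i) i = i"
  using LeastI[of "\<lambda>l. l > 0 \<and> (\<sigma> ^^ l) i = i" m] order[OF assms] m unfolding len_def by auto

lemma len_le: "l > 0 \<Longrightarrow> (\<sigma> ^^ l) i = i \<Longrightarrow> len i \<le> l"
  unfolding len_def by (rule Least_le) auto

lemma funpow_mod_len: assumes "i < n" shows "(\<sigma> ^^ k) i = (\<sigma> ^^ (k mod len i)) i"
  using funpow_mod_eq[OF len(2)[OF assms], of k] by simp

lemma len_dvd: assumes i: "i < n" and k: "(\<sigma> ^^ k) i = i" shows "len i dvd k"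
proof (rule ccontr)
  assume "\<not> len i dvd k"
  hence "k mod len i > 0" by (simp add: dvd_eq_mod_eq_0)
  moreover have "(\<sigma> ^^ (k mod len i)) i = i" using funpow_mod_len[OF i] k by simp
  ultimately have "len i \<le> k mod len i" by (rule len_le)
  moreover have "k mod len i < len i" using len(1)[OF i] by simp
  ultimately show False by linarith
qed

lemma rep_funpow: assumes "i < n" shows "\<exists>k. (\<sigma> ^^ k) i = rep i"
  unfolding rep_def by (rule LeastI[of _ i]) (auto intro: exI[of _ 0])

lemma rep_orbit: assumes i: "i < n" shows "rep ((\<sigma> ^^ k) i) = rep i"
proof -
  have "(\<exists>l. (\<sigma> ^^ l) ((\<sigma> ^^ k) i) = r) \<longleftrightarrow> (\<exists>l. (\<sigma> ^^ l) i = r)" for r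
  proof
    assume "\<exists>l. (\<sigma> ^^ l) i = r"
    then obtain l where l: "(\<sigma> ^^ l) i = r" ..
    \<comment> \<open>Since the m-th iterate is the identity, the k-th iterate is undone by the
      iterate with exponent k * m - k.\<close>
    have km: "k \<le> k * m" using m by simp
    have "(\<sigma> ^^ (k * m)) i = i"
      using order[OF i] by (metis dvd_triv_right funpow_0 funpow_mod_eq mod_mult_self2_is_0)
    hence "(\<sigma> ^^ (l + (k * m - k))) ((\<sigma> ^^ k) i) = r"
      using l km by (metis (no_types, lifting) add.assoc funpow_add comp_apply le_add_diff_inverse2)
    thus "\<exists>l. (\<sigma> ^^ l) ((\<sigma> ^^ k) i) = r" ..
  qed (metis comp_apply funpow_add)
  thus ?thesis by (simp add: rep_def)
qed

lemma rep_less: "i < n \<Longrightarrow> rep i < n"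
  using rep_funpow funpow_less by metis

lemma rep_rep: "i < n \<Longrightarrow> rep (rep i) = rep i"
  using rep_funpow rep_orbit by metis

lemma pos_funpow: assumes i: "i < n" shows "(\<sigma> ^^ pos i) (rep i) = i"
proof -
  obtain k where k: "(\<sigma> ^^ k) i = rep i" using rep_funpow[OF i] by blast
  have km: "k \<le> k * m" using m by simp
  have "(\<sigma> ^^ (k * m)) i = i"
    using order[OF i] by (metis dvd_triv_right funpow_0 funpow_mod_eq mod_mult_self2_is_0)
  hence "(\<sigma> ^^ (k * m - k)) (rep i) = i"
    using k km by (metis comp_apply funpow_add le_add_diff_inverse2)
  thus ?thesis unfolding pos_def by (rule LeastI)
qed

lemma pos_less: assumes i: "i < n" shows "pos i < len (rep i)"
proof -
  have "(\<sigma> ^^ (pos i mod len (rep i))) (rep i) = i"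
    using pos_funpow[OF i] funpow_mod_len[OF rep_less[OF i], of "pos i"] by simp
  hence "pos i \<le> pos i mod len (rep i)" unfolding pos_def by (rule Least_le)
  moreover have "pos i mod len (rep i) < len (rep i)" using len(1)[OF rep_less[OF i]] by simp
  ultimately show ?thesis by linarith
qed

text \<open>If the least distance were smaller than k, walking from i the rest of the orbit would
  return to the representative after fewer than \<open>len\<close> steps in total.\<close>

lemma pos_unique: assumes i: "i < n" and k: "k < len (rep i)" "(\<sigma> ^^ k) (rep i) = i" shows "pos i = k"
proof (rule ccontr)
  assume ne: "pos i \<noteq> k"
  have le: "pos i \<le> k" unfolding pos_def by (rule Least_le) (fact k)
  let ?r = "rep i" and ?l = "len (rep i)"
  have "(\<sigma> ^^ (?l - k + pos i)) ?r = (\<sigma> ^^ (?l - k)) ((\<sigma> ^^ k) ?r)"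
    unfolding funpow_add comp_apply pos_funpow[OF i] k(2) ..
  also have "\<dots> = (\<sigma> ^^ ?l) ?r" using k(1) by (metis comp_apply funpow_add le_add_diff_inverse2 less_imp_le_nat)
  also have "\<dots> = ?r" by (rule len(2)[OF rep_less[OF i]])
  finally have "?l \<le> ?l - k + pos i" using k by (intro len_le) auto
  thus False using le ne k by linarith
qed

lemma pos_step: assumes i: "i < n" shows "pos (\<sigma> i) = Suc (pos i) mod len (rep i)"
proof (rule pos_unique[OF map[OF i]])
  have r: "rep (\<sigma> i) = rep i" using rep_orbit[OF i, of 1] by simp
  show "Suc (pos i) mod len (rep i) < len (rep (\<sigma> i))" using len(1)[OF rep_less[OF i]] r by simp
  have "(\<sigma> ^^ (Suc (pos i) mod len (rep i))) (rep i) = (\<sigma> ^^ Suc (pos i)) (rep i)"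
    by (rule funpow_mod_len[OF rep_less[OF i], symmetric])
  thus "(\<sigma> ^^ (Suc (pos i) mod len (rep i))) (rep (\<sigma> i)) = \<sigma> i" using pos_funpow[OF i] r by simp
qed

lemma pos_bij: assumes r: "r < n" "rep r = r" shows "bij_betw pos {i. i < n \<and> rep i = r} {..<len r}"
proof (rule bij_betw_byWitness[where f' = "\<lambda>k. (\<sigma> ^^ k) r"])
  show "\<forall>a\<in>{i. i < n \<and> rep i = r}. (\<sigma> ^^ pos a) r = a" using pos_funpow by auto
  show "\<forall>k\<in>{..<len r}. pos ((\<sigma> ^^ k) r) = k"
    using pos_unique[OF funpow_less[OF r(1)]] rep_orbit[OF r(1)] r(2) by auto
  show "pos ` {i. i < n \<and> rep i = r} \<subseteq> {..<len r}" using pos_less by auto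
  show "(\<lambda>k. (\<sigma> ^^ k) r) ` {..<len r} \<subseteq> {i. i < n \<and> rep i = r}"
    using funpow_less[OF r(1)] rep_orbit[OF r(1)] r(2) by auto
qed

lemma len_eq_1_iff: assumes "i < n" shows "len i = 1 \<longleftrightarrow> \<sigma> i = i"
  using len[OF assms] len_le[of 1 i] by (auto simp: le_Suc_eq)

end

context brauer
begin

text \<open>A discrete Fourier transform on each orbit diagonalizes a permutation matrix; an orbit with l elements contributes all l-th roots
  of unity, whose lifts have sum 0 unless l = 1.\<close>

lemma bt_perm_mat:
  assumes map: "\<And>i. i < n \<Longrightarrow> \<sigma> i < n" and order: "\<And>i. i < n \<Longrightarrow> (\<sigma> ^^ m) i = i"
    and m: "m > 0" "coprime m CHAR('k)"
  shows "bt (perm_mat n \<sigma>) = of_nat (card {i. i < n \<and> \<sigma> i = i})"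
proof -
  note m_coprime = m(2)
  interpret finite_order_map n m \<sigma> by unfold_locales (use assms in auto)
  have cop: "coprime (len i) CHAR('k)" if "i < n" for i
    using len_dvd[OF that order[OF that]] m_coprime by (rule coprime_divisors[OF _ dvd_refl])
  have "\<exists>w. bij_betw w {..<l} {x :: 'k. x ^ l = 1}" if "coprime l CHAR('k)" "l > 0" for l
  proof -
    have c: "card {x :: 'k. x ^ l = 1} = l" by (rule card_roots[OF that])
    hence "finite {x :: 'k. x ^ l = 1}" using that by (metis card.infinite less_irrefl)
    from ex_bij_betw_nat_finite[OF this] show ?thesis unfolding c atLeast0LessThan .
  qed
  then obtain w where w: "\<And>l. coprime l CHAR('k) \<Longrightarrow> l > 0 \<Longrightarrow> bij_betw (w l) {..<l} {x :: 'k. x ^ l = 1}" by metis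
  \<comment> \<open>Every j < n serves twice: as a point of its orbit and, through its position, as
    the label of one l-th root of unity, l being the length of its orbit. So {..<n} also indexes the
    eigenvectors.\<close>
  define \<xi> where "\<xi> j = w (len (rep j)) (pos j)" for j
  have w': "bij_betw (w (len (rep j))) {..<len (rep j)} {x :: 'k. x ^ len (rep j) = 1}" if "j < n" for j
    by (rule w) (use cop[OF rep_less[OF that]] len[OF rep_less[OF that]] in auto)
  have \<xi>: "\<xi> j ^ len (rep j) = 1" if "j < n" for j
    using bij_betwE[OF w'[OF that]] pos_less[OF that] by (auto simp: \<xi>_def)
  have \<xi>_inj: "i = j" if ij: "i < n" "j < n" "rep i = rep j" "\<xi> i = \<xi> j" for i j
  proof -
    have "pos i = pos j"
      using bij_betw_imp_inj_on[OF w'[OF ij(1)]] ij pos_less[OF ij(1)] pos_less[OF ij(2)]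
      by (auto simp: \<xi>_def inj_on_def)
    hence "(\<sigma> ^^ pos i) (rep i) = (\<sigma> ^^ pos j) (rep j)" using ij(3) by simp
    thus ?thesis unfolding pos_funpow[OF ij(1)] pos_funpow[OF ij(2)] .
  qed
  have \<xi>0: "\<xi> j \<noteq> 0" if "j < n" for j using \<xi>[OF that] len(1)[OF rep_less[OF that]] by (auto simp: zero_power)
  \<comment> \<open>\<open>Z'\<close> is the Fourier matrix of the cyclic group acting on each
    orbit, extended by 0 between different orbits; \<open>Z\<close> is its inverse.\<close>
  define Z where "Z = mat n n (\<lambda>(i, j). if rep i = rep j then inverse (of_nat (len (rep j))) * inverse (\<xi> j) ^ pos i else 0)"
  define Z' where "Z' = mat n n (\<lambda>(j, i). if rep i = rep j then \<xi> j ^ pos i else 0)"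
  define D where "D = mat n n (\<lambda>(i, j). if i = j then \<xi> i else 0)"
  have c: "Z \<in> carrier_mat n n" "Z' \<in> carrier_mat n n" "D \<in> carrier_mat n n" by (auto simp: Z_def Z'_def D_def)
  have Z'Z: "Z' * Z = 1\<^sub>m n"
  proof (rule eq_matI)
    fix j j' assume "j < dim_row (1\<^sub>m n :: 'k mat)" "j' < dim_col (1\<^sub>m n :: 'k mat)"
    hence j: "j < n" "j' < n" by auto
    let ?l = "len (rep j)" and ?y = "\<xi> j * inverse (\<xi> j')"
    have l0: "(of_nat ?l :: 'k) \<noteq> 0" using of_nat_eq_0_iff_coprime[OF char_pos] cop[OF rep_less[OF j(1)]] by blast
    have "(Z' * Z) $$ (j, j') = (\<Sum>i<n. if rep i = rep j \<and> rep i = rep j' then inverse (of_nat (len (rep j'))) * (\<xi> j ^ pos i * inverse (\<xi> j') ^ pos i) else 0)"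
      using j c by (auto simp: Z_def Z'_def scalar_prod_def atLeast0LessThan intro!: sum.cong)
    also have "\<dots> = (1\<^sub>m n :: 'k mat) $$ (j, j')"
    proof (cases "rep j = rep j'")
      case False
      thus ?thesis using j by (auto intro!: sum.neutral)
    next
      case True
      have "(\<Sum>i<n. if rep i = rep j \<and> rep i = rep j' then inverse (of_nat (len (rep j'))) * (\<xi> j ^ pos i * inverse (\<xi> j') ^ pos i) else 0)
        = (\<Sum>i\<in>{i. i < n \<and> rep i = rep j}. inverse (of_nat ?l) * ?y ^ pos i)"
        using True by (intro sum.mono_neutral_cong_right) (auto simp: power_mult_distrib)
      also have "\<dots> = (\<Sum>k<?l. inverse (of_nat ?l) * ?y ^ k)"
        by (rule sum.reindex_bij_betw[OF pos_bij[OF rep_less[OF j(1)] rep_rep[OF j(1)]]])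
      also have "\<dots> = inverse (of_nat ?l) * (\<Sum>k<?l. ?y ^ k)" by (simp add: sum_distrib_left)
      also have "\<dots> = (if j = j' then 1 else 0)"
      proof (cases "j = j'")
        case True
        thus ?thesis using \<xi>0[OF j(1)] l0 by simp
      next
        case False
        hence "?y \<noteq> 1" using \<xi>_inj[OF j True] \<xi>0[OF j(2)] by (metis divide_inverse divide_eq_1_iff)
        moreover have "?y ^ ?l = 1" using \<xi>[OF j(1)] \<xi>[OF j(2)] True by (simp add: power_mult_distrib power_inverse)
        ultimately have "(\<Sum>k<?l. ?y ^ k) = 0" using geometric_sum[of ?y ?l] by simp
        thus ?thesis using False by simp
      qed
      finally show ?thesis using j by simp
    qed
    finally show "(Z' * Z) $$ (j, j') = (1\<^sub>m n :: 'k mat) $$ (j, j')" .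
  qed (use c in auto)
  hence ZZ': "Z * Z' = 1\<^sub>m n" by (rule mat_mult_left_right_inverse[OF c(2,1)])
  \<comment> \<open>Applying the permutation raises the position by 1 modulo the orbit length, which
    multiplies the entry of \<open>Z'\<close> in row j by \<xi> j.\<close>
  have ZD: "D * Z' = Z' * perm_mat n \<sigma>"
  proof (rule eq_matI)
    fix j i assume "j < dim_row (Z' * perm_mat n \<sigma>)" "i < dim_col (Z' * perm_mat n \<sigma>)"
    hence ji: "j < n" "i < n" using c by (auto simp: perm_mat_def)
    have "(D * Z') $$ (j, i) = \<xi> j * Z' $$ (j, i)"
      using c ji by (auto simp: D_def scalar_prod_def if_distrib[of "\<lambda>x. x * _"] cong: if_cong)
    also have "\<dots> = Z' $$ (j, \<sigma> i)"
    proof -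
      have "rep (\<sigma> i) = rep i" using rep_orbit[OF ji(2), of 1] by simp
      moreover have "\<xi> j ^ (Suc (pos i) mod len (rep i)) = \<xi> j ^ Suc (pos i)" if e: "rep i = rep j"
      proof -
        have "\<xi> j ^ Suc (pos i) = \<xi> j ^ (len (rep i) * (Suc (pos i) div len (rep i)) + Suc (pos i) mod len (rep i))"
          by (simp only: mult_div_mod_eq)
        also have "\<dots> = \<xi> j ^ (Suc (pos i) mod len (rep i))"
          unfolding power_add power_mult e \<xi>[OF ji(1)] by simp
        finally show ?thesis ..
      qed
      ultimately show ?thesis using ji map[OF ji(2)] pos_step[OF ji(2)] by (simp add: Z'_def)
    qed
    also have "\<dots> = (Z' * perm_mat n \<sigma>) $$ (j, i)" by (rule mult_perm_mat[where \<sigma> = \<sigma>, OF c(2) ji map[OF ji(2)], symmetric])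
    finally show "(D * Z') $$ (j, i) = (Z' * perm_mat n \<sigma>) $$ (j, i)" .
  qed (use c in \<open>auto simp: perm_mat_def\<close>)
  have "evs (perm_mat n \<sigma>) = evs D"
    by (rule evs_intertwined[OF c(3) perm_mat_carrier c(2,1) Z'Z ZZ' ZD, symmetric])
  also have "\<dots> = image_mset \<xi> (mset_set {..<n})"
  proof -
    have "evs D = mset (diag_mat D)" by (rule evs_upper_triangular[OF c(3)]) (auto simp: D_def)
    also have "\<dots> = image_mset (\<lambda>i. D $$ (i, i)) (mset_set {..<n})" by (rule mset_diag_mat[OF c(3)])
    also have "\<dots> = image_mset \<xi> (mset_set {..<n})" by (rule image_mset_cong) (auto simp: D_def)
    finally show ?thesis .
  qed
  finally have "bt (perm_mat n \<sigma>) = (\<Sum>i<n. \<theta> (\<xi> i))"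
    by (simp add: bt_def sum_unfold_sum_mset multiset.map_comp comp_def)
  \<comment> \<open>Grouped by orbits: each orbit of length l runs once through all l-th roots of
    unity.\<close>
  also have "\<dots> = (\<Sum>r\<in>rep ` {..<n}. \<Sum>i\<in>{i \<in> {..<n}. rep i = r}. \<theta> (\<xi> i))"
    by (rule sum.image_gen) simp
  also have "\<dots> = (\<Sum>r\<in>rep ` {..<n}. if len r = 1 then 1 else 0)"
  proof (rule sum.cong[OF refl])
    fix r assume "r \<in> rep ` {..<n}"
    hence r: "r < n" "rep r = r" using rep_less rep_rep by auto
    have "(\<Sum>i\<in>{i \<in> {..<n}. rep i = r}. \<theta> (\<xi> i)) = (\<Sum>i\<in>{i. i < n \<and> rep i = r}. \<theta> (w (len r) (pos i)))"
      by (intro sum.cong) (auto simp: \<xi>_def)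
    also have "\<dots> = (\<Sum>k<len r. \<theta> (w (len r) k))" by (rule sum.reindex_bij_betw[OF pos_bij[OF r]])
    also have "\<dots> = (\<Sum>x | x ^ len r = 1. \<theta> x)" by (rule sum.reindex_bij_betw) (use w'[OF r(1)] r in simp)
    also have "\<dots> = (if len r = 1 then 1 else 0)" by (rule sum_lift_roots[OF cop[OF r(1)] len(1)[OF r(1)]])
    finally show "(\<Sum>i\<in>{i \<in> {..<n}. rep i = r}. \<theta> (\<xi> i)) = (if len r = 1 then 1 else 0)" .
  qed
  also have "\<dots> = of_nat (card {r \<in> rep ` {..<n}. len r = 1})"
    by (simp add: sum.If_cases Int_def)
  also have "{r \<in> rep ` {..<n}. len r = 1} = {i. i < n \<and> \<sigma> i = i}"
  proof (intro equalityI subsetI)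
    fix r assume "r \<in> {r \<in> rep ` {..<n}. len r = 1}"
    thus "r \<in> {i. i < n \<and> \<sigma> i = i}" using rep_less len_eq_1_iff by auto
  next
    fix i assume "i \<in> {i. i < n \<and> \<sigma> i = i}"
    hence i: "i < n" "\<sigma> i = i" by auto
    have "(\<sigma> ^^ k) i = i" for k by (induction k) (use i in auto)
    hence "rep i = i" using rep_funpow[OF i(1)] by metis
    thus "i \<in> {r \<in> rep ` {..<n}. len r = 1}" using len_eq_1_iff[OF i(1)] i by force
  qed
  finally show ?thesis .
qed

end

section \<open>Brauer characters\<close>

lemma tensor_gmod_kron: "snd (M \<otimes>\<^sub>M N) g = kron (snd M g) (snd N g)"
  if "snd M g \<in> carrier_mat (fst M) (fst M)" "snd N g \<in> carrier_mat (fst N) (fst N)"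
  using that by (auto simp: tensor_gmod_def kron_def)

lemma tensor_gmod_is_gmod:
  fixes M N :: "('g, 'k :: field) gmod"
  assumes G: "group G" and M: "is_gmod G M" and N: "is_gmod G N"
  shows "is_gmod G (M \<otimes>\<^sub>M N)"
  unfolding is_gmod_def
proof (intro conjI ballI)
  interpret group G by fact
  have f: "fst (M \<otimes>\<^sub>M N) = fst M * fst N" by (simp add: tensor_gmod_def)
  note k = tensor_gmod_kron[OF gmod_carrier[OF M] gmod_carrier[OF N]]
  fix g h assume g: "g \<in> carrier G" and h: "h \<in> carrier G"
  show "snd (M \<otimes>\<^sub>M N) g \<in> carrier_mat (fst (M \<otimes>\<^sub>M N)) (fst (M \<otimes>\<^sub>M N))"
    unfolding k[OF g g] f by (intro kron_carrier gmod_carrier[OF M g] gmod_carrier[OF N g])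
  show "snd (M \<otimes>\<^sub>M N) (g \<otimes>\<^bsub>G\<^esub> h) = snd (M \<otimes>\<^sub>M N) g * snd (M \<otimes>\<^sub>M N) h"
    unfolding k[OF g g] k[OF h h] k[OF m_closed[OF g h] m_closed[OF g h]] gmod_mult[OF M g h] gmod_mult[OF N g h]
    by (rule kron_mult[OF gmod_carrier[OF M g] gmod_carrier[OF N g] gmod_carrier[OF M h] gmod_carrier[OF N h], symmetric])
next
  interpret group G by fact
  show "snd (M \<otimes>\<^sub>M N) \<one>\<^bsub>G\<^esub> = 1\<^sub>m (fst (M \<otimes>\<^sub>M N))"
    using tensor_gmod_kron[OF gmod_carrier[OF M one_closed] gmod_carrier[OF N one_closed]]
    by (simp add: gmod_one[OF M] gmod_one[OF N] kron_one tensor_gmod_def)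
qed

lemma sum_mset_cnj: "(\<Sum>x\<in>#A. cnj (f x)) = cnj (\<Sum>x\<in>#A. f x)"
  by (induction A) auto

locale modular_rep = group G + brauer \<theta>
  for G :: "('g, 'b) monoid_scheme" (structure) and \<theta> :: "'k :: alg_closed_field \<Rightarrow> complex" +
  fixes p :: nat
  assumes fin: "finite (carrier G)" and char: "CHAR('k) = p"
begin

abbreviation Br :: "('g, 'k) gmod \<Rightarrow> 'g \<Rightarrow> complex" where "Br \<equiv> brauer_char \<theta> G"
abbreviation preg :: "'g set" where "preg \<equiv> p_regular G p"

lemma preg_carrier: "g \<in> preg \<Longrightarrow> g \<in> carrier G"
  by (simp add: p_regular_def)

lemma preg_coprime: "g \<in> preg \<Longrightarrow> coprime (ord g) CHAR('k)"
  by (simp add: p_regular_def char)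

lemma ord_pos: "g \<in> carrier G \<Longrightarrow> ord g > 0"
  using ord_ge_1[OF fin] by force

lemma one_preg: "\<one> \<in> preg"
  by (simp add: p_regular_def)

lemma gmod_pow:
  fixes M :: "('g, 'k) gmod"
  assumes M: "is_gmod G M" and g: "g \<in> carrier G"
  shows "snd M (g [^] (k :: nat)) = snd M g ^\<^sub>m k"
proof (induction k)
  case 0
  thus ?case using gmod_one[OF M] gmod_carrier[OF M g] by simp
next
  case (Suc k)
  thus ?case using gmod_mult[OF M nat_pow_closed[OF g] g] by simp
qed

lemma gmod_pow_ord:
  fixes M :: "('g, 'k) gmod"
  assumes "is_gmod G M" "g \<in> carrier G"
  shows "snd M g ^\<^sub>m ord g = 1\<^sub>m (fst M)"
  using gmod_pow[OF assms, of "ord g"] pow_ord_eq_1[OF assms(2)] gmod_one[OF assms(1)] by simp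

lemma evs_root_of_unity:
  fixes M :: "('g, 'k) gmod"
  assumes M: "is_gmod G M" and g: "g \<in> carrier G" and x: "x \<in># evs (snd M g)"
  shows "x ^ ord g = 1"
proof -
  obtain v where v: "v \<in> carrier_vec (fst M)" "v \<noteq> 0\<^sub>v (fst M)" "snd M g *\<^sub>v v = x \<cdot>\<^sub>v v"
    by (rule evs_eigenvector[OF gmod_carrier[OF M g] x])
  show ?thesis by (rule eigenvalue_root_of_unity[OF gmod_carrier[OF M g] gmod_pow_ord[OF M g] v])
qed

lemma Br_eq: "g \<in> preg \<Longrightarrow> Br M g = bt (snd M g)"
  by (simp add: brauer_char_def bt_def evs_def char)

lemma Br_not_regular: "g \<notin> preg \<Longrightarrow> Br M g = 0"
  by (simp add: brauer_char_def char)

lemma Br_eqI: "(\<And>g. g \<in> preg \<Longrightarrow> Br M g = Br N g) \<Longrightarrow> Br M = Br N"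
proof
  fix g assume "\<And>g. g \<in> preg \<Longrightarrow> Br M g = Br N g"
  thus "Br M g = Br N g" by (cases "g \<in> preg") (auto simp: Br_not_regular)
qed

lemma Br_one: "is_gmod G M \<Longrightarrow> Br M \<one> = of_nat (fst M)"
  by (simp add: Br_eq[OF one_preg] gmod_one bt_def evs_one)

lemma Br_iso: "is_gmod G M \<Longrightarrow> is_gmod G N \<Longrightarrow> gmod_iso G M N \<Longrightarrow> Br M = Br N"
  by (rule Br_eqI) (simp add: Br_eq bt_def gmod_iso_evs[of G M N] preg_carrier)

lemma pow_ord_minus_one:
  assumes g: "g \<in> carrier G"
  shows "g [^] (ord g - 1) = inv g"
proof -
  have "g [^] (ord g - 1) \<otimes> g = g [^] Suc (ord g - 1)" by simp
  also have "\<dots> = \<one>" using ord_pos[OF g] pow_ord_eq_1[OF g] by simp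
  finally show ?thesis using inv_equality[OF _ g] g by simp
qed

lemma inv_preg: assumes "g \<in> preg" shows "inv g \<in> preg"
  using assms ord_inv[of g] by (auto simp: p_regular_def)

text \<open>The inverse of g is a power of g, so its eigenvalues are the inverses of those of g, and
  the lift sends inverses of roots of unity to conjugates.\<close>

lemma bt_inv:
  fixes M :: "('g, 'k) gmod"
  assumes M: "is_gmod G M" and g: "g \<in> carrier G"
  shows "bt (snd M (inv g)) = cnj (bt (snd M g))"
proof -
  have "evs (snd M (inv g)) = image_mset (\<lambda>x. x ^ (ord g - 1)) (evs (snd M g))"
    unfolding pow_ord_minus_one[OF g, symmetric] gmod_pow[OF M g] by (rule evs_pow[OF gmod_carrier[OF M g]])
  hence "bt (snd M (inv g)) = (\<Sum>x\<in>#evs (snd M g). \<theta> (x ^ (ord g - 1)))"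
    by (simp add: bt_def multiset.map_comp comp_def)
  also have "\<dots> = (\<Sum>x\<in>#evs (snd M g). cnj (\<theta> x))"
  proof (intro arg_cong[of _ _ sum_mset] image_mset_cong)
    fix x assume "x \<in># evs (snd M g)"
    hence x: "x ^ ord g = 1" by (rule evs_root_of_unity[OF M g])
    have "x * x ^ (ord g - 1) = 1" using x ord_pos[OF g] by (simp flip: power_Suc)
    hence "x ^ (ord g - 1) = inverse x" by (rule inverse_unique[symmetric])
    thus "\<theta> (x ^ (ord g - 1)) = cnj (\<theta> x)" using lift_inverse[OF x ord_pos[OF g]] by simp
  qed
  also have "\<dots> = cnj (bt (snd M g))"
    unfolding bt_def by (rule sum_mset_cnj)
  finally show ?thesis .
qed

lemma Br_inv: "is_gmod G M \<Longrightarrow> g \<in> preg \<Longrightarrow> Br M (inv g) = cnj (Br M g)"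
  using Br_eq inv_preg bt_inv preg_carrier by simp

lemma evs_conj:
  fixes M :: "('g, 'k) gmod"
  assumes M: "is_gmod G M" and g: "g \<in> carrier G" and x: "x \<in> carrier G"
  shows "evs (snd M (x \<otimes> g \<otimes> inv x)) = evs (snd M g)"
proof (rule evs_conjugate)
  show "snd M (x \<otimes> g \<otimes> inv x) = snd M x * snd M g * snd M (inv x)"
    using gmod_mult[OF M] g x by simp
  show "snd M x * snd M (inv x) = 1\<^sub>m (fst M)" "snd M (inv x) * snd M x = 1\<^sub>m (fst M)"
    using gmod_mult[OF M, symmetric] gmod_one[OF M] x by simp_all
qed (use gmod_carrier[OF M] g x in auto)

lemma ord_conj:
  assumes g: "g \<in> carrier G" and x: "x \<in> carrier G"
  shows "ord (x \<otimes> g \<otimes> inv x) = ord g"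
proof -
  have pow: "(x \<otimes> g \<otimes> inv x) [^] (k :: nat) = x \<otimes> g [^] k \<otimes> inv x" for k
  proof (induction k)
    case (Suc k)
    have "inv x \<otimes> (x \<otimes> (g \<otimes> inv x)) = g \<otimes> inv x"
      using m_assoc[of "inv x" x "g \<otimes> inv x"] g x by simp
    thus ?case using Suc g x by (simp add: m_assoc)
  qed (use x in simp)
  have "x \<otimes> h \<otimes> inv x = \<one> \<longleftrightarrow> h = \<one>" if h: "h \<in> carrier G" for h
  proof
    assume "x \<otimes> h \<otimes> inv x = \<one>"
    hence "x \<otimes> h = x" using inv_equality[of "x \<otimes> h" "inv x"] h x by simp
    thus "h = \<one>" using h x by (metis l_cancel_one' one_closed r_cancel_one)
  qed (use x in simp)
  hence "(x \<otimes> g \<otimes> inv x) [^] k = \<one> \<longleftrightarrow> g [^] k = \<one>" for k :: nat unfolding pow using g by simp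
  hence "ord (x \<otimes> g \<otimes> inv x) dvd k \<longleftrightarrow> ord g dvd k" for k
    using pow_eq_id g x by simp
  thus ?thesis by (metis dvd_antisym dvd_refl)
qed

lemma conj_class_preg:
  assumes "g \<in> preg" "h \<in> conj_class G g"
  shows "h \<in> preg" "Br M g = Br M h \<or> \<not> is_gmod G M"
proof -
  obtain x where x: "x \<in> carrier G" "h = x \<otimes> g \<otimes> inv x" using assms by (auto simp: conj_class_def)
  show h: "h \<in> preg" using assms ord_conj x by (auto simp: p_regular_def)
  show "Br M g = Br M h \<or> \<not> is_gmod G M"
    using Br_eq[OF h] Br_eq[OF assms(1)] evs_conj[of M g x] x preg_carrier[OF assms(1)] by (auto simp: bt_def)
qed

lemma Br_tensor:
  assumes M: "is_gmod G M" and N: "is_gmod G N"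
  shows "Br (M \<otimes>\<^sub>M N) g = Br M g * Br N g"
proof (cases "g \<in> preg")
  case True
  note g = preg_carrier[OF True]
  note c = gmod_carrier[OF M g] gmod_carrier[OF N g]
  have "bt (kron (snd M g) (snd N g)) = bt (snd M g) * bt (snd N g)"
    unfolding bt_def
  proof (rule sum_evs_kron[OF c])
    fix x y assume "x \<in># evs (snd M g)" "y \<in># evs (snd N g)"
    thus "\<theta> (x * y) = \<theta> x * \<theta> y"
      using lift_mult[OF _ ord_pos[OF g] _ ord_pos[OF g]] evs_root_of_unity[OF _ g] M N by blast
  qed
  thus ?thesis using Br_eq[OF True] tensor_gmod_kron[OF c] by simp
qed (simp add: Br_not_regular)

section \<open>The regular module\<close>

text \<open>The group elements are numbered arbitrarily, by \<open>en\<close> with inverse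
  \<open>ix\<close>; this provides the coordinates of kG.\<close>

definition num :: nat where "num = card (carrier G)"
definition en :: "nat \<Rightarrow> 'g" where "en = (SOME e. bij_betw e {..<num} (carrier G))"
definition ix :: "'g \<Rightarrow> nat" where "ix = inv_into {..<num} en"

lemma en_bij: "bij_betw en {..<num} (carrier G)"
  using ex_bij_betw_nat_finite[OF fin] unfolding en_def num_def atLeast0LessThan by (rule someI_ex)

lemma en_carrier [simp]: "j < num \<Longrightarrow> en j \<in> carrier G"
  using en_bij bij_betwE by blast

lemma ix_less [simp]: "g \<in> carrier G \<Longrightarrow> ix g < num"
  using en_bij by (metis bij_betw_def inv_into_into ix_def lessThan_iff)

lemma en_ix [simp]: "g \<in> carrier G \<Longrightarrow> en (ix g) = g"
  using en_bij by (simp add: bij_betw_inv_into_right ix_def)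

lemma ix_en [simp]: "j < num \<Longrightarrow> ix (en j) = j"
  using en_bij by (simp add: bij_betw_inv_into_left ix_def)

definition reg :: "('g, 'k) gmod" where
  "reg = (num, \<lambda>g. perm_mat num (\<lambda>j. ix (g \<otimes> en j)))"

definition rmul :: "'g \<Rightarrow> 'k mat" where
  "rmul c = perm_mat num (\<lambda>j. ix (en j \<otimes> c))"

text \<open>The homomorphism from the regular module to M that maps 1 to t.\<close>

definition orb :: "('g, 'k) gmod \<Rightarrow> 'k vec \<Rightarrow> 'k mat" where
  "orb M t = mat (fst M) num (\<lambda>(a, j). (snd M (en j) *\<^sub>v t) $ a)"

lemma fst_reg [simp]: "fst reg = num"
  by (simp add: reg_def)

lemma rmul_carrier [simp]: "rmul c \<in> carrier_mat num num"
  by (simp add: rmul_def)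

lemma perm_mat_mult:
  assumes "\<And>j. j < n \<Longrightarrow> \<sigma> j < n" "\<And>j. j < n \<Longrightarrow> \<tau> j < n"
  shows "perm_mat n \<sigma> * perm_mat n \<tau> = (perm_mat n (\<lambda>j. \<sigma> (\<tau> j)) :: 'k mat)"
proof (rule eq_matI)
  fix i j assume "i < dim_row (perm_mat n (\<lambda>j. \<sigma> (\<tau> j)) :: 'k mat)" "j < dim_col (perm_mat n (\<lambda>j. \<sigma> (\<tau> j)) :: 'k mat)"
  hence ij: "i < n" "j < n" by (auto simp: perm_mat_def)
  show "(perm_mat n \<sigma> * perm_mat n \<tau>) $$ (i, j) = (perm_mat n (\<lambda>j. \<sigma> (\<tau> j)) :: 'k mat) $$ (i, j)"
    using mult_perm_mat[OF perm_mat_carrier ij, of \<tau> \<sigma>] assms ij by (simp add: perm_mat_def)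
qed (auto simp: perm_mat_def)

lemma perm_mat_cong: "(\<And>j. j < n \<Longrightarrow> \<sigma> j = \<tau> j) \<Longrightarrow> perm_mat n \<sigma> = perm_mat n \<tau>"
  by (auto simp: perm_mat_def intro!: eq_matI)

lemma perm_mat_id: "(\<And>j. j < n \<Longrightarrow> \<sigma> j = j) \<Longrightarrow> perm_mat n \<sigma> = 1\<^sub>m n"
  by (auto simp: perm_mat_def intro!: eq_matI)

lemma reg_gmod: "is_gmod G reg"
  unfolding is_gmod_def
proof (intro conjI ballI)
  fix g h assume g: "g \<in> carrier G" and h: "h \<in> carrier G"
  show "snd reg (g \<otimes> h) = snd reg g * snd reg h"
    unfolding reg_def snd_conv by (subst perm_mat_mult) (use g h in \<open>auto simp: m_assoc intro!: perm_mat_cong\<close>)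
next
  show "snd reg \<one> = 1\<^sub>m (fst reg)" unfolding reg_def snd_conv fst_conv by (rule perm_mat_id) simp
qed (simp add: reg_def)

lemma rmul_hom: assumes c: "c \<in> carrier G" shows "rmul c \<in> gmod_hom G reg reg"
proof (rule homI)
  fix g assume g: "g \<in> carrier G"
  have "rmul c * snd reg g = perm_mat num (\<lambda>j. ix (g \<otimes> en j \<otimes> c))"
    unfolding rmul_def reg_def snd_conv by (subst perm_mat_mult) (use g c in \<open>auto intro!: perm_mat_cong\<close>)
  moreover have "snd reg g * rmul c = perm_mat num (\<lambda>j. ix (g \<otimes> en j \<otimes> c))"
    unfolding rmul_def reg_def snd_conv by (subst perm_mat_mult) (use g c in \<open>auto simp: m_assoc intro!: perm_mat_cong\<close>)
  ultimately show "rmul c * snd reg g = snd reg g * rmul c" by simp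
qed simp

lemma rmul_pow: assumes c: "c \<in> carrier G" shows "rmul c ^\<^sub>m k = rmul (c [^] k)"
proof (induction k)
  case 0
  show ?case using carrier_matD[OF rmul_carrier[of c]] by (simp add: rmul_def perm_mat_id)
next
  case (Suc k)
  have "rmul (c [^] k) * rmul c = rmul (c \<otimes> c [^] k)"
    unfolding rmul_def by (subst perm_mat_mult) (use c in \<open>auto simp: m_assoc intro!: perm_mat_cong\<close>)
  also have "c \<otimes> c [^] k = c [^] Suc k" using nat_pow_Suc2[OF c, of k] by simp
  finally show ?case using Suc by simp
qed

lemma rmul_pow_ord: "c \<in> carrier G \<Longrightarrow> rmul c ^\<^sub>m ord c = 1\<^sub>m num"
  unfolding rmul_pow using pow_ord_eq_1[of c] by (simp add: rmul_def perm_mat_id)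

lemma orb_carrier [simp]: "orb M t \<in> carrier_mat (fst M) num"
  by (simp add: orb_def)

lemma orb_hom:
  assumes M: "is_gmod G M" and t: "t \<in> carrier_vec (fst M)"
  shows "orb M t \<in> gmod_hom G reg M"
proof (rule homI)
  fix g assume g: "g \<in> carrier G"
  note A = gmod_carrier[OF M]
  show "orb M t * snd reg g = snd M g * orb M t"
  proof (rule eq_matI)
    fix a j assume "a < dim_row (snd M g * orb M t)" "j < dim_col (snd M g * orb M t)"
    hence aj: "a < fst M" "j < num" using A[OF g] by (auto simp: orb_def)
    have col: "col (orb M t) j = snd M (en j) *\<^sub>v t"
      using aj A[OF en_carrier[OF aj(2)]] by (intro eq_vecI) (auto simp: orb_def)
    have "(orb M t * snd reg g) $$ (a, j) = orb M t $$ (a, ix (g \<otimes> en j))"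
      unfolding reg_def snd_conv by (rule mult_perm_mat[OF orb_carrier aj]) (use g aj in simp)
    also have "\<dots> = (snd M g * snd M (en j) *\<^sub>v t) $ a"
      using g aj gmod_mult[OF M g, of "en j"] by (simp add: orb_def)
    also have "snd M g * snd M (en j) *\<^sub>v t = snd M g *\<^sub>v (snd M (en j) *\<^sub>v t)"
      by (rule assoc_mult_mat_vec[OF A[OF g] A t]) (use aj in simp)
    also have "\<dots> $ a = (snd M g * orb M t) $$ (a, j)"
      unfolding col[symmetric] using aj A[OF g] carrier_matD[OF orb_carrier[of M t]] by simp
    finally show "(orb M t * snd reg g) $$ (a, j) = (snd M g * orb M t) $$ (a, j)" .
  qed (use A[OF g] in \<open>auto simp: reg_def orb_def perm_mat_def\<close>)
qed simp

abbreviation j1 :: nat where "j1 \<equiv> ix \<one>"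

lemma col_orb: assumes "is_gmod G M" "t \<in> carrier_vec (fst M)" shows "col (orb M t) j1 = t"
  using assms gmod_one[OF assms(1)] by (intro eq_vecI) (auto simp: orb_def)

text \<open>The column with index \<open>j1\<close> is the image of the identity element, and it
  determines a homomorphism from kG; with \<open>orb\<close> this identifies such homomorphisms with
  vectors of \<open>M\<close>.\<close>

lemma hom_reg_col:
  assumes M: "is_gmod G M" and F: "F \<in> gmod_hom G reg M" and j: "j < num"
  shows "col F j = snd M (en j) *\<^sub>v col F j1"
proof (rule eq_vecI)
  note cF = hom_carrier[OF F] and A = gmod_carrier[OF M en_carrier[OF j]]
  fix a assume "a < dim_vec (snd M (en j) *\<^sub>v col F j1)"
  hence a: "a < fst M" using A by simp
  have "col F j $ a = F $$ (a, ix (en j \<otimes> en j1))" using cF a j by simp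
  also have "\<dots> = (F * snd reg (en j)) $$ (a, j1)"
    unfolding reg_def snd_conv by (rule mult_perm_mat[symmetric]) (use cF a j in auto)
  also have "\<dots> = (snd M (en j) *\<^sub>v col F j1) $ a"
    unfolding hom_commute[OF F en_carrier[OF j]] using A cF a by simp
  finally show "col F j $ a = (snd M (en j) *\<^sub>v col F j1) $ a" .
qed (use hom_carrier[OF F] gmod_carrier[OF M en_carrier[OF j]] in auto)

lemma hom_reg_eqI:
  assumes "is_gmod G M" and F: "F \<in> gmod_hom G reg M" and F': "F' \<in> gmod_hom G reg M" and e: "col F j1 = col F' j1"
  shows "F = F'"
proof (rule mat_col_eqI)
  fix j assume "j < dim_col F'"
  hence j: "j < num" using hom_carrier[OF F'] by simp
  show "col F j = col F' j" unfolding hom_reg_col[OF assms(1) F j] hom_reg_col[OF assms(1) F' j] e ..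
qed (use hom_carrier[OF F] hom_carrier[OF F'] in auto)

lemma orb_col: assumes "is_gmod G M" and F: "F \<in> gmod_hom G reg M" shows "orb M (col F j1) = F"
proof -
  have c: "col F j1 \<in> carrier_vec (fst M)" by (rule carrier_vecI) (use hom_carrier[OF F] in simp)
  show ?thesis using hom_reg_eqI[OF assms(1) orb_hom[OF assms(1) c] F] col_orb[OF assms(1) c] by simp
qed

lemma col_rmul:
  assumes "is_gmod G M" and F: "F \<in> gmod_hom G reg M" and c: "c \<in> carrier G"
  shows "col (F * rmul c) j1 = snd M c *\<^sub>v col F j1"
proof -
  note cF = hom_carrier[OF F]
  have "col (F * rmul c) j1 = col F (ix c)"
  proof (rule eq_vecI)
    fix a assume "a < dim_vec (col F (ix c))"
    hence a: "a < fst M" using cF by simp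
    have "(F * rmul c) $$ (a, j1) = F $$ (a, ix (en j1 \<otimes> c))"
      unfolding rmul_def by (rule mult_perm_mat) (use cF a c in auto)
    thus "col (F * rmul c) j1 $ a = col F (ix c) $ a" using cF a c carrier_matD[OF rmul_carrier[of c]] by simp
  qed (use cF in simp)
  also have "\<dots> = snd M c *\<^sub>v col F j1" using hom_reg_col[OF assms(1) F ix_less[OF c]] c by simp
  finally show ?thesis .
qed

text \<open>kG is free of rank one: any preimage of the image of the identity element determines a
  lift.\<close>

lemma reg_projective: "projective_gmod G reg"
  unfolding projective_gmod_def
proof (intro conjI reg_gmod allI impI ballI)
  fix M N :: "('g, 'k) gmod" and T F
  assume M: "is_gmod G M" and N: "is_gmod G N" and T: "T \<in> gmod_epi G M N" and F: "F \<in> gmod_hom G reg N"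
  note cF = hom_carrier[OF F] and cT = hom_carrier[OF epi_hom[OF T]]
  have "col F j1 \<in> carrier_vec (fst N)" by (rule carrier_vecI) (use cF in simp)
  then obtain t where t: "t \<in> carrier_vec (fst M)" "T *\<^sub>v t = col F j1" using T unfolding gmod_epi_def by (metis (mono_tags, lifting) imageE mem_Collect_eq)
  have "col (T * orb M t) j1 = T *\<^sub>v col (orb M t) j1"
    using cT carrier_matD[OF orb_carrier[of M t]] by (intro eq_vecI) auto
  hence "T * orb M t = F"
    using hom_reg_eqI[OF N hom_comp[OF reg_gmod M N orb_hom[OF M t(1)] epi_hom[OF T]] F] col_orb[OF M t(1)] t(2) by simp
  thus "\<exists>F'\<in>gmod_hom G reg M. T * F' = F" using orb_hom[OF M t(1)] by blast
qed

text \<open>Any nonzero vector of \<open>S\<close> gives a surjection onto \<open>S\<close> from kG,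
  which is projective; splitting off summands then leads to a cover.\<close>

lemma irreducible_cover_exists:
  fixes S :: "('g, 'k) gmod"
  assumes S: "irreducible_gmod G S"
  shows "\<exists>P. proj_indec_cover G S P"
proof -
  note S' = irreducibleD(1)[OF S]
  define t :: "'k vec" where "t = unit_vec (fst S) 0"
  have t: "t \<in> carrier_vec (fst S)" "t \<noteq> 0\<^sub>v (fst S)"
    using irreducibleD(2)[OF S] by (auto simp: t_def)
  have "orb S t \<noteq> 0\<^sub>m (fst S) (fst reg)" using col_orb[OF S' t(1)] t(2) by auto
  hence "orb S t \<in> gmod_epi G reg S" by (rule irreducible_hom_surjective[OF S reg_gmod orb_hom[OF S' t(1)]])
  from proj_indec_cover_exists[OF reg_projective this S] show ?thesis .
qed

text \<open>In the basis G the operator is the permutation taking x to g^{-1} x c. Its order divides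
  \<open>ord g * ord c\<close>, which is prime to p, so the Brauer trace counts its fixed
  points.\<close>

lemma bt_reg_rmul:
  assumes g: "g \<in> preg" and c: "c \<in> preg"
  shows "bt (snd reg (inv g) * rmul c) = of_nat (card {x \<in> carrier G. x \<otimes> c = g \<otimes> x})"
proof -
  note gc = preg_carrier[OF g] and cc = preg_carrier[OF c]
  let ?s = "\<lambda>j. ix (inv g \<otimes> en j \<otimes> c)"
  have "snd reg (inv g) * rmul c = perm_mat num ?s"
    unfolding rmul_def reg_def snd_conv by (subst perm_mat_mult) (use gc cc in \<open>auto simp: m_assoc intro!: perm_mat_cong\<close>)
  moreover have "bt (perm_mat num ?s) = of_nat (card {j. j < num \<and> ?s j = j})"
  proof (rule bt_perm_mat)
    fix j assume j: "j < num"
    have "(?s ^^ k) j = ix (inv g [^] k \<otimes> en j \<otimes> c [^] k)" for k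
    proof (induction k)
      case (Suc k)
      have "inv g \<otimes> (inv g [^] k \<otimes> en j \<otimes> c [^] k) \<otimes> c = inv g [^] Suc k \<otimes> en j \<otimes> c [^] Suc k"
        using gc cc j nat_pow_Suc2[of "inv g" k] by (simp add: m_assoc)
      thus ?case using Suc gc cc j by simp
    qed (use j in simp)
    moreover have "inv g [^] (ord g * ord c) = \<one>" "c [^] (ord g * ord c) = \<one>"
      using gc cc ord_inv[OF gc] by (simp_all add: pow_eq_id)
    ultimately show "(?s ^^ (ord g * ord c)) j = j" using j by simp
  next
    show "coprime (ord g * ord c) CHAR('k)" using preg_coprime[OF g] preg_coprime[OF c] by simp
  qed (use gc cc ord_pos in auto)
  moreover have "card {j. j < num \<and> ?s j = j} = card {x \<in> carrier G. x \<otimes> c = g \<otimes> x}"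
  proof (rule bij_betw_same_card[of en])
    have eq: "?s j = j \<longleftrightarrow> en j \<otimes> c = g \<otimes> en j" if j: "j < num" for j
    proof -
      have "?s j = j \<longleftrightarrow> inv g \<otimes> en j \<otimes> c = en j"
        using j gc cc by (metis en_carrier en_ix inv_closed ix_en m_closed)
      also have "\<dots> \<longleftrightarrow> en j \<otimes> c = g \<otimes> en j"
        using j gc cc by (metis en_carrier inv_closed inv_solve_left m_assoc m_closed)
      finally show ?thesis .
    qed
    show "bij_betw en {j. j < num \<and> ?s j = j} {x \<in> carrier G. x \<otimes> c = g \<otimes> x}"
      unfolding bij_betw_def
    proof
      show "inj_on en {j. j < num \<and> ?s j = j}"
        using en_bij by (auto simp: bij_betw_def inj_on_def)
      show "en ` {j. j < num \<and> ?s j = j} = {x \<in> carrier G. x \<otimes> c = g \<otimes> x}"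
      proof (intro equalityI subsetI)
        fix x assume x: "x \<in> {x \<in> carrier G. x \<otimes> c = g \<otimes> x}"
        hence "x = en (ix x)" "ix x \<in> {j. j < num \<and> ?s j = j}" using eq[of "ix x"] by auto
        thus "x \<in> en ` {j. j < num \<and> ?s j = j}" by (rule image_eqI)
      qed (use eq in auto)
    qed
  qed
  ultimately show ?thesis by simp
qed

end

lemma tr_evs:
  fixes A :: "'k :: alg_closed_field mat"
  assumes "A \<in> carrier_mat n n"
  shows "tr A = (\<Sum>x\<in>#evs A. x)"
proof -
  obtain P Q U where T: "triangularizes n P Q U A" using triangularize[OF assms] by blast
  show ?thesis using tr_triangularizes[OF T] sum_evs_triangularizes[OF T, of "\<lambda>x. x"] by simp
qed

context modular_rep
begin

section \<open>Decompositions of the regular module\<close>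

context
  fixes c :: 'g and d :: nat and P :: "nat \<Rightarrow> ('g, 'k) gmod" and B C :: "nat \<Rightarrow> 'k mat" and x :: "nat \<Rightarrow> 'k"
  assumes c: "c \<in> preg" and dec: "decomposition G reg (rmul c) d P B C x"
begin

lemma dec_P: "i < d \<Longrightarrow> indecomposable_gmod G (P i)"
  and dec_B: "i < d \<Longrightarrow> B i \<in> gmod_hom G (P i) reg"
  and dec_C: "i < d \<Longrightarrow> C i \<in> gmod_hom G reg (P i)"
  and dec_CR: "i < d \<Longrightarrow> C i * rmul c = x i \<cdot>\<^sub>m C i"
  and dec_CB: "i < d \<Longrightarrow> j < d \<Longrightarrow> C i * B j = (if i = j then 1\<^sub>m (fst (P i)) else 0\<^sub>m (fst (P i)) (fst (P j)))"
  and dec_sum: "msum num num d (\<lambda>i. B i * C i) = 1\<^sub>m num"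
  and dec_evs: "g \<in> carrier G \<Longrightarrow> evs (snd reg g * rmul c) = (\<Sum>i<d. image_mset ((*) (x i)) (evs (snd (P i) g)))"
  using dec unfolding decomposition_def by auto

lemma dec_gmod: "i < d \<Longrightarrow> is_gmod G (P i)"
  using dec_P indecomposableD by blast

lemma dec_projective: "i < d \<Longrightarrow> projective_gmod G (P i)"
  by (rule retract_projective[OF reg_projective dec_gmod dec_B dec_C]) (auto simp: dec_CB)

text \<open>\<open>x i\<close> is an eigenvalue of right multiplication by c. Being a root of unity
  is what gives access to the multiplicativity of the lift.\<close>

lemma dec_root: assumes i: "i < d" shows "x i ^ ord c = 1"
proof -
  let ?n = "fst (P i)"
  note cc = preg_carrier[OF c] and cC = hom_carrier[OF dec_C[OF i], unfolded fst_reg] and cB = hom_carrier[OF dec_B[OF i], unfolded fst_reg]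
  have "C i * rmul c ^\<^sub>m k = x i ^ k \<cdot>\<^sub>m C i" for k
  proof (induction k)
    case 0
    thus ?case using cC carrier_matD[OF rmul_carrier[of c]] by auto
  next
    case (Suc k)
    have "C i * rmul c ^\<^sub>m Suc k = C i * rmul c ^\<^sub>m k * rmul c"
      using assoc_mult_mat[OF cC pow_carrier_mat[OF rmul_carrier] rmul_carrier] by simp
    also have "\<dots> = x i ^ k \<cdot>\<^sub>m (C i * rmul c)" unfolding Suc by (rule mult_smult_assoc_mat[OF cC rmul_carrier])
    finally show ?case unfolding dec_CR[OF i] by (intro eq_matI) auto
  qed
  from this[of "ord c"] have "C i = x i ^ ord c \<cdot>\<^sub>m C i" unfolding rmul_pow_ord[OF cc] using cC by simp
  hence "C i * B i = x i ^ ord c \<cdot>\<^sub>m (C i * B i)" using mult_smult_assoc_mat[OF cC cB] by metis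
  hence "(1\<^sub>m ?n :: 'k mat) $$ (0, 0) = (x i ^ ord c \<cdot>\<^sub>m 1\<^sub>m ?n) $$ (0, 0)" using dec_CB[OF i i] by simp
  thus ?thesis using indecomposableD(2)[OF dec_P[OF i]] by simp
qed

text \<open>A nonzero map to an irreducible module is onto, so for irreducible \<open>S\<close>
  these are the indices of the summands that are covers of \<open>S\<close>.\<close>

definition top_of :: "('g, 'k) gmod \<Rightarrow> nat set" where
  "top_of S = {i. i < d \<and> (\<exists>a \<in> gmod_hom G (P i) S. a \<noteq> 0\<^sub>m (fst S) (fst (P i)))}"

lemma finite_top_of [simp]: "finite (top_of S)"
  by (simp add: top_of_def)

lemma top_of_cover: "irreducible_gmod G S \<Longrightarrow> i \<in> top_of S \<Longrightarrow> proj_indec_cover G S (P i)"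
  unfolding top_of_def proj_indec_cover_def
  using dec_P dec_projective irreducible_hom_surjective[OF _ dec_gmod] by blast

text \<open>Under the identification of Hom(kG, S) with S, right multiplication by c on kG becomes the action of c on S; the
  decomposition of kG then provides a basis of S that consists of eigenvectors of c.\<close>

lemma evs_decomposition:
  assumes S: "irreducible_gmod G S"
  shows "evs (snd S c) = image_mset x (mset_set (top_of S))"
proof -
  let ?n = "fst S" and ?D = "top_of S"
  note S' = irreducibleD(1)[OF S] and cc = preg_carrier[OF c]
  have "\<exists>a. a \<in> gmod_hom G (P i) S \<and> a \<noteq> 0\<^sub>m ?n (fst (P i))" if "i \<in> ?D" for i
    using that by (auto simp: top_of_def)
  then obtain a where a: "\<And>i. i \<in> ?D \<Longrightarrow> a i \<in> gmod_hom G (P i) S" "\<And>i. i \<in> ?D \<Longrightarrow> a i \<noteq> 0\<^sub>m ?n (fst (P i))" by metis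
  have Dd: "i < d" if "i \<in> ?D" for i using that by (simp add: top_of_def)
  define q where "q = card ?D"
  obtain h where h: "bij_betw h {..<q} ?D"
    using ex_bij_betw_nat_finite[OF finite_top_of] unfolding q_def atLeast0LessThan by blast
  have hD: "h k \<in> ?D" if "k < q" for k using bij_betwE[OF h] that by blast
  have h_inj: "h k = h l \<longleftrightarrow> k = l" if "k < q" "l < q" for k l
    using bij_betw_imp_inj_on[OF h] that by (auto simp: inj_on_def)
  \<comment> \<open>The nonzero map to \<open>S\<close> on the i-th summand, extended by 0 to kG;
    composing it with right multiplication by c multiplies it by \<open>x i\<close>.\<close>
  define F where "F i = a i * C i" for i
  have F: "F i \<in> gmod_hom G reg S" if "i \<in> ?D" for i
    unfolding F_def by (rule hom_comp[OF reg_gmod dec_gmod S' dec_C a(1)]) (use that Dd in auto)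
  have cF: "F i \<in> carrier_mat ?n num" if "i \<in> ?D" for i using hom_carrier[OF F[OF that]] by simp
  have FR: "F i * rmul c = x i \<cdot>\<^sub>m F i" if i: "i \<in> ?D" for i
  proof -
    note ca = hom_carrier[OF a(1)[OF i]] and cC = hom_carrier[OF dec_C[OF Dd[OF i]], unfolded fst_reg]
    show ?thesis unfolding F_def
      using assoc_mult_mat[OF ca cC rmul_carrier] dec_CR[OF Dd[OF i]] mult_smult_distrib[OF ca cC] by simp
  qed
  have FB: "F i * B l = (if i = l then a i else 0\<^sub>m ?n (fst (P l)))" if i: "i \<in> ?D" and l: "l < d" for i l
  proof -
    note ca = hom_carrier[OF a(1)[OF i]] and cC = hom_carrier[OF dec_C[OF Dd[OF i]]] and cB = hom_carrier[OF dec_B[OF l]]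
    show ?thesis unfolding F_def
      using assoc_mult_mat[OF ca cC cB] dec_CB[OF Dd[OF i] l] ca by auto
  qed
  \<comment> \<open>Column k is the value of \<open>F (h k)\<close> at the identity of G. The
    invertibility of \<open>T\<close> proved below says that these columns form a basis of
    \<open>S\<close>.\<close>
  define T where "T = mat ?n q (\<lambda>(b, k). F (h k) $$ (b, j1))"
  have T: "T \<in> carrier_mat ?n q" by (simp add: T_def)
  define E where "E = mat q q (\<lambda>(k, l). if k = l then x (h k) else 0)"
  have E: "E \<in> carrier_mat q q" by (simp add: E_def)
  have ST: "snd S c * T = T * E"
  proof (rule eq_matI)
    note A = gmod_carrier[OF S' cc]
    fix b k assume "b < dim_row (T * E)" "k < dim_col (T * E)"
    hence bk: "b < ?n" "k < q" using T E by auto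
    note Fk = cF[OF hD[OF bk(2)]]
    have "col T k = col (F (h k)) j1" using bk Fk by (intro eq_vecI) (auto simp: T_def)
    hence "(snd S c * T) $$ (b, k) = (snd S c *\<^sub>v col (F (h k)) j1) $ b" using A T bk by simp
    also have "\<dots> = (F (h k) * rmul c) $$ (b, j1)"
      unfolding col_rmul[OF S' F[OF hD[OF bk(2)]] cc, symmetric]
      using bk Fk carrier_matD[OF rmul_carrier[of c]] by simp
    also have "\<dots> = x (h k) * F (h k) $$ (b, j1)" unfolding FR[OF hD[OF bk(2)]] using Fk bk by simp
    also have "\<dots> = (T * E) $$ (b, k)"
      using bk by (auto simp: T_def E_def scalar_prod_def if_distrib[of "\<lambda>x. _ * x"] cong: if_cong)
    finally show "(snd S c * T) $$ (b, k) = (T * E) $$ (b, k)" .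
  qed (use T E gmod_carrier[OF S' cc] in auto)
  obtain R where R: "R \<in> carrier_mat q ?n" "T * R = 1\<^sub>m ?n" "R * T = 1\<^sub>m q"
  proof (rule bijective_matrix_inverse[OF T])
    fix v :: "'k vec" assume v: "v \<in> carrier_vec q" and Tv: "T *\<^sub>v v = 0\<^sub>v ?n"
    \<comment> \<open>A linear relation between the columns makes this homomorphism vanish at the
      identity, hence everywhere; composing it with the inclusion \<open>B (h k)\<close> isolates
      the k-th coefficient.\<close>
    define Z where "Z = msum ?n num q (\<lambda>k. v $ k \<cdot>\<^sub>m F (h k))"
    have cvF: "v $ k \<cdot>\<^sub>m F (h k) \<in> carrier_mat ?n num" if "k < q" for k using cF[OF hD[OF that]] by simp
    have Z: "Z \<in> gmod_hom G reg S"
    proof (rule homI)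
      fix g assume g: "g \<in> carrier G"
      note Ag = gmod_carrier[OF S' g] and Rg = gmod_carrier[OF reg_gmod g, unfolded fst_reg]
      have 1: "Z * snd reg g = msum ?n num q (\<lambda>k. v $ k \<cdot>\<^sub>m F (h k) * snd reg g)"
        unfolding Z_def by (rule msum_mult[OF Rg cvF])
      have 2: "snd S g * Z = msum ?n num q (\<lambda>k. snd S g * (v $ k \<cdot>\<^sub>m F (h k)))"
        unfolding Z_def by (rule mult_msum[OF Ag cvF])
      show "Z * snd reg g = snd S g * Z" unfolding 1 2
      proof (rule msum_cong)
        fix k assume k: "k < q"
        show "v $ k \<cdot>\<^sub>m F (h k) * snd reg g = snd S g * (v $ k \<cdot>\<^sub>m F (h k))"
          unfolding mult_smult_assoc_mat[OF cF[OF hD[OF k]] Rg] mult_smult_distrib[OF Ag cF[OF hD[OF k]]]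
            hom_commute[OF F[OF hD[OF k]] g] ..
      qed
    qed (simp add: Z_def)
    have Z0: "Z = 0\<^sub>m ?n num"
    proof (rule hom_reg_eqI[OF S' Z])
      show "0\<^sub>m ?n num \<in> gmod_hom G reg S"
        by (rule homI) (use left_mult_zero_mat[OF gmod_carrier[OF reg_gmod]] right_mult_zero_mat[OF gmod_carrier[OF S']] in auto)
      show "col Z j1 = col (0\<^sub>m ?n num) j1"
      proof (rule eq_vecI)
        fix b assume "b < dim_vec (col (0\<^sub>m ?n num :: 'k mat) j1)"
        hence b: "b < ?n" by simp
        have "(v $ k \<cdot>\<^sub>m F (h k)) $$ (b, j1) = v $ k * F (h k) $$ (b, j1)" if "k < q" for k
          using cF[OF hD[OF that]] b by simp
        hence "col Z j1 $ b = (\<Sum>k<q. v $ k * F (h k) $$ (b, j1))"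
          using b by (simp add: Z_def msum_def)
        also have "\<dots> = (T *\<^sub>v v) $ b"
          unfolding mult_mat_vec_index[OF T v b] by (intro sum.cong) (use b in \<open>auto simp: T_def\<close>)
        finally show "col Z j1 $ b = col (0\<^sub>m ?n num) j1 $ b" using Tv b by simp
      qed (simp add: Z_def msum_def)
    qed
    have "v $ k = 0" if k: "k < q" for k
    proof -
      let ?m = "fst (P (h k))"
      note kD = hD[OF k] and cB = hom_carrier[OF dec_B[OF Dd[OF hD[OF k]]], unfolded fst_reg] and ca = hom_carrier[OF a(1)[OF hD[OF k]]]
      obtain i j where ij: "i < ?n" "j < ?m" "a (h k) $$ (i, j) \<noteq> 0"
        using a(2)[OF kD] ca by (metis carrier_matD eq_matI index_zero_mat)
      have vFB: "(v $ l \<cdot>\<^sub>m F (h l) * B (h k)) $$ (i, j) = (if l = k then v $ k * a (h k) $$ (i, j) else 0)" if l: "l < q" for l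
        unfolding mult_smult_assoc_mat[OF cF[OF hD[OF l]] cB] FB[OF hD[OF l] Dd[OF kD]]
        using h_inj[OF l k] ij ca by auto
      have "0 = (Z * B (h k)) $$ (i, j)" using Z0 cB ij by simp
      also have "Z * B (h k) = msum ?n ?m q (\<lambda>l. v $ l \<cdot>\<^sub>m F (h l) * B (h k))"
        unfolding Z_def by (rule msum_mult[OF cB cvF])
      also have "\<dots> $$ (i, j) = (\<Sum>l<q. (v $ l \<cdot>\<^sub>m F (h l) * B (h k)) $$ (i, j))"
        using ij by (simp add: msum_def)
      also have "\<dots> = v $ k * a (h k) $$ (i, j)" using k by (simp add: vFB)
      finally show "v $ k = 0" using ij by simp
    qed
    thus "v = 0\<^sub>v q" using v by (intro eq_vecI) auto
  next
    show "(\<lambda>v. T *\<^sub>v v) ` carrier_vec q = carrier_vec ?n"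
    proof (intro equalityI subsetI)
      fix t :: "'k vec" assume t: "t \<in> carrier_vec ?n"
      have oB: "orb S t * B i \<in> gmod_hom G (P i) S" if "i < d" for i
        by (rule hom_comp[OF dec_gmod[OF that] reg_gmod S' dec_B[OF that] orb_hom[OF S' t]])
      \<comment> \<open>The map from kG that sends the identity to t restricts on each summand with
        top \<open>S\<close> to a multiple of \<open>a i\<close>, and on the other summands to
        0.\<close>
      have "\<exists>s. orb S t * B i = s \<cdot>\<^sub>m a i" if i: "i \<in> ?D" for i
        by (rule projective_top_scalar[OF dec_projective dec_P S a oB]) (use i Dd in auto)
      then obtain s where s: "\<And>i. i \<in> ?D \<Longrightarrow> orb S t * B i = s i \<cdot>\<^sub>m a i" by metis
      have oB0: "orb S t * B i = 0\<^sub>m ?n (fst (P i))" if "i < d" "i \<notin> ?D" for i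
        using oB[OF that(1)] that by (auto simp: top_of_def)
      have cBC: "B i * C i \<in> carrier_mat num num" if "i < d" for i
        using hom_carrier[OF dec_B[OF that]] hom_carrier[OF dec_C[OF that]] by simp
      define v where "v = vec q (\<lambda>k. s (h k))"
      have v: "v \<in> carrier_vec q" by (simp add: v_def)
      have oBC: "orb S t * (B i * C i) = (if i \<in> ?D then s i \<cdot>\<^sub>m F i else 0\<^sub>m ?n num)" if i: "i < d" for i
      proof -
        note cB = hom_carrier[OF dec_B[OF i], unfolded fst_reg] and cC = hom_carrier[OF dec_C[OF i], unfolded fst_reg]
        have "orb S t * (B i * C i) = orb S t * B i * C i" by (rule assoc_mult_mat[OF orb_carrier cB cC, symmetric])
        moreover have "s i \<cdot>\<^sub>m a i * C i = s i \<cdot>\<^sub>m F i" if "i \<in> ?D"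
          unfolding F_def by (rule mult_smult_assoc_mat[OF hom_carrier[OF a(1)[OF that]] cC])
        ultimately show ?thesis using s[of i] oB0[OF i] cC by auto
      qed
      have "t = T *\<^sub>v v"
      proof (rule eq_vecI)
        fix b assume "b < dim_vec (T *\<^sub>v v)"
        hence b: "b < ?n" using T by simp
        have "t $ b = orb S t $$ (b, j1)" using col_orb[OF S' t] b carrier_matD[OF orb_carrier[of S t]] by (metis ix_less one_closed index_col)
        also have "orb S t = orb S t * msum num num d (\<lambda>i. B i * C i)"
          unfolding dec_sum using right_mult_one_mat[OF orb_carrier] by simp
        also have "\<dots> = msum ?n num d (\<lambda>i. orb S t * (B i * C i))" by (rule mult_msum[OF orb_carrier cBC])
        also have "\<dots> $$ (b, j1) = (\<Sum>i<d. (orb S t * (B i * C i)) $$ (b, j1))" using b by (simp add: msum_def)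
        also have "\<dots> = (\<Sum>i\<in>?D. s i * F i $$ (b, j1))"
        proof (rule sum.mono_neutral_cong_right)
          show "?D \<subseteq> {..<d}" using Dd by auto
          show "\<forall>i\<in>{..<d} - ?D. (orb S t * (B i * C i)) $$ (b, j1) = 0" using oBC b by simp
          fix i assume "i \<in> ?D"
          thus "(orb S t * (B i * C i)) $$ (b, j1) = s i * F i $$ (b, j1)" using oBC[of i] Dd cF[of i] b by simp
        qed simp
        also have "\<dots> = (\<Sum>k<q. s (h k) * F (h k) $$ (b, j1))" by (rule sum.reindex_bij_betw[OF h, symmetric])
        also have "\<dots> = (T *\<^sub>v v) $ b"
          unfolding mult_mat_vec_index[OF T v b] by (intro sum.cong) (use b in \<open>auto simp: T_def v_def\<close>)
        finally show "t $ b = (T *\<^sub>v v) $ b" .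
      qed (use t T in auto)
      thus "t \<in> (\<lambda>v. T *\<^sub>v v) ` carrier_vec q" using v by blast
    qed (use T in auto)
  qed
  have "evs (snd S c) = evs E" by (rule evs_intertwined[OF gmod_carrier[OF S' cc] E T R ST])
  also have "\<dots> = mset (diag_mat E)" by (rule evs_upper_triangular[OF E]) (auto simp: E_def)
  also have "\<dots> = image_mset (\<lambda>k. E $$ (k, k)) (mset_set {..<q})" by (rule mset_diag_mat[OF E])
  also have "\<dots> = image_mset (\<lambda>k. x (h k)) (mset_set {..<q})" by (rule image_mset_cong) (auto simp: E_def)
  also have "\<dots> = image_mset x (image_mset h (mset_set {..<q}))" by (simp add: multiset.map_comp comp_def)
  also have "image_mset h (mset_set {..<q}) = mset_set ?D"
    using image_mset_mset_set[OF bij_betw_imp_inj_on[OF h]] bij_betw_imp_surj_on[OF h] by simp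
  finally show ?thesis .
qed

lemma Br_decomposition:
  assumes "irreducible_gmod G S"
  shows "Br S c = (\<Sum>i\<in>top_of S. \<theta> (x i))"
  unfolding Br_eq[OF c] bt_def evs_decomposition[OF assms]
  by (simp add: sum_unfold_sum_mset multiset.map_comp comp_def)

text \<open>On the i-th summand the operator is \<open>x i\<close> times the action of the inverse
  of g; the lift is multiplicative on the eigenvalues, which are roots of unity, and inversion of g
  becomes conjugation.\<close>

lemma bt_decomposition:
  assumes g: "g \<in> preg"
  shows "bt (snd reg (inv g) * rmul c) = (\<Sum>i<d. cnj (Br (P i) g) * \<theta> (x i))"
proof -
  note gi = inv_preg[OF g]
  note gic = preg_carrier[OF gi]
  have "bt (snd reg (inv g) * rmul c) = (\<Sum>i<d. \<Sum>y\<in>#evs (snd (P i) (inv g)). \<theta> (x i * y))"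
  proof -
    have "(\<Sum>z\<in>#(\<Sum>i<k. image_mset ((*) (x i)) (evs (snd (P i) (inv g)))). \<theta> z) =
      (\<Sum>i<k. \<Sum>y\<in>#evs (snd (P i) (inv g)). \<theta> (x i * y))" for k
      by (induction k) (auto simp: multiset.map_comp comp_def)
    thus ?thesis unfolding bt_def dec_evs[OF gic] .
  qed
  also have "\<dots> = (\<Sum>i<d. cnj (Br (P i) g) * \<theta> (x i))"
  proof (rule sum.cong[OF refl])
    fix i assume "i \<in> {..<d}"
    hence i: "i < d" by simp
    have "(\<Sum>y\<in>#evs (snd (P i) (inv g)). \<theta> (x i * y)) = (\<Sum>y\<in>#evs (snd (P i) (inv g)). \<theta> (x i) * \<theta> y)"
    proof (intro arg_cong[of _ _ sum_mset] image_mset_cong)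
      fix y assume y: "y \<in># evs (snd (P i) (inv g))"
      show "\<theta> (x i * y) = \<theta> (x i) * \<theta> y"
        by (rule lift_mult[OF dec_root[OF i] ord_pos[OF preg_carrier[OF c]] evs_root_of_unity[OF dec_gmod[OF i] gic y] ord_pos[OF gic]])
    qed
    also have "\<dots> = \<theta> (x i) * Br (P i) (inv g)" by (simp add: Br_eq[OF gi] bt_def sum_mset_distrib_left multiset.map_comp comp_def)
    finally show "(\<Sum>y\<in>#evs (snd (P i) (inv g)). \<theta> (x i * y)) = cnj (Br (P i) g) * \<theta> (x i)"
      using Br_inv[OF dec_gmod[OF i] g] by simp
  qed
  finally show ?thesis .
qed

end

text \<open>The order of a p-regular element is invertible in the field, which is the condition for
  decomposing along right multiplication by it.\<close>

lemma decomposition_reg: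
  assumes c: "c \<in> preg"
  obtains d P B C x where "decomposition G reg (rmul c) d P B C x"
proof -
  have "(of_nat (ord c) :: 'k) \<noteq> 0" using of_nat_eq_0_iff_coprime[OF char_pos] preg_coprime[OF c] by blast
  thus ?thesis
    using decomposition_exists[OF reg_gmod rmul_hom, of c "ord c"] rmul_pow_ord preg_carrier[OF c] that by auto
qed

section \<open>Orthogonality\<close>

text \<open>Modules are compared up to isomorphism here because irreducible Brauer characters are
  not yet known to separate them; \<open>IBr\<close> takes over as index set once they are.\<close>

definition simple_system :: "('g, 'k) gmod set \<Rightarrow> bool" where
  "simple_system J \<longleftrightarrow> finite J \<and> (\<forall>S\<in>J. irreducible_gmod G S) \<and> (\<forall>S\<in>J. \<forall>T\<in>J. gmod_iso G S T \<longrightarrow> S = T)"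

definition complete_system :: "('g, 'k) gmod set \<Rightarrow> bool" where
  "complete_system J \<longleftrightarrow> simple_system J \<and> (\<forall>S. irreducible_gmod G S \<longrightarrow> (\<exists>T\<in>J. gmod_iso G S T))"

text \<open>The sets \<open>top_of S\<close> partition the summands: every summand has a simple
  quotient, and projectivity makes it unique up to isomorphism. In the part belonging to
  \<open>S\<close> every summand is a cover of \<open>S\<close>, and the lifted scalars add up to
  S(c).\<close>

theorem Br_orthogonality:
  assumes J: "complete_system J" and PC: "\<And>S. S \<in> J \<Longrightarrow> proj_indec_cover G S (PC S)"
    and g: "g \<in> preg" and c: "c \<in> preg"
  shows "(\<Sum>S\<in>J. cnj (Br (PC S) g) * Br S c) = of_nat (card {x \<in> carrier G. x \<otimes> c = g \<otimes> x})"
proof -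
  obtain d P B C x where dec: "decomposition G reg (rmul c) d P B C x" by (rule decomposition_reg[OF c])
  note J = J[unfolded complete_system_def simple_system_def]
  let ?D = "\<lambda>S. top_of d P S"
  have irr: "irreducible_gmod G S" if "S \<in> J" for S using J that by blast
  have un: "(\<Union>S\<in>J. ?D S) = {..<d}"
  proof (intro equalityI subsetI)
    fix i assume "i \<in> {..<d}"
    hence i: "i < d" by simp
    note Pi = dec_gmod[OF c dec i]
    obtain S T where S: "irreducible_gmod G S" and T: "T \<in> gmod_epi G (P i) S"
      using simple_quotient_exists[OF Pi indecomposableD(2)[OF dec_P[OF c dec i]]] by blast
    obtain S' where S': "S' \<in> J" "gmod_iso G S S'" using J S by blast
    obtain F R where F: "F \<in> gmod_hom G S S'" and R: "R \<in> gmod_hom G S' S" "R * F = 1\<^sub>m (fst S)"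
      using S'(2) by (auto simp: gmod_iso_def)
    note cT = hom_carrier[OF epi_hom[OF T]]
    have FT: "F * T \<in> gmod_hom G (P i) S'"
      by (rule hom_comp[OF Pi irreducibleD(1)[OF S] irreducibleD(1)[OF irr[OF S'(1)]] epi_hom[OF T] F])
    have "F * T \<noteq> 0\<^sub>m (fst S') (fst (P i))"
    proof
      assume 0: "F * T = 0\<^sub>m (fst S') (fst (P i))"
      have "T = R * (F * T)" by (rule mat_cancel_left[OF R(2), symmetric]) (use cT hom_carrier[OF F] hom_carrier[OF R(1)] in auto)
      also have "\<dots> = 0\<^sub>m (fst S) (fst (P i))" unfolding 0 using hom_carrier[OF R(1)] by simp
      finally show False using epi_nonzero[OF T irreducibleD(2)[OF S]] by simp
    qed
    hence "i \<in> ?D S'" using FT i by (auto simp: top_of_def[OF c dec])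
    thus "i \<in> (\<Union>S\<in>J. ?D S)" using S' by blast
  qed (auto simp: top_of_def[OF c dec])
  have disj: "?D S \<inter> ?D T = {}" if "S \<in> J" "T \<in> J" "S \<noteq> T" for S T
  proof (rule ccontr)
    assume "?D S \<inter> ?D T \<noteq> {}"
    then obtain i a b where i: "i < d" and a: "a \<in> gmod_hom G (P i) S" "a \<noteq> 0\<^sub>m (fst S) (fst (P i))"
      and b: "b \<in> gmod_hom G (P i) T" "b \<noteq> 0\<^sub>m (fst T) (fst (P i))" by (auto simp: top_of_def[OF c dec])
    have "gmod_iso G S T"
      by (rule projective_top_unique[OF dec_projective[OF c dec i] dec_P[OF c dec i] irr[OF that(1)] irr[OF that(2)] a b])
    thus False using J that by blast
  qed
  have "(\<Sum>i<d. cnj (Br (P i) g) * \<theta> (x i)) = (\<Sum>S\<in>J. \<Sum>i\<in>?D S. cnj (Br (P i) g) * \<theta> (x i))"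
    unfolding un[symmetric] by (rule sum.UNION_disjoint) (use J disj finite_top_of[OF c dec] in auto)
  also have "\<dots> = (\<Sum>S\<in>J. cnj (Br (PC S) g) * Br S c)"
  proof (rule sum.cong[OF refl])
    fix S assume S: "S \<in> J"
    have "Br (P i) = Br (PC S)" if i: "i \<in> ?D S" for i
    proof -
      have cov: "proj_indec_cover G S (P i)" by (rule top_of_cover[OF c dec irr[OF S] i])
      show ?thesis
        by (rule Br_iso[OF _ _ proj_indec_cover_unique[OF irr[OF S] cov PC[OF S]]])
           (use cov PC[OF S] in \<open>auto simp: proj_indec_cover_def indecomposable_gmod_def\<close>)
    qed
    thus "(\<Sum>i\<in>?D S. cnj (Br (P i) g) * \<theta> (x i)) = cnj (Br (PC S) g) * Br S c"
      by (simp add: Br_decomposition[OF c dec irr[OF S]] sum_distrib_left)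
  qed
  finally show ?thesis using bt_decomposition[OF c dec g] bt_reg_rmul[OF g c] by simp
qed


section \<open>The number of irreducible modules\<close>

text \<open>The lift of \<open>y\<close> satisfies an equation z^m = 1 with m prime to p and one
  whose exponent is a power of p; a Bezout identity leaves only z = 1.\<close>

lemma p_power_root_trivial:
  fixes y :: 'k
  assumes y: "y ^ (CHAR('k) ^ a) = 1"
  shows "y = 1"
proof -
  let ?q = "CHAR('k) ^ a"
  have q: "?q > 0" using char_pos by simp
  obtain m where m: "m > 0" "coprime m CHAR('k)" "\<theta> y ^ m = 1" using lift_root[OF y q] by blast
  obtain u v where uv: "?q * u = m * v + gcd ?q m" using bezout_nat[of ?q m] q by auto
  have "coprime ?q m" using m(2) by (simp add: coprime_commute)
  hence "?q * u = Suc (m * v)" using uv by (simp add: coprime_iff_gcd_eq_1)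
  hence "\<theta> y ^ (?q * u) = \<theta> y * \<theta> y ^ (m * v)" by simp
  hence "\<theta> y = 1" using lift_power_eq_1[OF y q] m(3) by (simp add: power_mult)
  thus ?thesis using lift_inj[OF y q, of 1 1] by simp
qed

text \<open>\<open>h\<close> is the p-regular part of g: the power g^q with q divisible by the
  p-part of \<open>ord g\<close> and congruent to 1 modulo the remaining factor m. The eigenvalues
  of g are m-th roots of unity, since 1 is the only root of unity of p-power order in k; raising
  them to the power q changes nothing.\<close>

lemma tr_regular_part:
  assumes g: "g \<in> carrier G"
  obtains h where "h \<in> preg" "\<And>M. is_gmod G M \<Longrightarrow> tr (snd M g) = tr (snd M h :: 'k mat)"
proof -
  let ?p = "CHAR('k)"
  have p: "prime ?p" using char_pos prime_CHAR_semidom by blast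
  have "ord g \<noteq> 0" using ord_pos[OF g] by simp
  then obtain m where m: "ord g = ?p ^ multiplicity ?p (ord g) * m" "\<not> ?p dvd m"
    using multiplicity_decompose'[of "ord g" ?p] p not_prime_unit by blast
  define a where "a = multiplicity ?p (ord g)"
  have om: "ord g = ?p ^ a * m" using m(1) by (simp add: a_def)
  have cop: "coprime ?p m" using p m(2) by (simp add: prime_imp_coprime)
  have m0: "m > 0" using om ord_pos[OF g] by (cases m) auto
  obtain u v where uv: "?p ^ a * u = m * v + gcd (?p ^ a) m" using bezout_nat[of "?p ^ a" m] char_pos by auto
  define q where "q = ?p ^ a * u"
  have "gcd (?p ^ a) m = 1" using cop by simp
  hence q: "q = Suc (m * v)" using uv by (simp add: q_def)
  define h where "h = g [^] q"
  have hc: "h \<in> carrier G" using g by (simp add: h_def)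
  have "g [^] (q * m) = \<one>" using g by (simp add: pow_eq_id om q_def mult_ac)
  hence "h [^] m = \<one>" using g by (simp add: h_def nat_pow_pow)
  hence "ord h dvd m" using hc by (simp add: pow_eq_id)
  moreover have "coprime m ?p" using cop by (simp only: coprime_commute)
  ultimately have "coprime (ord h) ?p" using coprime_divisors[OF _ dvd_refl] by blast
  hence "h \<in> preg" using hc by (simp add: p_regular_def char)
  moreover have "tr (snd M g) = tr (snd M h)" if M: "is_gmod G M" for M :: "('g, 'k) gmod"
  proof -
    have "evs (snd M h) = image_mset (\<lambda>x. x ^ q) (evs (snd M g))"
      unfolding h_def gmod_pow[OF M g] by (rule evs_pow[OF gmod_carrier[OF M g]])
    also have "\<dots> = image_mset (\<lambda>x. x) (evs (snd M g))"
    proof (rule image_mset_cong)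
      fix x assume "x \<in># evs (snd M g)"
      from evs_root_of_unity[OF M g this] have "(x ^ m) ^ (?p ^ a) = 1"
        unfolding om by (metis mult.commute power_mult)
      hence "x ^ m = 1" by (rule p_power_root_trivial)
      thus "x ^ q = x" unfolding q by (simp add: power_mult)
    qed
    finally show ?thesis unfolding tr_evs[OF gmod_carrier[OF M g]] tr_evs[OF gmod_carrier[OF M hc]] by simp
  qed
  ultimately show ?thesis by (rule that)
qed

lemma tr_conj_class:
  fixes M :: "('g, 'k) gmod"
  assumes M: "is_gmod G M" and g: "g \<in> carrier G" and h: "h \<in> conj_class G g"
  shows "tr (snd M h) = tr (snd M g)"
proof -
  obtain x where x: "x \<in> carrier G" "h = x \<otimes> g \<otimes> inv x" using h by (auto simp: conj_class_def)
  hence hc: "h \<in> carrier G" using g by simp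
  show ?thesis unfolding tr_evs[OF gmod_carrier[OF M g]] tr_evs[OF gmod_carrier[OF M hc]]
    using evs_conj[OF M g x(1)] x(2) by simp
qed

text \<open>The coordinates of an idempotent e of the group algebra that generates a projective cover of S; e acts on S as a
  projection onto a line, and as zero on the other irreducible modules.\<close>

lemma trace_separates:
  assumes S: "irreducible_gmod G S"
  obtains \<epsilon> :: "nat \<Rightarrow> 'k" where "(\<Sum>j<num. \<epsilon> j * tr (snd S (en j))) = 1"
    "\<And>T. irreducible_gmod G T \<Longrightarrow> \<not> gmod_iso G S T \<Longrightarrow> (\<Sum>j<num. \<epsilon> j * tr (snd T (en j))) = 0"
proof -
  obtain d P B C x where dec: "decomposition G reg (rmul \<one>) d P B C x" by (rule decomposition_reg[OF one_preg])
  note S' = irreducibleD(1)[OF S]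
  have "size (evs (snd S \<one>)) = fst S" by (rule size_evs[OF gmod_carrier[OF S' one_closed]])
  hence "top_of d P S \<noteq> {}"
    using evs_decomposition[OF one_preg dec S] irreducibleD(2)[OF S] by auto
  then obtain i a where i: "i < d" and a: "a \<in> gmod_hom G (P i) S" "a \<noteq> 0\<^sub>m (fst S) (fst (P i))"
    by (auto simp: top_of_def[OF one_preg dec])
  note Pi = dec_gmod[OF one_preg dec i] and pP = dec_projective[OF one_preg dec i] and iP = dec_P[OF one_preg dec i]
  note hB = dec_B[OF one_preg dec i] and hC = dec_C[OF one_preg dec i]
  note cB = hom_carrier[OF hB, unfolded fst_reg] and cC = hom_carrier[OF hC, unfolded fst_reg] and ca = hom_carrier[OF a(1)]
  have CB: "C i * B i = 1\<^sub>m (fst (P i))" using dec_CB[OF one_preg dec i i] by simp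
  \<comment> \<open>The projection of kG onto the i-th summand; as an endomorphism of the left
    module it is right multiplication by an idempotent e.\<close>
  define E where "E = B i * C i"
  have E: "E \<in> carrier_mat num num" using cB cC by (simp add: E_def)
  \<comment> \<open>The image of the identity element under \<open>E\<close>, that is, the
    coordinates of e.\<close>
  define \<epsilon> where "\<epsilon> j = E $$ (j, j1)" for j
  \<comment> \<open>The matrix by which e acts on \<open>T\<close>. Applying it to t amounts to
    evaluating \<open>orb T t * E\<close> at the identity element.\<close>
  define N where "N T = mat (fst T) (fst T) (\<lambda>(b, a). \<Sum>j<num. \<epsilon> j * snd T (en j) $$ (b, a))" for T :: "('g, 'k) gmod"
  have cN: "N T \<in> carrier_mat (fst T) (fst T)" for T by (simp add: N_def)
  have trN: "tr (N T) = (\<Sum>j<num. \<epsilon> j * tr (snd T (en j)))" if T: "is_gmod G T" for T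
  proof -
    have "tr (N T) = (\<Sum>a<fst T. \<Sum>j<num. \<epsilon> j * snd T (en j) $$ (a, a))" by (simp add: tr_def N_def)
    also have "\<dots> = (\<Sum>j<num. \<epsilon> j * tr (snd T (en j)))"
      using carrier_matD(1)[OF gmod_carrier[OF T en_carrier]]
      by (subst sum.swap) (auto simp: tr_def sum_distrib_left intro!: sum.cong)
    finally show ?thesis .
  qed
  have N: "N T *\<^sub>v t = col (orb T t * E) j1" if T: "is_gmod G T" and t: "t \<in> carrier_vec (fst T)" for T t
  proof (rule eq_vecI)
    fix b assume "b < dim_vec (col (orb T t * E) j1)"
    hence b: "b < fst T" using carrier_matD[OF orb_carrier[of T t]] by simp
    have o: "orb T t $$ (b, j) = (\<Sum>a<fst T. snd T (en j) $$ (b, a) * t $ a)" if "j < num" for j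
      unfolding mult_mat_vec_index[OF gmod_carrier[OF T en_carrier[OF that]] t b, symmetric] using b that by (simp add: orb_def)
    have "(N T *\<^sub>v t) $ b = (\<Sum>a<fst T. \<Sum>j<num. \<epsilon> j * snd T (en j) $$ (b, a) * t $ a)"
      unfolding mult_mat_vec_index[OF cN t b] using b by (simp add: N_def sum_distrib_right)
    also have "\<dots> = (\<Sum>j<num. orb T t $$ (b, j) * E $$ (j, j1))"
      by (subst sum.swap) (auto simp: o \<epsilon>_def sum_distrib_left sum_distrib_right mult_ac intro!: sum.cong)
    also have "\<dots> = (orb T t * E) $$ (b, j1)"
      using b E carrier_matD[OF orb_carrier[of T t]] by (simp add: scalar_prod_def atLeast0LessThan)
    also have "\<dots> = col (orb T t * E) j1 $ b"
      using b E carrier_matD[OF orb_carrier[of T t]] by simp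
    finally show "(N T *\<^sub>v t) $ b = col (orb T t * E) j1 $ b" .
  qed (use cN[of T] carrier_matD[OF orb_carrier[of T t]] in simp)
  have oE: "orb T t * E = orb T t * B i * C i" for T t unfolding E_def by (rule assoc_mult_mat[OF orb_carrier cB cC, symmetric])
  have oB: "orb T t * B i \<in> gmod_hom G (P i) T" if "is_gmod G T" "t \<in> carrier_vec (fst T)" for T t
    by (rule hom_comp[OF Pi reg_gmod that(1) hB orb_hom[OF that]])
  show ?thesis
  proof (rule that)
    fix T :: "('g, 'k) gmod"
    assume T: "irreducible_gmod G T" and ni: "\<not> gmod_iso G S T"
    note T' = irreducibleD(1)[OF T]
    have "N T *\<^sub>v t = 0\<^sub>v (fst T)" if t: "t \<in> carrier_vec (fst T)" for t
    proof -
      have "orb T t * B i = 0\<^sub>m (fst T) (fst (P i))"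
        using projective_top_unique[OF pP iP S T a oB[OF T' t]] ni by blast
      thus ?thesis unfolding N[OF T' t] oE using cC by (simp add: left_mult_zero_mat[OF cC])
    qed
    hence "N T = 0\<^sub>m (fst T) (fst T)" using eq_mat_by_vec[OF cN zero_carrier_mat] by simp
    thus "(\<Sum>j<num. \<epsilon> j * tr (snd T (en j))) = 0" unfolding trN[OF T', symmetric] by (simp add: tr_def)
  next
    \<comment> \<open>The vector of \<open>S\<close> that corresponds to \<open>F\<close> is
      \<open>u\<close> below; it is fixed by e, and e maps every vector to a multiple of it.\<close>
    define F where "F = a * C i"
    have F: "F \<in> gmod_hom G reg S" unfolding F_def by (rule hom_comp[OF reg_gmod Pi S' hC a(1)])
    have cF: "F \<in> carrier_mat (fst S) num" using hom_carrier[OF F] by simp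
    define u where "u = col F j1"
    have u: "u \<in> carrier_vec (fst S)" unfolding u_def by (rule carrier_vecI) (use cF in simp)
    have ou: "orb S u = F" unfolding u_def by (rule orb_col[OF S' F])
    have FB: "F * B i = a" unfolding F_def using assoc_mult_mat[OF ca cC cB] CB right_mult_one_mat[OF ca] by simp
    have "F * E = F" using oE[of S u] unfolding ou FB F_def[symmetric] .
    hence Nu: "N S *\<^sub>v u = u" unfolding N[OF S' u] ou by (simp add: u_def)
    have "\<exists>s. orb S t * B i = s \<cdot>\<^sub>m a" if "t \<in> carrier_vec (fst S)" for t
      by (rule projective_top_scalar[OF pP iP S a oB[OF S' that]])
    then obtain s where s: "\<And>t. t \<in> carrier_vec (fst S) \<Longrightarrow> orb S t * B i = s t \<cdot>\<^sub>m a" by metis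
    have Nt: "N S *\<^sub>v t = s t \<cdot>\<^sub>v u" if t: "t \<in> carrier_vec (fst S)" for t
    proof -
      have "orb S t * E = s t \<cdot>\<^sub>m F" unfolding oE s[OF t] F_def by (rule mult_smult_assoc_mat[OF ca cC])
      thus ?thesis unfolding N[OF S' t] u_def using cF by (intro eq_vecI) auto
    qed
    \<comment> \<open>The matrix of e on \<open>S\<close> is thus the product of the column
      \<open>u\<close> with a row; its trace is the factor by which it multiplies \<open>u\<close>,
      namely 1.\<close>
    have Nba: "N S $$ (b, k) = s (unit_vec (fst S) k) * u $ b" if "b < fst S" "k < fst S" for b k
    proof -
      have "N S $$ (b, k) = (N S *\<^sub>v unit_vec (fst S) k) $ b"
        using mult_mat_unit_vec[OF cN that(2)] cN[of S] that by simp
      thus ?thesis using Nt[of "unit_vec (fst S) k"] u that by simp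
    qed
    have "u \<noteq> 0\<^sub>v (fst S)"
    proof
      assume 0: "u = 0\<^sub>v (fst S)"
      have "orb S u = 0\<^sub>m (fst S) num"
        using mult_mat_vec_zero'[OF gmod_carrier[OF S' en_carrier]] unfolding 0 by (intro eq_matI) (auto simp: orb_def)
      hence "a = 0\<^sub>m (fst S) (fst (P i))" using FB ou cB by simp
      thus False using a(2) by simp
    qed
    then obtain b where b: "b < fst S" "u $ b \<noteq> 0" using u by (metis carrier_vecD eq_vecI index_zero_vec)
    have "u $ b = (N S *\<^sub>v u) $ b" using Nu by simp
    also have "\<dots> = (\<Sum>k<fst S. N S $$ (b, k) * u $ k)" by (rule mult_mat_vec_index[OF cN u b(1)])
    also have "\<dots> = (\<Sum>k<fst S. N S $$ (k, k) * u $ b)" using Nba b by (intro sum.cong) auto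
    also have "\<dots> = tr (N S) * u $ b" using cN[of S] by (simp add: tr_def sum_distrib_right)
    finally have "tr (N S) = 1" using b(2) by simp
    thus "(\<Sum>j<num. \<epsilon> j * tr (snd S (en j))) = 1" unfolding trN[OF S'] .
  qed
qed

context
  fixes K :: "'g set"
  assumes K: "p_regular_reps G p K"
begin

lemma reps_preg: "c \<in> K \<Longrightarrow> c \<in> preg"
  using K by (auto simp: p_regular_reps_def)

lemma reps_carrier: "c \<in> K \<Longrightarrow> c \<in> carrier G"
  using reps_preg preg_carrier by blast

lemma reps_ex: "g \<in> preg \<Longrightarrow> \<exists>c\<in>K. c \<in> conj_class G g"
  using K by (auto simp: p_regular_reps_def)

lemma finite_reps: "finite K"
  using reps_carrier fin by (meson finite_subset subsetI)

text \<open>With more irreducible modules than classes there is a nontrivial linear relation between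
  their traces on the representatives. It extends to all of G, since a trace depends only on the
  class of the p-regular part, and the functionals of \<open>trace_separates\<close> show that all
  its coefficients vanish.\<close>

theorem card_simple_system_le:
  assumes J: "simple_system J"
  shows "card J \<le> card K"
proof (rule ccontr)
  assume "\<not> card J \<le> card K"
  hence lt: "card K < card J" by simp
  note J = J[unfolded simple_system_def]
  obtain h where h: "bij_betw h {..<card J} J" using ex_bij_betw_nat_finite[of J] J unfolding atLeast0LessThan by blast
  obtain k where k: "bij_betw k {..<card K} K" using ex_bij_betw_nat_finite[OF finite_reps] unfolding atLeast0LessThan by blast
  have hJ: "h l \<in> J" if "l < card J" for l using bij_betwE[OF h] that by blast
  have irr: "irreducible_gmod G (h l)" if "l < card J" for l using J hJ[OF that] by blast
  have gm: "is_gmod G (h l)" if "l < card J" for l using irreducibleD(1)[OF irr[OF that]] .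
  define Z where "Z = mat (card K) (card J) (\<lambda>(i, l). tr (snd (h l) (k i)))"
  have Z: "Z \<in> carrier_mat (card K) (card J)" by (simp add: Z_def)
  obtain v where v: "v \<in> carrier_vec (card J)" "v \<noteq> 0\<^sub>v (card J)" "Z *\<^sub>v v = 0\<^sub>v (card K)"
    using wide_matrix_kernel[OF Z lt] by blast
  have rel_K: "(\<Sum>l<card J. tr (snd (h l) c) * v $ l) = 0" if "c \<in> K" for c
  proof -
    have "c \<in> k ` {..<card K}" using bij_betw_imp_surj_on[OF k] that by simp
    then obtain i where i: "i < card K" "c = k i" by auto
    have "0 = (Z *\<^sub>v v) $ i" using v(3) i by simp
    also have "\<dots> = (\<Sum>l<card J. Z $$ (i, l) * v $ l)" by (rule mult_mat_vec_index[OF Z v(1) i(1)])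
    finally show ?thesis using i by (simp add: Z_def)
  qed
  have rel: "(\<Sum>l<card J. tr (snd (h l) g) * v $ l) = 0" if g: "g \<in> carrier G" for g
  proof -
    obtain g' where g': "g' \<in> preg" "\<And>M. is_gmod G M \<Longrightarrow> tr (snd M g) = tr (snd M g' :: 'k mat)"
      by (rule tr_regular_part[OF g]) blast
    obtain c where c: "c \<in> K" "c \<in> conj_class G g'" using reps_ex[OF g'(1)] by blast
    have "tr (snd (h l) g) = tr (snd (h l) c)" if "l < card J" for l
      using g'(2)[OF gm[OF that]] tr_conj_class[OF gm[OF that] preg_carrier[OF g'(1)] c(2)] by simp
    thus ?thesis using rel_K[OF c(1)] by simp
  qed
  have "v $ l = 0" if l: "l < card J" for l
  proof -
    obtain \<epsilon> :: "nat \<Rightarrow> 'k" where e1: "(\<Sum>j<num. \<epsilon> j * tr (snd (h l) (en j))) = 1"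
      and e0: "\<And>T. irreducible_gmod G T \<Longrightarrow> \<not> gmod_iso G (h l) T \<Longrightarrow> (\<Sum>j<num. \<epsilon> j * tr (snd T (en j))) = 0"
      using trace_separates[OF irr[OF l]] by blast
    have e: "(\<Sum>j<num. \<epsilon> j * tr (snd (h l') (en j))) = (if l' = l then 1 else 0)" if l': "l' < card J" for l'
    proof (cases "l' = l")
      case False
      hence "h l' \<noteq> h l" using bij_betw_imp_inj_on[OF h] l l' by (auto simp: inj_on_def)
      hence "\<not> gmod_iso G (h l) (h l')" using J hJ[OF l] hJ[OF l'] by metis
      thus ?thesis using e0[OF irr[OF l']] False by simp
    qed (simp add: e1)
    have "0 = (\<Sum>j<num. \<epsilon> j * (\<Sum>l'<card J. tr (snd (h l') (en j)) * v $ l'))" using rel by simp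
    also have "\<dots> = (\<Sum>l'<card J. (\<Sum>j<num. \<epsilon> j * tr (snd (h l') (en j))) * v $ l')"
      unfolding sum_distrib_left sum_distrib_right by (subst sum.swap) (simp add: mult_ac)
    also have "\<dots> = (\<Sum>l'<card J. if l' = l then v $ l else 0)" using e by (intro sum.cong) auto
    also have "\<dots> = v $ l" using l by simp
    finally show ?thesis ..
  qed
  thus False using v(1,2) by (metis carrier_vecD eq_vecI index_zero_vec)
qed

text \<open>The bound on simple systems provides one of largest cardinality, which cannot be
  enlarged.\<close>

lemma complete_system_exists: "\<exists>J. complete_system J"
proof -
  have "simple_system {}" by (simp add: simple_system_def)
  moreover have "\<forall>J. simple_system J \<longrightarrow> card J < Suc (card K)" using card_simple_system_le by (simp add: less_Suc_eq_le)
  ultimately obtain J where J: "simple_system J" and max: "\<And>J'. simple_system J' \<Longrightarrow> card J' \<le> card J"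
    using ex_has_greatest_nat[of simple_system "{}" card "Suc (card K)"] by metis
  have "\<exists>T\<in>J. gmod_iso G S T" if S: "irreducible_gmod G S" for S
  proof (rule ccontr)
    assume n: "\<not> (\<exists>T\<in>J. gmod_iso G S T)"
    have "S \<notin> J" using n gmod_iso_refl[OF irreducibleD(1)[OF S]] by blast
    moreover have "simple_system (insert S J)" using J S n gmod_iso_sym unfolding simple_system_def by blast
    ultimately show False using max[of "insert S J"] J by (auto simp: simple_system_def)
  qed
  thus ?thesis using J unfolding complete_system_def by blast
qed

end

end

section \<open>Composition series\<close>

text \<open>A composition series consists of sets of vectors, whereas eigenvalues and simple
  quotients need modules; \<open>X\<close> embeds such a module with image \<open>V\<close>, and
  \<open>Y\<close> is a linear, not necessarily equivariant, retraction.\<close>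

definition realizes ::
  "('g, 'b) monoid_scheme \<Rightarrow> ('g, 'k :: field) gmod \<Rightarrow> 'k vec set \<Rightarrow> ('g, 'k) gmod \<Rightarrow> 'k mat \<Rightarrow> 'k mat \<Rightarrow> bool" where
  "realizes G M V N X Y \<longleftrightarrow> is_gmod G N \<and> X \<in> gmod_hom G N M \<and> Y \<in> carrier_mat (fst N) (fst M) \<and>
     Y * X = 1\<^sub>m (fst N) \<and> (\<lambda>v. X *\<^sub>v v) ` carrier_vec (fst N) = V"

lemma realizes_exists:
  fixes M :: "('g, 'k :: field) gmod"
  assumes "is_gmod G M" "gsubmod G M V"
  shows "\<exists>N X Y. realizes G M V N X Y"
proof -
  obtain N N' X Y X' Y' where "sub_quot G M V N N' X Y X' Y'" by (rule sub_quot_exists[OF assms])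
  thus ?thesis unfolding sub_quot_def splitting_def realizes_def by blast
qed

lemma realizes_full: "is_gmod G M \<Longrightarrow> realizes G M (carrier_vec (fst M)) M (1\<^sub>m (fst M)) (1\<^sub>m (fst M))"
  using hom_id[of G M] by (auto simp: realizes_def image_iff)

lemma realizesD:
  assumes "realizes G M V N X Y"
  shows "is_gmod G N" "X \<in> gmod_hom G N M" "X \<in> carrier_mat (fst M) (fst N)" "Y \<in> carrier_mat (fst N) (fst M)"
    "Y * X = 1\<^sub>m (fst N)" "v \<in> carrier_vec (fst N) \<Longrightarrow> X *\<^sub>v v \<in> V"
    "v \<in> carrier_vec (fst N) \<Longrightarrow> Y *\<^sub>v (X *\<^sub>v v) = v" "u \<in> V \<Longrightarrow> \<exists>v\<in>carrier_vec (fst N). u = X *\<^sub>v v"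
proof -
  note a = assms[unfolded realizes_def]
  show "is_gmod G N" "X \<in> gmod_hom G N M" "Y \<in> carrier_mat (fst N) (fst M)" and YX: "Y * X = 1\<^sub>m (fst N)" using a by auto
  show cX: "X \<in> carrier_mat (fst M) (fst N)" using a hom_carrier by blast
  show "v \<in> carrier_vec (fst N) \<Longrightarrow> X *\<^sub>v v \<in> V" "u \<in> V \<Longrightarrow> \<exists>v\<in>carrier_vec (fst N). u = X *\<^sub>v v" using a by auto
  show "v \<in> carrier_vec (fst N) \<Longrightarrow> Y *\<^sub>v (X *\<^sub>v v) = v"
    by (rule mat_vec_cancel_left[OF YX]) (use cX a in auto)
qed

text \<open>Either embedding factors through the other by means of its retraction, since both have
  the image \<open>V\<close>.\<close>

lemma realizes_iso:
  fixes M :: "('g, 'k :: field) gmod"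
  assumes M: "is_gmod G M" and 1: "realizes G M V N X Y" and 2: "realizes G M V N' X' Y'"
  shows "gmod_iso G N N'"
proof -
  have factor: "X' * (Y' * X) = X \<and> Y' * X \<in> gmod_hom G N N'"
    if 1: "realizes G M V N X Y" and 2: "realizes G M V N' X' Y'" for N X Y N' X' Y'
  proof -
    note r = realizesD[OF 1] and r' = realizesD[OF 2]
    have X: "X' * (Y' * X) = X"
    proof (rule eq_mat_by_vec[of _ "fst M" "fst N"])
      fix v :: "'k vec" assume v: "v \<in> carrier_vec (fst N)"
      obtain w where w: "w \<in> carrier_vec (fst N')" "X *\<^sub>v v = X' *\<^sub>v w" using r'(8)[OF r(6)[OF v]] by blast
      have "X' * (Y' * X) *\<^sub>v v = X' *\<^sub>v (Y' *\<^sub>v (X *\<^sub>v v))" using r(3) r'(3,4) v by (simp add: mat_vec_assoc)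
      also have "\<dots> = X *\<^sub>v v" unfolding w(2) r'(7)[OF w(1)] ..
      finally show "X' * (Y' * X) *\<^sub>v v = X *\<^sub>v v" .
    qed (use r(3) r'(3,4) in auto)
    have "Y' * X \<in> gmod_hom G N N'"
    proof (rule homI)
      show c: "Y' * X \<in> carrier_mat (fst N') (fst N)" using r(3) r'(4) by simp
      fix g assume g: "g \<in> carrier G"
      note A = gmod_carrier[OF r(1) g] gmod_carrier[OF r'(1) g] gmod_carrier[OF M g]
      have "Y' * X * snd N g = Y' * (snd M g * X)"
        using assoc_mult_mat[OF r'(4) r(3) A(1)] hom_commute[OF r(2) g] by simp
      also have "\<dots> = Y' * (snd M g * (X' * (Y' * X)))" unfolding X ..
      also have "\<dots> = Y' * (X' * (snd N' g * (Y' * X)))"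
        using assoc_mult_mat[OF A(3) r'(3) c] assoc_mult_mat[OF r'(3) A(2) c] hom_commute[OF r'(2) g] by simp
      also have "\<dots> = snd N' g * (Y' * X)" by (rule mat_cancel_left[OF r'(5)]) (use r(3) r'(3,4) A in auto)
      finally show "Y' * X * snd N g = snd N' g * (Y' * X)" .
    qed
    thus ?thesis using X by blast
  qed
  have inv: "Y' * X * (Y * X') = 1\<^sub>m (fst N')"
    if 1: "realizes G M V N X Y" and 2: "realizes G M V N' X' Y'" for N X Y N' X' Y'
  proof -
    note r = realizesD[OF 1] and r' = realizesD[OF 2]
    have "Y' * X * (Y * X') = Y' * (X * (Y * X'))" by (rule assoc_mult_mat[OF r'(4) r(3)]) (use r(4) r'(3) in auto)
    thus ?thesis using factor[OF 2 1] r'(5) by simp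
  qed
  show ?thesis unfolding gmod_iso_def using factor[OF 1 2] factor[OF 2 1] inv[OF 1 2] inv[OF 2 1] by blast
qed

definition maximal_in ::
  "('g, 'b) monoid_scheme \<Rightarrow> ('g, 'k :: field) gmod \<Rightarrow> 'k vec set \<Rightarrow> 'k vec set \<Rightarrow> bool" where
  "maximal_in G M U V \<longleftrightarrow> gsubmod G M U \<and> gsubmod G M V \<and> U \<subset> V \<and> \<not> (\<exists>W. gsubmod G M W \<and> U \<subset> W \<and> W \<subset> V)"

text \<open>\<open>U\<close> is the image of the kernel of a map from \<open>N\<close> onto an
  irreducible module; a submodule strictly between would have a proper nonzero image there.\<close>

lemma maximal_submodule_exists:
  fixes M :: "('g, 'k :: field) gmod"
  assumes M: "is_gmod G M" and V: "gsubmod G M V" and R: "realizes G M V N X Y" and n: "fst N > 0"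
  shows "\<exists>U L Z Y'. maximal_in G M U V \<and> realizes G M U L Z Y' \<and> fst L < fst N"
proof -
  note r = realizesD[OF R]
  obtain S T where S: "irreducible_gmod G S" and T: "T \<in> gmod_epi G N S" using simple_quotient_exists[OF r(1) n] by blast
  note S' = irreducibleD(1)[OF S] and hT = epi_hom[OF T]
  note cT = hom_carrier[OF hT]
  let ?K = "{v \<in> carrier_vec (fst N). T *\<^sub>v v = 0\<^sub>v (fst S)}"
  have K: "gsubmod G N ?K" by (rule gsubmod_kernel[OF r(1) S' hT])
  obtain L F Z Y1 X' Q where SQ: "sub_quot G N ?K L F Z Y1 X' Q" by (rule sub_quot_exists[OF r(1) K])
  note s = SQ[unfolded sub_quot_def]
  have L: "is_gmod G L" and Z: "Z \<in> gmod_hom G L N" and Y1: "Y1 \<in> carrier_mat (fst L) (fst N)" and YZ: "Y1 * Z = 1\<^sub>m (fst L)"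
    and imZ: "(\<lambda>v. Z *\<^sub>v v) ` carrier_vec (fst L) = ?K" and dim: "fst N = fst L + fst F" 
    and kerQ: "{v \<in> carrier_vec (fst N). Q *\<^sub>v v = 0\<^sub>v (fst F)} = ?K" and Q: "Q \<in> gmod_hom G N F"
    using s by (auto simp: splitting_def)
  note cZ = hom_carrier[OF Z]
  have Knot: "?K \<noteq> carrier_vec (fst N)"
    using epi_nonzero[OF T irreducibleD(2)[OF S]] hom_zero_iff[OF hT] by blast
  have "fst F \<noteq> 0"
  proof
    assume 0: "fst F = 0"
    have "Q *\<^sub>v v = 0\<^sub>v (fst F)" for v using hom_carrier[OF Q] 0 by (intro eq_vecI) auto
    thus False using kerQ Knot by simp
  qed
  let ?U = "(\<lambda>v. X *\<^sub>v v) ` ?K"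
  have U: "gsubmod G M ?U" by (rule gsubmod_image[OF r(1) M r(2) K])
  have XZ: "X * Z \<in> gmod_hom G L M" by (rule hom_comp[OF L r(1) M Z r(2)])
  have "realizes G M ?U L (X * Z) (Y1 * Y)"
    unfolding realizes_def
  proof (intro conjI L XZ)
    show "Y1 * Y \<in> carrier_mat (fst L) (fst M)" using Y1 r(4) by simp
    have "Y1 * Y * (X * Z) = Y1 * (Y * (X * Z))" by (rule assoc_mult_mat[OF Y1 r(4)]) (use r(3) cZ in auto)
    also have "Y * (X * Z) = Z" by (rule mat_cancel_left[OF r(5)]) (use r(3,4) cZ in auto)
    finally show "Y1 * Y * (X * Z) = 1\<^sub>m (fst L)" using YZ by simp
    have "(\<lambda>v. X * Z *\<^sub>v v) ` carrier_vec (fst L) = (\<lambda>v. X *\<^sub>v v) ` ((\<lambda>v. Z *\<^sub>v v) ` carrier_vec (fst L))"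
      unfolding image_image by (intro image_cong refl assoc_mult_mat_vec[OF r(3) cZ])
    thus "(\<lambda>v. X * Z *\<^sub>v v) ` carrier_vec (fst L) = ?U" unfolding imZ .
  qed
  moreover have "maximal_in G M ?U V"
    unfolding maximal_in_def
  proof (intro conjI U V notI)
    have pull: "X *\<^sub>v v \<in> ?U \<longleftrightarrow> v \<in> ?K" if v: "v \<in> carrier_vec (fst N)" for v
    proof
      assume "X *\<^sub>v v \<in> ?U"
      then obtain w where w: "w \<in> ?K" "X *\<^sub>v v = X *\<^sub>v w" by auto
      have "v = w" using r(7)[OF v] r(7)[of w] w by (metis (no_types, lifting) mem_Collect_eq)
      thus "v \<in> ?K" using w by simp
    qed blast
    show "?U \<subset> V"
    proof
      show "?U \<subseteq> V" using r(6) by auto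
      show "?U \<noteq> V"
      proof
        assume "?U = V"
        hence "v \<in> ?K" if "v \<in> carrier_vec (fst N)" for v using pull[OF that] r(6)[OF that] by blast
        thus False using Knot by blast
      qed
    qed
    assume "\<exists>W. gsubmod G M W \<and> ?U \<subset> W \<and> W \<subset> V"
    then obtain W where W: "gsubmod G M W" "?U \<subset> W" "W \<subset> V" by blast
    let ?W' = "{v \<in> carrier_vec (fst N). X *\<^sub>v v \<in> W}"
    have W': "gsubmod G N ?W'" by (rule gsubmod_preimage[OF r(1) M r(2) W(1) gsubmod_full[OF r(1)]])
    have KW: "?K \<subseteq> ?W'" using W(2) by auto
    have "gsubmod G S ((\<lambda>v. T *\<^sub>v v) ` ?W')" by (rule gsubmod_image[OF r(1) S' hT W'])
    from irreducible_submodule[OF S this] show False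
    proof
      assume 0: "(\<lambda>v. T *\<^sub>v v) ` ?W' = {0\<^sub>v (fst S)}"
      have "W \<subseteq> ?U"
      proof
        fix u assume u: "u \<in> W"
        then obtain v where v: "v \<in> carrier_vec (fst N)" "u = X *\<^sub>v v" using r(8) W(3) by blast
        hence "v \<in> ?W'" using u by simp
        hence "T *\<^sub>v v = 0\<^sub>v (fst S)" using 0 by blast
        thus "u \<in> ?U" using v by blast
      qed
      thus False using W(2) by blast
    next
      assume 1: "(\<lambda>v. T *\<^sub>v v) ` ?W' = carrier_vec (fst S)"
      have "V \<subseteq> W"
      proof
        fix u assume "u \<in> V"
        then obtain v where v: "v \<in> carrier_vec (fst N)" "u = X *\<^sub>v v" using r(8) by blast
        have Tv: "T *\<^sub>v v \<in> carrier_vec (fst S)" using cT v by auto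
        then obtain w where w: "w \<in> ?W'" "T *\<^sub>v v = T *\<^sub>v w" using 1 by (metis (no_types, lifting) imageE)
        have wc: "w \<in> carrier_vec (fst N)" using w by simp
        have "T *\<^sub>v (v - w) = 0\<^sub>v (fst S)"
          unfolding mult_minus_distrib_mat_vec[OF cT v(1) wc] w(2)[symmetric] using Tv by simp
        hence "v - w \<in> ?K" using v wc by simp
        hence "v - w \<in> ?W'" using KW by blast
        hence "(v - w) + w \<in> ?W'" using w(1) gsubmodD(4)[OF W'] unfolding subspace_vec_iff by blast
        moreover have "(v - w) + w = v" using v wc by (intro eq_vecI) auto
        ultimately have "v \<in> ?W'" by (simp only:)
        thus "u \<in> W" using v by simp
      qed
      thus False using W(3) by blast
    qed
  qed
  ultimately show ?thesis using dim \<open>fst F \<noteq> 0\<close> by (metis less_add_same_cancel1 neq0_conv)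
qed

lemma realizes_zero_dim:
  fixes M :: "('g, 'k :: field) gmod"
  assumes R: "realizes G M V N X Y" and 0: "fst N = 0"
  shows "V = {0\<^sub>v (fst M)}"
proof -
  note r = realizesD[OF R]
  have e: "X *\<^sub>v v = 0\<^sub>v (fst M)" if "v \<in> carrier_vec 0" for v
    using r(3) that 0 by (intro eq_vecI) (auto simp: scalar_prod_def)
  show ?thesis
  proof (intro equalityI subsetI)
    fix u assume "u \<in> V"
    then obtain v where "v \<in> carrier_vec (fst N)" "u = X *\<^sub>v v" using r(8) by blast
    thus "u \<in> {0\<^sub>v (fst M)}" using e 0 by simp
  next
    fix u :: "'k vec" assume "u \<in> {0\<^sub>v (fst M)}"
    hence "u = X *\<^sub>v 0\<^sub>v (fst N)" using e[of "0\<^sub>v (fst N)"] 0 by simp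
    thus "u \<in> V" using r(6)[of "0\<^sub>v (fst N)"] by simp
  qed
qed

text \<open>Built from the top: the claim is generalized to submodules \<open>V\<close>, and the
  recursion goes to a maximal submodule, realized in smaller dimension.\<close>

lemma composition_series_exists:
  fixes M :: "('g, 'k :: field) gmod"
  assumes M: "is_gmod G M"
  shows "\<exists>m W. composition_series G M m W"
proof -
  have "\<exists>m W. W 0 = {0\<^sub>v (fst M)} \<and> W m = V \<and> (\<forall>i\<le>m. gsubmod G M (W i)) \<and> (\<forall>i<m. maximal_in G M (W i) (W (Suc i)))"
    if "gsubmod G M V" "realizes G M V N X Y" for V N X Y
    using that
  proof (induction "fst N" arbitrary: V N X Y rule: less_induct)
    case less
    show ?case
    proof (cases "fst N = 0")
      case True
      have "V = {0\<^sub>v (fst M)}" by (rule realizes_zero_dim[OF less.prems(2) True])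
      thus ?thesis using gsubmod_zero[OF M] by (intro exI[of _ 0] exI[of _ "\<lambda>_. V"]) auto
    next
      case False
      then obtain U L Z Y' where U: "maximal_in G M U V" "realizes G M U L Z Y'" "fst L < fst N"
        using maximal_submodule_exists[OF M less.prems] by auto
      have "gsubmod G M U" using U(1) by (simp add: maximal_in_def)
      from less.hyps[OF U(3) this U(2)] obtain m W where W: "W 0 = {0\<^sub>v (fst M)}" "W m = U"
        "\<forall>i\<le>m. gsubmod G M (W i)" "\<forall>i<m. maximal_in G M (W i) (W (Suc i))" by blast
      show ?thesis
        by (intro exI[of _ "Suc m"] exI[of _ "W(Suc m := V)"])
           (use W U(1) less.prems(1) in \<open>auto simp: less_Suc_eq le_Suc_eq\<close>)
    qed
  qed
  from this[OF gsubmod_full[OF M] realizes_full[OF M]]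
  obtain m W where W: "W 0 = {0\<^sub>v (fst M)}" "W m = carrier_vec (fst M)" "\<forall>i\<le>m. gsubmod G M (W i)"
    "\<forall>i<m. maximal_in G M (W i) (W (Suc i))" by blast
  hence "composition_series G M m W" by (simp add: composition_series_def maximal_in_def)
  thus ?thesis by blast
qed

text \<open>\<open>F\<close> is the factor of \<open>V\<close> by \<open>U\<close> as a module in
  its own right, obtained as a quotient of \<open>N\<close>. It turns the predicate
  \<open>factor_iso\<close> into isomorphism with one fixed module and makes the eigenvalues
  additive.\<close>

lemma maximal_factor:
  fixes M :: "('g, 'k :: field) gmod"
  assumes M: "is_gmod G M" and UV: "maximal_in G M U V"
    and R: "realizes G M V N X Y" and R': "realizes G M U N' X' Y'"
  obtains F where "irreducible_gmod G F" "\<And>g. g \<in> carrier G \<Longrightarrow> evs (snd N g) = evs (snd N' g) + evs (snd F g)"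
    "\<And>S. irreducible_gmod G S \<Longrightarrow> factor_iso G M U V S \<longleftrightarrow> gmod_iso G F S"
proof -
  note r = realizesD[OF R] and r' = realizesD[OF R']
  note mx = UV[unfolded maximal_in_def]
  have U: "gsubmod G M U" and V: "gsubmod G M V" and sub: "U \<subset> V" using mx by auto
  let ?K = "{v \<in> carrier_vec (fst N). X *\<^sub>v v \<in> U}"
  have K: "gsubmod G N ?K" by (rule gsubmod_preimage[OF r(1) M r(2) U gsubmod_full[OF r(1)]])
  obtain L F Z Y1 X1 Q where SQ: "sub_quot G N ?K L F Z Y1 X1 Q" by (rule sub_quot_exists[OF r(1) K])
  note s = SQ[unfolded sub_quot_def]
  have L: "is_gmod G L" and F: "is_gmod G F" and Z: "Z \<in> gmod_hom G L N" and Y1: "Y1 \<in> carrier_mat (fst L) (fst N)" and YZ: "Y1 * Z = 1\<^sub>m (fst L)"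
    and imZ: "(\<lambda>v. Z *\<^sub>v v) ` carrier_vec (fst L) = ?K"
    and kerQ: "{v \<in> carrier_vec (fst N). Q *\<^sub>v v = 0\<^sub>v (fst F)} = ?K" and Q: "Q \<in> gmod_hom G N F"
    and cX1: "X1 \<in> carrier_mat (fst N) (fst F)" and QX1: "Q * X1 = 1\<^sub>m (fst F)"
    using s by (auto simp: splitting_def)
  have evs_F: "evs (snd N g) = evs (snd L g) + evs (snd F g)" if "g \<in> carrier G" for g using s that by blast
  note cZ = hom_carrier[OF Z] and cQ = hom_carrier[OF Q]
  have QX1v: "Q *\<^sub>v (X1 *\<^sub>v v) = v" if "v \<in> carrier_vec (fst F)" for v
    by (rule mat_vec_cancel_left[OF QX1]) (use cQ cX1 that in auto)
  have XZ: "X * Z \<in> gmod_hom G L M" by (rule hom_comp[OF L r(1) M Z r(2)])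
  have "realizes G M U L (X * Z) (Y1 * Y)"
    unfolding realizes_def
  proof (intro conjI L XZ)
    show "Y1 * Y \<in> carrier_mat (fst L) (fst M)" using Y1 r(4) by simp
    have "Y1 * Y * (X * Z) = Y1 * (Y * (X * Z))" by (rule assoc_mult_mat[OF Y1 r(4)]) (use r(3) cZ in auto)
    also have "Y * (X * Z) = Z" by (rule mat_cancel_left[OF r(5)]) (use r(3,4) cZ in auto)
    finally show "Y1 * Y * (X * Z) = 1\<^sub>m (fst L)" using YZ by simp
    have "(\<lambda>v. X * Z *\<^sub>v v) ` carrier_vec (fst L) = (\<lambda>v. X *\<^sub>v v) ` ((\<lambda>v. Z *\<^sub>v v) ` carrier_vec (fst L))"
      unfolding image_image by (intro image_cong refl assoc_mult_mat_vec[OF r(3) cZ])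
    also have "\<dots> = U"
    proof
      show "(\<lambda>v. X *\<^sub>v v) ` ((\<lambda>v. Z *\<^sub>v v) ` carrier_vec (fst L)) \<subseteq> U" unfolding imZ by auto
      show "U \<subseteq> (\<lambda>v. X *\<^sub>v v) ` ((\<lambda>v. Z *\<^sub>v v) ` carrier_vec (fst L))" unfolding imZ using r(8) sub by blast
    qed
    finally show "(\<lambda>v. X * Z *\<^sub>v v) ` carrier_vec (fst L) = U" .
  qed
  from realizes_iso[OF M this R'] have iso: "gmod_iso G L N'" .
  have evs_N: "evs (snd N g) = evs (snd N' g) + evs (snd F g)" if "g \<in> carrier G" for g
    using evs_F[OF that] gmod_iso_evs[OF L r'(1) iso that] by simp
  have irr: "irreducible_gmod G F"
    unfolding irreducible_gmod_def
  proof (intro conjI F allI impI)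
    show "fst F > 0"
    proof (rule ccontr)
      assume "\<not> fst F > 0"
      hence "Q *\<^sub>v v = 0\<^sub>v (fst F)" for v using cQ by (intro eq_vecI) auto
      hence "X *\<^sub>v v \<in> U" if "v \<in> carrier_vec (fst N)" for v using kerQ that by blast
      hence "V \<subseteq> U" using r(8) by blast
      thus False using sub by blast
    qed
    fix W assume W: "gsubmod G F W"
    let ?W' = "{v \<in> carrier_vec (fst N). Q *\<^sub>v v \<in> W}"
    have W': "gsubmod G N ?W'" by (rule gsubmod_preimage[OF r(1) F Q W gsubmod_full[OF r(1)]])
    let ?XW = "(\<lambda>v. X *\<^sub>v v) ` ?W'"
    have XW: "gsubmod G M ?XW" by (rule gsubmod_image[OF r(1) M r(2) W'])
    have "U \<subseteq> ?XW"
    proof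
      fix u assume u: "u \<in> U"
      then obtain v where v: "v \<in> carrier_vec (fst N)" "u = X *\<^sub>v v" using r(8) sub by blast
      hence "Q *\<^sub>v v = 0\<^sub>v (fst F)" using kerQ u by blast
      thus "u \<in> ?XW" using v gsubmodD(2)[OF W] by auto
    qed
    moreover have "?XW \<subseteq> V" using r(6) by auto
    ultimately have "?XW = U \<or> ?XW = V" using mx XW by blast
    thus "W = {0\<^sub>v (fst F)} \<or> W = carrier_vec (fst F)"
    proof
      assume e: "?XW = U"
      have "w = 0\<^sub>v (fst F)" if w: "w \<in> W" for w
      proof -
        have wc: "w \<in> carrier_vec (fst F)" using w gsubmodD(1)[OF W] by blast
        have "X1 *\<^sub>v w \<in> ?W'" using QX1v[OF wc] w cX1 wc by auto
        hence "X *\<^sub>v (X1 *\<^sub>v w) \<in> U" using e by blast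
        moreover have "X1 *\<^sub>v w \<in> carrier_vec (fst N)" using cX1 wc by auto
        ultimately have "Q *\<^sub>v (X1 *\<^sub>v w) = 0\<^sub>v (fst F)" using kerQ by blast
        thus ?thesis unfolding QX1v[OF wc] .
      qed
      thus ?thesis using gsubmodD(2)[OF W] by blast
    next
      assume e: "?XW = V"
      have "w \<in> W" if w: "w \<in> carrier_vec (fst F)" for w
      proof -
        have c: "X1 *\<^sub>v w \<in> carrier_vec (fst N)" using cX1 w by auto
        obtain v where v: "v \<in> ?W'" "X *\<^sub>v (X1 *\<^sub>v w) = X *\<^sub>v v" using r(6)[OF c] e by (metis (no_types, lifting) imageE)
        have "X1 *\<^sub>v w = v" using r(7)[OF c] r(7)[of v] v by (metis (no_types, lifting) mem_Collect_eq)
        thus ?thesis using v(1) QX1v[OF w] by auto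
      qed
      thus ?thesis using gsubmodD(1)[OF W] by blast
    qed
  qed
  have "factor_iso G M U V S \<longleftrightarrow> gmod_iso G F S" if S: "irreducible_gmod G S" for S
  proof
    note S' = irreducibleD(1)[OF S]
    assume "gmod_iso G F S"
    then obtain H H' where H: "H \<in> gmod_hom G F S" and H': "H' \<in> gmod_hom G S F" "H * H' = 1\<^sub>m (fst S)" "H' * H = 1\<^sub>m (fst F)"
      by (auto simp: gmod_iso_def)
    note cH = hom_carrier[OF H] and cH' = hom_carrier[OF H'(1)]
    \<comment> \<open>The retraction \<open>Y\<close> extends the map on \<open>V\<close> to a
      matrix on the whole space.\<close>
    define T where "T = H * (Q * Y)"
    have T: "T \<in> carrier_mat (fst S) (fst M)" using cH cQ r(4) by (simp add: T_def)
    have TX: "T *\<^sub>v (X *\<^sub>v v) = H *\<^sub>v (Q *\<^sub>v v)" if v: "v \<in> carrier_vec (fst N)" for v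
    proof -
      have "T *\<^sub>v (X *\<^sub>v v) = H *\<^sub>v (Q *\<^sub>v (Y *\<^sub>v (X *\<^sub>v v)))" using cH cQ r(3,4) v by (simp add: T_def mat_vec_assoc)
      thus ?thesis unfolding r(7)[OF v] .
    qed
    have HQ: "H * Q \<in> gmod_hom G N S" by (rule hom_comp[OF r(1) F S' Q H])
    have HQv: "H *\<^sub>v (Q *\<^sub>v v) = H * Q *\<^sub>v v" if "v \<in> carrier_vec (fst N)" for v
      by (rule assoc_mult_mat_vec[OF cH cQ that, symmetric])
    show "factor_iso G M U V S"
      unfolding factor_iso_def
    proof (intro bexI[OF _ T] conjI ballI)
      fix g v assume g: "g \<in> carrier G" and "v \<in> V"
      then obtain w where w: "w \<in> carrier_vec (fst N)" "v = X *\<^sub>v w" using r(8) by blast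
      have gw: "snd N g *\<^sub>v w \<in> carrier_vec (fst N)" using gmod_carrier[OF r(1) g] w by auto
      have "T *\<^sub>v (snd M g *\<^sub>v v) = T *\<^sub>v (X *\<^sub>v (snd N g *\<^sub>v w))"
        unfolding w(2) hom_vec[OF r(1) M r(2) g w(1)] ..
      also have "\<dots> = snd S g *\<^sub>v (T *\<^sub>v v)"
        unfolding TX[OF gw] w(2) TX[OF w(1)] HQv[OF gw] HQv[OF w(1)] by (rule hom_vec[OF r(1) S' HQ g w(1)])
      finally show "T *\<^sub>v (snd M g *\<^sub>v v) = snd S g *\<^sub>v (T *\<^sub>v v)" .
    next
      show "(\<lambda>v. T *\<^sub>v v) ` V = carrier_vec (fst S)"
      proof (intro equalityI subsetI)
        fix z assume "z \<in> (\<lambda>v. T *\<^sub>v v) ` V"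
        thus "z \<in> carrier_vec (fst S)" using T gsubmodD(1)[OF V] by auto
      next
        fix z :: "'k vec" assume z: "z \<in> carrier_vec (fst S)"
        let ?f = "H' *\<^sub>v z"
        have f: "?f \<in> carrier_vec (fst F)" using cH' z by auto
        have n: "X1 *\<^sub>v ?f \<in> carrier_vec (fst N)" using cX1 f by auto
        have "T *\<^sub>v (X *\<^sub>v (X1 *\<^sub>v ?f)) = H *\<^sub>v ?f" unfolding TX[OF n] QX1v[OF f] ..
        also have "\<dots> = z" by (rule mat_vec_cancel_left[OF H'(2)]) (use cH cH' z in auto)
        finally show "z \<in> (\<lambda>v. T *\<^sub>v v) ` V" using r(6)[OF n] by (metis image_eqI)
      qed
      show "{v \<in> V. T *\<^sub>v v = 0\<^sub>v (fst S)} = U"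
      proof (intro equalityI subsetI)
        fix v assume v: "v \<in> {v \<in> V. T *\<^sub>v v = 0\<^sub>v (fst S)}"
        then obtain w where w: "w \<in> carrier_vec (fst N)" "v = X *\<^sub>v w" using r(8) by blast
        have Qw: "Q *\<^sub>v w \<in> carrier_vec (fst F)" using cQ w by auto
        have 0: "H *\<^sub>v (Q *\<^sub>v w) = 0\<^sub>v (fst S)" using v TX[OF w(1)] w(2) by simp
        have "Q *\<^sub>v w = H' *\<^sub>v (H *\<^sub>v (Q *\<^sub>v w))"
          by (rule mat_vec_cancel_left[OF H'(3), symmetric]) (use cH cH' cQ in auto)
        also have "\<dots> = 0\<^sub>v (fst F)" unfolding 0 by (rule mult_mat_vec_zero'[OF cH'])
        finally show "v \<in> U" using kerQ w by blast
      next
        fix v assume v: "v \<in> U"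
        then obtain w where w: "w \<in> carrier_vec (fst N)" "v = X *\<^sub>v w" using r(8) sub by blast
        have "Q *\<^sub>v w = 0\<^sub>v (fst F)" using kerQ v w by blast
        thus "v \<in> {v \<in> V. T *\<^sub>v v = 0\<^sub>v (fst S)}"
          using v sub TX[OF w(1)] w(2) mult_mat_vec_zero'[OF cH] by auto
      qed
    qed
  next
    note S' = irreducibleD(1)[OF S]
    assume "factor_iso G M U V S"
    then obtain T where T: "T \<in> carrier_mat (fst S) (fst M)"
      and eq: "\<And>g v. g \<in> carrier G \<Longrightarrow> v \<in> V \<Longrightarrow> T *\<^sub>v (snd M g *\<^sub>v v) = snd S g *\<^sub>v (T *\<^sub>v v)"
      and im: "(\<lambda>v. T *\<^sub>v v) ` V = carrier_vec (fst S)" and ker: "{v \<in> V. T *\<^sub>v v = 0\<^sub>v (fst S)} = U"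
      unfolding factor_iso_def by blast
    have TXv: "T * X *\<^sub>v v = T *\<^sub>v (X *\<^sub>v v)" if "v \<in> carrier_vec (fst N)" for v by (rule assoc_mult_mat_vec[OF T r(3) that])
    have cTX: "T * X \<in> carrier_mat (fst S) (fst N)" using T r(3) by simp
    have TX: "T * X \<in> gmod_hom G N S"
    proof (rule homI[OF cTX], rule eq_mat_by_vec[of _ "fst S" "fst N"])
      fix g and v :: "'k vec" assume g: "g \<in> carrier G" and v: "v \<in> carrier_vec (fst N)"
      note A = gmod_carrier[OF r(1) g] gmod_carrier[OF S' g]
      have gv: "snd N g *\<^sub>v v \<in> carrier_vec (fst N)" using A v by auto
      have "T * X * snd N g *\<^sub>v v = T * X *\<^sub>v (snd N g *\<^sub>v v)" by (rule assoc_mult_mat_vec[OF cTX A(1) v])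
      also have "\<dots> = T *\<^sub>v (snd M g *\<^sub>v (X *\<^sub>v v))" unfolding TXv[OF gv] hom_vec[OF r(1) M r(2) g v] ..
      also have "\<dots> = snd S g *\<^sub>v (T * X *\<^sub>v v)" unfolding eq[OF g r(6)[OF v]] TXv[OF v] ..
      also have "\<dots> = snd S g * (T * X) *\<^sub>v v" by (rule assoc_mult_mat_vec[OF A(2) cTX v, symmetric])
      finally show "T * X * snd N g *\<^sub>v v = snd S g * (T * X) *\<^sub>v v" .
    qed (use mult_carrier_mat[OF cTX gmod_carrier[OF r(1)]] mult_carrier_mat[OF gmod_carrier[OF S'] cTX] in auto)
    have kerTX: "T * X *\<^sub>v v = 0\<^sub>v (fst S)" if v: "v \<in> ?K" for v
      using TXv[of v] v ker by auto
    \<comment> \<open>The map on the quotient \<open>F\<close> induced by \<open>T * X\<close>, read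
      off along the linear section \<open>X1\<close> of \<open>Q\<close>.\<close>
    define c where "c = T * X * X1"
    have cc: "c \<in> carrier_mat (fst S) (fst F)" using cTX cX1 by (simp add: c_def)
    have cQ_TX: "c * Q = T * X"
    proof (rule eq_mat_by_vec[of _ "fst S" "fst N"])
      fix v :: "'k vec" assume v: "v \<in> carrier_vec (fst N)"
      have Qv: "Q *\<^sub>v v \<in> carrier_vec (fst F)" using cQ v by auto
      have w: "X1 *\<^sub>v (Q *\<^sub>v v) \<in> carrier_vec (fst N)" using cX1 Qv by auto
      have "Q *\<^sub>v (X1 *\<^sub>v (Q *\<^sub>v v) - v) = 0\<^sub>v (fst F)"
        unfolding mult_minus_distrib_mat_vec[OF cQ w v] QX1v[OF Qv] using Qv by simp
      hence "X1 *\<^sub>v (Q *\<^sub>v v) - v \<in> ?K" using kerQ w v by (metis (mono_tags, lifting) mem_Collect_eq minus_carrier_vec)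
      hence "T * X *\<^sub>v (X1 *\<^sub>v (Q *\<^sub>v v)) - T * X *\<^sub>v v = 0\<^sub>v (fst S)"
        unfolding mult_minus_distrib_mat_vec[OF cTX w v, symmetric] by (rule kerTX)
      hence "T * X *\<^sub>v (X1 *\<^sub>v (Q *\<^sub>v v)) = T * X *\<^sub>v v"
        by (rule minus_vec_zero_imp_eq[OF mult_mat_vec_carrier[OF cTX w] mult_mat_vec_carrier[OF cTX v]])
      moreover have "c * Q *\<^sub>v v = T * X *\<^sub>v (X1 *\<^sub>v (Q *\<^sub>v v))"
        using assoc_mult_mat_vec[OF cc cQ v] assoc_mult_mat_vec[OF cTX cX1 Qv] by (simp add: c_def)
      ultimately show "c * Q *\<^sub>v v = T * X *\<^sub>v v" by simp
    qed (use cc cQ cTX in auto)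
    have c: "c \<in> gmod_hom G F S"
    proof (rule homI[OF cc])
      fix g assume g: "g \<in> carrier G"
      note A = gmod_carrier[OF r(1) g] gmod_carrier[OF S' g] gmod_carrier[OF F g]
      have "c * snd F g * Q = c * (Q * snd N g)" using assoc_mult_mat[OF cc A(3) cQ] hom_commute[OF Q g] by simp
      also have "\<dots> = T * X * snd N g" unfolding cQ_TX[symmetric] by (rule assoc_mult_mat[OF cc cQ A(1), symmetric])
      also have "\<dots> = snd S g * (c * Q)" unfolding hom_commute[OF TX g] cQ_TX ..
      also have "\<dots> = snd S g * c * Q" by (rule assoc_mult_mat[OF A(2) cc cQ, symmetric])
      finally have "c * snd F g * Q * X1 = snd S g * c * Q * X1" by simp
      thus "c * snd F g = snd S g * c"
        using assoc_mult_mat[OF mult_carrier_mat[OF cc A(3)] cQ cX1] assoc_mult_mat[OF mult_carrier_mat[OF A(2) cc] cQ cX1]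
          QX1 right_mult_one_mat[OF mult_carrier_mat[OF cc A(3)]] right_mult_one_mat[OF mult_carrier_mat[OF A(2) cc]] by simp
    qed
    have "c \<noteq> 0\<^sub>m (fst S) (fst F)"
    proof
      assume "c = 0\<^sub>m (fst S) (fst F)"
      hence TX0: "T * X = 0\<^sub>m (fst S) (fst N)" using cQ_TX left_mult_zero_mat[OF cQ] by simp
      have "z = 0\<^sub>v (fst S)" if "z \<in> carrier_vec (fst S)" for z :: "'k vec"
      proof -
        have "z \<in> (\<lambda>v. T *\<^sub>v v) ` V" unfolding im by (rule that)
        then obtain v where v: "v \<in> V" "z = T *\<^sub>v v" by (rule imageE)
        obtain w where w: "w \<in> carrier_vec (fst N)" "v = X *\<^sub>v w" using r(8) v by blast
        show ?thesis using TXv[OF w(1)] v w unfolding TX0 by simp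
      qed
      from this[of "unit_vec (fst S) 0"] show False using irreducibleD(2)[OF S] by simp
    qed
    thus "gmod_iso G F S" by (rule schur_iso[OF irr S c])
  qed
  thus ?thesis using that[OF irr evs_N] by blast
qed

section \<open>Biorthogonal systems\<close>

text \<open>Read as matrices, the hypothesis is A B = 1, which gives card X <= card Y; the assumed
  opposite inequality makes them square, and then B A = 1. Orthogonality in one index thus becomes
  orthogonality in the other.\<close>

lemma biorthogonal_swap:
  fixes L R :: "'c \<Rightarrow> 's \<Rightarrow> 'a :: field"
  assumes X: "finite X" and Y: "finite Y" and card: "card Y \<le> card X"
    and orth: "\<And>c c'. c \<in> X \<Longrightarrow> c' \<in> X \<Longrightarrow> (\<Sum>s\<in>Y. L c s * R c' s) = (if c = c' then 1 else 0)"
    and s: "s \<in> Y" "s' \<in> Y"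
  shows "(\<Sum>c\<in>X. R c s * L c s') = (if s = s' then 1 else 0)"
proof -
  obtain h where h: "bij_betw h {..<card X} X" using ex_bij_betw_nat_finite[OF X] unfolding atLeast0LessThan by blast
  obtain k where k: "bij_betw k {..<card Y} Y" using ex_bij_betw_nat_finite[OF Y] unfolding atLeast0LessThan by blast
  have hX: "h i \<in> X" if "i < card X" for i using bij_betwE[OF h] that by blast
  have h_inj: "h i = h j \<longleftrightarrow> i = j" if "i < card X" "j < card X" for i j
    using bij_betw_imp_inj_on[OF h] that by (auto simp: inj_on_def)
  have k_inj: "k i = k j \<longleftrightarrow> i = j" if "i < card Y" "j < card Y" for i j
    using bij_betw_imp_inj_on[OF k] that by (auto simp: inj_on_def)
  define A where "A = mat (card X) (card Y) (\<lambda>(i, j). L (h i) (k j))"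
  define B where "B = mat (card Y) (card X) (\<lambda>(j, i). R (h i) (k j))"
  have A: "A \<in> carrier_mat (card X) (card Y)" and B: "B \<in> carrier_mat (card Y) (card X)" by (simp_all add: A_def B_def)
  have AB: "A * B = 1\<^sub>m (card X)"
  proof (rule eq_matI)
    fix i j assume "i < dim_row (1\<^sub>m (card X) :: 'a mat)" "j < dim_col (1\<^sub>m (card X) :: 'a mat)"
    hence ij: "i < card X" "j < card X" by auto
    have "(A * B) $$ (i, j) = (\<Sum>l<card Y. L (h i) (k l) * R (h j) (k l))"
      using ij by (simp add: A_def B_def scalar_prod_def atLeast0LessThan)
    also have "\<dots> = (\<Sum>s\<in>Y. L (h i) s * R (h j) s)" by (rule sum.reindex_bij_betw[OF k])
    finally show "(A * B) $$ (i, j) = (1\<^sub>m (card X) :: 'a mat) $$ (i, j)"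
      using orth[OF hX hX] ij h_inj by simp
  qed (use A B in auto)
  have eq: "card X = card Y" using right_inverse_dim_le[OF A B AB] card by simp
  have BA: "B * A = 1\<^sub>m (card Y)"
    using mat_mult_left_right_inverse[of A "card Y" B] A B AB unfolding eq by simp
  obtain i j where ij: "i < card Y" "s = k i" "j < card Y" "s' = k j"
    using s bij_betw_imp_surj_on[OF k] by (metis imageE lessThan_iff)
  have "(B * A) $$ (i, j) = (\<Sum>l<card X. R (h l) (k i) * L (h l) (k j))"
    using ij by (simp add: A_def B_def scalar_prod_def atLeast0LessThan)
  also have "\<dots> = (\<Sum>c\<in>X. R c (k i) * L c (k j))" by (rule sum.reindex_bij_betw[OF h])
  finally show ?thesis using BA ij k_inj by simp
qed

locale biorthogonal =
  fixes X :: "'c set" and I :: "'s set" and L R :: "'c \<Rightarrow> 's \<Rightarrow> complex"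
  assumes fX: "finite X" and fI: "finite I"
    and col_orth: "\<And>c c'. c \<in> X \<Longrightarrow> c' \<in> X \<Longrightarrow> (\<Sum>s\<in>I. L c s * R c' s) = (if c = c' then 1 else 0)"
    and row_orth: "\<And>s s'. s \<in> I \<Longrightarrow> s' \<in> I \<Longrightarrow> (\<Sum>c\<in>X. R c s * L c s') = (if s = s' then 1 else 0)"
begin

lemma expand_R:
  assumes s: "s \<in> I" shows "f s = (\<Sum>c\<in>X. (\<Sum>s'\<in>I. L c s' * f s') * R c s)"
proof -
  have "(\<Sum>c\<in>X. (\<Sum>s'\<in>I. L c s' * f s') * R c s) = (\<Sum>s'\<in>I. (\<Sum>c\<in>X. R c s * L c s') * f s')"
    unfolding sum_distrib_right by (subst sum.swap) (simp add: mult_ac)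
  also have "\<dots> = (\<Sum>s'\<in>I. if s = s' then f s' else 0)" using s by (intro sum.cong) (auto simp: row_orth)
  finally show ?thesis using s fI by simp
qed

lemma coeff_R:
  assumes c: "c \<in> X" and f: "\<And>s. s \<in> I \<Longrightarrow> f s = (\<Sum>c\<in>X. a c * R c s)"
  shows "a c = (\<Sum>s\<in>I. L c s * f s)"
proof -
  have "(\<Sum>s\<in>I. L c s * f s) = (\<Sum>s\<in>I. \<Sum>c'\<in>X. L c s * (a c' * R c' s))" using f by (simp add: sum_distrib_left)
  also have "\<dots> = (\<Sum>c'\<in>X. a c' * (\<Sum>s\<in>I. L c s * R c' s))"
    by (subst sum.swap) (simp add: sum_distrib_left mult_ac)
  also have "\<dots> = (\<Sum>c'\<in>X. if c = c' then a c' else 0)" using c by (intro sum.cong) (auto simp: col_orth)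
  finally show ?thesis using c fX by simp
qed

lemma function_basis_R: "function_basis I X R"
  unfolding function_basis_def
proof
  fix f :: "'s \<Rightarrow> complex"
  define a where "a = restrict (\<lambda>c. \<Sum>s\<in>I. L c s * f s) X"
  show "\<exists>!a. a \<in> extensional X \<and> (\<forall>s\<in>I. f s = (\<Sum>c\<in>X. a c * R c s))"
  proof (rule ex1I[of _ a])
    have "(\<Sum>c\<in>X. a c * R c s) = f s" if "s \<in> I" for s
      unfolding expand_R[OF that, of f] by (intro sum.cong) (auto simp: a_def)
    thus "a \<in> extensional X \<and> (\<forall>s\<in>I. f s = (\<Sum>c\<in>X. a c * R c s))" by (simp add: a_def)
    fix b assume b: "b \<in> extensional X \<and> (\<forall>s\<in>I. f s = (\<Sum>c\<in>X. b c * R c s))"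
    show "b = a"
    proof (rule extensionalityI[of _ X])
      show "b \<in> extensional X" "a \<in> extensional X" using b by (auto simp: a_def)
      fix c assume c: "c \<in> X"
      show "b c = a c" using coeff_R[OF c, of f b] b c by (simp add: a_def)
    qed
  qed
qed

lemma swapped: "biorthogonal X I R L"
  by unfold_locales (use fX fI col_orth row_orth in \<open>auto simp: mult.commute\<close>)

lemma expand_L: "s \<in> I \<Longrightarrow> f s = (\<Sum>c\<in>X. (\<Sum>s'\<in>I. R c s' * f s') * L c s)"
  by (rule biorthogonal.expand_R[OF swapped])

lemma function_basis_L: "function_basis I X L"
  by (rule biorthogonal.function_basis_R[OF swapped])

lemma R_nonzero: assumes "c \<in> X" shows "\<exists>s\<in>I. R c s \<noteq> 0"
proof (rule ccontr)
  assume "\<not> ?thesis"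
  thus False using col_orth[OF assms assms] by simp
qed

end

text \<open>Eigenfunctions are assumed on the right; the dual family \<open>L\<close> then consists
  of left eigenfunctions, and the powers of \<open>K\<close> follow.\<close>

locale diagonalized = biorthogonal +
  fixes K :: "'b \<Rightarrow> 'b \<Rightarrow> complex" and \<beta> :: "'a \<Rightarrow> complex"
  assumes eigen: "\<And>c x. c \<in> X \<Longrightarrow> x \<in> I \<Longrightarrow> (\<Sum>y\<in>I. K x y * R c y) = \<beta> c * R c x"
begin

lemma K_expand:
  assumes "x \<in> I" "y \<in> I"
  shows "K x y = (\<Sum>c\<in>X. \<beta> c * R c x * L c y)"
proof -
  have "K x y = (\<Sum>c\<in>X. (\<Sum>z\<in>I. R c z * K x z) * L c y)" by (rule expand_L[OF assms(2)])
  also have "\<dots> = (\<Sum>c\<in>X. \<beta> c * R c x * L c y)"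
    using eigen assms by (intro sum.cong) (auto simp: mult.commute)
  finally show ?thesis .
qed

lemma left_eigen:
  assumes c: "c \<in> X" and y: "y \<in> I"
  shows "(\<Sum>x\<in>I. L c x * K x y) = \<beta> c * L c y"
proof -
  have "(\<Sum>x\<in>I. L c x * K x y) = (\<Sum>x\<in>I. \<Sum>c'\<in>X. L c x * (\<beta> c' * R c' x * L c' y))"
    using K_expand[OF _ y] by (simp add: sum_distrib_left)
  also have "\<dots> = (\<Sum>c'\<in>X. (\<Sum>x\<in>I. L c x * R c' x) * (\<beta> c' * L c' y))"
    by (subst sum.swap) (simp add: sum_distrib_left mult_ac)
  also have "\<dots> = (\<Sum>c'\<in>X. if c = c' then \<beta> c' * L c' y else 0)" using c by (intro sum.cong) (auto simp: col_orth)
  finally show ?thesis using c fX by simp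
qed

lemma right_eigenfunction_R: "c \<in> X \<Longrightarrow> right_eigenfunction I K (\<beta> c) (R c)"
  using R_nonzero eigen by (simp add: right_eigenfunction_def)

lemma left_eigenfunction_L: "c \<in> X \<Longrightarrow> left_eigenfunction I K (\<beta> c) (L c)"
  using biorthogonal.R_nonzero[OF swapped] left_eigen by (simp add: left_eigenfunction_def)

text \<open>An eigenfunction f pairs nontrivially with some \<open>L c\<close>; moving
  \<open>K\<close> from f to \<open>L c\<close> in this pairing shows b = \<beta> c.\<close>

lemma eigenvalues: "{b. \<exists>f. right_eigenfunction I K b f} = \<beta> ` X"
proof (intro equalityI subsetI)
  fix b assume "b \<in> {b. \<exists>f. right_eigenfunction I K b f}"
  then obtain f x where x: "x \<in> I" "f x \<noteq> 0" and f: "\<And>x. x \<in> I \<Longrightarrow> (\<Sum>y\<in>I. K x y * f y) = b * f x"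
    by (auto simp: right_eigenfunction_def)
  have "\<exists>c\<in>X. (\<Sum>y\<in>I. L c y * f y) \<noteq> 0"
  proof (rule ccontr)
    assume "\<not> ?thesis"
    thus False using expand_R[OF x(1), of f] x(2) by simp
  qed
  then obtain c where c: "c \<in> X" "(\<Sum>y\<in>I. L c y * f y) \<noteq> 0" by blast
  have "b * (\<Sum>x\<in>I. L c x * f x) = (\<Sum>x\<in>I. L c x * (\<Sum>y\<in>I. K x y * f y))"
    using f by (simp add: sum_distrib_left mult_ac)
  also have "\<dots> = (\<Sum>y\<in>I. (\<Sum>x\<in>I. L c x * K x y) * f y)"
    unfolding sum_distrib_left sum_distrib_right by (subst sum.swap) (simp add: mult_ac)
  also have "\<dots> = \<beta> c * (\<Sum>y\<in>I. L c y * f y)"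
    using left_eigen[OF c(1)] by (simp add: sum_distrib_left mult_ac)
  finally show "b \<in> \<beta> ` X" using c by simp
qed (use right_eigenfunction_R in blast)

text \<open>The component of a fixed \<mu> along \<open>L c\<close> is its pairing with
  \<open>R c\<close>, which \<open>K\<close> multiplies by \<beta> c; so only the component at e
  remains.\<close>

lemma left_fixed_unique:
  assumes e: "e \<in> X" and one: "\<And>c. c \<in> X \<Longrightarrow> \<beta> c = 1 \<Longrightarrow> c = e"
    and fixed: "\<And>y. y \<in> I \<Longrightarrow> (\<Sum>x\<in>I. \<mu> x * K x y) = \<mu> y" and s: "s \<in> I"
  shows "\<mu> s = (\<Sum>x\<in>I. R e x * \<mu> x) * L e s"
proof -
  have 0: "(\<Sum>x\<in>I. R c x * \<mu> x) = 0" if c: "c \<in> X" "c \<noteq> e" for c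
  proof -
    have "(\<Sum>y\<in>I. R c y * \<mu> y) = (\<Sum>y\<in>I. R c y * (\<Sum>x\<in>I. \<mu> x * K x y))" using fixed by simp
    also have "\<dots> = (\<Sum>x\<in>I. (\<Sum>y\<in>I. K x y * R c y) * \<mu> x)"
      unfolding sum_distrib_left sum_distrib_right by (subst sum.swap) (simp add: mult_ac)
    also have "\<dots> = \<beta> c * (\<Sum>x\<in>I. R c x * \<mu> x)"
      using eigen[OF c(1)] by (simp add: sum_distrib_left mult_ac)
    finally show ?thesis using one[OF c(1)] c(2) by auto
  qed
  have "\<mu> s = (\<Sum>c\<in>X. (\<Sum>x\<in>I. R c x * \<mu> x) * L c s)" by (rule expand_L[OF s])
  also have "\<dots> = (\<Sum>c\<in>X. if c = e then (\<Sum>x\<in>I. R e x * \<mu> x) * L e s else 0)"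
    by (intro sum.cong) (auto simp: 0)
  finally show ?thesis using e fX by simp
qed

lemma mc_power_expand:
  assumes x: "x \<in> I" and y: "y \<in> I"
  shows "mc_power I K l x y = (\<Sum>c\<in>X. \<beta> c ^ l * R c x * L c y)"
  using y
proof (induction l arbitrary: y)
  case 0
  thus ?case using row_orth[OF x] by simp
next
  case (Suc l)
  have "mc_power I K (Suc l) x y = (\<Sum>z\<in>I. \<Sum>c\<in>X. \<beta> c ^ l * R c x * (L c z * K z y))"
    using Suc.IH by (simp add: sum_distrib_left mult_ac)
  also have "\<dots> = (\<Sum>c\<in>X. \<beta> c ^ l * R c x * (\<Sum>z\<in>I. L c z * K z y))"
    by (subst sum.swap) (simp add: sum_distrib_left)
  also have "\<dots> = (\<Sum>c\<in>X. \<beta> c ^ Suc l * R c x * L c y)"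
    using left_eigen[OF _ Suc.prems] by (intro sum.cong) (auto simp: mult_ac)
  finally show ?case .
qed

end

text \<open>The equality case of the triangle inequality: real parts are at most 1, so each must be
  1.\<close>

lemma sum_unit_vectors:
  assumes "\<forall>z\<in>#A. norm (z :: complex) = 1" "(\<Sum>z\<in>#A. z) = of_nat (size A)"
  shows "\<forall>z\<in>#A. z = 1"
proof -
  have "Re (\<Sum>z\<in>#A. z) \<le> real (size A) \<and> (Re (\<Sum>z\<in>#A. z) = real (size A) \<longrightarrow> (\<forall>z\<in>#A. Re z = 1))"
    using assms(1)
  proof (induction A)
    case (add z A)
    have "Re z \<le> 1" using add.prems complex_Re_le_cmod[of z] by simp
    thus ?case using add by auto
  qed simp
  hence "\<forall>z\<in>#A. Re z = 1" using assms(2) by simp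
  thus ?thesis using assms(1) by (auto simp: complex_eq_iff cmod_def)
qed

text \<open>A matrix of order prime to the characteristic is diagonalizable: apply the decomposition to the trivial group.\<close>

lemma finite_order_unipotent:
  fixes R :: "'k :: alg_closed_field mat"
  assumes R: "R \<in> carrier_mat n n" and Rm: "R ^\<^sub>m m = 1\<^sub>m n" and m: "(of_nat m :: 'k) \<noteq> 0"
    and ev: "\<And>x. x \<in># evs R \<Longrightarrow> x = 1"
  shows "R = 1\<^sub>m n"
proof -
  define G where "G = \<lparr>carrier = {()}, monoid.mult = (\<lambda>_ _. ()), one = ()\<rparr>"
  define M :: "(unit, 'k) gmod" where "M = (n, \<lambda>_. 1\<^sub>m n)"
  have M: "is_gmod G M" by (simp add: is_gmod_def M_def G_def)
  have "R \<in> gmod_hom G M M" using R by (simp add: gmod_hom_def M_def)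
  hence "\<exists>d P B C x. decomposition G M R d P B C x"
    by (rule decomposition_exists[OF M _ _ m]) (simp add: M_def Rm)
  then obtain d P B C x where dec: "decomposition G M R d P B C x" by blast
  note e = dec[unfolded decomposition_def]
  have BC: "B i \<in> carrier_mat n (fst (P i))" "C i \<in> carrier_mat (fst (P i)) n" if "i < d" for i
    using e that hom_carrier[of "B i" G "P i" M] hom_carrier[of "C i" G M "P i"] by (auto simp: M_def)
  have sum: "msum n n d (\<lambda>i. B i * C i) = 1\<^sub>m n" using e by (simp add: M_def)
  have evsR: "evs R = (\<Sum>i<d. image_mset ((*) (x i)) (evs (snd (P i) ())))" using e R by (simp add: M_def G_def)
  have x: "x i = 1" if i: "i < d" for i
  proof -
    have I: "indecomposable_gmod G (P i)" using e i by blast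
    have "snd (P i) () = 1\<^sub>m (fst (P i))" using gmod_one[OF indecomposableD(1)[OF I]] by (simp add: G_def)
    hence "1 \<in># evs (snd (P i) ())" using indecomposableD(2)[OF I] by (simp add: evs_one)
    hence "x i \<in># image_mset ((*) (x i)) (evs (snd (P i) ()))" by force
    hence "x i \<in># evs R" unfolding evsR using i by (subst set_mset_sum) auto
    thus ?thesis by (rule ev)
  qed
  have "R = R * msum n n d (\<lambda>i. B i * C i)" unfolding sum right_mult_one_mat[OF R] ..
  also have "\<dots> = msum n n d (\<lambda>i. R * (B i * C i))" by (rule mult_msum[OF R mult_carrier_mat[OF BC]])
  also have "\<dots> = msum n n d (\<lambda>i. B i * C i)"
  proof (rule msum_cong)
    fix i assume i: "i < d"
    have "R * B i = B i" using e i x[OF i] by auto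
    thus "R * (B i * C i) = B i * C i" using assoc_mult_mat[OF R BC[OF i]] by simp
  qed
  finally show ?thesis unfolding sum .
qed

section \<open>Irreducible Brauer characters as the state space of the chain\<close>

context modular_rep
begin

text \<open>The eigenvalue multisets of the realized terms telescope along the series, starting from
  the zero module.\<close>

lemma Br_composition_series:
  fixes M :: "('g, 'k) gmod"
  assumes M: "is_gmod G M" and W: "composition_series G M m W"
  obtains F where "\<And>i. i < m \<Longrightarrow> irreducible_gmod G (F i)"
    "\<And>i S. i < m \<Longrightarrow> irreducible_gmod G S \<Longrightarrow> factor_iso G M (W i) (W (Suc i)) S \<longleftrightarrow> gmod_iso G (F i) S"
    "\<And>g. Br M g = (\<Sum>i<m. Br (F i) g)"
proof -
  note w = W[unfolded composition_series_def]
  have mx: "maximal_in G M (W i) (W (Suc i))" if "i < m" for i using w that by (simp add: maximal_in_def)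
  have "\<exists>N X Y. realizes G M (W i) N X Y" if "i \<le> m" for i
    by (rule realizes_exists[OF M]) (use w that in simp)
  then obtain N X Y where N: "\<And>i. i \<le> m \<Longrightarrow> realizes G M (W i) (N i) (X i) (Y i)" by metis
  have "\<exists>F. irreducible_gmod G F \<and> (\<forall>g\<in>carrier G. evs (snd (N (Suc i)) g) = evs (snd (N i) g) + evs (snd F g)) \<and>
    (\<forall>S. irreducible_gmod G S \<longrightarrow> factor_iso G M (W i) (W (Suc i)) S = gmod_iso G F S)" if i: "i < m" for i
  proof -
    have "i \<le> m" "Suc i \<le> m" using i by auto
    from maximal_factor[OF M mx[OF i] N[OF this(2)] N[OF this(1)]] show ?thesis by metis
  qed
  then obtain F where F: "\<And>i. i < m \<Longrightarrow> irreducible_gmod G (F i)"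
    and evs_F: "\<And>i g. i < m \<Longrightarrow> g \<in> carrier G \<Longrightarrow> evs (snd (N (Suc i)) g) = evs (snd (N i) g) + evs (snd (F i) g)"
    and iso: "\<And>i S. i < m \<Longrightarrow> irreducible_gmod G S \<Longrightarrow> factor_iso G M (W i) (W (Suc i)) S = gmod_iso G (F i) S" by metis
  have "fst (N 0) = 0"
  proof (rule ccontr)
    assume "fst (N 0) \<noteq> 0"
    note r = realizesD[OF N[OF le0]]
    let ?u = "unit_vec (fst (N 0)) 0 :: 'k vec"
    have "X 0 *\<^sub>v ?u = 0\<^sub>v (fst M)" using r(6)[of ?u] w by simp
    hence "?u = 0\<^sub>v (fst (N 0))" using r(7)[of ?u] mult_mat_vec_zero'[OF r(4)] by simp
    thus False using \<open>fst (N 0) \<noteq> 0\<close> by simp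
  qed
  hence N0: "evs (snd (N 0) g) = {#}" if "g \<in> carrier G" for g
    using size_evs[OF gmod_carrier[OF realizesD(1)[OF N[OF le0]] that]] by simp
  have "Br M g = (\<Sum>i<m. Br (F i) g)" for g
  proof (cases "g \<in> preg")
    case True
    note g = preg_carrier[OF True]
    have "bt (snd (N k) g) = (\<Sum>i<k. bt (snd (F i) g))" if "k \<le> m" for k
      using that
    proof (induction k)
      case 0
      thus ?case using N0[OF g] by (simp add: bt_def)
    next
      case (Suc k)
      thus ?case using evs_F[of k g] g by (simp add: bt_def)
    qed
    moreover have "bt (snd M g) = bt (snd (N m) g)"
    proof -
      have R: "realizes G M (W m) M (1\<^sub>m (fst M)) (1\<^sub>m (fst M))" using realizes_full[OF M] w by simp
      have "evs (snd M g) = evs (snd (N m) g)"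
        by (rule gmod_iso_evs[OF M realizesD(1)[OF N[OF order_refl]] realizes_iso[OF M R N[OF order_refl]] g])
      thus ?thesis by (simp add: bt_def)
    qed
    ultimately show ?thesis by (simp add: Br_eq[OF True])
  qed (simp add: Br_not_regular)
  thus ?thesis using that F iso by blast
qed

context
  fixes K :: "'g set"
  assumes K: "p_regular_reps G p K"
begin

abbreviation IB :: "('g \<Rightarrow> complex) set" where "IB \<equiv> IBr \<theta> G"
abbreviation im :: "('g \<Rightarrow> complex) \<Rightarrow> ('g, 'k) gmod" where "im \<equiv> irr_mod \<theta> G"
abbreviation pc :: "('g \<Rightarrow> complex) \<Rightarrow> ('g, 'k) gmod" where "pc \<chi> \<equiv> SOME P. proj_indec_cover G (im \<chi>) P"

lemma reps_unique: "c \<in> K \<Longrightarrow> c' \<in> K \<Longrightarrow> c \<in> conj_class G c' \<Longrightarrow> c = c'"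
proof -
  assume c: "c \<in> K" "c' \<in> K" "c \<in> conj_class G c'"
  have "c' \<in> conj_class G c'"
    unfolding conj_class_def by (rule image_eqI[of _ _ \<one>]) (use reps_carrier[OF K c(2)] in auto)
  thus "c = c'" using K c reps_preg[OF K c(2)] unfolding p_regular_reps_def by blast
qed

lemma one_reps: "\<one> \<in> K"
  using reps_ex[OF K one_preg] by (auto simp: conj_class_def)

text \<open>For representatives the count in the orthogonality relation vanishes unless c = c',
  because x c' = c x makes c a conjugate of c'.\<close>

lemma card_transporter:
  assumes c: "c \<in> K" "c' \<in> K"
  shows "card {x \<in> carrier G. x \<otimes> c' = c \<otimes> x} = (if c = c' then card (centralizer G c) else 0)"
proof (cases "c = c'")
  case False
  have "{x \<in> carrier G. x \<otimes> c' = c \<otimes> x} = {}"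
  proof (rule ccontr)
    assume "{x \<in> carrier G. x \<otimes> c' = c \<otimes> x} \<noteq> {}"
    then obtain x where x: "x \<in> carrier G" "x \<otimes> c' = c \<otimes> x" by blast
    have "c = x \<otimes> c' \<otimes> inv x" using x reps_carrier[OF K] c by (simp add: m_assoc)
    hence "c \<in> conj_class G c'" unfolding conj_class_def using x(1) by (rule image_eqI)
    thus False using reps_unique[OF c] False by blast
  qed
  thus ?thesis using False by (simp only: card.empty if_False)
qed (simp add: centralizer_def)

lemma centralizer_card_pos: "c \<in> K \<Longrightarrow> card (centralizer G c) > 0"
proof -
  assume "c \<in> K"
  hence "\<one> \<in> centralizer G c" using reps_carrier[OF K] by (simp add: centralizer_def)
  moreover have "finite (centralizer G c)" using fin by (simp add: centralizer_def)
  ultimately show ?thesis by (auto simp: card_gt_0_iff)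
qed

text \<open>Orbit-stabilizer: the fibres of the map from x to x c x^{-1} are left translates of the
  centralizer.\<close>

lemma card_conj_class:
  assumes c: "c \<in> carrier G"
  shows "card (carrier G) = card (conj_class G c) * card (centralizer G c)"
proof -
  let ?f = "\<lambda>x. x \<otimes> c \<otimes> inv x"
  have "card {x \<in> carrier G. ?f x = y} = card (centralizer G c)" if y: "y \<in> conj_class G c" for y
  proof -
    obtain z where z: "z \<in> carrier G" "y = ?f z" using y by (auto simp: conj_class_def)
    have "bij_betw (\<lambda>x. z \<otimes> x) (centralizer G c) {x \<in> carrier G. ?f x = y}"
    proof (rule bij_betw_byWitness[where f' = "\<lambda>x. inv z \<otimes> x"])
      show "\<forall>x\<in>centralizer G c. inv z \<otimes> (z \<otimes> x) = x" "\<forall>x\<in>{x \<in> carrier G. ?f x = y}. z \<otimes> (inv z \<otimes> x) = x"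
        using z by (simp_all add: centralizer_def m_assoc[symmetric])
      show "(\<lambda>x. z \<otimes> x) ` centralizer G c \<subseteq> {x \<in> carrier G. ?f x = y}"
      proof (intro subsetI, elim imageE)
        fix u x assume x: "x \<in> centralizer G c" "u = z \<otimes> x"
        hence xc: "x \<in> carrier G" "x \<otimes> c = c \<otimes> x" by (auto simp: centralizer_def)
        have "?f (z \<otimes> x) = z \<otimes> (x \<otimes> c) \<otimes> (inv x \<otimes> inv z)" using z xc(1) c by (simp add: m_assoc inv_mult_group)
        also have "\<dots> = z \<otimes> c \<otimes> (x \<otimes> inv x) \<otimes> inv z" 
          unfolding xc(2) using z xc(1) c m_assoc[of x "inv x" "inv z"] by (simp add: m_assoc)
        also have "\<dots> = y" using z xc(1) c by simp
        finally show "u \<in> {x \<in> carrier G. ?f x = y}" using x(2) z xc(1) by simp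
      qed
      show "(\<lambda>x. inv z \<otimes> x) ` {x \<in> carrier G. ?f x = y} \<subseteq> centralizer G c"
      proof (intro subsetI, elim imageE)
        fix u x assume x: "x \<in> {x \<in> carrier G. ?f x = y}" "u = inv z \<otimes> x"
        hence xc: "x \<in> carrier G" "?f x = ?f z" using z by auto
        have "x \<otimes> c = ?f x \<otimes> x" using xc(1) c by (simp add: m_assoc)
        also have "\<dots> = z \<otimes> c \<otimes> (inv z \<otimes> x)" unfolding xc(2) using z xc(1) c by (simp add: m_assoc)
        finally have "inv z \<otimes> (x \<otimes> c) = inv z \<otimes> (z \<otimes> (c \<otimes> (inv z \<otimes> x)))" using z xc(1) c by (simp add: m_assoc)
        also have "\<dots> = c \<otimes> (inv z \<otimes> x)" using m_assoc[of "inv z" z "c \<otimes> (inv z \<otimes> x)"] z xc(1) c by simp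
        finally show "u \<in> centralizer G c" using x(2) z xc(1) c by (simp add: centralizer_def m_assoc)
      qed
    qed
    thus ?thesis by (rule bij_betw_same_card[symmetric])
  qed
  moreover have "card (carrier G) = (\<Sum>y\<in>?f ` carrier G. card {x \<in> carrier G. ?f x = y})"
    using sum.image_gen[OF fin, of "\<lambda>_. 1 :: nat" ?f] by simp
  ultimately show ?thesis by (simp add: conj_class_def)
qed

text \<open>The row relation distinguishes any two members of a complete system by their values on
  the representatives: equal characters of different members would give 0 = 1. \<open>S\<close> and
  \<open>T\<close> are replaced by the members isomorphic to them.\<close>

lemma Br_inj_irreducible:
  assumes S: "irreducible_gmod G S" and T: "irreducible_gmod G T" and e: "Br S = Br T"
  shows "gmod_iso G S T"
proof -
  obtain J where J: "complete_system J" using complete_system_exists[OF K] by blast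
  note j = J[unfolded complete_system_def simple_system_def]
  have ex: "\<exists>U'\<in>J. gmod_iso G U U'" if "irreducible_gmod G U" for U
    using J that unfolding complete_system_def by blast
  obtain S' where S': "S' \<in> J" "gmod_iso G S S'" using ex[OF S] by blast
  obtain T' where T': "T' \<in> J" "gmod_iso G T T'" using ex[OF T] by blast
  have irr: "irreducible_gmod G U" if "U \<in> J" for U using j that by blast
  note gS = irreducibleD(1)[OF S] and gT = irreducibleD(1)[OF T]
    and gS' = irreducibleD(1)[OF irr[OF S'(1)]] and gT' = irreducibleD(1)[OF irr[OF T'(1)]]
  have e': "Br S' = Br T'" using e Br_iso[OF gS gS' S'(2)] Br_iso[OF gT gT' T'(2)] by simp
  obtain PC where PC: "\<And>U. U \<in> J \<Longrightarrow> proj_indec_cover G U (PC U)" using irreducible_cover_exists irr by metis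
  define L where "L c U = cnj (Br (PC U) c) / of_nat (card (centralizer G c))" for c U
  have orth: "(\<Sum>U\<in>J. L c U * Br U c') = (if c = c' then 1 else 0)" if "c \<in> K" "c' \<in> K" for c c'
  proof -
    have "(\<Sum>U\<in>J. L c U * Br U c') = (\<Sum>U\<in>J. cnj (Br (PC U) c) * Br U c') / of_nat (card (centralizer G c))"
      by (simp add: L_def sum_divide_distrib)
    also have "\<dots> = of_nat (card {x \<in> carrier G. x \<otimes> c' = c \<otimes> x}) / of_nat (card (centralizer G c))"
      using Br_orthogonality[OF J PC reps_preg[OF K that(1)] reps_preg[OF K that(2)]] by simp
    finally show ?thesis
      using card_transporter[OF that] centralizer_card_pos[OF that(1)] centralizer_card_pos[OF that(2)] by simp
  qed
  have row: "(\<Sum>c\<in>K. Br U c * L c V) = (if U = V then 1 else 0)" if "U \<in> J" "V \<in> J" for U V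
    by (rule biorthogonal_swap[where R = "\<lambda>c U. Br U c", OF finite_reps[OF K] _ card_simple_system_le[OF K] orth that])
       (use j J in \<open>auto simp: complete_system_def\<close>)
  have "S' = T'" using row[OF S'(1) T'(1)] row[OF S'(1) S'(1)] row[OF T'(1) T'(1)] unfolding e' by (metis zero_neq_one)
  thus ?thesis using gmod_iso_trans[OF gS gS' gT S'(2)] gmod_iso_sym[OF T'(2)] by simp
qed

lemma irr_mod: assumes "\<chi> \<in> IB" shows "irreducible_gmod G (im \<chi>)" "Br (im \<chi>) = \<chi>"
proof -
  have "\<exists>S. irreducible_gmod G S \<and> Br S = \<chi>" using assms by (auto simp: IBr_def)
  from someI_ex[OF this] show "irreducible_gmod G (im \<chi>)" "Br (im \<chi>) = \<chi>" by (auto simp: irr_mod_def)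
qed

lemma IB_I: "irreducible_gmod G S \<Longrightarrow> Br S \<in> IB"
  by (auto simp: IBr_def)

lemma im_inj: "inj_on im IB"
  using irr_mod(2) by (metis inj_onI)

lemma complete_im: "complete_system (im ` IB)"
proof -
  \<comment> \<open>Finiteness of \<open>IB\<close> is not known beforehand; the common bound on its
    finite subsets implies it.\<close>
  have "card J \<le> card K \<and> finite J" if "J \<subseteq> im ` IB" "finite J" for J
  proof -
    have "simple_system J"
      unfolding simple_system_def
    proof (intro conjI that ballI impI)
      fix S assume "S \<in> J"
      thus "irreducible_gmod G S" using that irr_mod by auto
    next
      fix S T assume "S \<in> J" "T \<in> J" and iso: "gmod_iso G S T"
      have "S \<in> im ` IB" "T \<in> im ` IB" using subsetD[OF that(1)] \<open>S \<in> J\<close> \<open>T \<in> J\<close> by blast+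
      then obtain \<chi> \<psi> where x: "\<chi> \<in> IB" "S = im \<chi>" "\<psi> \<in> IB" "T = im \<psi>" by blast
      thus "S = T" using Br_iso[OF _ _ iso] irr_mod irreducibleD(1) by metis
    qed
    thus ?thesis using card_simple_system_le[OF K] that by blast
  qed
  hence fin: "finite (im ` IB)" using infinite_arbitrarily_large[of "im ` IB" "Suc (card K)"] by (metis Suc_n_not_le_n)
  show ?thesis
    unfolding complete_system_def simple_system_def
  proof (intro conjI fin ballI impI allI)
    fix S assume "S \<in> im ` IB"
    thus "irreducible_gmod G S" using irr_mod by auto
  next
    fix S T assume "S \<in> im ` IB" "T \<in> im ` IB" and iso: "gmod_iso G S T"
    then obtain \<chi> \<psi> where x: "\<chi> \<in> IB" "S = im \<chi>" "\<psi> \<in> IB" "T = im \<psi>" by blast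
    thus "S = T" using Br_iso[OF _ _ iso] irr_mod irreducibleD(1) by metis
  next
    fix S :: "('g, 'k) gmod" assume S: "irreducible_gmod G S"
    have "gmod_iso G S (im (Br S))"
      by (rule Br_inj_irreducible[OF S irr_mod(1)[OF IB_I[OF S]]]) (simp add: irr_mod(2)[OF IB_I[OF S]])
    thus "\<exists>T\<in>im ` IB. gmod_iso G S T" using IB_I[OF S] by blast
  qed
qed

lemma finite_IB: "finite IB"
  using complete_im finite_imageD[OF _ im_inj] by (simp add: complete_system_def simple_system_def)

lemma card_IB: "card IB \<le> card K"
  using card_simple_system_le[OF K, of "im ` IB"] complete_im card_image[OF im_inj] by (simp add: complete_system_def)

lemma pc_cover: "\<chi> \<in> IB \<Longrightarrow> proj_indec_cover G (im \<chi>) (pc \<chi>)"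
  by (rule someI_ex[OF irreducible_cover_exists[OF irr_mod(1)]])

lemma proj_char_eq: "proj_char \<theta> G \<chi> = Br (pc \<chi>)"
  by (simp add: proj_char_def)

lemma IB_orthogonality:
  assumes "c \<in> K" "c' \<in> K"
  shows "(\<Sum>\<chi>\<in>IB. cnj (proj_char \<theta> G \<chi> c) * \<chi> c') = (if c = c' then of_nat (card (centralizer G c)) else 0)"
proof -
  \<comment> \<open>A module \<open>im \<chi>\<close> gives back its character, so covers that were
    chosen per character can be indexed by modules.\<close>
  define PC where "PC S = pc (Br S)" for S
  have PC: "proj_indec_cover G S (PC S)" if "S \<in> im ` IB" for S
  proof -
    obtain \<chi> where x: "\<chi> \<in> IB" "S = im \<chi>" using \<open>S \<in> im ` IB\<close> by (rule imageE)
    thus ?thesis using pc_cover[OF x(1)] irr_mod(2)[OF x(1)] by (simp add: PC_def)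
  qed
  have "(\<Sum>S\<in>im ` IB. cnj (Br (PC S) c) * Br S c') = (\<Sum>\<chi>\<in>IB. cnj (proj_char \<theta> G \<chi> c) * \<chi> c')"
    unfolding sum.reindex[OF im_inj] by (intro sum.cong) (simp_all add: PC_def irr_mod proj_char_eq)
  hence "(\<Sum>\<chi>\<in>IB. cnj (proj_char \<theta> G \<chi> c) * \<chi> c') = of_nat (card {x \<in> carrier G. x \<otimes> c' = c \<otimes> x})"
    using Br_orthogonality[OF complete_im PC reps_preg[OF K assms(1)] reps_preg[OF K assms(2)]] by simp
  thus ?thesis unfolding card_transporter[OF assms] by simp
qed

lemma IB_one: assumes "\<chi> \<in> IB" shows "\<chi> \<one> = of_nat (fst (im \<chi>))" "\<chi> \<one> \<noteq> 0" "cnj (\<chi> \<one>) = \<chi> \<one>"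
proof -
  note i = irr_mod[OF assms]
  show 1: "\<chi> \<one> = of_nat (fst (im \<chi>))" using Br_one[OF irreducibleD(1)[OF i(1)]] i(2) by simp
  show "\<chi> \<one> \<noteq> 0" unfolding 1 using irreducibleD(2)[OF i(1)] by simp
  show "cnj (\<chi> \<one>) = \<chi> \<one>" unfolding 1 by simp
qed

lemma proj_char_one: assumes "\<chi> \<in> IB"
  shows "proj_char \<theta> G \<chi> \<one> = of_nat (fst (pc \<chi>))" "proj_char \<theta> G \<chi> \<one> \<noteq> 0"
proof -
  have I: "indecomposable_gmod G (pc \<chi>)" using pc_cover[OF assms] by (simp add: proj_indec_cover_def)
  show 1: "proj_char \<theta> G \<chi> \<one> = of_nat (fst (pc \<chi>))" using Br_one[OF indecomposableD(1)[OF I]] by (simp add: proj_char_eq)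
  show "proj_char \<theta> G \<chi> \<one> \<noteq> 0" unfolding 1 using indecomposableD(2)[OF I] by simp
qed

text \<open>The factors \<chi>(1) in \<open>l_fun\<close> and \<open>r_fun\<close> cancel, leaving
  the orthogonality relation divided by the order of the centralizer. The bound
  \<open>card_IB\<close> then yields the relation summed over the representatives.\<close>

lemma biorthogonal_IB: "biorthogonal K IB (l_fun \<theta> G) (r_fun G)"
proof
  show "finite K" "finite IB" by (rule finite_reps[OF K], rule finite_IB)
  show orth: "(\<Sum>\<chi>\<in>IB. l_fun \<theta> G c \<chi> * r_fun G c' \<chi>) = (if c = c' then 1 else 0)" if "c \<in> K" "c' \<in> K" for c c'
  proof -
    have "(\<Sum>\<chi>\<in>IB. l_fun \<theta> G c \<chi> * r_fun G c' \<chi>) =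
      (\<Sum>\<chi>\<in>IB. cnj (proj_char \<theta> G \<chi> c) * \<chi> c') / of_nat (card (centralizer G c))"
      unfolding sum_divide_distrib by (intro sum.cong) (simp_all add: l_fun_def r_fun_def IB_one(2))
    thus ?thesis using IB_orthogonality[OF that] centralizer_card_pos[OF that(1)] centralizer_card_pos[OF that(2)] by simp
  qed
  show "(\<Sum>c\<in>K. r_fun G c \<chi> * l_fun \<theta> G c \<psi>) = (if \<chi> = \<psi> then 1 else 0)" if "\<chi> \<in> IB" "\<psi> \<in> IB" for \<chi> \<psi>
    by (rule biorthogonal_swap[OF finite_reps[OF K] finite_IB card_IB orth that])
qed

text \<open>In the expansion of a(\<chi>) \<chi>(1), as a function of \<chi>, in the basis of the
  \<open>l_fun\<close>, the coefficient at c is exactly the vanishing sum.\<close>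

lemma IB_independent:
  assumes a: "\<And>c. c \<in> K \<Longrightarrow> (\<Sum>\<chi>\<in>IB. a \<chi> * \<chi> c) = 0" and \<psi>: "\<psi> \<in> IB"
  shows "a \<psi> = 0"
proof -
  interpret b: biorthogonal K IB "l_fun \<theta> G" "r_fun G" by (rule biorthogonal_IB)
  have "a \<psi> * \<psi> \<one> = (\<Sum>c\<in>K. (\<Sum>\<chi>\<in>IB. r_fun G c \<chi> * (a \<chi> * \<chi> \<one>)) * l_fun \<theta> G c \<psi>)"
    by (rule b.expand_L[OF \<psi>])
  also have "\<dots> = (\<Sum>c\<in>K. (\<Sum>\<chi>\<in>IB. a \<chi> * \<chi> c) * l_fun \<theta> G c \<psi>)"
  proof (rule sum.cong[OF refl])
    fix c
    have "(\<Sum>\<chi>\<in>IB. r_fun G c \<chi> * (a \<chi> * \<chi> \<one>)) = (\<Sum>\<chi>\<in>IB. a \<chi> * \<chi> c)"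
      by (intro sum.cong) (simp_all add: r_fun_def IB_one(2))
    thus "(\<Sum>\<chi>\<in>IB. r_fun G c \<chi> * (a \<chi> * \<chi> \<one>)) * l_fun \<theta> G c \<psi> = (\<Sum>\<chi>\<in>IB. a \<chi> * \<chi> c) * l_fun \<theta> G c \<psi>" by simp
  qed
  also have "\<dots> = 0" using a by simp
  finally show ?thesis using IB_one(2)[OF \<psi>] by simp
qed

text \<open>Each composition series writes the Brauer character as a combination of irreducible ones
  with its own multiplicities. Linear independence makes these equal for any two series, which is
  what the definite description in \<open>comp_mult\<close> requires.\<close>

lemma Br_comp_mult:
  assumes M: "is_gmod G M"
  shows "Br M g = (\<Sum>\<chi>\<in>IB. of_nat (comp_mult G (im \<chi>) M) * \<chi> g)"
proof -
  define cnt where "cnt m W \<chi> = card {i. i < m \<and> factor_iso G M (W i) (W (Suc i)) (im \<chi>)}"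
    for m :: nat and W :: "nat \<Rightarrow> 'k vec set" and \<chi>
  have sum_cnt: "Br M g = (\<Sum>\<chi>\<in>IB. of_nat (cnt m W \<chi>) * \<chi> g)" if W: "composition_series G M m W" for m W g
  proof -
    obtain F where F: "\<And>i. i < m \<Longrightarrow> irreducible_gmod G (F i)"
      and iso: "\<And>i S. i < m \<Longrightarrow> irreducible_gmod G S \<Longrightarrow> factor_iso G M (W i) (W (Suc i)) S \<longleftrightarrow> gmod_iso G (F i) S"
      and Br: "\<And>g. Br M g = (\<Sum>i<m. Br (F i) g)" by (rule Br_composition_series[OF M W]) blast
    have eq: "factor_iso G M (W i) (W (Suc i)) (im \<chi>) \<longleftrightarrow> Br (F i) = \<chi>" if i: "i < m" and x: "\<chi> \<in> IB" for i \<chi>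
      unfolding iso[OF i irr_mod(1)[OF x]]
      using Br_iso[OF irreducibleD(1)[OF F[OF i]] irreducibleD(1)[OF irr_mod(1)[OF x]]]
        Br_inj_irreducible[OF F[OF i] irr_mod(1)[OF x]] irr_mod(2)[OF x] by auto
    have "Br M g = (\<Sum>i<m. \<Sum>\<chi>\<in>IB. if Br (F i) = \<chi> then \<chi> g else 0)"
      unfolding Br by (intro sum.cong refl) (use F IB_I finite_IB in simp)
    also have "\<dots> = (\<Sum>\<chi>\<in>IB. \<Sum>i<m. if Br (F i) = \<chi> then \<chi> g else 0)" by (rule sum.swap)
    also have "\<dots> = (\<Sum>\<chi>\<in>IB. of_nat (cnt m W \<chi>) * \<chi> g)"
    proof (rule sum.cong[OF refl])
      fix \<chi> assume x: "\<chi> \<in> IB"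
      have "{i. i < m \<and> factor_iso G M (W i) (W (Suc i)) (im \<chi>)} = {i \<in> {..<m}. Br (F i) = \<chi>}" using eq[OF _ x] by auto
      thus "(\<Sum>i<m. if Br (F i) = \<chi> then \<chi> g else 0) = of_nat (cnt m W \<chi>) * \<chi> g"
        unfolding cnt_def by (simp add: sum.If_cases Int_def)
    qed
    finally show ?thesis .
  qed
  obtain m W where W: "composition_series G M m W" using composition_series_exists[OF M] by blast
  have "comp_mult G (im \<chi>) M = cnt m W \<chi>" if x: "\<chi> \<in> IB" for \<chi>
    unfolding comp_mult_def
  proof (rule the_equality)
    show "\<exists>m' W'. composition_series G M m' W' \<and> cnt m W \<chi> = card {i. i < m' \<and> factor_iso G M (W' i) (W' (Suc i)) (im \<chi>)}"
      using W unfolding cnt_def by blast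
    fix r assume "\<exists>m' W'. composition_series G M m' W' \<and> r = card {i. i < m' \<and> factor_iso G M (W' i) (W' (Suc i)) (im \<chi>)}"
    then obtain m' W' where W': "composition_series G M m' W'" "r = cnt m' W' \<chi>" unfolding cnt_def by blast
    have "(of_nat (cnt m' W' \<chi>) - of_nat (cnt m W \<chi>) :: complex) = 0"
    proof (rule IB_independent[OF _ x])
      fix c
      show "(\<Sum>\<chi>\<in>IB. (of_nat (cnt m' W' \<chi>) - of_nat (cnt m W \<chi>)) * \<chi> c) = 0"
        using sum_cnt[OF W'(1), of c] sum_cnt[OF W, of c] by (simp add: left_diff_distrib sum_subtractf)
    qed
    thus "r = cnt m W \<chi>" using W'(2) by simp
  qed
  thus ?thesis using sum_cnt[OF W, of g] by simp
qed

text \<open>The factors \<psi>(1) cancel, and what remains is the Brauer character of the tensor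
  product at c, expanded by composition multiplicities.\<close>

lemma K_chain_eigen:
  assumes A: "is_gmod G A" and c: "c \<in> K" and x: "\<chi> \<in> IB"
  shows "(\<Sum>\<psi>\<in>IB. K_chain \<theta> G A \<chi> \<psi> * r_fun G c \<psi>) = Br A c / Br A \<one> * r_fun G c \<chi>"
proof -
  note X = irreducibleD(1)[OF irr_mod(1)[OF x]]
  have "(\<Sum>\<psi>\<in>IB. K_chain \<theta> G A \<chi> \<psi> * r_fun G c \<psi>) =
    (\<Sum>\<psi>\<in>IB. of_nat (comp_mult G (im \<psi>) (im \<chi> \<otimes>\<^sub>M A)) * \<psi> c) / (Br A \<one> * \<chi> \<one>)"
    unfolding sum_divide_distrib by (intro sum.cong) (simp_all add: K_chain_def r_fun_def IB_one(2))
  also have "\<dots> = Br (im \<chi> \<otimes>\<^sub>M A) c / (Br A \<one> * \<chi> \<one>)"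
    using Br_comp_mult[OF tensor_gmod_is_gmod[OF is_group X A]] by simp
  also have "\<dots> = Br A c / Br A \<one> * r_fun G c \<chi>"
    using Br_tensor[OF X A] irr_mod(2)[OF x] by (simp add: r_fun_def)
  finally show ?thesis .
qed

lemma diagonalized_K:
  assumes "is_gmod G A"
  shows "diagonalized K IB (l_fun \<theta> G) (r_fun G) (K_chain \<theta> G A) (\<lambda>c. Br A c / Br A \<one>)"
  using biorthogonal_IB K_chain_eigen[OF assms] by (simp add: diagonalized_def diagonalized_axioms_def)

text \<open>If n roots of unity have sum n, all of them are 1; so every eigenvalue of c is 1. The
  order of c is prime to p, hence c acts as the identity matrix and is trivial by
  faithfulness.\<close>

lemma faithful_eigenvalue_one:
  assumes A: "faithful_gmod G A" and n: "fst A > 0" and c: "c \<in> K" and e: "Br A c / Br A \<one> = 1"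
  shows "c = \<one>"
proof -
  have A': "is_gmod G A" and inj: "inj_on (snd A) (carrier G)" using A by (auto simp: faithful_gmod_def)
  note cc = reps_carrier[OF K c] and cp = reps_preg[OF K c]
  note cA = gmod_carrier[OF A' cc]
  have "bt (snd A c) = of_nat (fst A)" using e n Br_one[OF A'] Br_eq[OF cp, of A] by (simp split: if_splits)
  hence "(\<Sum>z\<in>#image_mset \<theta> (evs (snd A c)). z) = of_nat (size (image_mset \<theta> (evs (snd A c))))"
    using size_evs[OF cA] by (simp add: bt_def)
  moreover have "\<forall>z\<in>#image_mset \<theta> (evs (snd A c)). norm z = 1"
    using norm_lift[OF evs_root_of_unity[OF A' cc] ord_pos[OF cc]] by auto
  ultimately have 1: "\<forall>z\<in>#image_mset \<theta> (evs (snd A c)). z = 1" by (intro sum_unit_vectors)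
  have "x = 1" if "x \<in># evs (snd A c)" for x
    using lift_inj[OF evs_root_of_unity[OF A' cc that] ord_pos[OF cc], of 1 1] 1 that by simp
  moreover have "(of_nat (ord c) :: 'k) \<noteq> 0" using of_nat_eq_0_iff_coprime[OF char_pos] preg_coprime[OF cp] by blast
  ultimately have "snd A c = 1\<^sub>m (fst A)" using finite_order_unipotent[OF cA gmod_pow_ord[OF A' cc]] by blast
  hence "snd A c = snd A \<one>" using gmod_one[OF A'] by simp
  thus ?thesis using inj cc by (auto simp: inj_on_def)
qed

section \<open>Stationary distribution and powers of the chain\<close>

lemma l_fun_one: assumes x: "\<chi> \<in> IB" shows "l_fun \<theta> G \<one> \<chi> = pi_stat \<theta> G \<chi>"
proof -
  have "centralizer G \<one> = carrier G" by (auto simp: centralizer_def)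
  thus ?thesis using proj_char_one[OF x] by (simp add: l_fun_def pi_stat_def)
qed

lemma r_fun_one: "\<chi> \<in> IB \<Longrightarrow> r_fun G \<one> \<chi> = 1"
  using IB_one(2) by (simp add: r_fun_def)

text \<open>\<pi> is the left eigenfunction at the identity class, and its pairing with the constant
  right eigenfunction 1 is its total mass. Uniqueness is the simplicity of the eigenvalue 1.\<close>

lemma stationary_pi:
  assumes A: "faithful_gmod G A" and n: "fst A > 0"
  shows "stationary_dist IB (K_chain \<theta> G A) (pi_stat \<theta> G)"
    and "stationary_dist IB (K_chain \<theta> G A) \<mu> \<Longrightarrow> \<chi> \<in> IB \<Longrightarrow> \<mu> \<chi> = pi_stat \<theta> G \<chi>"
proof -
  have A': "is_gmod G A" using A by (simp add: faithful_gmod_def)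
  interpret D: diagonalized K IB "l_fun \<theta> G" "r_fun G" "K_chain \<theta> G A" "\<lambda>c. Br A c / Br A \<one>"
    by (rule diagonalized_K[OF A'])
  have b1: "Br A \<one> / Br A \<one> = 1" using Br_one[OF A'] n by simp
  show "stationary_dist IB (K_chain \<theta> G A) (pi_stat \<theta> G)"
    unfolding stationary_dist_def
  proof (intro conjI ballI)
    fix \<chi> assume x: "\<chi> \<in> IB"
    show "pi_stat \<theta> G \<chi> \<in> \<real>\<^sub>\<ge>\<^sub>0"
      unfolding pi_stat_def proj_char_one(1)[OF x] IB_one(1)[OF x]
      by (intro nonneg_Reals_divide_I nonneg_Reals_mult_I nonneg_Reals_of_nat_I)
    have "(\<Sum>\<psi>\<in>IB. l_fun \<theta> G \<one> \<psi> * K_chain \<theta> G A \<psi> \<chi>) = l_fun \<theta> G \<one> \<chi>"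
      using D.left_eigen[OF one_reps x] b1 by simp
    thus "(\<Sum>\<psi>\<in>IB. pi_stat \<theta> G \<psi> * K_chain \<theta> G A \<psi> \<chi>) = pi_stat \<theta> G \<chi>" using l_fun_one x by simp
  next
    have "(\<Sum>\<chi>\<in>IB. l_fun \<theta> G \<one> \<chi> * r_fun G \<one> \<chi>) = 1" using D.col_orth[OF one_reps one_reps] by simp
    thus "(\<Sum>\<chi>\<in>IB. pi_stat \<theta> G \<chi>) = 1" by (simp add: l_fun_one r_fun_one)
  qed
  assume \<mu>: "stationary_dist IB (K_chain \<theta> G A) \<mu>" and x: "\<chi> \<in> IB"
  \<comment> \<open>The coefficient in front is the total mass of \<mu>, which is 1.\<close>
  have "\<mu> \<chi> = (\<Sum>\<psi>\<in>IB. r_fun G \<one> \<psi> * \<mu> \<psi>) * l_fun \<theta> G \<one> \<chi>"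
    by (rule D.left_fixed_unique[OF one_reps _ _ x])
       (use faithful_eigenvalue_one[OF A n] \<mu> in \<open>auto simp: stationary_dist_def\<close>)
  thus "\<mu> \<chi> = pi_stat \<theta> G \<chi>" using \<mu> by (simp add: r_fun_one l_fun_one[OF x] stationary_dist_def)
qed

lemma triv_gmod:
  shows "irreducible_gmod G (triv_gmod :: ('g, 'k) gmod)" "g \<in> preg \<Longrightarrow> Br triv_gmod g = 1"
proof -
  show "Br triv_gmod g = 1" if "g \<in> preg" by (simp add: Br_eq[OF that] triv_gmod_def bt_def evs_one)
  show "irreducible_gmod G (triv_gmod :: ('g, 'k) gmod)"
    unfolding irreducible_gmod_def
  proof (intro conjI allI impI)
    show "is_gmod G (triv_gmod :: ('g, 'k) gmod)" by (simp add: is_gmod_def triv_gmod_def)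
    show "fst (triv_gmod :: ('g, 'k) gmod) > 0" by (simp add: triv_gmod_def)
    fix W assume "gsubmod G (triv_gmod :: ('g, 'k) gmod) W"
    hence "vsub 1 W" by (auto simp: gsubmod_def triv_gmod_def)
    note W = this[unfolded subspace_vec_iff]
    have "W = carrier_vec 1" if ne: "W \<noteq> {0\<^sub>v 1}"
    proof -
      obtain w where w: "w \<in> W" "w \<noteq> 0\<^sub>v 1" using ne W by blast
      have wc: "w \<in> carrier_vec 1" using w W by blast
      have w0: "w $ 0 \<noteq> 0"
      proof
        assume "w $ 0 = 0"
        hence "w = 0\<^sub>v 1" using wc by (intro eq_vecI) auto
        thus False using w by simp
      qed
      have "v \<in> W" if v: "v \<in> carrier_vec 1" for v
      proof -
        have "v = (v $ 0 / w $ 0) \<cdot>\<^sub>v w" using v wc w0 by (intro eq_vecI) auto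
        thus ?thesis using W w(1) by metis
      qed
      thus ?thesis using W by blast
    qed
    thus "W = {0\<^sub>v (fst (triv_gmod :: ('g, 'k) gmod))} \<or> W = carrier_vec (fst (triv_gmod :: ('g, 'k) gmod))"
      by (auto simp: triv_gmod_def)
  qed
qed

text \<open>\<open>r_fun\<close> is 1 at the trivial character, so only the quotients of
  \<open>l_fun\<close> by \<open>pi_stat\<close> remain, in which orbit-stabilizer turns |G| /
  |C_G(c)| into the class size. The term at the identity is 1 and cancels the 1 that is
  subtracted.\<close>

lemma mc_power_triv:
  assumes A: "faithful_gmod G A" and n: "fst A > 0" and x: "\<chi> \<in> IB"
  shows "mc_power IB (K_chain \<theta> G A) l (Br triv_gmod) \<chi> / pi_stat \<theta> G \<chi> - 1 =
    (\<Sum>c\<in>K - {\<one>}. (Br A c / Br A \<one>) ^ l * (cnj (proj_char \<theta> G \<chi> c) / proj_char \<theta> G \<chi> \<one>) * of_nat (card (conj_class G c)))"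
proof -
  have A': "is_gmod G A" using A by (simp add: faithful_gmod_def)
  interpret D: diagonalized K IB "l_fun \<theta> G" "r_fun G" "K_chain \<theta> G A" "\<lambda>c. Br A c / Br A \<one>"
    by (rule diagonalized_K[OF A'])
  have T: "(Br triv_gmod :: 'g \<Rightarrow> complex) \<in> IB" by (rule IB_I[OF triv_gmod(1)])
  have rT: "r_fun G c (Br triv_gmod) = 1" if "c \<in> K" for c
    using triv_gmod(2)[OF reps_preg[OF K that]] triv_gmod(2)[OF one_preg] by (simp add: r_fun_def)
  have G0: "(of_nat (card (carrier G)) :: complex) \<noteq> 0" using fin by (auto simp: card_eq_0_iff)
  let ?t = "\<lambda>c. (Br A c / Br A \<one>) ^ l * (cnj (proj_char \<theta> G \<chi> c) / proj_char \<theta> G \<chi> \<one>) * of_nat (card (conj_class G c))"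
  have "mc_power IB (K_chain \<theta> G A) l (Br triv_gmod) \<chi> / pi_stat \<theta> G \<chi> =
    (\<Sum>c\<in>K. (Br A c / Br A \<one>) ^ l * (l_fun \<theta> G c \<chi> / pi_stat \<theta> G \<chi>))"
    unfolding D.mc_power_expand[OF T x] sum_divide_distrib by (intro sum.cong) (simp_all add: rT)
  also have "\<dots> = (\<Sum>c\<in>K. ?t c)"
  proof (rule sum.cong[OF refl])
    fix c assume c: "c \<in> K"
    have "(of_nat (card (carrier G)) :: complex) = of_nat (card (conj_class G c)) * of_nat (card (centralizer G c))"
      using card_conj_class[OF reps_carrier[OF K c]] by simp
    hence "l_fun \<theta> G c \<chi> / pi_stat \<theta> G \<chi> = cnj (proj_char \<theta> G \<chi> c) / proj_char \<theta> G \<chi> \<one> * of_nat (card (conj_class G c))"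
      using centralizer_card_pos[OF c] IB_one(2)[OF x] proj_char_one(2)[OF x]
      by (simp add: l_fun_def pi_stat_def field_simps)
    thus "(Br A c / Br A \<one>) ^ l * (l_fun \<theta> G c \<chi> / pi_stat \<theta> G \<chi>) = ?t c" by simp
  qed
  also have "\<dots> = ?t \<one> + (\<Sum>c\<in>K - {\<one>}. ?t c)" by (rule sum.remove[OF finite_reps[OF K] one_reps])
  also have "?t \<one> = 1"
  proof -
    have "conj_class G \<one> = {\<one>}" by (auto simp: conj_class_def image_iff intro!: bexI[of _ \<one>])
    thus ?thesis using Br_one[OF A'] n proj_char_one[OF x] by simp
  qed
  finally show ?thesis by simp
qed

text \<open>The value at the inverse is the conjugate, and conjugate elements have equal
  values.\<close>

lemma Br_real:
  assumes M: "is_gmod G M" and c: "c \<in> K" and inv: "inv c \<in> conj_class G c"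
  shows "cnj (Br M c) = Br M c"
  using Br_inv[OF M reps_preg[OF K c]] conj_class_preg(2)[OF reps_preg[OF K c] inv, of M] M by simp

lemma r_fun_real:
  assumes x: "\<chi> \<in> IB" and c: "c \<in> K" and inv: "inv c \<in> conj_class G c"
  shows "cnj (r_fun G c \<chi>) = r_fun G c \<chi>"
  using Br_real[OF irreducibleD(1)[OF irr_mod(1)[OF x]] c inv] IB_one(3)[OF x] irr_mod(2)[OF x] by (simp add: r_fun_def)

end

end

text \<open>That the listed functions are all eigenfunctions up to linear combination is expressed
  by \<open>function_basis\<close>. Pairing and expansion hold without conjugation for every G; the
  conjugated versions are derived where each representative is conjugate to its inverse, which makes
  \<alpha> and the right eigenfunctions real.\<close>

theorem proposition3p1:
  fixes G :: "('g, 'b) monoid_scheme"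
    and p :: nat
    and \<theta> :: "'k :: alg_closed_field \<Rightarrow> complex"
    and A :: "('g, 'k) gmod"
    and C :: "'g set"
    and \<alpha> :: "'g \<Rightarrow> complex"
    and I :: "('g \<Rightarrow> complex) set"
    and K :: "('g \<Rightarrow> complex) \<Rightarrow> ('g \<Rightarrow> complex) \<Rightarrow> complex"
    and \<p> \<r> \<l> :: "'g \<Rightarrow> ('g \<Rightarrow> complex) \<Rightarrow> complex"
    and \<pi> :: "('g \<Rightarrow> complex) \<Rightarrow> complex"
    and triv :: "'g \<Rightarrow> complex"
  assumes "group G" and "finite (carrier G)"
    and "CHAR('k) = p" and "p > 0"
    and "brauer_lift \<theta>"
    and "faithful_gmod G A" and "fst A > 0"
    and "p_regular_reps G p C"
    and "\<alpha> = brauer_char \<theta> G A"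
    and "I = IBr \<theta> G"
    and "K = K_chain \<theta> G A"
    and "\<p> = (\<lambda>c \<chi>. proj_char \<theta> G \<chi> c)"
    and "\<pi> = pi_stat \<theta> G"
    and "\<r> = r_fun G"
    and "\<l> = l_fun \<theta> G"
    and "triv = brauer_char \<theta> G triv_gmod"
  shows "
    \<comment> \<open>(i)\<close>
    (stationary_dist I K \<pi> \<and> (\<forall>\<mu>. stationary_dist I K \<mu> \<longrightarrow> (\<forall>\<chi> \<in> I. \<mu> \<chi> = \<pi> \<chi>))) \<and>
    \<comment> \<open>(ii)\<close>
    ({\<beta>. \<exists>f. right_eigenfunction I K \<beta> f} = (\<lambda>c. \<alpha> c / \<alpha> \<one>\<^bsub>G\<^esub>) ` C) \<and>
    \<comment> \<open>(iii)\<close>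
    (\<forall>c \<in> C. right_eigenfunction I K (\<alpha> c / \<alpha> \<one>\<^bsub>G\<^esub>) (\<r> c)) \<and>
    (function_basis I C \<r>) \<and>
    \<comment> \<open>(iv)\<close>
    (\<forall>c \<in> C. left_eigenfunction I K (\<alpha> c / \<alpha> \<one>\<^bsub>G\<^esub>) (\<l> c)) \<and>
    (function_basis I C \<l>) \<and>
    (\<forall>\<chi> \<in> I. \<l> \<one>\<^bsub>G\<^esub> \<chi> = \<pi> \<chi> \<and> \<r> \<one>\<^bsub>G\<^esub> \<chi> = 1) \<and>
    (\<forall>c \<in> C. \<forall>c' \<in> C. (\<Sum>\<chi> \<in> I. \<l> c \<chi> * \<r> c' \<chi>) = (if c = c' then 1 else 0)) \<and>
    \<comment> \<open>(v)\<close>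
    (\<forall>l \<ge> 1. \<forall>\<chi> \<in> I. \<forall>\<chi>' \<in> I. mc_power I K l \<chi> \<chi>' =
       (\<Sum>c \<in> C. (\<alpha> c / \<alpha> \<one>\<^bsub>G\<^esub>) ^ l * \<r> c \<chi> * \<l> c \<chi>')) \<and>
    (\<forall>l \<ge> 1. \<forall>\<chi>' \<in> I. mc_power I K l triv \<chi>' / \<pi> \<chi>' - 1 =
       (\<Sum>c \<in> C - {\<one>\<^bsub>G\<^esub>}. (\<alpha> c / \<alpha> \<one>\<^bsub>G\<^esub>) ^ l *
          (cnj (\<p> c \<chi>') / \<p> \<one>\<^bsub>G\<^esub> \<chi>') * of_nat (card (conj_class G c)))) \<and>
    \<comment> \<open>the conjugated forms of the last statement of (iv) and of (v)\<close>
    ((\<forall>c \<in> C. inv\<^bsub>G\<^esub> c \<in> conj_class G c) \<longrightarrow>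
       (\<forall>c \<in> C. \<forall>c' \<in> C. (\<Sum>\<chi> \<in> I. \<l> c \<chi> * cnj (\<r> c' \<chi>)) = (if c = c' then 1 else 0)) \<and>
       (\<forall>l \<ge> 1. \<forall>\<chi> \<in> I. \<forall>\<chi>' \<in> I. mc_power I K l \<chi> \<chi>' =
          (\<Sum>c \<in> C. (cnj (\<alpha> c) / \<alpha> \<one>\<^bsub>G\<^esub>) ^ l * cnj (\<r> c \<chi>) * \<l> c \<chi>')) \<and>
       (\<forall>l \<ge> 1. \<forall>\<chi>' \<in> I. mc_power I K l triv \<chi>' / \<pi> \<chi>' - 1 =
          (\<Sum>c \<in> C - {\<one>\<^bsub>G\<^esub>}. (cnj (\<alpha> c) / \<alpha> \<one>\<^bsub>G\<^esub>) ^ l *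
             (cnj (\<p> c \<chi>') / \<p> \<one>\<^bsub>G\<^esub> \<chi>') * of_nat (card (conj_class G c)))))"
proof -
  interpret modular_rep G \<theta> p
    by (intro modular_rep.intro brauer.intro modular_rep_axioms.intro) (use assms in auto)
  have A: "is_gmod G A" using assms(6) by (simp add: faithful_gmod_def)
  note reps = assms(8)
  interpret D: diagonalized C "IBr \<theta> G" "l_fun \<theta> G" "r_fun G" "K_chain \<theta> G A" "\<lambda>c. \<alpha> c / \<alpha> \<one>\<^bsub>G\<^esub>"
    unfolding assms(9) by (rule diagonalized_K[OF reps A])
  note st = stationary_pi[OF reps assms(6,7)]
  note triv_power = mc_power_triv[OF reps assms(6,7)]
  have 1: "\<forall>\<chi>\<in>IBr \<theta> G. l_fun \<theta> G \<one>\<^bsub>G\<^esub> \<chi> = pi_stat \<theta> G \<chi> \<and> r_fun G \<one>\<^bsub>G\<^esub> \<chi> = 1"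
    using l_fun_one[OF reps] r_fun_one[OF reps] by blast
  have 2: "(\<forall>c\<in>C. \<forall>c'\<in>C. (\<Sum>\<chi>\<in>IBr \<theta> G. l_fun \<theta> G c \<chi> * cnj (r_fun G c' \<chi>)) = (if c = c' then 1 else 0)) \<and>
    (\<forall>l\<ge>1. \<forall>\<chi>\<in>IBr \<theta> G. \<forall>\<chi>'\<in>IBr \<theta> G. mc_power (IBr \<theta> G) (K_chain \<theta> G A) l \<chi> \<chi>' =
       (\<Sum>c\<in>C. (cnj (\<alpha> c) / \<alpha> \<one>\<^bsub>G\<^esub>) ^ l * cnj (r_fun G c \<chi>) * l_fun \<theta> G c \<chi>')) \<and>
    (\<forall>l\<ge>1. \<forall>\<chi>'\<in>IBr \<theta> G. mc_power (IBr \<theta> G) (K_chain \<theta> G A) l triv \<chi>' / pi_stat \<theta> G \<chi>' - 1 =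
       (\<Sum>c\<in>C - {\<one>\<^bsub>G\<^esub>}. (cnj (\<alpha> c) / \<alpha> \<one>\<^bsub>G\<^esub>) ^ l *
          (cnj (proj_char \<theta> G \<chi>' c) / proj_char \<theta> G \<chi>' \<one>\<^bsub>G\<^esub>) * of_nat (card (conj_class G c))))"
    if inv: "\<forall>c\<in>C. inv\<^bsub>G\<^esub> c \<in> conj_class G c"
  proof (intro conjI ballI allI impI)
    have r: "cnj (r_fun G c \<chi>) = r_fun G c \<chi>" if "c \<in> C" "\<chi> \<in> IBr \<theta> G" for c \<chi>
      using r_fun_real[OF reps that(2,1)] inv that(1) by blast
    have a: "cnj (\<alpha> c) = \<alpha> c" if "c \<in> C" for c
      unfolding assms(9) using Br_real[OF reps A that] inv that by blast
    show "(\<Sum>\<chi>\<in>IBr \<theta> G. l_fun \<theta> G c \<chi> * cnj (r_fun G c' \<chi>)) = (if c = c' then 1 else 0)" if "c \<in> C" "c' \<in> C" for c c'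
      using D.col_orth[OF that] r[OF that(2)] by simp
    show "mc_power (IBr \<theta> G) (K_chain \<theta> G A) l \<chi> \<chi>' =
        (\<Sum>c\<in>C. (cnj (\<alpha> c) / \<alpha> \<one>\<^bsub>G\<^esub>) ^ l * cnj (r_fun G c \<chi>) * l_fun \<theta> G c \<chi>')"
      if "\<chi> \<in> IBr \<theta> G" "\<chi>' \<in> IBr \<theta> G" for l \<chi> \<chi>'
      unfolding D.mc_power_expand[OF that] by (intro sum.cong) (simp_all add: r[OF _ that(1)] a)
    show "mc_power (IBr \<theta> G) (K_chain \<theta> G A) l triv \<chi>' / pi_stat \<theta> G \<chi>' - 1 =
       (\<Sum>c\<in>C - {\<one>\<^bsub>G\<^esub>}. (cnj (\<alpha> c) / \<alpha> \<one>\<^bsub>G\<^esub>) ^ l *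
          (cnj (proj_char \<theta> G \<chi>' c) / proj_char \<theta> G \<chi>' \<one>\<^bsub>G\<^esub>) * of_nat (card (conj_class G c)))"
      if "\<chi>' \<in> IBr \<theta> G" for l \<chi>'
      unfolding assms(16) triv_power[OF that] by (intro sum.cong) (simp_all add: a flip: assms(9))
  qed
  have 3: "\<forall>l\<ge>1. \<forall>\<chi>'\<in>IBr \<theta> G. mc_power (IBr \<theta> G) (K_chain \<theta> G A) l triv \<chi>' / pi_stat \<theta> G \<chi>' - 1 =
    (\<Sum>c\<in>C - {\<one>\<^bsub>G\<^esub>}. (\<alpha> c / \<alpha> \<one>\<^bsub>G\<^esub>) ^ l *
       (cnj (proj_char \<theta> G \<chi>' c) / proj_char \<theta> G \<chi>' \<one>\<^bsub>G\<^esub>) * of_nat (card (conj_class G c)))"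
    unfolding assms(9,16) using triv_power by blast
  have 4: "\<forall>c\<in>C. \<forall>c'\<in>C. (\<Sum>\<chi>\<in>IBr \<theta> G. l_fun \<theta> G c \<chi> * r_fun G c' \<chi>) = (if c = c' then 1 else 0)"
    using D.col_orth by blast
  have 5: "\<forall>l\<ge>1. \<forall>\<chi>\<in>IBr \<theta> G. \<forall>\<chi>'\<in>IBr \<theta> G. mc_power (IBr \<theta> G) (K_chain \<theta> G A) l \<chi> \<chi>' =
    (\<Sum>c\<in>C. (\<alpha> c / \<alpha> \<one>\<^bsub>G\<^esub>) ^ l * r_fun G c \<chi> * l_fun \<theta> G c \<chi>')"
    using D.mc_power_expand by blast
  have 6: "stationary_dist (IBr \<theta> G) (K_chain \<theta> G A) (pi_stat \<theta> G) \<and>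
    (\<forall>\<mu>. stationary_dist (IBr \<theta> G) (K_chain \<theta> G A) \<mu> \<longrightarrow> (\<forall>\<chi>\<in>IBr \<theta> G. \<mu> \<chi> = pi_stat \<theta> G \<chi>))"
    using st by blast
  have 7: "\<forall>c\<in>C. right_eigenfunction (IBr \<theta> G) (K_chain \<theta> G A) (\<alpha> c / \<alpha> \<one>\<^bsub>G\<^esub>) (r_fun G c)"
    using D.right_eigenfunction_R by blast
  have 8: "\<forall>c\<in>C. left_eigenfunction (IBr \<theta> G) (K_chain \<theta> G A) (\<alpha> c / \<alpha> \<one>\<^bsub>G\<^esub>) (l_fun \<theta> G c)"
    using D.left_eigenfunction_L by blast
  show ?thesis
    unfolding assms(10-15)
    by (intro conjI[OF 6] conjI[OF D.eigenvalues] conjI[OF 7] conjI[OF D.function_basis_R] conjI[OF 8]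
        conjI[OF D.function_basis_L] conjI[OF 1] conjI[OF 4] conjI[OF 5] conjI[OF 3] impI 2) blast
qed

end
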